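(* Let $-\frac12 < s < 0$ and $1 \le r \le \infty$, and let $X$ be either the line $\mathbb{R}$ or the circle $\mathbb{R}/\mathbb{Z}$. There is a constant $K = K(s,r) < \infty$ such that for every real-valued solution $q \in C^0_t H^3_x(\mathbb{R}\times X) \cap C^1_t H^1_x(\mathbb{R}\times X)$ of the Benjamin-Ono equation $$\frac{d}{dt} q = - H q'' + 2 q q'$$ on $X$ (global in time), one has $$\Big(1 + \| q(0)\|^{\frac{2}{1+2s}}_{B^{s,2}_r}\Big)^{s} \sup_{t \in \mathbb{R}} \| q(t) \|_{B^{s,2}_r} \le K\, \| q(0) \|_{B^{s,2}_r}$$ and $$\| q(0) \|_{B^{s,2}_r} \le K\, \Big(1 + \|q(0)\|^{\frac{2}{(1+2s)^2}}_{B^{s,2}_r}\Big)^{-s} \inf_{t \in \mathbb{R}} \| q(t)\|_{B^{s,2}_r}.$$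
   Context: Primes denote $\partial_x$. Fourier transform: on the line $\hat f(\xi) = \frac{1}{\sqrt{2\pi}}\int_{\mathbb{R}} e^{-ix\xi} f(x)\,dx$, $\xi\in\mathbb{R}$; on the circle $\hat f(\xi) = \int_0^1 e^{-ix\xi} f(x)\,dx$, $\xi \in 2\pi\mathbb{Z}$. The Hilbert transform is $\widehat{Hf}(\xi) = -i\,\mathrm{sgn}(\xi)\hat f(\xi)$ (with $\mathrm{sgn}(0)=0$). $H^k$ ($k=1,3$) are the usual $L^2$-based Sobolev spaces on $X$; $C^0_tH^3_x\cap C^1_tH^1_x$ means $t\mapsto q(t)$ is continuous from $\mathbb{R}$ to $H^3(X)$ and continuously differentiable from $\mathbb{R}$ to $H^1(X)$. The Besov norm is $$\| f \|_{B^{s,2}_r} = \Big( \| \hat{f} \|_{L^2(|\xi| \leq 1)}^r + \sum_{N} N^{rs} \| \hat{f} \|_{L^2(N \leq |\xi| < 2N)}^r \Big)^{1/r},$$ where the sum is over dyadic $N = 1,2,4,8,\ldots$, with the usual supremum interpretation if $r=\infty$. On the circle, $L^2$ norms on the frequency side are with respect to counting measure on $2\pi\mathbb{Z}$. *)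

theory Defs
  imports "HOL-Analysis.Analysis"
begin

text \<open>
  A function on the circle \<open>\<real>/\<int>\<close> is represented by a 1-periodic function on \<open>\<real>\<close>, so that
  functions on either space have type \<^typ>\<open>real \<Rightarrow> real\<close>.
\<close>

datatype domain = Line | Circle

definition space_measure :: "domain \<Rightarrow> real measure" where
  "space_measure X = (case X of Line \<Rightarrow> lborel | Circle \<Rightarrow> restrict_space lborel {0..1})"

definition freq_measure :: "domain \<Rightarrow> real measure" where
  "freq_measure X = (case X of
     Line \<Rightarrow> lborel
   | Circle \<Rightarrow> count_space (range (\<lambda>k::int. 2 * pi * of_int k)))"

definition L2 :: "domain \<Rightarrow> (real \<Rightarrow> real) set" where
  "L2 X = {f \<in> borel_measurable borel.
     (X = Circle \<longrightarrow> (\<forall>x. f (x + 1) = f x)) \<and>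
     integrable (space_measure X) (\<lambda>x. (f x)\<^sup>2)}"

definition truncated_fourier :: "real \<Rightarrow> (real \<Rightarrow> real) \<Rightarrow> real \<Rightarrow> complex" where
  "truncated_fourier R f \<xi> =
     of_real (1 / sqrt (2 * pi)) *
     (LINT x:{-R..R}|lborel. cis (- (x * \<xi>)) * of_real (f x))"

text \<open>
  A square-integrable function on the line need not be integrable, so its Fourier transform is
  the limit in \<open>L\<^sup>2(\<real>)\<close> of the Fourier integrals over \<open>[-R, R]\<close>. This determines it up to a null
  set, and the choice of representative does not matter for any notion below.
\<close>

definition fourier :: "domain \<Rightarrow> (real \<Rightarrow> real) \<Rightarrow> real \<Rightarrow> complex" where
  "fourier X f = (case X of
     Line \<Rightarrow> (SOME g. g \<in> borel_measurable borel \<and>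
       ((\<lambda>R. \<integral>\<^sup>+\<xi>. ennreal ((cmod (truncated_fourier R f \<xi> - g \<xi>))\<^sup>2) \<partial>lborel) \<longlongrightarrow> 0) at_top)
   | Circle \<Rightarrow> (\<lambda>\<xi>. LINT x:{0..1}|lborel. cis (- (x * \<xi>)) * of_real (f x)))"

text \<open>The Hilbert transform is again determined only up to a null set.\<close>

definition hilbert :: "domain \<Rightarrow> (real \<Rightarrow> real) \<Rightarrow> real \<Rightarrow> real" where
  "hilbert X f = (SOME h. h \<in> L2 X \<and>
     (AE \<xi> in freq_measure X. fourier X h \<xi> = - \<i> * of_real (sgn \<xi>) * fourier X f \<xi>))"

definition epowr :: "ennreal \<Rightarrow> real \<Rightarrow> ennreal" where
  "epowr x p =
     (if p = 0 then 1
      else if x = 0 then (if p < 0 then \<infinity> else 0)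
      else if x = \<infinity> then (if p < 0 then 0 else \<infinity>)
      else ennreal (enn2real x powr p))"

definition sobolev_norm :: "domain \<Rightarrow> nat \<Rightarrow> (real \<Rightarrow> real) \<Rightarrow> ennreal" where
  "sobolev_norm X k f =
     epowr (\<integral>\<^sup>+\<xi>. ennreal ((1 + \<xi>\<^sup>2) ^ k * (cmod (fourier X f \<xi>))\<^sup>2) \<partial>freq_measure X) (1/2)"

definition sobolev :: "domain \<Rightarrow> nat \<Rightarrow> (real \<Rightarrow> real) set" where
  "sobolev X k = {f \<in> L2 X. sobolev_norm X k f < \<infinity>}"

definition fourier_norm :: "domain \<Rightarrow> (real \<Rightarrow> real) \<Rightarrow> real set \<Rightarrow> ennreal" where
  "fourier_norm X f A =
     epowr (\<integral>\<^sup>+\<xi>\<in>A. ennreal ((cmod (fourier X f \<xi>))\<^sup>2) \<partial>freq_measure X) (1/2)"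

definition besov_norm :: "domain \<Rightarrow> real \<Rightarrow> ennreal \<Rightarrow> (real \<Rightarrow> real) \<Rightarrow> ennreal" where
  "besov_norm X s r f =
     (let low = fourier_norm X f {\<xi>. \<bar>\<xi>\<bar> \<le> 1};
          block = (\<lambda>j::nat. fourier_norm X f {\<xi>. 2 ^ j \<le> \<bar>\<xi>\<bar> \<and> \<bar>\<xi>\<bar> < 2 * 2 ^ j})
      in if r = \<infinity>
         then max low (SUP j. ennreal ((2 ^ j) powr s) * block j)
         else (let \<rho> = enn2real r in
           epowr (epowr low \<rho> + (\<Sum>j. ennreal ((2 ^ j) powr (\<rho> * s)) * epowr (block j) \<rho>))
             (1 / \<rho>)))"

definition C0_sobolev :: "domain \<Rightarrow> nat \<Rightarrow> (real \<Rightarrow> real \<Rightarrow> real) \<Rightarrow> bool" where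
  "C0_sobolev X k q \<longleftrightarrow>
     (\<forall>t. q t \<in> sobolev X k) \<and>
     (\<forall>t. ((\<lambda>\<tau>. sobolev_norm X k (\<lambda>x. q \<tau> x - q t x)) \<longlongrightarrow> 0) (at t))"

definition has_sobolev_time_deriv ::
    "domain \<Rightarrow> nat \<Rightarrow> (real \<Rightarrow> real \<Rightarrow> real) \<Rightarrow> (real \<Rightarrow> real \<Rightarrow> real) \<Rightarrow> bool" where
  "has_sobolev_time_deriv X k q p \<longleftrightarrow>
     (\<forall>t. ((\<lambda>h. sobolev_norm X k (\<lambda>x. (q (t + h) x - q t x) / h - p t x)) \<longlongrightarrow> 0) (at 0))"

text \<open>
  Elements of \<open>H\<^sup>3\<close> are classes of functions modulo null sets, and each of them contains exactly
  one continuous function, which is of class \<open>C\<^sup>2\<close>. A solution takes this representative at every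
  time, so \<open>q'\<close> and \<open>q''\<close> are classical derivatives. The function \<open>p\<close> is the time derivative
  \<open>dq/dt\<close>, a continuous curve in \<open>H\<^sup>1\<close>.
\<close>

definition BO_solution :: "domain \<Rightarrow> (real \<Rightarrow> real \<Rightarrow> real) \<Rightarrow> bool" where
  "BO_solution X q \<longleftrightarrow>
     C0_sobolev X 3 q \<and>
     (\<forall>t. continuous_on UNIV (q t)) \<and>
     (\<exists>p. C0_sobolev X 1 p \<and> has_sobolev_time_deriv X 1 q p \<and>
        (\<forall>t. AE x in space_measure X.
           p t x = - hilbert X (deriv (deriv (q t))) x + 2 * q t x * deriv (q t) x))"

end

theory Submission
  imports Defs "HOL-Probability.Probability"
begin

text \<open>
  Write \<open>u\<close> for the suitably normalised Fourier transform of \<open>q(t)\<close>. For large \<open>\<kappa>\<close> let \<open>v\<close>, supported on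
  frequencies \<open>\<omega> \<ge> 0\<close>, solve \<open>(\<omega> + \<kappa>) v = u + C\<^sub>+(u * v)\<close>, where \<open>C\<^sub>+\<close> restricts to \<open>\<omega> \<ge> 0\<close>. The
  quantity \<open>\<beta>(\<kappa>) = \<langle>u, v\<rangle>\<close> is conserved by the flow: its time derivative is the pairing of the
  nonlinearity with \<open>|1 + m|\<^sup>2 - 1\<close>, where \<open>m\<close> is the inverse transform of \<open>v\<close>, and after
  symmetrisation this pairing reduces to \<open>(\<omega>\<^sub>1 + \<kappa>)\<^sup>2 - (\<omega>\<^sub>2 + \<kappa>)\<^sup>2\<close> against a hermitian form, which
  the equation for \<open>v\<close> evaluates to a multiple of \<open>Im \<beta> = 0\<close>.

  If \<open>\<Sum>\<^sub>j \<integral> |u|\<^sup>2 / (|\<omega>| + 2\<^sup>j \<kappa>)\<close> is small, so is the Hilbert--Schmidt norm of the equation, and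
  then \<open>\<beta>(\<kappa>)\<close> is comparable to \<open>\<integral> |u|\<^sup>2 / (|\<omega>| + \<kappa>)\<close>. A continuity argument in time propagates the
  smallness, so for every large dyadic \<open>\<kappa>\<close> the latter integral at time \<open>t\<close> is at most \<open>4\<close> times its
  initial value. Since the \<open>\<kappa> = 2\<^sup>i\<close> integral is comparable to the dyadic average
  \<open>\<Sum>\<^sub>m D\<^sub>m / (2\<^sup>m + 2\<^sup>i)\<close> of the block masses \<open>D\<^sub>m\<close>, summing over \<open>i\<close> recovers the Besov norm. The
  threshold frequency is a power of the Besov norm, and the frequencies below it cost the factor
  \<open>(1 + \<parallel>q\<parallel>\<^bsup>2/(1+2s)\<^esup>)\<^bsup>-s\<^esup>\<close>. The same bound with the two times exchanged gives the lower estimate.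
\<close>

section \<open>Square integrable functions and Hilbert--Schmidt operators\<close>

text \<open>On the line the Hilbert--Schmidt norm of the symmetrised equation carries the weight
  log(1 + |\<omega>|/\<kappa>)/|\<omega>|, which is not of the form 1/(|\<omega>| + \<kappa>). The
  dyadic sum has the same size but consists of integrals that the conserved quantities control, one
  for each 2^j \<kappa>. The smallness assumption is thus built from the very quantities it
  propagates, and the continuity argument closes.

  For s > -1/2 the integral at \<kappa> is at most a constant times \<kappa>^(-(1+2s)) times the
  squared Besov norm, so smallness holds above a threshold; this is the source of the exponent
  2/(1+2s). Inserting the upper bound for q(t) into the estimate with exchanged times gives
  2/(1+2s)^2.

  Line and circle are treated at once on an abstract group of frequencies with invariant measure,
  where only intervals of length at least 1 have controlled measure; hence \<kappa> \<ge> 1. Space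
  enters through a few facts on the Fourier transform, established for both domains.\<close>

definition sq :: "'a measure \<Rightarrow> ('a \<Rightarrow> complex) \<Rightarrow> bool" where
  "sq M f \<longleftrightarrow> f \<in> borel_measurable M \<and> integrable M (\<lambda>x. (cmod (f x))\<^sup>2)"

definition nm :: "'a measure \<Rightarrow> ('a \<Rightarrow> complex) \<Rightarrow> real" where
  "nm M f = sqrt (\<integral>x. (cmod (f x))\<^sup>2 \<partial>M)"

lemma measurable_cnj' [measurable (raw)]:
  assumes "f \<in> borel_measurable M"
  shows "(\<lambda>x. cnj (f x)) \<in> borel_measurable M"
proof -
  have c: "cnj \<in> borel_measurable borel"
    by (intro borel_measurable_continuous_onI continuous_intros)
  show ?thesis using measurable_compose[OF assms c] by assumption
qed

lemma le_suminf_ennreal: "(f :: nat \<Rightarrow> ennreal) j \<le> suminf f"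
  using sum_le_suminf[of f "{j}"] by simp

lemmas integral_cnj' = Bochner_Integration.integral_cnj

lemma sq_measurable[measurable_dest]: "sq M f \<Longrightarrow> f \<in> borel_measurable M"
  by (simp add: sq_def)

lemma nm_nonneg[simp]: "0 \<le> nm M f"
  by (simp add: nm_def)

lemma nm_sq: "(nm M f)\<^sup>2 = (\<integral>x. (cmod (f x))\<^sup>2 \<partial>M)"
  by (simp add: nm_def)

lemma sq_iff_nn:
  "f \<in> borel_measurable M \<Longrightarrow> sq M f \<longleftrightarrow> (\<integral>\<^sup>+x. ennreal ((cmod (f x))\<^sup>2) \<partial>M) < \<infinity>"
  unfolding sq_def by (auto simp: integrable_iff_bounded)

lemma sq_nn_eq: "sq M f \<Longrightarrow> (\<integral>\<^sup>+x. ennreal ((cmod (f x))\<^sup>2) \<partial>M) = ennreal ((nm M f)\<^sup>2)"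
  by (simp add: nm_sq sq_def nn_integral_eq_integral)

lemma nm_le_nn:
  assumes "f \<in> borel_measurable M" "(\<integral>\<^sup>+x. ennreal ((cmod (f x))\<^sup>2) \<partial>M) \<le> ennreal (c\<^sup>2)" "0 \<le> c"
  shows "sq M f" "nm M f \<le> c"
proof -
  show s: "sq M f"
    using assms by (simp add: sq_iff_nn le_less_trans)
  have "(nm M f)\<^sup>2 \<le> c\<^sup>2"
    using assms(2) unfolding sq_nn_eq[OF s] by (simp add: ennreal_le_iff)
  then show "nm M f \<le> c"
    using assms(3) by (rule power2_le_imp_le)
qed

lemma sq_mult_integrable:
  assumes "sq M f" "sq M g"
  shows "integrable M (\<lambda>x. f x * g x)"
proof (rule Bochner_Integration.integrable_bound)
  show "integrable M (\<lambda>x. (cmod (f x))\<^sup>2 + (cmod (g x))\<^sup>2)"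
    using assms by (simp add: sq_def)
  show "(\<lambda>x. f x * g x) \<in> borel_measurable M"
    using assms by measurable
  have "a * b \<le> a\<^sup>2 + b\<^sup>2" for a b :: real
    using sum_squares_bound[of a b] sum_power2_ge_zero[of a b] by linarith
  then show "AE x in M. cmod (f x * g x) \<le> norm ((cmod (f x))\<^sup>2 + (cmod (g x))\<^sup>2)"
    by (auto simp: norm_mult)
qed

text \<open>Integrate 2ab \<le> t a^2 + b^2/t and optimise over t > 0; degenerate norms are
  separated because the optimal t is a quotient.\<close>

lemma nm_CS_abs:
  assumes "sq M f" "sq M g"
  shows "(\<integral>x. cmod (f x) * cmod (g x) \<partial>M) \<le> nm M f * nm M g"
proof -
  let ?F = "\<integral>x. (cmod (f x))\<^sup>2 \<partial>M" and ?G = "\<integral>x. (cmod (g x))\<^sup>2 \<partial>M"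
    and ?I = "\<integral>x. cmod (f x) * cmod (g x) \<partial>M"
  have i: "integrable M (\<lambda>x. cmod (f x) * cmod (g x))"
    using sq_mult_integrable[OF assms, THEN integrable_norm] by (simp add: norm_mult)
  have 1: "2 * ?I \<le> t * ?F + ?G / t" if t: "t > 0" for t
  proof -
    have *: "2 * (a * b) \<le> t * a\<^sup>2 + b\<^sup>2 / t" for a b :: real
    proof -
      have "0 \<le> (t * a - b)\<^sup>2 / t" using t by simp
      also have "\<dots> = t * a\<^sup>2 + b\<^sup>2 / t - 2 * (a * b)"
        using t by (simp add: power2_eq_square field_simps)
      finally show ?thesis by simp
    qed
    have "2 * ?I = (\<integral>x. 2 * (cmod (f x) * cmod (g x)) \<partial>M)" by simp
    also have "\<dots> \<le> (\<integral>x. t * (cmod (f x))\<^sup>2 + (cmod (g x))\<^sup>2 / t \<partial>M)"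
      by (rule integral_mono) (use i assms * in \<open>auto simp: sq_def\<close>)
    also have "\<dots> = t * ?F + ?G / t"
      using assms by (simp add: sq_def)
    finally show ?thesis .
  qed
  have F0: "0 \<le> ?F" and G0: "0 \<le> ?G" and I0: "0 \<le> ?I" by simp_all
  have "?I\<^sup>2 \<le> ?F * ?G"
  proof (cases "?F = 0")
    case True
    have "?I = 0"
    proof (rule ccontr)
      assume "?I \<noteq> 0"
      then have Ip: "?I > 0" using I0 by linarith
      \<comment> \<open>With \<open>?F = 0\<close> the estimate reads
        \<open>2 * ?I \<le> ?G / t\<close>, and any \<open>t\<close> above \<open>?G / ?I\<close>
        contradicts \<open>?I > 0\<close>.\<close>
      have pos: "0 < (?G + 1) / ?I" using Ip G0 by (intro divide_pos_pos) linarith+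
      have "2 * ?I \<le> ?G / ((?G + 1) / ?I)"
        using 1[OF pos] True by simp
      also have "\<dots> \<le> ?I" using pos Ip by (subst pos_divide_le_eq[OF pos]) simp
      finally show False using Ip by simp
    qed
    then show ?thesis using True by simp
  next
    case False
    then have Fp: "?F > 0" using F0 by linarith
    show ?thesis
    proof (cases "?I = 0")
      case True then show ?thesis using F0 G0 by simp
    next
      case False
      then have Ip: "?I > 0" using I0 by linarith
      \<comment> \<open>The choice \<open>t = ?I / ?F\<close> turns \<open>t * ?F\<close> into
        \<open>?I\<close>, which is absorbed on the left.\<close>
      have "2 * ?I \<le> ?I + ?G * ?F / ?I"
        using 1[of "?I / ?F"] Fp Ip by simp
      then have "?I \<le> ?G * ?F / ?I" by simp
      then show ?thesis using Ip by (simp add: field_simps power2_eq_square)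
    qed
  qed
  then have "?I \<le> sqrt (?F * ?G)" by (rule real_le_rsqrt)
  then show ?thesis by (simp add: nm_def real_sqrt_mult)
qed

lemma nm_CS:
  assumes "sq M f" "sq M g"
  shows "cmod (\<integral>x. f x * g x \<partial>M) \<le> nm M f * nm M g"
proof -
  have "cmod (\<integral>x. f x * g x \<partial>M) \<le> (\<integral>x. cmod (f x * g x) \<partial>M)"
    by (rule integral_norm_bound)
  then show ?thesis using nm_CS_abs[OF assms] by (simp add: norm_mult)
qed

lemma sq_cnj[simp]: "sq M (\<lambda>x. cnj (f x)) \<longleftrightarrow> sq M f"
  using measurable_cnj'[of f M] measurable_cnj'[of "\<lambda>x. cnj (f x)" M]
  unfolding sq_def complex_cnj_cnj complex_mod_cnj by blast

lemma nm_cnj[simp]: "nm M (\<lambda>x. cnj (f x)) = nm M f"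
  by (simp add: nm_def)

lemma sq_scale: "sq M f \<Longrightarrow> sq M (\<lambda>x. c * f x)"
  unfolding sq_def by (auto simp: norm_mult power_mult_distrib)

lemma nm_scale: "nm M (\<lambda>x. c * f x) = cmod c * nm M f"
  by (simp add: nm_def norm_mult power_mult_distrib real_sqrt_mult)

lemma sq_bound:
  assumes "sq M f" "g \<in> borel_measurable M" "AE x in M. cmod (g x) \<le> cmod (f x)"
  shows "sq M g" "nm M g \<le> nm M f"
proof -
  have ae: "AE x in M. (cmod (g x))\<^sup>2 \<le> (cmod (f x))\<^sup>2"
    using assms(3) by eventually_elim (simp add: power_mono)
  show s: "sq M g"
    unfolding sq_def
  proof
    show "integrable M (\<lambda>x. (cmod (g x))\<^sup>2)"
      by (rule Bochner_Integration.integrable_bound[of _ "\<lambda>x. (cmod (f x))\<^sup>2"])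
        (use assms ae in \<open>auto simp: sq_def\<close>)
  qed fact
  have "(\<integral>x. (cmod (g x))\<^sup>2 \<partial>M) \<le> (\<integral>x. (cmod (f x))\<^sup>2 \<partial>M)"
    by (rule integral_mono_AE) (use s assms ae in \<open>auto simp: sq_def\<close>)
  then show "nm M g \<le> nm M f" by (simp add: nm_def)
qed

lemma sq_add:
  assumes "sq M f" "sq M g"
  shows "sq M (\<lambda>x. f x + g x)"
  unfolding sq_def
proof
  show "(\<lambda>x. f x + g x) \<in> borel_measurable M" using assms by measurable
  have *: "(cmod (a + b))\<^sup>2 \<le> 2 * (cmod a)\<^sup>2 + 2 * (cmod b)\<^sup>2" for a b
  proof -
    have "(cmod (a + b))\<^sup>2 \<le> (cmod a + cmod b)\<^sup>2"
      by (simp add: norm_triangle_ineq power_mono)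
    also have "\<dots> \<le> 2 * (cmod a)\<^sup>2 + 2 * (cmod b)\<^sup>2"
      using sum_squares_bound[of "cmod a" "cmod b"] by (simp add: power2_sum)
    finally show ?thesis .
  qed
  show "integrable M (\<lambda>x. (cmod (f x + g x))\<^sup>2)"
    by (rule Bochner_Integration.integrable_bound[of _ "\<lambda>x. 2 * (cmod (f x))\<^sup>2 + 2 * (cmod (g x))\<^sup>2"])
      (use assms * in \<open>auto simp: sq_def\<close>)
qed

lemma nm_triangle:
  assumes "sq M f" "sq M g"
  shows "nm M (\<lambda>x. f x + g x) \<le> nm M f + nm M g"
proof -
  have i: "integrable M (\<lambda>x. cmod (f x) * cmod (g x))"
    using sq_mult_integrable[OF assms, THEN integrable_norm] by (simp add: norm_mult)
  have *: "(cmod (a + b))\<^sup>2 \<le> (cmod a)\<^sup>2 + (cmod b)\<^sup>2 + 2 * (cmod a * cmod b)" for a b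
  proof -
    have "(cmod (a + b))\<^sup>2 \<le> (cmod a + cmod b)\<^sup>2"
      by (simp add: norm_triangle_ineq power_mono)
    then show ?thesis by (simp add: power2_sum)
  qed
  have "(nm M (\<lambda>x. f x + g x))\<^sup>2 \<le> (\<integral>x. (cmod (f x))\<^sup>2 + (cmod (g x))\<^sup>2 + 2 * (cmod (f x) * cmod (g x)) \<partial>M)"
    unfolding nm_sq by (rule integral_mono) (use sq_add[OF assms] assms i * in \<open>auto simp: sq_def\<close>)
  also have "\<dots> = (nm M f)\<^sup>2 + (nm M g)\<^sup>2 + 2 * (\<integral>x. cmod (f x) * cmod (g x) \<partial>M)"
    using assms i by (simp add: sq_def nm_sq)
  also have "\<dots> \<le> (nm M f + nm M g)\<^sup>2"
    using nm_CS_abs[OF assms] by (simp add: power2_sum)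
  finally show ?thesis by (rule power2_le_imp_le) simp
qed

lemma sq_diff: "sq M f \<Longrightarrow> sq M g \<Longrightarrow> sq M (\<lambda>x. f x - g x)"
  using sq_add[of M f "\<lambda>x. - 1 * g x"] sq_scale[of M g "-1"] by simp

lemma nm_triangle_diff:
  assumes "sq M f" "sq M g"
  shows "nm M (\<lambda>x. f x - g x) \<le> nm M f + nm M g"
  using nm_triangle[of M f "\<lambda>x. - 1 * g x"] sq_scale[of M g "-1"] assms nm_scale[of M "-1" g] by simp

lemma nm_cong_AE:
  assumes "f \<in> borel_measurable M" "g \<in> borel_measurable M" "AE x in M. f x = g x"
  shows "nm M f = nm M g"
  unfolding nm_def using assms by (intro arg_cong[where f=sqrt] integral_cong_AE) auto

definition hs_op :: "'a measure \<Rightarrow> ('a \<Rightarrow> 'a \<Rightarrow> complex) \<Rightarrow> ('a \<Rightarrow> complex) \<Rightarrow> 'a \<Rightarrow> complex" where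
  "hs_op M k f x = (\<integral>y. k x y * f y \<partial>M)"

text \<open>Cauchy--Schwarz in each row, then Tonelli collects the squared row norms into the
  squared norm on the product. Rows are square-integrable at every point, so the operator has a
  meaningful value everywhere and not just almost everywhere.\<close>

lemma hs_op_bound:
  assumes "sigma_finite_measure M"
    and k: "sq (M \<Otimes>\<^sub>M M) (\<lambda>p. k (fst p) (snd p))" and r: "\<And>x. x \<in> space M \<Longrightarrow> sq M (k x)" and f: "sq M f"
  shows "sq M (hs_op M k f)" "nm M (hs_op M k f) \<le> nm (M \<Otimes>\<^sub>M M) (\<lambda>p. k (fst p) (snd p)) * nm M f"
proof -
  interpret sigma_finite_measure M by fact
  have [measurable]: "(\<lambda>p. k (fst p) (snd p)) \<in> borel_measurable (M \<Otimes>\<^sub>M M)" using k by measurable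
  have [measurable]: "f \<in> borel_measurable M" using f by measurable
  have m: "hs_op M k f \<in> borel_measurable M"
  proof -
    have "(\<lambda>x. \<integral>y. k (fst (x, y)) (snd (x, y)) * f (snd (x,y)) \<partial>M) \<in> borel_measurable M"
      by measurable
    then show ?thesis by (simp add: hs_op_def[abs_def])
  qed
  have "(\<integral>\<^sup>+x. ennreal ((cmod (hs_op M k f x))\<^sup>2) \<partial>M) \<le> (\<integral>\<^sup>+x. (\<integral>\<^sup>+y. ennreal ((cmod (k x y))\<^sup>2) \<partial>M) * ennreal ((nm M f)\<^sup>2) \<partial>M)"
  proof (rule nn_integral_mono)
    fix x assume "x \<in> space M"
    then have s: "sq M (k x)" by (rule r)
    have "cmod (hs_op M k f x) \<le> nm M (k x) * nm M f"
      unfolding hs_op_def by (rule nm_CS[OF s f])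
    then have "(cmod (hs_op M k f x))\<^sup>2 \<le> (nm M (k x) * nm M f)\<^sup>2" by (rule power_mono) simp
    then show "ennreal ((cmod (hs_op M k f x))\<^sup>2) \<le> (\<integral>\<^sup>+y. ennreal ((cmod (k x y))\<^sup>2) \<partial>M) * ennreal ((nm M f)\<^sup>2)"
      by (simp add: sq_nn_eq[OF s] ennreal_mult[symmetric] power_mult_distrib)
  qed
  also have "\<dots> = (\<integral>\<^sup>+x. (\<integral>\<^sup>+y. ennreal ((cmod (k (fst (x,y)) (snd (x,y))))\<^sup>2) \<partial>M) \<partial>M) * ennreal ((nm M f)\<^sup>2)"
    unfolding fst_conv snd_conv
    by (rule nn_integral_multc) (use borel_measurable_nn_integral_fst[of "\<lambda>p. ennreal ((cmod (k (fst p) (snd p)))\<^sup>2)" M] in simp)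
  also have "\<dots> = (\<integral>\<^sup>+p. ennreal ((cmod (k (fst p) (snd p)))\<^sup>2) \<partial>(M \<Otimes>\<^sub>M M)) * ennreal ((nm M f)\<^sup>2)"
    by (subst nn_integral_fst[symmetric]) auto
  also have "\<dots> = ennreal ((nm (M \<Otimes>\<^sub>M M) (\<lambda>p. k (fst p) (snd p)) * nm M f)\<^sup>2)"
    by (simp add: sq_nn_eq[OF k] ennreal_mult[symmetric] power_mult_distrib)
  finally have b: "(\<integral>\<^sup>+x. ennreal ((cmod (hs_op M k f x))\<^sup>2) \<partial>M) \<le> ennreal ((nm (M \<Otimes>\<^sub>M M) (\<lambda>p. k (fst p) (snd p)) * nm M f)\<^sup>2)" .
  show "sq M (hs_op M k f)" "nm M (hs_op M k f) \<le> nm (M \<Otimes>\<^sub>M M) (\<lambda>p. k (fst p) (snd p)) * nm M f"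
    by (rule nm_le_nn[OF m b], simp)+
qed

text \<open>A Neumann series summed pointwise. The n-th iterate at \<open>x\<close> is at most the
  row norm at \<open>x\<close> times a geometric factor, so the series converges at every point, the
  integral may be exchanged with the sum, and the equation holds everywhere.\<close>

lemma hs_solve:
  assumes "sigma_finite_measure M"
    and k: "sq (M \<Otimes>\<^sub>M M) (\<lambda>p. k (fst p) (snd p))" and r: "\<And>x. x \<in> space M \<Longrightarrow> sq M (k x)" and f: "sq M f"
    and small: "nm (M \<Otimes>\<^sub>M M) (\<lambda>p. k (fst p) (snd p)) \<le> 1/4"
  shows "\<exists>w. sq M w \<and> (\<forall>x\<in>space M. w x = f x + hs_op M k w x)"
proof -
  let ?T = "hs_op M k" and ?K = "nm (M \<Otimes>\<^sub>M M) (\<lambda>p. k (fst p) (snd p))"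
  define W where "W n = (?T ^^ n) f" for n
  have W0: "W 0 = f" and WS: "\<And>n. W (Suc n) = ?T (W n)" by (simp_all add: W_def)
  have W: "sq M (W n) \<and> nm M (W n) \<le> (1/4)^n * nm M f" for n
  proof (induction n)
    case 0 then show ?case using f W0 by simp
  next
    case (Suc n)
    then have *: "sq M (W n)" by simp
    have "nm M (?T (W n)) \<le> ?K * nm M (W n)" by (rule hs_op_bound[OF assms(1) k r *])
    also have "\<dots> \<le> 1/4 * ((1/4)^n * nm M f)" using Suc small by (intro mult_mono) auto
    finally show ?case using hs_op_bound(1)[OF assms(1) k r *] by (simp add: WS)
  qed
  have Wsq: "sq M (W n)" and Wnm: "nm M (W n) \<le> (1/4)^n * nm M f" for n using W by auto
  have [measurable]: "W n \<in> borel_measurable M" for n using Wsq by measurable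
  have geo: "summable (\<lambda>n. C * ((1/4::real)^n * nm M f))" for C
    by (intro summable_mult summable_mult2) (simp add: summable_geometric)
  have pb: "cmod (W (Suc n) x) \<le> nm M (k x) * ((1/4)^n * nm M f)" if "x \<in> space M" for n x
  proof -
    have "cmod (W (Suc n) x) \<le> nm M (k x) * nm M (W n)"
      unfolding WS hs_op_def by (rule nm_CS[OF r[OF that] Wsq])
    also have "\<dots> \<le> nm M (k x) * ((1/4)^n * nm M f)" using Wnm by (intro mult_left_mono) auto
    finally show ?thesis .
  qed
  have sm: "summable (\<lambda>n. norm (W n x))" if "x \<in> space M" for x
    by (subst summable_Suc_iff[symmetric], rule summable_comparison_test[OF _ geo[of "nm M (k x)"]])
      (use pb[OF that] in auto)
  define w where "w x = (\<Sum>n. W n x)" for x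
  have w_eq: "w x = f x + ?T w x" if x: "x \<in> space M" for x
  proof -
    have i: "integrable M (\<lambda>y. k x y * W n y)" for n by (rule sq_mult_integrable[OF r[OF x] Wsq])
    have "(\<lambda>n. \<integral>y. k x y * W n y \<partial>M) sums (\<integral>y. (\<Sum>n. k x y * W n y) \<partial>M)"
    proof (rule sums_integral[OF i])
      show "AE y in M. summable (\<lambda>n. norm (k x y * W n y))"
        using sm by (auto simp: norm_mult intro!: summable_mult)
      have "norm (\<integral>y. norm (k x y * W n y) \<partial>M) \<le> nm M (k x) * ((1/4)^n * nm M f)" for n
      proof -
        have "(\<integral>y. norm (k x y * W n y) \<partial>M) \<le> nm M (k x) * nm M (W n)"
          using nm_CS_abs[OF r[OF x] Wsq] by (simp add: norm_mult)
        also have "\<dots> \<le> nm M (k x) * ((1/4)^n * nm M f)" using Wnm by (intro mult_left_mono) auto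
        finally show ?thesis by simp
      qed
      then show "summable (\<lambda>n. \<integral>y. norm (k x y * W n y) \<partial>M)"
        by (intro summable_comparison_test[OF _ geo[of "nm M (k x)"]]) auto
    qed
    also have "(\<integral>y. (\<Sum>n. k x y * W n y) \<partial>M) = ?T w x"
      unfolding hs_op_def w_def
      by (intro Bochner_Integration.integral_cong refl suminf_mult) (rule summable_norm_cancel, rule sm)
    finally have "(\<lambda>n. W (Suc n) x) sums ?T w x" by (simp add: WS hs_op_def)
    then have "(\<lambda>n. W n x) sums (?T w x + W 0 x)" by (rule sums_Suc)
    then show ?thesis by (simp add: w_def sums_unique[symmetric] W0 add.commute)
  qed
  have [measurable]: "w \<in> borel_measurable M" unfolding w_def by measurable
  have "sq M w"
  proof -
    \<comment> \<open>The majorant of \<open>w - f\<close>: the row norm times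
      \<open>4/3 * nm M f\<close>, where \<open>4/3\<close> is the sum of the powers of
      \<open>1/4\<close>. It is square-integrable because the squared row norms integrate to the
      squared Hilbert--Schmidt norm.\<close>
    have meas: "(\<lambda>x. of_real (nm M (k x) * (4/3 * nm M f)) :: complex) \<in> borel_measurable M"
      and "(\<integral>\<^sup>+x. ennreal ((cmod (of_real (nm M (k x) * (4/3 * nm M f)) :: complex))\<^sup>2) \<partial>M) < \<infinity>"
    proof -
      interpret sigma_finite_measure M by fact
      have [measurable]: "(\<lambda>p. k (fst p) (snd p)) \<in> borel_measurable (M \<Otimes>\<^sub>M M)" using k by measurable
      have "(\<lambda>x. \<integral>y. (cmod (k (fst (x,y)) (snd (x,y))))\<^sup>2 \<partial>M) \<in> borel_measurable M" by measurable
      then have 1[measurable]: "(\<lambda>x. nm M (k x)) \<in> borel_measurable M" unfolding nm_def by simp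
      show "(\<lambda>x. of_real (nm M (k x) * (4/3 * nm M f)) :: complex) \<in> borel_measurable M" by measurable
      have "(\<integral>\<^sup>+x. ennreal ((cmod (of_real (nm M (k x) * (4/3 * nm M f)) :: complex))\<^sup>2) \<partial>M)
         = (\<integral>\<^sup>+x. ennreal ((nm M (k x))\<^sup>2) * ennreal ((4/3 * nm M f)\<^sup>2) \<partial>M)"
        by (intro nn_integral_cong)
          (simp add: norm_mult ennreal_mult[symmetric] power_mult_distrib[symmetric])
      also have "\<dots> = (\<integral>\<^sup>+x. ennreal ((nm M (k x))\<^sup>2) \<partial>M) * ennreal ((4/3 * nm M f)\<^sup>2)"
        by (rule nn_integral_multc) simp
      also have "(\<integral>\<^sup>+x. ennreal ((nm M (k x))\<^sup>2) \<partial>M) = (\<integral>\<^sup>+x. (\<integral>\<^sup>+y. ennreal ((cmod (k (fst (x,y)) (snd (x,y))))\<^sup>2) \<partial>M) \<partial>M)"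
        by (rule nn_integral_cong) (simp add: sq_nn_eq r)
      also have "\<dots> = (\<integral>\<^sup>+p. ennreal ((cmod (k (fst p) (snd p)))\<^sup>2) \<partial>(M \<Otimes>\<^sub>M M))"
        by (rule nn_integral_fst) simp
      also have "\<dots> * ennreal ((4/3 * nm M f)\<^sup>2) < \<infinity>"
        using sq_nn_eq[OF k] by (simp add: ennreal_mult_less_top)
      finally show "(\<integral>\<^sup>+x. ennreal ((cmod (of_real (nm M (k x) * (4/3 * nm M f)) :: complex))\<^sup>2) \<partial>M) < \<infinity>" .
    qed
    then have D: "sq M (\<lambda>x. of_real (nm M (k x) * (4/3 * nm M f)))" by (simp add: sq_iff_nn)
    have "sq M (\<lambda>x. w x - f x)"
    proof (rule sq_bound(1)[OF D])
      show "(\<lambda>x. w x - f x) \<in> borel_measurable M" using f by measurable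
      have "cmod (w x - f x) \<le> nm M (k x) * (4/3 * nm M f)" if x: "x \<in> space M" for x
      proof -
        have s: "summable (\<lambda>n. W n x)" using sm[OF x] by (rule summable_norm_cancel)
        have "w x - f x = (\<Sum>n. W (Suc n) x)"
          using suminf_split_head[OF s] by (simp add: w_def W0)
        also have "cmod \<dots> \<le> (\<Sum>n. nm M (k x) * ((1/4)^n * nm M f))"
          by (rule norm_suminf_le[OF pb[OF x] geo])
        also have "\<dots> = nm M (k x) * ((\<Sum>n. (1/4)^n) * nm M f)"
          by (subst suminf_mult, intro summable_mult2, simp add: summable_geometric)
            (subst suminf_mult2, auto simp: summable_geometric)
        also have "\<dots> = nm M (k x) * (4/3 * nm M f)" by (simp add: suminf_geometric)
        finally show ?thesis .
      qed
      then show "AE x in M. cmod (w x - f x) \<le> cmod (of_real (nm M (k x) * (4/3 * nm M f)))"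
        by (auto simp: norm_mult)
    qed
    from sq_add[OF this f] show ?thesis by simp
  qed
  then show ?thesis using w_eq by blast
qed

section \<open>Frequency spaces\<close>

text \<open>Instances: the line with \<open>\<omega>(\<xi>) = \<xi>\<close>, and \<open>\<int>\<close> with counting measure and \<open>\<omega>(k) = 2 \<pi> k\<close>.\<close>

locale freq_space = sigma_finite_measure \<mu> for \<mu> :: "'a::ab_group_add measure" +
  fixes \<omega> :: "'a \<Rightarrow> real"
  assumes space_mu [simp]: "space \<mu> = UNIV"
    and minus_measurable: "(\<lambda>p. fst p - snd p) \<in> measurable (\<mu> \<Otimes>\<^sub>M \<mu>) \<mu>"
    and freq_measurable [measurable]: "\<omega> \<in> borel_measurable \<mu>"
    and freq_add [simp]: "\<And>x y. \<omega> (x + y) = \<omega> x + \<omega> y"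
    and distr_shift: "\<And>a. distr \<mu> \<mu> (\<lambda>x. x + a) = \<mu>"
    and distr_reflect: "distr \<mu> \<mu> uminus = \<mu>"
    and growth: "\<And>a b. 1 \<le> b - a \<Longrightarrow> emeasure \<mu> {x. a \<le> \<omega> x \<and> \<omega> x < b} \<le> ennreal (2 * (b - a))"
begin

lemma freq_zero [simp]: "\<omega> 0 = 0"
  using freq_add[of 0 0] by simp

lemma freq_minus [simp]: "\<omega> (- x) = - \<omega> x"
  using freq_add[of x "- x"] by simp

lemma freq_diff [simp]: "\<omega> (x - y) = \<omega> x - \<omega> y"
  using freq_add[of x "- y"] by simp

lemma measurable_diff' [measurable (raw)]:
  assumes "f \<in> measurable N \<mu>" "g \<in> measurable N \<mu>"
  shows "(\<lambda>x. f x - g x) \<in> measurable N \<mu>"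
  using measurable_compose[OF measurable_Pair[OF assms] minus_measurable] by simp

lemma measurable_uminus' [measurable (raw)]:
  assumes "f \<in> measurable N \<mu>"
  shows "(\<lambda>x. - f x) \<in> measurable N \<mu>"
  using measurable_diff'[OF measurable_const[of 0 \<mu>] assms] by simp

lemma measurable_add' [measurable (raw)]:
  assumes "f \<in> measurable N \<mu>" "g \<in> measurable N \<mu>"
  shows "(\<lambda>x. f x + g x) \<in> measurable N \<mu>"
  using measurable_diff'[OF assms(1) measurable_uminus'[OF assms(2)]] by simp

lemma pair_sigma: "pair_sigma_finite \<mu> \<mu>"
  by standard

sublocale P: pair_sigma_finite \<mu> \<mu>
  by (rule pair_sigma)

lemma nn_integral_shift:
  assumes [measurable]: "f \<in> borel_measurable \<mu>"
  shows "(\<integral>\<^sup>+x. f (x + a) \<partial>\<mu>) = (\<integral>\<^sup>+x. f x \<partial>\<mu>)"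
proof -
  have "(\<integral>\<^sup>+x. f x \<partial>\<mu>) = (\<integral>\<^sup>+x. f x \<partial>(distr \<mu> \<mu> (\<lambda>x. x + a)))" by (simp add: distr_shift)
  also have "\<dots> = (\<integral>\<^sup>+x. f (x + a) \<partial>\<mu>)" by (rule nn_integral_distr) measurable
  finally show ?thesis by simp
qed

lemma nn_integral_reflect:
  assumes [measurable]: "f \<in> borel_measurable \<mu>"
  shows "(\<integral>\<^sup>+x. f (- x) \<partial>\<mu>) = (\<integral>\<^sup>+x. f x \<partial>\<mu>)"
proof -
  have "(\<integral>\<^sup>+x. f x \<partial>\<mu>) = (\<integral>\<^sup>+x. f x \<partial>(distr \<mu> \<mu> uminus))" by (simp add: distr_reflect)
  also have "\<dots> = (\<integral>\<^sup>+x. f (- x) \<partial>\<mu>)" by (rule nn_integral_distr) measurable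
  finally show ?thesis by simp
qed

lemma nn_integral_sub:
  assumes [measurable]: "f \<in> borel_measurable \<mu>"
  shows "(\<integral>\<^sup>+x. f (a - x) \<partial>\<mu>) = (\<integral>\<^sup>+x. f x \<partial>\<mu>)"
  using nn_integral_reflect[of "\<lambda>x. f (x + a)"] nn_integral_shift[OF assms, of a] by simp

lemma integral_shift:
  fixes f :: "'a \<Rightarrow> complex"
  assumes [measurable]: "f \<in> borel_measurable \<mu>"
  shows "(\<integral>x. f (x + a) \<partial>\<mu>) = (\<integral>x. f x \<partial>\<mu>)"
proof -
  have "(\<integral>x. f x \<partial>\<mu>) = (\<integral>x. f x \<partial>(distr \<mu> \<mu> (\<lambda>x. x + a)))" by (simp add: distr_shift)
  also have "\<dots> = (\<integral>x. f (x + a) \<partial>\<mu>)" by (rule integral_distr) measurable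
  finally show ?thesis by simp
qed

lemma integral_reflect:
  fixes f :: "'a \<Rightarrow> complex"
  assumes [measurable]: "f \<in> borel_measurable \<mu>"
  shows "(\<integral>x. f (- x) \<partial>\<mu>) = (\<integral>x. f x \<partial>\<mu>)"
proof -
  have "(\<integral>x. f x \<partial>\<mu>) = (\<integral>x. f x \<partial>(distr \<mu> \<mu> uminus))" by (simp add: distr_reflect)
  also have "\<dots> = (\<integral>x. f (- x) \<partial>\<mu>)" by (rule integral_distr) measurable
  finally show ?thesis by simp
qed

lemma integral_sub:
  fixes f :: "'a \<Rightarrow> complex"
  assumes [measurable]: "f \<in> borel_measurable \<mu>"
  shows "(\<integral>x. f (a - x) \<partial>\<mu>) = (\<integral>x. f x \<partial>\<mu>)"
  using integral_reflect[of "\<lambda>x. f (x + a)"] integral_shift[OF assms, of a] by simp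

lemma integrable_iff_nn:
  fixes f :: "'b \<Rightarrow> complex"
  assumes "f \<in> borel_measurable N"
  shows "integrable N f \<longleftrightarrow> (\<integral>\<^sup>+x. ennreal (cmod (f x)) \<partial>N) < \<infinity>"
  using assms by (auto simp: integrable_iff_bounded)

lemma integrable_sub:
  fixes f :: "'a \<Rightarrow> complex"
  assumes f: "integrable \<mu> f"
  shows "integrable \<mu> (\<lambda>x. f (a - x))"
proof -
  have [measurable]: "f \<in> borel_measurable \<mu>" using f by simp
  show ?thesis using f nn_integral_sub[of "\<lambda>x. ennreal (cmod (f x))" a]
    by (simp add: integrable_iff_nn)
qed

lemma integrable_reflect:
  fixes f :: "'a \<Rightarrow> complex"
  shows "integrable \<mu> f \<Longrightarrow> integrable \<mu> (\<lambda>x. f (- x))"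
  using integrable_sub[of f 0] by simp

lemma sq_sub: "sq \<mu> f \<Longrightarrow> sq \<mu> (\<lambda>x. f (a - x))"
proof -
  assume f: "sq \<mu> f"
  have [measurable]: "f \<in> borel_measurable \<mu>" using f by measurable
  show ?thesis using f nn_integral_sub[of "\<lambda>x. ennreal ((cmod (f x))\<^sup>2)" a]
    by (simp add: sq_iff_nn)
qed

definition conv :: "('a \<Rightarrow> complex) \<Rightarrow> ('a \<Rightarrow> complex) \<Rightarrow> 'a \<Rightarrow> complex" where
  "conv f g x = (\<integral>y. f (x - y) * g y \<partial>\<mu>)"

lemma conv_measurable[measurable]:
  assumes [measurable]: "f \<in> borel_measurable \<mu>" "g \<in> borel_measurable \<mu>"
  shows "conv f g \<in> borel_measurable \<mu>"
  unfolding conv_def[abs_def] by measurable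

section \<open>Hilbert--Schmidt bounds for the symmetrised equation\<close>

definition rt :: "real \<Rightarrow> 'a \<Rightarrow> real" where
  "rt \<kappa> x = (if 0 \<le> \<omega> x then 1 / sqrt (\<omega> x + \<kappa>) else 0)"

lemma rt_measurable[measurable]: "rt \<kappa> \<in> borel_measurable \<mu>"
  unfolding rt_def[abs_def] by measurable

lemma rt_nonneg[simp]: "1 \<le> \<kappa> \<Longrightarrow> 0 \<le> rt \<kappa> x"
  by (simp add: rt_def)

lemma rt_le1: "1 \<le> \<kappa> \<Longrightarrow> rt \<kappa> x \<le> 1"
  by (simp add: rt_def)

lemma rt_sq: "1 \<le> \<kappa> \<Longrightarrow> (rt \<kappa> x)\<^sup>2 = (if 0 \<le> \<omega> x then 1 / (\<omega> x + \<kappa>) else 0)"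
  by (simp add: rt_def power_divide)

text \<open>In operator terms: convolution with \<open>u\<close>, i.e. multiplication by the
  potential, between two copies of the multiplier (\<omega> + \<kappa>)^(-1/2) cut off to \<omega>
  \<ge> 0. The symmetric splitting makes the operator hermitian for a real potential.\<close>

definition kern :: "real \<Rightarrow> ('a \<Rightarrow> complex) \<Rightarrow> 'a \<Rightarrow> 'a \<Rightarrow> complex" where
  "kern \<kappa> u x y = of_real (rt \<kappa> x) * u (x - y) * of_real (rt \<kappa> y)"

definition qf :: "('a \<Rightarrow> complex) \<Rightarrow> real \<Rightarrow> ennreal" where
  "qf u k = (\<integral>\<^sup>+x. ennreal ((cmod (u x))\<^sup>2 / (\<bar>\<omega> x\<bar> + k)) \<partial>\<mu>)"

definition hsq :: "('a \<Rightarrow> complex) \<Rightarrow> real \<Rightarrow> ennreal" where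
  "hsq u \<kappa> = (\<Sum>j. qf u (2 ^ j * \<kappa>))"

lemma kern_row:
  assumes k: "1 \<le> \<kappa>" and u: "sq \<mu> u"
  shows "sq \<mu> (kern \<kappa> u x)"
proof (rule sq_bound(1)[OF sq_sub[OF u, of x]])
  have [measurable]: "u \<in> borel_measurable \<mu>" using u by measurable
  show "kern \<kappa> u x \<in> borel_measurable \<mu>" unfolding kern_def[abs_def] by measurable
  have "cmod (kern \<kappa> u x y) \<le> cmod (u (x - y))" for y
  proof -
    have "cmod (kern \<kappa> u x y) = rt \<kappa> x * cmod (u (x - y)) * rt \<kappa> y"
      using k by (simp add: kern_def norm_mult)
    also have "\<dots> \<le> 1 * cmod (u (x - y)) * 1"
      using k by (intro mult_mono rt_le1) auto
    finally show ?thesis by simp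
  qed
  then show "AE y in \<mu>. cmod (kern \<kappa> u x y) \<le> cmod (u (x - y))" by simp
qed

lemma dyadic_exists:
  assumes "0 < \<kappa>" "\<kappa> \<le> (t::real)"
  shows "\<exists>j::nat. 2 ^ j * \<kappa> \<le> t \<and> t < 2 * (2 ^ j * \<kappa>)"
proof -
  obtain n where n: "t / \<kappa> < 2 ^ n" using real_arch_pow[of 2 "t / \<kappa>"] by auto
  define m where "m = (LEAST n. t < 2 ^ n * \<kappa>)"
  have ex: "t < 2 ^ n * \<kappa>" using n assms by (simp add: field_simps)
  then have m: "t < 2 ^ m * \<kappa>" unfolding m_def by (rule LeastI)
  have "m \<noteq> 0" using m assms by (cases "m = 0") auto
  then obtain j where j: "m = Suc j" by (cases m) auto
  have "\<not> t < 2 ^ j * \<kappa>" using j not_less_Least[of j "\<lambda>n. t < 2 ^ n * \<kappa>"] by (simp add: m_def)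
  then show ?thesis using m j by (intro exI[of _ j]) auto
qed

text \<open>Split by the dyadic size 2^j \<kappa> of \<omega> y + \<kappa>. On such a shell the
  integrand is at most 1/((\<omega> z + 2^j \<kappa>) 2^j \<kappa>), and \<open>growth\<close>
  applies since the shell has length 2^j \<kappa> \<ge> 1; its measure cancels one factor.\<close>

lemma weight_bound_pos:
  assumes k: "1 \<le> \<kappa>" and z: "0 \<le> \<omega> z"
  shows "(\<integral>\<^sup>+y. ennreal ((rt \<kappa> (z + y))\<^sup>2 * (rt \<kappa> y)\<^sup>2) \<partial>\<mu>) \<le> (\<Sum>j. ennreal (2 / (\<bar>\<omega> z\<bar> + 2 ^ j * \<kappa>)))"
proof -
  let ?A = "\<lambda>j::nat. {y. 2 ^ j * \<kappa> - \<kappa> \<le> \<omega> y \<and> \<omega> y < 2 * (2 ^ j * \<kappa>) - \<kappa>}"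
  let ?c = "\<lambda>j::nat. ennreal (1 / ((\<omega> z + 2 ^ j * \<kappa>) * (2 ^ j * \<kappa>)))"
  have A[measurable]: "?A j \<in> sets \<mu>" for j
    using measurable_sets[OF freq_measurable, of "{2 ^ j * \<kappa> - \<kappa>..<2 * (2 ^ j * \<kappa>) - \<kappa>}"]
    by (simp add: vimage_def)
  have "(\<integral>\<^sup>+y. ennreal ((rt \<kappa> (z + y))\<^sup>2 * (rt \<kappa> y)\<^sup>2) \<partial>\<mu>) \<le> (\<integral>\<^sup>+y. (\<Sum>j. ?c j * indicator (?A j) y) \<partial>\<mu>)"
  proof (rule nn_integral_mono)
    fix y
    show "ennreal ((rt \<kappa> (z + y))\<^sup>2 * (rt \<kappa> y)\<^sup>2) \<le> (\<Sum>j. ?c j * indicator (?A j) y)"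
    proof (cases "0 \<le> \<omega> y")
      case False then show ?thesis using k by (simp add: rt_def)
    next
      case True
      then have "\<kappa> \<le> \<omega> y + \<kappa>" by simp
      then obtain j :: nat where j: "2 ^ j * \<kappa> \<le> \<omega> y + \<kappa>" "\<omega> y + \<kappa> < 2 * (2 ^ j * \<kappa>)"
        using dyadic_exists[of \<kappa> "\<omega> y + \<kappa>"] k by auto
      have p: "0 < 2 ^ j * \<kappa>" using k by simp
      have "(rt \<kappa> (z + y))\<^sup>2 * (rt \<kappa> y)\<^sup>2 = 1 / ((\<omega> z + (\<omega> y + \<kappa>)) * (\<omega> y + \<kappa>))"
        using True z k by (simp add: rt_sq algebra_simps)
      also have "\<dots> \<le> 1 / ((\<omega> z + 2 ^ j * \<kappa>) * (2 ^ j * \<kappa>))"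
        using j p z k True by (intro divide_left_mono mult_mono mult_pos_pos add_nonneg_pos) auto
      finally have "ennreal ((rt \<kappa> (z + y))\<^sup>2 * (rt \<kappa> y)\<^sup>2) \<le> ?c j * indicator (?A j) y"
        using j by (simp add: ennreal_leI indicator_def)
      also have "\<dots> \<le> (\<Sum>j. ?c j * indicator (?A j) y)"
        by (rule le_suminf_ennreal)
      finally show ?thesis .
    qed
  qed
  also have "\<dots> = (\<Sum>j. ?c j * emeasure \<mu> (?A j))"
    by (subst nn_integral_suminf) (auto simp: nn_integral_cmult)
  also have "\<dots> \<le> (\<Sum>j. ennreal (2 / (\<bar>\<omega> z\<bar> + 2 ^ j * \<kappa>)))"
  proof (rule suminf_le)
    fix j :: nat
    have p: "1 \<le> 2 ^ j * \<kappa>" using k one_le_power[of "2::real" j] mult_mono[of 1 "2^j::real" 1 \<kappa>] by simp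
    have "emeasure \<mu> (?A j) \<le> ennreal (2 * (2 * (2 ^ j * \<kappa>) - \<kappa> - (2 ^ j * \<kappa> - \<kappa>)))"
      by (rule growth) (use p in linarith)
    also have "\<dots> = ennreal (2 * (2 ^ j * \<kappa>))" by (simp add: algebra_simps)
    finally have "?c j * emeasure \<mu> (?A j) \<le> ?c j * ennreal (2 * (2 ^ j * \<kappa>))" by (rule mult_left_mono) simp
    also have "\<dots> = ennreal (1 / ((\<omega> z + 2 ^ j * \<kappa>) * (2 ^ j * \<kappa>)) * (2 * (2 ^ j * \<kappa>)))"
      by (rule ennreal_mult[symmetric]) (use z p in \<open>auto intro!: divide_nonneg_nonneg mult_nonneg_nonneg add_nonneg_nonneg\<close>)
    also have "1 / ((\<omega> z + 2 ^ j * \<kappa>) * (2 ^ j * \<kappa>)) * (2 * (2 ^ j * \<kappa>)) = 2 / (\<bar>\<omega> z\<bar> + 2 ^ j * \<kappa>)"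
      using z p k by (simp add: divide_simps)
    finally show "?c j * emeasure \<mu> (?A j) \<le> ennreal (2 / (\<bar>\<omega> z\<bar> + 2 ^ j * \<kappa>))" .
  qed auto
  finally show ?thesis .
qed

lemma weight_bound:
  assumes k: "1 \<le> \<kappa>"
  shows "(\<integral>\<^sup>+y. ennreal ((rt \<kappa> (z + y))\<^sup>2 * (rt \<kappa> y)\<^sup>2) \<partial>\<mu>) \<le> (\<Sum>j. ennreal (2 / (\<bar>\<omega> z\<bar> + 2 ^ j * \<kappa>)))"
proof (cases "0 \<le> \<omega> z")
  case True then show ?thesis using weight_bound_pos k by blast
next
  \<comment> \<open>For \<omega> z < 0, translating \<open>y\<close> by \<open>- z\<close> exchanges
    the two weights and so replaces \<open>z\<close> by \<open>- z\<close>.\<close>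
  case False
  have "(\<integral>\<^sup>+y. ennreal ((rt \<kappa> (z + y))\<^sup>2 * (rt \<kappa> y)\<^sup>2) \<partial>\<mu>)
      = (\<integral>\<^sup>+y. ennreal ((rt \<kappa> (z + (y + - z)))\<^sup>2 * (rt \<kappa> (y + - z))\<^sup>2) \<partial>\<mu>)"
    by (rule nn_integral_shift[symmetric]) measurable
  also have "\<dots> = (\<integral>\<^sup>+y. ennreal ((rt \<kappa> (- z + y))\<^sup>2 * (rt \<kappa> y)\<^sup>2) \<partial>\<mu>)"
    by (simp add: algebra_simps)
  also have "\<dots> \<le> (\<Sum>j. ennreal (2 / (\<bar>\<omega> (- z)\<bar> + 2 ^ j * \<kappa>)))"
    by (rule weight_bound_pos) (use k False in auto)
  finally show ?thesis by simp
qed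

text \<open>The shift of \<open>x\<close> by \<open>y\<close> turns \<open>u (x - y)\<close> into
  \<open>u x\<close>, so the integral over \<open>y\<close> meets the two weights alone and
  \<open>weight_bound\<close> produces the dyadic sum.\<close>

lemma kern_hs_nn:
  assumes k: "1 \<le> \<kappa>" and [measurable]: "u \<in> borel_measurable \<mu>"
  shows "(\<integral>\<^sup>+p. ennreal ((cmod (kern \<kappa> u (fst p) (snd p)))\<^sup>2) \<partial>(\<mu> \<Otimes>\<^sub>M \<mu>)) \<le> 2 * hsq u \<kappa>"
proof -
  have "(\<integral>\<^sup>+p. ennreal ((cmod (kern \<kappa> u (fst p) (snd p)))\<^sup>2) \<partial>(\<mu> \<Otimes>\<^sub>M \<mu>))
     = (\<integral>\<^sup>+y. \<integral>\<^sup>+x. ennreal ((cmod (kern \<kappa> u x y))\<^sup>2) \<partial>\<mu> \<partial>\<mu>)"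
    by (subst P.nn_integral_snd[symmetric]) (auto simp: kern_def)
  also have "\<dots> = (\<integral>\<^sup>+y. \<integral>\<^sup>+x. ennreal ((cmod (kern \<kappa> u (x + y) y))\<^sup>2) \<partial>\<mu> \<partial>\<mu>)"
    by (intro nn_integral_cong nn_integral_shift[symmetric]) (simp add: kern_def)
  also have "\<dots> = (\<integral>\<^sup>+y. \<integral>\<^sup>+x. ennreal ((cmod (u x))\<^sup>2) * ennreal ((rt \<kappa> (x + y))\<^sup>2 * (rt \<kappa> y)\<^sup>2) \<partial>\<mu> \<partial>\<mu>)"
    using k by (intro nn_integral_cong)
      (simp add: kern_def norm_mult ennreal_mult[symmetric] power_mult_distrib mult_ac)
  also have "\<dots> = (\<integral>\<^sup>+x. \<integral>\<^sup>+y. ennreal ((cmod (u x))\<^sup>2) * ennreal ((rt \<kappa> (x + y))\<^sup>2 * (rt \<kappa> y)\<^sup>2) \<partial>\<mu> \<partial>\<mu>)"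
    by (rule P.Fubini') measurable
  also have "\<dots> = (\<integral>\<^sup>+x. ennreal ((cmod (u x))\<^sup>2) * (\<integral>\<^sup>+y. ennreal ((rt \<kappa> (x + y))\<^sup>2 * (rt \<kappa> y)\<^sup>2) \<partial>\<mu>) \<partial>\<mu>)"
    by (intro nn_integral_cong nn_integral_cmult) measurable
  also have "\<dots> \<le> (\<integral>\<^sup>+x. ennreal ((cmod (u x))\<^sup>2) * (\<Sum>j. ennreal (2 / (\<bar>\<omega> x\<bar> + 2 ^ j * \<kappa>))) \<partial>\<mu>)"
    by (intro nn_integral_mono mult_left_mono weight_bound k) simp
  also have "\<dots> = (\<integral>\<^sup>+x. (\<Sum>j. 2 * ennreal ((cmod (u x))\<^sup>2 / (\<bar>\<omega> x\<bar> + 2 ^ j * \<kappa>))) \<partial>\<mu>)"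
  proof (rule nn_integral_cong)
    fix x
    have "ennreal ((cmod (u x))\<^sup>2) * ennreal (2 / (\<bar>\<omega> x\<bar> + 2 ^ j * \<kappa>)) = 2 * ennreal ((cmod (u x))\<^sup>2 / (\<bar>\<omega> x\<bar> + 2 ^ j * \<kappa>))" for j :: nat
    proof -
      have p: "0 < \<bar>\<omega> x\<bar> + 2 ^ j * \<kappa>" using k by (intro add_nonneg_pos) auto
      have "ennreal ((cmod (u x))\<^sup>2) * ennreal (2 / (\<bar>\<omega> x\<bar> + 2 ^ j * \<kappa>)) = ennreal ((cmod (u x))\<^sup>2 * (2 / (\<bar>\<omega> x\<bar> + 2 ^ j * \<kappa>)))"
        by (rule ennreal_mult[symmetric]) (use p in auto)
      also have "(cmod (u x))\<^sup>2 * (2 / (\<bar>\<omega> x\<bar> + 2 ^ j * \<kappa>)) = 2 * ((cmod (u x))\<^sup>2 / (\<bar>\<omega> x\<bar> + 2 ^ j * \<kappa>))" by simp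
      also have "ennreal \<dots> = ennreal 2 * ennreal ((cmod (u x))\<^sup>2 / (\<bar>\<omega> x\<bar> + 2 ^ j * \<kappa>))"
        by (rule ennreal_mult) (use p in auto)
      finally show ?thesis by simp
    qed
    then show "ennreal ((cmod (u x))\<^sup>2) * (\<Sum>j. ennreal (2 / (\<bar>\<omega> x\<bar> + 2 ^ j * \<kappa>)))
       = (\<Sum>j. 2 * ennreal ((cmod (u x))\<^sup>2 / (\<bar>\<omega> x\<bar> + 2 ^ j * \<kappa>)))"
      by (simp only: ennreal_suminf_cmult[symmetric])
  qed
  also have "\<dots> = (\<Sum>j. 2 * (\<integral>\<^sup>+x. ennreal ((cmod (u x))\<^sup>2 / (\<bar>\<omega> x\<bar> + 2 ^ j * \<kappa>)) \<partial>\<mu>))"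
    by (subst nn_integral_suminf) (auto simp: nn_integral_cmult)
  also have "\<dots> = 2 * hsq u \<kappa>"
    by (simp add: hsq_def qf_def)
  finally show ?thesis .
qed

lemma kern_hs:
  assumes k: "1 \<le> \<kappa>" and u: "sq \<mu> u" and h: "hsq u \<kappa> \<le> ennreal (c\<^sup>2 / 2)" and c: "0 \<le> c"
  shows "sq (\<mu> \<Otimes>\<^sub>M \<mu>) (\<lambda>p. kern \<kappa> u (fst p) (snd p))" "nm (\<mu> \<Otimes>\<^sub>M \<mu>) (\<lambda>p. kern \<kappa> u (fst p) (snd p)) \<le> c"
proof -
  have [measurable]: "u \<in> borel_measurable \<mu>" using u by measurable
  have m: "(\<lambda>p. kern \<kappa> u (fst p) (snd p)) \<in> borel_measurable (\<mu> \<Otimes>\<^sub>M \<mu>)" unfolding kern_def by measurable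
  have "(\<integral>\<^sup>+p. ennreal ((cmod (kern \<kappa> u (fst p) (snd p)))\<^sup>2) \<partial>(\<mu> \<Otimes>\<^sub>M \<mu>)) \<le> 2 * hsq u \<kappa>"
    by (rule kern_hs_nn[OF k]) measurable
  also have "\<dots> \<le> 2 * ennreal (c\<^sup>2 / 2)" by (rule mult_left_mono[OF h]) simp
  also have "\<dots> = ennreal (2 * (c\<^sup>2 / 2))" by (subst ennreal_mult) auto
  finally have "(\<integral>\<^sup>+p. ennreal ((cmod (kern \<kappa> u (fst p) (snd p)))\<^sup>2) \<partial>(\<mu> \<Otimes>\<^sub>M \<mu>)) \<le> ennreal (c\<^sup>2)" by simp
  from nm_le_nn[OF m this c] show "sq (\<mu> \<Otimes>\<^sub>M \<mu>) (\<lambda>p. kern \<kappa> u (fst p) (snd p))"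
    "nm (\<mu> \<Otimes>\<^sub>M \<mu>) (\<lambda>p. kern \<kappa> u (fst p) (snd p)) \<le> c" .
qed

lemma qf_le:
  assumes u: "sq \<mu> u" and k: "0 < k"
  shows "qf u k \<le> ennreal ((nm \<mu> u)\<^sup>2 / k)"
proof -
  have [measurable]: "u \<in> borel_measurable \<mu>" using u by measurable
  have "qf u k \<le> (\<integral>\<^sup>+x. ennreal (1 / k) * ennreal ((cmod (u x))\<^sup>2) \<partial>\<mu>)"
    unfolding qf_def
  proof (rule nn_integral_mono)
    fix x
    have "(cmod (u x))\<^sup>2 / (\<bar>\<omega> x\<bar> + k) \<le> (cmod (u x))\<^sup>2 / k"
      using k by (intro divide_left_mono mult_pos_pos) auto
    then show "ennreal ((cmod (u x))\<^sup>2 / (\<bar>\<omega> x\<bar> + k)) \<le> ennreal (1 / k) * ennreal ((cmod (u x))\<^sup>2)"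
      using k by (simp add: ennreal_mult[symmetric] ennreal_leI)
  qed
  also have "\<dots> = ennreal (1 / k) * ennreal ((nm \<mu> u)\<^sup>2)"
    by (subst nn_integral_cmult) (auto simp: sq_nn_eq[OF u])
  finally show ?thesis using k by (simp add: ennreal_mult[symmetric])
qed

lemma hsq_le:
  assumes u: "sq \<mu> u" and k: "1 \<le> \<kappa>"
  shows "hsq u \<kappa> \<le> ennreal (2 * (nm \<mu> u)\<^sup>2)"
proof -
  have "hsq u \<kappa> \<le> (\<Sum>j. ennreal ((nm \<mu> u)\<^sup>2 * (1/2) ^ j))"
    unfolding hsq_def
  proof (rule suminf_le)
    fix j :: nat
    have p: "1 * 1 \<le> 2 ^ j * \<kappa>" using k by (intro mult_mono) auto
    have "qf u (2 ^ j * \<kappa>) \<le> ennreal ((nm \<mu> u)\<^sup>2 / (2 ^ j * \<kappa>))" by (rule qf_le[OF u]) (use p in auto)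
    also have "\<dots> \<le> ennreal ((nm \<mu> u)\<^sup>2 * (1/2) ^ j)"
    proof (rule ennreal_leI)
      have "(nm \<mu> u)\<^sup>2 / (2 ^ j * \<kappa>) \<le> (nm \<mu> u)\<^sup>2 / (2 ^ j)"
        using k by (intro divide_left_mono) auto
      then show "(nm \<mu> u)\<^sup>2 / (2 ^ j * \<kappa>) \<le> (nm \<mu> u)\<^sup>2 * (1/2) ^ j"
        by (simp add: power_one_over field_simps)
    qed
    finally show "qf u (2 ^ j * \<kappa>) \<le> ennreal ((nm \<mu> u)\<^sup>2 * (1/2) ^ j)" .
  qed auto
  also have "\<dots> = ennreal (\<Sum>j. (nm \<mu> u)\<^sup>2 * (1/2) ^ j)"
    by (rule suminf_ennreal2) (auto intro!: summable_mult summable_geometric)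
  also have "(\<Sum>j. (nm \<mu> u)\<^sup>2 * (1/2) ^ j) = (nm \<mu> u)\<^sup>2 * 2"
    by (subst suminf_mult) (auto simp: suminf_geometric summable_geometric)
  finally show ?thesis by (simp add: mult.commute)
qed

text \<open>A bound valid for every square-integrable \<open>u\<close>, however large: it makes the
  operators of increments, derivatives and remainders of \<open>u\<close> well defined, where no
  smallness is at hand.\<close>

lemma kern_hs_L2:
  assumes k: "1 \<le> \<kappa>" and u: "sq \<mu> u"
  shows "sq (\<mu> \<Otimes>\<^sub>M \<mu>) (\<lambda>p. kern \<kappa> u (fst p) (snd p))" "nm (\<mu> \<Otimes>\<^sub>M \<mu>) (\<lambda>p. kern \<kappa> u (fst p) (snd p)) \<le> 2 * nm \<mu> u"
proof -
  have h: "hsq u \<kappa> \<le> ennreal ((2 * nm \<mu> u)\<^sup>2 / 2)" using hsq_le[OF u k] by (simp add: power_mult_distrib)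
  show "sq (\<mu> \<Otimes>\<^sub>M \<mu>) (\<lambda>p. kern \<kappa> u (fst p) (snd p))" "nm (\<mu> \<Otimes>\<^sub>M \<mu>) (\<lambda>p. kern \<kappa> u (fst p) (snd p)) \<le> 2 * nm \<mu> u"
    by (rule kern_hs[OF k u h]; simp)+
qed

definition kern_op :: "real \<Rightarrow> ('a \<Rightarrow> complex) \<Rightarrow> ('a \<Rightarrow> complex) \<Rightarrow> 'a \<Rightarrow> complex" where
  "kern_op \<kappa> u = hs_op \<mu> (kern \<kappa> u)"

lemma kern_op_bound:
  assumes k: "1 \<le> \<kappa>" and u: "sq \<mu> u" and w: "sq \<mu> w"
  shows "sq \<mu> (kern_op \<kappa> u w)" "nm \<mu> (kern_op \<kappa> u w) \<le> nm (\<mu> \<Otimes>\<^sub>M \<mu>) (\<lambda>p. kern \<kappa> u (fst p) (snd p)) * nm \<mu> w"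
    "nm \<mu> (kern_op \<kappa> u w) \<le> 2 * nm \<mu> u * nm \<mu> w"
proof -
  note b = hs_op_bound[OF sigma_finite_measure_axioms kern_hs_L2(1)[OF k u] kern_row[OF k u] w]
  show "sq \<mu> (kern_op \<kappa> u w)" "nm \<mu> (kern_op \<kappa> u w) \<le> nm (\<mu> \<Otimes>\<^sub>M \<mu>) (\<lambda>p. kern \<kappa> u (fst p) (snd p)) * nm \<mu> w"
    unfolding kern_op_def using b by auto
  note this(2)
  also have "\<dots> \<le> 2 * nm \<mu> u * nm \<mu> w"
    using kern_hs_L2(2)[OF k u] by (rule mult_right_mono) simp
  finally show "nm \<mu> (kern_op \<kappa> u w) \<le> 2 * nm \<mu> u * nm \<mu> w" .
qed

lemma kern_add: "kern \<kappa> (\<lambda>x. u x + u' x) x y = kern \<kappa> u x y + kern \<kappa> u' x y"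
  by (simp add: kern_def algebra_simps)

lemma kern_op_add_kernel:
  assumes "1 \<le> \<kappa>" "sq \<mu> u" "sq \<mu> u'" "sq \<mu> w"
  shows "kern_op \<kappa> (\<lambda>x. u x + u' x) w x = kern_op \<kappa> u w x + kern_op \<kappa> u' w x"
  unfolding kern_op_def hs_op_def kern_add
  by (subst Bochner_Integration.integral_add[symmetric])
    (auto intro!: sq_mult_integrable kern_row assms simp: algebra_simps)

lemma kern_op_scale_kernel: "kern_op \<kappa> (\<lambda>x. c * u x) w x = c * kern_op \<kappa> u w x"
  unfolding kern_op_def hs_op_def
  by (subst integral_mult_right_zero[symmetric]) (auto simp: kern_def algebra_simps)

lemma kern_op_add:
  assumes "1 \<le> \<kappa>" "sq \<mu> u" "sq \<mu> w" "sq \<mu> w'"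
  shows "kern_op \<kappa> u (\<lambda>x. w x + w' x) x = kern_op \<kappa> u w x + kern_op \<kappa> u w' x"
  unfolding kern_op_def hs_op_def
  by (subst Bochner_Integration.integral_add[symmetric])
    (auto intro!: sq_mult_integrable kern_row assms simp: algebra_simps)

lemma kern_op_diff:
  assumes "1 \<le> \<kappa>" "sq \<mu> u" "sq \<mu> w" "sq \<mu> w'"
  shows "kern_op \<kappa> u (\<lambda>x. w x - w' x) x = kern_op \<kappa> u w x - kern_op \<kappa> u w' x"
  unfolding kern_op_def hs_op_def
  by (subst Bochner_Integration.integral_diff[symmetric])
    (auto intro!: sq_mult_integrable kern_row assms simp: algebra_simps)

definition ip :: "('a \<Rightarrow> complex) \<Rightarrow> ('a \<Rightarrow> complex) \<Rightarrow> complex" where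
  "ip f g = (\<integral>x. cnj (f x) * g x \<partial>\<mu>)"

lemma ip_integrable: "sq \<mu> f \<Longrightarrow> sq \<mu> g \<Longrightarrow> integrable \<mu> (\<lambda>x. cnj (f x) * g x)"
  by (rule sq_mult_integrable) auto

lemma ip_bound: "sq \<mu> f \<Longrightarrow> sq \<mu> g \<Longrightarrow> cmod (ip f g) \<le> nm \<mu> f * nm \<mu> g"
  unfolding ip_def using nm_CS[of \<mu> "\<lambda>x. cnj (f x)" g] by simp

lemma ip_add_right: "sq \<mu> f \<Longrightarrow> sq \<mu> g \<Longrightarrow> sq \<mu> h \<Longrightarrow> ip f (\<lambda>x. g x + h x) = ip f g + ip f h"
  unfolding ip_def by (simp add: ip_integrable distrib_left)

lemma ip_add_left: "sq \<mu> f \<Longrightarrow> sq \<mu> g \<Longrightarrow> sq \<mu> h \<Longrightarrow> ip (\<lambda>x. f x + g x) h = ip f h + ip g h"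
  unfolding ip_def by (simp add: ip_integrable distrib_right)

lemma ip_diff_right: "sq \<mu> f \<Longrightarrow> sq \<mu> g \<Longrightarrow> sq \<mu> h \<Longrightarrow> ip f (\<lambda>x. g x - h x) = ip f g - ip f h"
  unfolding ip_def by (simp add: ip_integrable right_diff_distrib)

lemma ip_diff_left: "sq \<mu> f \<Longrightarrow> sq \<mu> g \<Longrightarrow> sq \<mu> h \<Longrightarrow> ip (\<lambda>x. f x - g x) h = ip f h - ip g h"
  unfolding ip_def by (simp add: ip_integrable left_diff_distrib)

lemma ip_cnj: "cnj (ip f g) = ip g f"
  unfolding ip_def by (subst integral_cnj'[symmetric]) (simp add: mult.commute)

text \<open>Hermitian symmetry of \<open>u\<close> makes the kernel hermitian. Fubini is justified
  because both the kernel and the tensor product of \<open>f\<close> and \<open>g\<close> are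
  square-integrable on the product.\<close>

lemma kern_op_hermitian:
  assumes k: "1 \<le> \<kappa>" and u: "sq \<mu> u" and herm: "\<And>x. u (- x) = cnj (u x)" and f: "sq \<mu> f" and g: "sq \<mu> g"
  shows "ip (kern_op \<kappa> u f) g = ip f (kern_op \<kappa> u g)"
proof -
  have [measurable]: "u \<in> borel_measurable \<mu>" "f \<in> borel_measurable \<mu>" "g \<in> borel_measurable \<mu>" using u f g by measurable
  have km[measurable]: "(\<lambda>p. kern \<kappa> u (fst p) (snd p)) \<in> borel_measurable (\<mu> \<Otimes>\<^sub>M \<mu>)" unfolding kern_def by measurable
  have kh: "cnj (kern \<kappa> u x y) = kern \<kappa> u y x" for x y
    using herm[of "x - y"] by (simp add: kern_def)
  have fg: "sq (\<mu> \<Otimes>\<^sub>M \<mu>) (\<lambda>p. cnj (f (fst p)) * g (snd p))"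
  proof -
    have "(\<integral>\<^sup>+p. ennreal ((cmod (cnj (f (fst p)) * g (snd p)))\<^sup>2) \<partial>(\<mu> \<Otimes>\<^sub>M \<mu>))
      = (\<integral>\<^sup>+x. \<integral>\<^sup>+y. ennreal ((cmod (f x))\<^sup>2) * ennreal ((cmod (g y))\<^sup>2) \<partial>\<mu> \<partial>\<mu>)"
      by (subst nn_integral_fst[symmetric]) (auto simp: norm_mult power_mult_distrib ennreal_mult)
    also have "\<dots> = ennreal ((nm \<mu> f)\<^sup>2) * ennreal ((nm \<mu> g)\<^sup>2)"
      by (simp add: nn_integral_cmult nn_integral_multc sq_nn_eq f g)
    also have "\<dots> < \<infinity>" by (simp add: ennreal_mult[symmetric])
    finally show ?thesis by (subst sq_iff_nn) measurable
  qed
  have i: "integrable (\<mu> \<Otimes>\<^sub>M \<mu>) (\<lambda>p. kern \<kappa> u (fst p) (snd p) * (cnj (f (fst p)) * g (snd p)))"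
    by (rule sq_mult_integrable[OF kern_hs_L2(1)[OF k u] fg])
  have "ip f (kern_op \<kappa> u g) = (\<integral>x. \<integral>y. kern \<kappa> u x y * (cnj (f x) * g y) \<partial>\<mu> \<partial>\<mu>)"
    unfolding ip_def kern_op_def hs_op_def by (subst integral_mult_right_zero[symmetric]) (simp add: mult_ac)
  also have "\<dots> = (\<integral>y. \<integral>x. kern \<kappa> u x y * (cnj (f x) * g y) \<partial>\<mu> \<partial>\<mu>)"
    by (rule P.Fubini_integral[symmetric]) (use i in \<open>simp add: case_prod_unfold\<close>)
  also have "\<dots> = (\<integral>y. cnj (\<integral>x. kern \<kappa> u y x * f x \<partial>\<mu>) * g y \<partial>\<mu>)"
    by (simp add: integral_cnj'[symmetric] kh mult.assoc[symmetric])
  also have "\<dots> = ip (kern_op \<kappa> u f) g"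
    unfolding ip_def kern_op_def hs_op_def by simp
  finally show ?thesis by simp
qed


text \<open>
  The equation for \<open>v\<close> is symmetrised by \<open>w = (\<omega> + \<kappa>)\<^bsup>1/2\<^esup> v\<close>, so that \<open>\<langle>u, v\<rangle> = \<langle>src \<kappa> u, w\<rangle>\<close>; an
  exact pointwise solution is available because the kernel has square integrable rows.
\<close>

definition src :: "real \<Rightarrow> ('a \<Rightarrow> complex) \<Rightarrow> 'a \<Rightarrow> complex" where
  "src \<kappa> u x = of_real (rt \<kappa> x) * u x"

lemma src_bound:
  assumes k: "1 \<le> \<kappa>" and u: "sq \<mu> u"
  shows "sq \<mu> (src \<kappa> u)" "nm \<mu> (src \<kappa> u) \<le> nm \<mu> u"
proof -
  have [measurable]: "u \<in> borel_measurable \<mu>" using u by measurable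
  have m: "src \<kappa> u \<in> borel_measurable \<mu>" unfolding src_def[abs_def] by measurable
  have b: "AE x in \<mu>. cmod (src \<kappa> u x) \<le> cmod (u x)"
    using k mult_right_mono[OF rt_le1[OF k]] by (simp add: src_def norm_mult)
  show "sq \<mu> (src \<kappa> u)" "nm \<mu> (src \<kappa> u) \<le> nm \<mu> u"
    using sq_bound[OF u m b] by auto
qed

lemma src_add: "src \<kappa> (\<lambda>x. u x + u' x) x = src \<kappa> u x + src \<kappa> u' x"
  by (simp add: src_def distrib_left)

lemma src_qf:
  assumes k: "1 \<le> \<kappa>" and u: "sq \<mu> u"
  shows "ennreal ((nm \<mu> (src \<kappa> u))\<^sup>2) \<le> qf u \<kappa>"
  unfolding sq_nn_eq[OF src_bound(1)[OF k u], symmetric] qf_def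
  by (rule nn_integral_mono)
    (use k in \<open>auto simp: src_def norm_mult power_mult_distrib rt_sq intro!: ennreal_leI\<close>)

text \<open>\<open>src\<close> sees nonnegative frequencies only; the symmetry of \<open>u\<close>
  gives the negative ones the same mass, whence the factor 2.\<close>

lemma qf_src:
  assumes k: "1 \<le> \<kappa>" and u: "sq \<mu> u" and herm: "\<And>x. u (- x) = cnj (u x)"
  shows "qf u \<kappa> \<le> ennreal (2 * (nm \<mu> (src \<kappa> u))\<^sup>2)"
proof -
  have [measurable]: "u \<in> borel_measurable \<mu>" using u by measurable
  have [measurable]: "src \<kappa> u \<in> borel_measurable \<mu>" unfolding src_def[abs_def] by measurable
  have "qf u \<kappa> \<le> (\<integral>\<^sup>+x. ennreal ((cmod (src \<kappa> u x))\<^sup>2) + ennreal ((cmod (src \<kappa> u (- x)))\<^sup>2) \<partial>\<mu>)"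
    unfolding qf_def
    by (rule nn_integral_mono)
      (use k in \<open>auto simp: src_def norm_mult power_mult_distrib rt_sq herm simp flip: ennreal_plus intro!: ennreal_leI\<close>)
  also have "\<dots> = ennreal (2 * (nm \<mu> (src \<kappa> u))\<^sup>2)"
    using nn_integral_reflect[of "\<lambda>x. ennreal ((cmod (src \<kappa> u x))\<^sup>2)"]
    by (subst nn_integral_add)
      (simp_all add: sq_nn_eq[OF src_bound(1)[OF k u]] ennreal_plus[symmetric] del: ennreal_plus)
  finally show ?thesis .
qed

section \<open>Solutions of the symmetrised equation and the quantity \<beta>\<close>

definition sol :: "real \<Rightarrow> ('a \<Rightarrow> complex) \<Rightarrow> ('a \<Rightarrow> complex) \<Rightarrow> bool" where
  "sol \<kappa> u w \<longleftrightarrow> sq \<mu> w \<and> (\<forall>x. w x = src \<kappa> u x + kern_op \<kappa> u w x)"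

definition small :: "real \<Rightarrow> ('a \<Rightarrow> complex) \<Rightarrow> bool" where
  "small \<kappa> u \<longleftrightarrow> 1 \<le> \<kappa> \<and> sq \<mu> u \<and> nm (\<mu> \<Otimes>\<^sub>M \<mu>) (\<lambda>p. kern \<kappa> u (fst p) (snd p)) \<le> 1/4"

text \<open>\<open>1/32\<close> is \<open>(1/4)\<^sup>2 / 2\<close>, the value of the dyadic sum for
  which \<open>kern_hs\<close> yields a Hilbert--Schmidt norm of at most \<open>1/4\<close>.\<close>

lemma smallI: "1 \<le> \<kappa> \<Longrightarrow> sq \<mu> u \<Longrightarrow> hsq u \<kappa> \<le> ennreal (1/32) \<Longrightarrow> small \<kappa> u"
  unfolding small_def using kern_hs(2)[of \<kappa> u "1/4"] by (simp add: power2_eq_square)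

lemma sol_exists: "small \<kappa> u \<Longrightarrow> \<exists>w. sol \<kappa> u w"
  unfolding small_def sol_def kern_op_def
  using hs_solve[OF sigma_finite_measure_axioms kern_hs_L2(1) kern_row src_bound(1), of \<kappa> u] by auto

lemma small_Top:
  assumes "small \<kappa> u" "sq \<mu> w"
  shows "nm \<mu> (kern_op \<kappa> u w) \<le> nm \<mu> w / 4"
  using kern_op_bound(2)[of \<kappa> u w] assms mult_right_mono[of "nm (\<mu> \<Otimes>\<^sub>M \<mu>) (\<lambda>p. kern \<kappa> u (fst p) (snd p))" "1/4" "nm \<mu> w"]
  by (simp add: small_def)

text \<open>Inserting the equation once gives \<beta> = |f|^2 + <f, T w> with f the source and T the
  operator. Since T has norm at most 1/4, |w| \<le> 4/3 |f|, and the second term is at most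
  (1/4)(4/3) |f|^2.\<close>

lemma beta_bound:
  assumes sm: "small \<kappa> u" and s: "sol \<kappa> u w"
  shows "\<bar>Re (ip (src \<kappa> u) w) - (nm \<mu> (src \<kappa> u))\<^sup>2\<bar> \<le> (nm \<mu> (src \<kappa> u))\<^sup>2 / 3"
proof -
  let ?f = "src \<kappa> u" and ?N = "nm \<mu> (src \<kappa> u)"
  have k: "1 \<le> \<kappa>" and u: "sq \<mu> u" using sm by (auto simp: small_def)
  have f: "sq \<mu> ?f" by (rule src_bound[OF k u])
  have w: "sq \<mu> w" and we: "w = (\<lambda>x. ?f x + kern_op \<kappa> u w x)" using s by (auto simp: sol_def)
  have T: "sq \<mu> (kern_op \<kappa> u w)" by (rule kern_op_bound[OF k u w])
  have "nm \<mu> w \<le> ?N + nm \<mu> w / 4"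
    using nm_triangle[OF f T] small_Top[OF sm w] we by simp
  then have wb: "nm \<mu> w \<le> 4/3 * ?N" by simp
  have "ip ?f w = ip ?f ?f + ip ?f (kern_op \<kappa> u w)"
    using ip_add_right[OF f f T] we by simp
  moreover have "ip ?f ?f = of_real (?N\<^sup>2)"
    unfolding nm_sq ip_def
    by (simp add: complex_norm_square[symmetric] mult.commute[of "cnj _"] flip: of_real_power)
  moreover have "cmod (ip ?f (kern_op \<kappa> u w)) \<le> ?N\<^sup>2 / 3"
  proof -
    have "cmod (ip ?f (kern_op \<kappa> u w)) \<le> ?N * nm \<mu> (kern_op \<kappa> u w)" by (rule ip_bound[OF f T])
    also have "\<dots> \<le> ?N * (4/3 * ?N / 4)"
      using small_Top[OF sm w] wb by (intro mult_left_mono) auto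
    finally show ?thesis by (simp add: power2_eq_square)
  qed
  ultimately show ?thesis
    using abs_Re_le_cmod[of "ip ?f (kern_op \<kappa> u w)"] by simp
qed

text \<open>The difference of the solutions solves the equation for \<open>u1\<close> with source
  \<open>src \<kappa> d + kern_op \<kappa> d w0\<close>; inverting 1 - T with T of norm at most 1/4
  costs the factor 4/3.\<close>

lemma sol_lipschitz:
  assumes s0: "sol \<kappa> u0 w0" and s1: "sol \<kappa> u1 w1" and sm: "small \<kappa> u1" and u0: "sq \<mu> u0"
    and d: "\<And>x. u1 x = u0 x + d x" "sq \<mu> d"
  shows "nm \<mu> (\<lambda>x. w1 x - w0 x) \<le> 4/3 * (nm \<mu> d * (1 + 2 * nm \<mu> w0))"
proof -
  have k: "1 \<le> \<kappa>" and u1: "sq \<mu> u1" using sm by (auto simp: small_def)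
  have w0: "sq \<mu> w0" and we0: "\<And>x. w0 x = src \<kappa> u0 x + kern_op \<kappa> u0 w0 x"
    and w1: "sq \<mu> w1" and we1: "\<And>x. w1 x = src \<kappa> u1 x + kern_op \<kappa> u1 w1 x" using s0 s1 by (auto simp: sol_def)
  let ?z = "\<lambda>x. w1 x - w0 x"
  have z: "sq \<mu> ?z" by (rule sq_diff[OF w1 w0])
  have u1e: "u1 = (\<lambda>x. u0 x + d x)" using d by auto
  have eq: "?z = (\<lambda>x. (src \<kappa> d x + kern_op \<kappa> d w0 x) + kern_op \<kappa> u1 ?z x)"
  proof
    fix x
    have "kern_op \<kappa> u1 ?z x = kern_op \<kappa> u1 w1 x - kern_op \<kappa> u1 w0 x" by (rule kern_op_diff[OF k u1 w1 w0])
    moreover have "kern_op \<kappa> u1 w0 x = kern_op \<kappa> u0 w0 x + kern_op \<kappa> d w0 x"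
      unfolding u1e by (rule kern_op_add_kernel[OF k u0 d(2) w0])
    moreover have "src \<kappa> u1 x = src \<kappa> u0 x + src \<kappa> d x" unfolding u1e by (rule src_add)
    ultimately show "?z x = (src \<kappa> d x + kern_op \<kappa> d w0 x) + kern_op \<kappa> u1 ?z x"
      using we0[of x] we1[of x] by simp
  qed
  have sd: "sq \<mu> (src \<kappa> d)" and Td: "sq \<mu> (kern_op \<kappa> d w0)" and T1: "sq \<mu> (kern_op \<kappa> u1 ?z)"
    using src_bound[OF k d(2)] kern_op_bound[OF k d(2) w0] kern_op_bound[OF k u1 z] by auto
  have "nm \<mu> ?z \<le> nm \<mu> (\<lambda>x. src \<kappa> d x + kern_op \<kappa> d w0 x) + nm \<mu> (kern_op \<kappa> u1 ?z)"
    by (subst eq) (rule nm_triangle[OF sq_add[OF sd Td] T1])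
  also have "\<dots> \<le> (nm \<mu> (src \<kappa> d) + nm \<mu> (kern_op \<kappa> d w0)) + nm \<mu> ?z / 4"
    by (intro add_mono nm_triangle[OF sd Td] small_Top[OF sm z])
  also have "\<dots> \<le> (nm \<mu> d + 2 * nm \<mu> d * nm \<mu> w0) + nm \<mu> ?z / 4"
    using src_bound(2)[OF k d(2)] kern_op_bound(3)[OF k d(2) w0] by simp
  finally show ?thesis by (simp add: algebra_simps)
qed

text \<open>A weak form of the resolvent identity. Hermitian symmetry moves the operator of
  \<open>u0\<close> from \<open>w0\<close> to \<open>w1\<close>, so every term on the right is
  linear in \<open>d\<close> and no term in \<open>w1 - w0\<close> appears; for the derivative of
  \<beta> it then suffices that the solutions are continuous in time.\<close>

lemma beta_diff:
  assumes s0: "sol \<kappa> u0 w0" and s1: "sol \<kappa> u1 w1" and k: "1 \<le> \<kappa>" and u0: "sq \<mu> u0"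
    and d: "\<And>x. u1 x = u0 x + d x" "sq \<mu> d"
    and herm: "\<And>x. u0 (- x) = cnj (u0 x)"
  shows "ip (src \<kappa> u1) w1 - ip (src \<kappa> u0) w0 = ip (src \<kappa> d) w1 + ip w0 (src \<kappa> d) + ip w0 (kern_op \<kappa> d w1)"
proof -
  have w0: "sq \<mu> w0" and we0: "\<And>x. w0 x = src \<kappa> u0 x + kern_op \<kappa> u0 w0 x"
    and w1: "sq \<mu> w1" and we1: "\<And>x. w1 x = src \<kappa> u1 x + kern_op \<kappa> u1 w1 x" using s0 s1 by (auto simp: sol_def)
  have u1e: "u1 = (\<lambda>x. u0 x + d x)" using d by auto
  note f0 = src_bound(1)[OF k u0] and fd = src_bound(1)[OF k d(2)]
  have f0e: "src \<kappa> u0 = (\<lambda>x. w0 x - kern_op \<kappa> u0 w0 x)" using we0 by (auto simp: fun_eq_iff)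
  note T00 = kern_op_bound(1)[OF k u0 w0] and T01 = kern_op_bound(1)[OF k u0 w1] and Td1 = kern_op_bound(1)[OF k d(2) w1]
  have a: "ip (src \<kappa> u0) w = ip w0 (\<lambda>x. w x - kern_op \<kappa> u0 w x)" if w: "sq \<mu> w" for w
  proof -
    have "ip (src \<kappa> u0) w = ip w0 w - ip (kern_op \<kappa> u0 w0) w"
      unfolding f0e by (rule ip_diff_left[OF w0 T00 w])
    also have "ip (kern_op \<kappa> u0 w0) w = ip w0 (kern_op \<kappa> u0 w)" by (rule kern_op_hermitian[OF k u0 herm w0 w])
    finally show ?thesis using ip_diff_right[OF w0 w kern_op_bound(1)[OF k u0 w]] by simp
  qed
  have "(\<lambda>x. w1 x - kern_op \<kappa> u0 w1 x) = (\<lambda>x. (src \<kappa> u0 x + src \<kappa> d x) + kern_op \<kappa> d w1 x)"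
  proof
    fix x
    have "kern_op \<kappa> u1 w1 x = kern_op \<kappa> u0 w1 x + kern_op \<kappa> d w1 x"
      unfolding u1e by (rule kern_op_add_kernel[OF k u0 d(2) w1])
    moreover have "src \<kappa> u1 x = src \<kappa> u0 x + src \<kappa> d x" unfolding u1e by (rule src_add)
    ultimately show "w1 x - kern_op \<kappa> u0 w1 x = (src \<kappa> u0 x + src \<kappa> d x) + kern_op \<kappa> d w1 x" using we1[of x] by simp
  qed
  then have "ip (src \<kappa> u0) w1 = ip w0 (\<lambda>x. (src \<kappa> u0 x + src \<kappa> d x) + kern_op \<kappa> d w1 x)"
    using a[OF w1] by simp
  also have "\<dots> = ip w0 (src \<kappa> u0) + ip w0 (src \<kappa> d) + ip w0 (kern_op \<kappa> d w1)"
    by (simp add: ip_add_right[OF w0 sq_add[OF f0 fd] Td1] ip_add_right[OF w0 f0 fd])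
  finally have 1: "ip (src \<kappa> u0) w1 = ip w0 (src \<kappa> u0) + ip w0 (src \<kappa> d) + ip w0 (kern_op \<kappa> d w1)" .
  have 2: "ip (src \<kappa> u0) w0 = ip w0 (src \<kappa> u0)" using a[OF w0] f0e by simp
  have "src \<kappa> u1 = (\<lambda>x. src \<kappa> u0 x + src \<kappa> d x)" unfolding u1e by (auto simp: src_add)
  then have "ip (src \<kappa> u1) w1 = ip (src \<kappa> u0) w1 + ip (src \<kappa> d) w1"
    using ip_add_left[OF f0 fd w1] by simp
  then show ?thesis using 1 2 by simp
qed

text \<open>The source equals (1 - T) w with T hermitian, so both pairings are the quadratic form of
  1 - T at w.\<close>

lemma beta_real:
  assumes "sol \<kappa> u w" "1 \<le> \<kappa>" "sq \<mu> u" "\<And>x. u (- x) = cnj (u x)"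
  shows "ip (src \<kappa> u) w = ip w (src \<kappa> u)"
proof -
  have w: "sq \<mu> w" and we: "\<And>x. w x = src \<kappa> u x + kern_op \<kappa> u w x" using assms by (auto simp: sol_def)
  have e: "src \<kappa> u = (\<lambda>x. w x - kern_op \<kappa> u w x)" using we by (auto simp: fun_eq_iff)
  note T = kern_op_bound(1)[OF assms(2,3) w]
  show ?thesis unfolding e
    by (simp add: ip_diff_left[OF w T w] ip_diff_right[OF w w T] kern_op_hermitian[OF assms(2-4) w w])
qed

lemma norm_triangle5: "cmod (a + b + c + d + e) \<le> cmod a + cmod b + cmod c + cmod d + cmod e"
  using norm_triangle_ineq[of "a + b + c + d" e] norm_triangle_ineq[of "a + b + c" d]
    norm_triangle_ineq[of "a + b" c] norm_triangle_ineq[of a b] by linarith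

text \<open>The derivative of \<open>\<beta>\<close> at a solution \<open>w\<close> in the direction \<open>p\<close>.\<close>

definition Fder :: "real \<Rightarrow> ('a \<Rightarrow> complex) \<Rightarrow> ('a \<Rightarrow> complex) \<Rightarrow> complex" where
  "Fder \<kappa> p w = ip (src \<kappa> p) w + ip w (src \<kappa> p) + ip w (kern_op \<kappa> p w)"

text \<open>\<open>beta_diff\<close> divided by the time step. Replacing the solution at time
  \<open>t + h\<close> by the one at \<open>t\<close>, and the difference quotient by
  \<open>p\<close>, leaves five error terms, each bounded by a summand of \<open>E\<close>.\<close>

lemma beta_deriv:
  fixes u w :: "real \<Rightarrow> 'a \<Rightarrow> complex"
  assumes S: "open S" "t \<in> S" and sm: "\<And>\<tau>. \<tau> \<in> S \<Longrightarrow> small \<kappa> (u \<tau>)" and s: "\<And>\<tau>. \<tau> \<in> S \<Longrightarrow> sol \<kappa> (u \<tau>) (w \<tau>)"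
    and herm: "\<And>\<tau> x. u \<tau> (- x) = cnj (u \<tau> x)"
    and p: "sq \<mu> p"
    and lim: "((\<lambda>h. nm \<mu> (\<lambda>x. (u (t + h) x - u t x) / of_real h - p x)) \<longlongrightarrow> 0) (at 0)"
  shows "DERIV (\<lambda>\<tau>. Re (ip (src \<kappa> (u \<tau>)) (w \<tau>))) t :> Re (Fder \<kappa> p (w t))"
proof -
  have k: "1 \<le> \<kappa>" using sm[OF S(2)] by (simp add: small_def)
  define \<delta> where "\<delta> h = nm \<mu> (\<lambda>x. (u (t + h) x - u t x) / of_real h - p x)" for h
  define B where "B \<tau> = ip (src \<kappa> (u \<tau>)) (w \<tau>)" for \<tau>
  let ?W = "nm \<mu> (w t)" and ?P = "nm \<mu> p"
  \<comment> \<open>Bounds the increment of the solution: \<open>sol_lipschitz\<close> for an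
    increment of \<open>u\<close> of norm at most
    \<open>\<bar>h\<bar> * (?P + \<delta> h)\<close>.\<close>
  define Z where "Z h = 4/3 * (\<bar>h\<bar> * (?P + \<delta> h) * (1 + 2 * ?W))" for h
  define E where "E h = ?P * Z h + \<delta> h * (?W + Z h) + ?W * \<delta> h + ?W * (2 * ?P * Z h) + ?W * (2 * \<delta> h * (?W + Z h))" for h
  have u0: "sq \<mu> (u t)" using sm[OF S(2)] by (simp add: small_def)
  have w0: "sq \<mu> (w t)" using s[OF S(2)] by (simp add: sol_def)
  have main: "cmod ((B (t + h) - B t) / of_real h - Fder \<kappa> p (w t)) \<le> E h" if h: "t + h \<in> S" "h \<noteq> 0" for h
  proof -
    \<comment> \<open>The increment of \<open>u\<close> is written as d = h (p + e), with
      \<open>e\<close> the error of the difference quotient, and that of \<open>w\<close> as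
      \<open>z\<close>.\<close>
    define e where "e x = (u (t + h) x - u t x) / of_real h - p x" for x
    define q where "q x = p x + e x" for x
    define d where "d x = of_real h * q x" for x
    define z where "z x = w (t + h) x - w t x" for x
    have u1: "sq \<mu> (u (t + h))" using sm[OF h(1)] by (simp add: small_def)
    have w1: "sq \<mu> (w (t + h))" using s[OF h(1)] by (simp add: sol_def)
    have e: "sq \<mu> e"
      unfolding e_def using sq_diff[OF sq_scale[OF sq_diff[OF u1 u0], of "1 / of_real h"] p] by simp
    have q: "sq \<mu> q" unfolding q_def by (rule sq_add[OF p e])
    have d: "sq \<mu> d" unfolding d_def by (rule sq_scale[OF q])
    have z: "sq \<mu> z" unfolding z_def by (rule sq_diff[OF w1 w0])
    have ne: "nm \<mu> e = \<delta> h" by (simp add: \<delta>_def e_def[abs_def])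
    have ud: "u (t + h) x = u t x + d x" for x using h(2) by (simp add: d_def q_def e_def)
    have "nm \<mu> d \<le> \<bar>h\<bar> * (?P + \<delta> h)"
      unfolding d_def nm_scale q_def using nm_triangle[OF p e] ne by (simp add: mult_left_mono)
    then have "nm \<mu> d * (1 + 2 * ?W) \<le> \<bar>h\<bar> * (?P + \<delta> h) * (1 + 2 * ?W)" by (rule mult_right_mono) simp
    then have nz: "nm \<mu> z \<le> Z h"
      using sol_lipschitz[OF s[OF S(2)] s[OF h(1)] sm[OF h(1)] u0 ud d]
      by (simp add: z_def[abs_def] Z_def)
    have we: "w (t + h) = (\<lambda>x. w t x + z x)" by (simp add: z_def)
    have nw: "nm \<mu> (w (t + h)) \<le> ?W + Z h" unfolding we using nm_triangle[OF w0 z] nz by simp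
    note Sp = src_bound[OF k p] and Se = src_bound[OF k e]
    note Tpz = kern_op_bound[OF k p z] and Tew = kern_op_bound[OF k e w1] and Tpw = kern_op_bound[OF k p w0]
    have srcd: "src \<kappa> d = (\<lambda>x. of_real h * (src \<kappa> p x + src \<kappa> e x))"
      by (auto simp: src_def d_def q_def algebra_simps)
    have Topd: "kern_op \<kappa> d (w (t + h)) = (\<lambda>x. of_real h * (kern_op \<kappa> p (w t) x + kern_op \<kappa> p z x + kern_op \<kappa> e (w (t + h)) x))"
    proof
      fix x
      have "kern_op \<kappa> d (w (t + h)) x = of_real h * kern_op \<kappa> q (w (t + h)) x"
        unfolding d_def by (rule kern_op_scale_kernel)
      also have "kern_op \<kappa> q (w (t + h)) x = kern_op \<kappa> p (w (t + h)) x + kern_op \<kappa> e (w (t + h)) x"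
        unfolding q_def by (rule kern_op_add_kernel[OF k p e w1])
      also have "kern_op \<kappa> p (w (t + h)) x = kern_op \<kappa> p (w t) x + kern_op \<kappa> p z x"
        unfolding we by (rule kern_op_add[OF k p w0 z])
      finally show "kern_op \<kappa> d (w (t + h)) x = of_real h * (kern_op \<kappa> p (w t) x + kern_op \<kappa> p z x + kern_op \<kappa> e (w (t + h)) x)" .
    qed
    have ips: "ip (\<lambda>x. of_real h * f x) g = of_real h * ip f g" "ip f (\<lambda>x. of_real h * g x) = of_real h * ip f g" for f g
      unfolding ip_def by (simp_all flip: integral_mult_right_zero add: mult_ac)
    have "(B (t + h) - B t) / of_real h = ip (\<lambda>x. src \<kappa> p x + src \<kappa> e x) (w (t + h)) + ip (w t) (\<lambda>x. src \<kappa> p x + src \<kappa> e x)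
        + ip (w t) (\<lambda>x. kern_op \<kappa> p (w t) x + kern_op \<kappa> p z x + kern_op \<kappa> e (w (t + h)) x)"
      unfolding B_def beta_diff[OF s[OF S(2)] s[OF h(1)] k u0 ud d herm] srcd Topd ips using h(2)
      by (simp add: field_simps)
    also have "\<dots> = (ip (src \<kappa> p) (w t) + ip (src \<kappa> p) z + ip (src \<kappa> e) (w (t + h))) + (ip (w t) (src \<kappa> p) + ip (w t) (src \<kappa> e))
       + (ip (w t) (kern_op \<kappa> p (w t)) + ip (w t) (kern_op \<kappa> p z) + ip (w t) (kern_op \<kappa> e (w (t + h))))"
    proof -
      have "ip (\<lambda>x. src \<kappa> p x + src \<kappa> e x) (w (t + h)) = ip (src \<kappa> p) (w (t + h)) + ip (src \<kappa> e) (w (t + h))"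
        by (rule ip_add_left[OF Sp(1) Se(1) w1])
      moreover have "ip (src \<kappa> p) (w (t + h)) = ip (src \<kappa> p) (w t) + ip (src \<kappa> p) z"
        unfolding we by (rule ip_add_right[OF Sp(1) w0 z])
      moreover have "ip (w t) (\<lambda>x. src \<kappa> p x + src \<kappa> e x) = ip (w t) (src \<kappa> p) + ip (w t) (src \<kappa> e)"
        by (rule ip_add_right[OF w0 Sp(1) Se(1)])
      moreover have "ip (w t) (\<lambda>x. kern_op \<kappa> p (w t) x + kern_op \<kappa> p z x + kern_op \<kappa> e (w (t + h)) x)
        = ip (w t) (kern_op \<kappa> p (w t)) + ip (w t) (kern_op \<kappa> p z) + ip (w t) (kern_op \<kappa> e (w (t + h)))"
        by (simp add: ip_add_right[OF w0 sq_add[OF Tpw(1) Tpz(1)] Tew(1)] ip_add_right[OF w0 Tpw(1) Tpz(1)])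
      ultimately show ?thesis by simp
    qed
    finally have A1: "(B (t + h) - B t) / of_real h - Fder \<kappa> p (w t)
       = ip (src \<kappa> p) z + ip (src \<kappa> e) (w (t + h)) + ip (w t) (src \<kappa> e) + ip (w t) (kern_op \<kappa> p z) + ip (w t) (kern_op \<kappa> e (w (t + h)))"
      by (simp add: Fder_def)
    have "cmod (ip (src \<kappa> p) z + ip (src \<kappa> e) (w (t + h)) + ip (w t) (src \<kappa> e) + ip (w t) (kern_op \<kappa> p z) + ip (w t) (kern_op \<kappa> e (w (t + h)))) \<le> cmod (ip (src \<kappa> p) z) + cmod (ip (src \<kappa> e) (w (t + h))) + cmod (ip (w t) (src \<kappa> e)) + cmod (ip (w t) (kern_op \<kappa> p z)) + cmod (ip (w t) (kern_op \<kappa> e (w (t + h))))"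
      by (rule norm_triangle5)
    moreover have "cmod (ip (src \<kappa> p) z) + cmod (ip (src \<kappa> e) (w (t + h))) + cmod (ip (w t) (src \<kappa> e)) + cmod (ip (w t) (kern_op \<kappa> p z)) + cmod (ip (w t) (kern_op \<kappa> e (w (t + h)))) \<le> E h"
      unfolding E_def
    proof (intro add_mono)
      have Z0: "0 \<le> Z h" using nz nm_nonneg[of \<mu> z] by linarith
      have d0: "0 \<le> \<delta> h" using ne nm_nonneg[of \<mu> e] by simp
      show "cmod (ip (src \<kappa> p) z) \<le> ?P * Z h"
        by (rule order.trans[OF ip_bound[OF Sp(1) z]]) (intro mult_mono Sp nz; simp)
      show "cmod (ip (src \<kappa> e) (w (t + h))) \<le> \<delta> h * (?W + Z h)"
        by (rule order.trans[OF ip_bound[OF Se(1) w1]]) (use Se(2) ne nw d0 in \<open>intro mult_mono; simp\<close>)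
      show "cmod (ip (w t) (src \<kappa> e)) \<le> ?W * \<delta> h"
        by (rule order.trans[OF ip_bound[OF w0 Se(1)]]) (use Se(2) ne in \<open>intro mult_mono; simp\<close>)
      show "cmod (ip (w t) (kern_op \<kappa> p z)) \<le> ?W * (2 * ?P * Z h)"
        by (rule order.trans[OF ip_bound[OF w0 Tpz(1)]], intro mult_left_mono order.trans[OF Tpz(3)])
          (use nz in \<open>auto intro!: mult_left_mono\<close>)
      have "2 * nm \<mu> e * nm \<mu> (w (t + h)) \<le> 2 * \<delta> h * (?W + Z h)"
        using nw d0 ne by (intro mult_mono) auto
      then show "cmod (ip (w t) (kern_op \<kappa> e (w (t + h)))) \<le> ?W * (2 * \<delta> h * (?W + Z h))"
        by (intro order.trans[OF ip_bound[OF w0 Tew(1)]] mult_left_mono order.trans[OF Tew(3)]) auto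
    qed
    ultimately show ?thesis unfolding A1 by (rule order.trans)
  qed
  have \<delta>: "(\<delta> \<longlongrightarrow> 0) (at 0)" using lim by (simp add: \<delta>_def[abs_def])
  have Z: "(Z \<longlongrightarrow> 4/3 * (\<bar>0\<bar> * (?P + 0) * (1 + 2 * ?W))) (at 0)"
    unfolding Z_def by (intro tendsto_intros \<delta>)
  then have Z': "(Z \<longlongrightarrow> 0) (at 0)" by simp
  have "(E \<longlongrightarrow> ?P * 0 + 0 * (?W + 0) + ?W * 0 + ?W * (2 * ?P * 0) + ?W * (2 * 0 * (?W + 0))) (at 0)"
    unfolding E_def by (intro tendsto_intros \<delta> Z')
  then have E: "(E \<longlongrightarrow> 0) (at 0)" by simp
  have ev: "\<forall>\<^sub>F h in at 0. t + h \<in> S \<and> h \<noteq> 0"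
  proof -
    have "open ((\<lambda>h. t + h) -` S)" by (rule open_vimage[OF S(1)]) (intro continuous_intros)
    then have "\<forall>\<^sub>F h in nhds 0. h \<in> (\<lambda>h. t + h) -` S" by (rule eventually_nhds_in_open) (use S in auto)
    then have "\<forall>\<^sub>F h in at 0. h \<in> (\<lambda>h. t + h) -` S" by (simp add: eventually_at_filter eventually_mono)
    moreover have "\<forall>\<^sub>F h in at (0::real). h \<noteq> 0" by (rule eventually_neq_at_within)
    ultimately show ?thesis by eventually_elim auto
  qed
  have "((\<lambda>h. Re (B (t + h) - B t) / h - Re (Fder \<kappa> p (w t))) \<longlongrightarrow> 0) (at 0)"
  proof (rule Lim_null_comparison[OF _ E])
    show "\<forall>\<^sub>F h in at 0. norm (Re (B (t + h) - B t) / h - Re (Fder \<kappa> p (w t))) \<le> E h"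
      using ev
    proof eventually_elim
      case (elim h)
      have "Re (B (t + h) - B t) / h - Re (Fder \<kappa> p (w t)) = Re ((B (t + h) - B t) / of_real h - Fder \<kappa> p (w t))"
        by simp
      then have "norm (Re (B (t + h) - B t) / h - Re (Fder \<kappa> p (w t))) \<le> cmod ((B (t + h) - B t) / of_real h - Fder \<kappa> p (w t))"
        using abs_Re_le_cmod by (simp del: minus_complex.sel)
      also have "\<dots> \<le> E h" using main elim by simp
      finally show ?case .
    qed
  qed
  then show ?thesis
    unfolding DERIV_def B_def[symmetric] using Lim_null[of "\<lambda>h. (Re (B (t + h)) - Re (B t)) / h" "Re (Fder \<kappa> p (w t))"] by simp
qed

end

section \<open>Convolution, reflection and pairings on the frequency side\<close>

lemma nn_Cauchy_Schwarz:
  fixes a b :: "'a \<Rightarrow> real"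
  assumes [measurable]: "a \<in> borel_measurable M" "b \<in> borel_measurable M"
    and nn: "\<And>x. 0 \<le> a x" "\<And>x. 0 \<le> b x"
  shows "(\<integral>\<^sup>+x. ennreal (a x * b x) \<partial>M)\<^sup>2 \<le> (\<integral>\<^sup>+x. ennreal ((a x)\<^sup>2) \<partial>M) * (\<integral>\<^sup>+x. ennreal ((b x)\<^sup>2) \<partial>M)"
proof -
  let ?A = "\<integral>\<^sup>+x. ennreal ((a x)\<^sup>2) \<partial>M" and ?B = "\<integral>\<^sup>+x. ennreal ((b x)\<^sup>2) \<partial>M"
  show ?thesis
  \<comment> \<open>In \<open>ennreal\<close> the product of 0 and \<infinity> is 0, so this case
    comes first; there one factor vanishes almost everywhere and so does the left side.\<close>
  proof (cases "?A = 0 \<or> ?B = 0")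
    case True
    then have "(AE x in M. ennreal ((a x)\<^sup>2) = 0) \<or> (AE x in M. ennreal ((b x)\<^sup>2) = 0)"
      by (auto simp: nn_integral_0_iff_AE)
    then have "AE x in M. ennreal (a x * b x) = 0"
      by (elim disjE) (erule eventually_mono, simp add: ennreal_eq_0_iff)+
    then have "(\<integral>\<^sup>+x. ennreal (a x * b x) \<partial>M) = 0" by (subst nn_integral_0_iff_AE) auto
    then show ?thesis by simp
  next
    case False
    show ?thesis
    proof (cases "?A = \<infinity> \<or> ?B = \<infinity>")
      case True
      then have "?A * ?B = \<infinity>" using False by (auto simp: ennreal_top_mult ennreal_mult_top)
      then show ?thesis by simp
    next
      case fin: False
      let ?a = "\<lambda>x. of_real (a x) :: complex" and ?b = "\<lambda>x. of_real (b x) :: complex"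
      have sa: "sq M ?a" and sb: "sq M ?b" using fin by (auto simp: sq_iff_nn less_top)
      have i: "integrable M (\<lambda>x. a x * b x)"
        using sq_mult_integrable[OF sa sb, THEN integrable_norm] nn by (simp add: norm_mult)
      have "(\<integral>\<^sup>+x. ennreal (a x * b x) \<partial>M) = ennreal (\<integral>x. a x * b x \<partial>M)"
        by (rule nn_integral_eq_integral[OF i]) (use nn in simp)
      also have "\<dots> \<le> ennreal (nm M ?a * nm M ?b)"
        using nm_CS_abs[OF sa sb] nn by (intro ennreal_leI) simp
      finally have "(\<integral>\<^sup>+x. ennreal (a x * b x) \<partial>M)\<^sup>2 \<le> (ennreal (nm M ?a * nm M ?b))\<^sup>2"
        by (rule power_mono) simp
      also have "\<dots> = ennreal ((nm M ?a)\<^sup>2) * ennreal ((nm M ?b)\<^sup>2)"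
        by (simp add: ennreal_power ennreal_mult[symmetric] power_mult_distrib)
      also have "\<dots> = ?A * ?B"
        using sq_nn_eq[OF sa] sq_nn_eq[OF sb] by simp
      finally show ?thesis .
    qed
  qed
qed

lemma ennreal_mult_le_squares: "a * b \<le> a\<^sup>2 + (b :: ennreal)\<^sup>2"
proof (cases "a \<le> b")
  case True
  then have "a * b \<le> b * b" by (rule mult_right_mono) simp
  then show ?thesis by (simp add: power2_eq_square add_increasing)
next
  case False
  then have "a * b \<le> a * a" by (intro mult_left_mono) auto
  then show ?thesis by (simp add: power2_eq_square add_increasing2)
qed

text \<open>A nonintegrable function has Bochner integral 0, so the bound holds for all
  \<open>f\<close>.\<close>

lemma cmod_integral_le_nn: "ennreal (cmod (\<integral>x. f x \<partial>M)) \<le> (\<integral>\<^sup>+x. ennreal (cmod (f x)) \<partial>M)"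
proof (cases "integrable M f")
  case True then show ?thesis using integral_norm_bound_ennreal by blast
next
  case False then show ?thesis by (simp add: not_integrable_integral_eq)
qed

context freq_space
begin

lemma nn_conv:
  assumes [measurable]: "f \<in> borel_measurable \<mu>" "g \<in> borel_measurable \<mu>"
  shows "(\<integral>\<^sup>+x. \<integral>\<^sup>+y. f (x - y) * g y \<partial>\<mu> \<partial>\<mu>) = (\<integral>\<^sup>+x. f x \<partial>\<mu>) * (\<integral>\<^sup>+x. g x \<partial>\<mu>)"
proof -
  have "(\<integral>\<^sup>+x. \<integral>\<^sup>+y. f (x - y) * g y \<partial>\<mu> \<partial>\<mu>) = (\<integral>\<^sup>+y. \<integral>\<^sup>+x. f (x - y) * g y \<partial>\<mu> \<partial>\<mu>)"
    by (rule P.Fubini'[symmetric]) measurable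
  also have "\<dots> = (\<integral>\<^sup>+y. (\<integral>\<^sup>+x. f x \<partial>\<mu>) * g y \<partial>\<mu>)"
    using nn_integral_shift[of f "- y" for y] by (subst nn_integral_multc) auto
  finally show ?thesis by (simp add: nn_integral_cmult)
qed

text \<open>Young's inequality for an L1 and an L2 factor: write ab = sqrt(a) (sqrt(a) b), apply
  Cauchy--Schwarz in \<open>y\<close>, then Tonelli.\<close>

lemma young_nn:
  fixes a b :: "'a \<Rightarrow> real"
  assumes [measurable]: "a \<in> borel_measurable \<mu>" "b \<in> borel_measurable \<mu>"
    and nn: "\<And>x. 0 \<le> a x" "\<And>x. 0 \<le> b x"
  shows "(\<integral>\<^sup>+x. (\<integral>\<^sup>+y. ennreal (a (x - y) * b y) \<partial>\<mu>)\<^sup>2 \<partial>\<mu>) \<le> (\<integral>\<^sup>+x. ennreal (a x) \<partial>\<mu>)\<^sup>2 * (\<integral>\<^sup>+x. ennreal ((b x)\<^sup>2) \<partial>\<mu>)"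
proof -
  let ?a = "\<integral>\<^sup>+x. ennreal (a x) \<partial>\<mu>"
  have "(\<integral>\<^sup>+y. ennreal (a (x - y) * b y) \<partial>\<mu>)\<^sup>2 \<le> ?a * (\<integral>\<^sup>+y. ennreal (a (x - y)) * ennreal ((b y)\<^sup>2) \<partial>\<mu>)" for x
  proof -
    have "(\<integral>\<^sup>+y. ennreal (a (x - y) * b y) \<partial>\<mu>)\<^sup>2 = (\<integral>\<^sup>+y. ennreal (sqrt (a (x - y)) * (sqrt (a (x - y)) * b y)) \<partial>\<mu>)\<^sup>2"
      by (simp add: mult.assoc[symmetric] nn)
    also have "\<dots> \<le> (\<integral>\<^sup>+y. ennreal ((sqrt (a (x - y)))\<^sup>2) \<partial>\<mu>) * (\<integral>\<^sup>+y. ennreal ((sqrt (a (x - y)) * b y)\<^sup>2) \<partial>\<mu>)"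
      by (rule nn_Cauchy_Schwarz) (auto simp: nn)
    also have "(\<integral>\<^sup>+y. ennreal ((sqrt (a (x - y)))\<^sup>2) \<partial>\<mu>) = ?a"
      using nn_integral_sub[of "\<lambda>y. ennreal (a y)" x] by (simp add: nn)
    also have "(\<integral>\<^sup>+y. ennreal ((sqrt (a (x - y)) * b y)\<^sup>2) \<partial>\<mu>) = (\<integral>\<^sup>+y. ennreal (a (x - y)) * ennreal ((b y)\<^sup>2) \<partial>\<mu>)"
      by (simp add: nn power_mult_distrib ennreal_mult)
    finally show ?thesis .
  qed
  then have "(\<integral>\<^sup>+x. (\<integral>\<^sup>+y. ennreal (a (x - y) * b y) \<partial>\<mu>)\<^sup>2 \<partial>\<mu>) \<le> (\<integral>\<^sup>+x. ?a * (\<integral>\<^sup>+y. ennreal (a (x - y)) * ennreal ((b y)\<^sup>2) \<partial>\<mu>) \<partial>\<mu>)"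
    by (intro nn_integral_mono) auto
  also have "\<dots> = ?a * (\<integral>\<^sup>+x. (\<integral>\<^sup>+y. ennreal (a (x - y)) * ennreal ((b y)\<^sup>2) \<partial>\<mu>) \<partial>\<mu>)"
    by (rule nn_integral_cmult) measurable
  also have "\<dots> = ?a * (?a * (\<integral>\<^sup>+x. ennreal ((b x)\<^sup>2) \<partial>\<mu>))"
    by (subst nn_conv) auto
  finally show ?thesis by (simp add: power2_eq_square mult.assoc)
qed

lemma conv_sq:
  assumes f: "integrable \<mu> f" and g: "sq \<mu> g"
  shows "sq \<mu> (conv f g)"
proof -
  have [measurable]: "f \<in> borel_measurable \<mu>" "g \<in> borel_measurable \<mu>" using f g by measurable
  have "(\<integral>\<^sup>+x. ennreal ((cmod (conv f g x))\<^sup>2) \<partial>\<mu>) \<le> (\<integral>\<^sup>+x. (\<integral>\<^sup>+y. ennreal (cmod (f (x - y)) * cmod (g y)) \<partial>\<mu>)\<^sup>2 \<partial>\<mu>)"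
  proof (rule nn_integral_mono)
    fix x
    have "ennreal (cmod (conv f g x)) \<le> (\<integral>\<^sup>+y. ennreal (cmod (f (x - y)) * cmod (g y)) \<partial>\<mu>)"
      unfolding conv_def using cmod_integral_le_nn[of \<mu> "\<lambda>y. f (x - y) * g y"] by (simp add: norm_mult)
    then have "(ennreal (cmod (conv f g x)))\<^sup>2 \<le> (\<integral>\<^sup>+y. ennreal (cmod (f (x - y)) * cmod (g y)) \<partial>\<mu>)\<^sup>2"
      by (rule power_mono) simp
    then show "ennreal ((cmod (conv f g x))\<^sup>2) \<le> (\<integral>\<^sup>+y. ennreal (cmod (f (x - y)) * cmod (g y)) \<partial>\<mu>)\<^sup>2"
      by (simp add: ennreal_power)
  qed
  also have "\<dots> \<le> (\<integral>\<^sup>+x. ennreal (cmod (f x)) \<partial>\<mu>)\<^sup>2 * (\<integral>\<^sup>+x. ennreal ((cmod (g x))\<^sup>2) \<partial>\<mu>)"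
    by (rule young_nn) auto
  also have "\<dots> < \<infinity>"
    using f g by (auto simp: integrable_iff_nn sq_iff_nn ennreal_mult_less_top power_less_top_ennreal)
  finally show ?thesis by (simp add: sq_iff_nn)
qed

text \<open>Justifies Fubini in pairings of an L2 function with the convolution of an L1 and an L2
  function: Young's inequality after the crude bound ab \<le> a^2 + b^2.\<close>

lemma trilinear:
  assumes a: "sq \<mu> a" and b: "integrable \<mu> b" and c: "sq \<mu> c"
  shows "integrable (\<mu> \<Otimes>\<^sub>M \<mu>) (\<lambda>p. a (fst p) * b (fst p - snd p) * c (snd p))"
proof -
  have [measurable]: "a \<in> borel_measurable \<mu>" "b \<in> borel_measurable \<mu>" "c \<in> borel_measurable \<mu>" using a b c by measurable
  let ?G = "\<lambda>x. \<integral>\<^sup>+y. ennreal (cmod (b (x - y)) * cmod (c y)) \<partial>\<mu>"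
  have "(\<integral>\<^sup>+p. ennreal (cmod (a (fst p) * b (fst p - snd p) * c (snd p))) \<partial>(\<mu> \<Otimes>\<^sub>M \<mu>))
     = (\<integral>\<^sup>+x. \<integral>\<^sup>+y. ennreal (cmod (a x)) * ennreal (cmod (b (x - y)) * cmod (c y)) \<partial>\<mu> \<partial>\<mu>)"
    by (subst nn_integral_fst[symmetric]) (auto simp: norm_mult ennreal_mult mult.assoc)
  also have "\<dots> = (\<integral>\<^sup>+x. ennreal (cmod (a x)) * ?G x \<partial>\<mu>)"
    by (intro nn_integral_cong nn_integral_cmult) measurable
  also have "\<dots> \<le> (\<integral>\<^sup>+x. (ennreal (cmod (a x)))\<^sup>2 + (?G x)\<^sup>2 \<partial>\<mu>)"
    by (intro nn_integral_mono ennreal_mult_le_squares)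
  also have "\<dots> = (\<integral>\<^sup>+x. (ennreal (cmod (a x)))\<^sup>2 \<partial>\<mu>) + (\<integral>\<^sup>+x. (?G x)\<^sup>2 \<partial>\<mu>)"
    by (rule nn_integral_add) measurable
  also have "\<dots> < \<infinity>"
  proof -
    have "(\<integral>\<^sup>+x. (?G x)\<^sup>2 \<partial>\<mu>) \<le> (\<integral>\<^sup>+x. ennreal (cmod (b x)) \<partial>\<mu>)\<^sup>2 * (\<integral>\<^sup>+x. ennreal ((cmod (c x))\<^sup>2) \<partial>\<mu>)"
      by (rule young_nn) auto
    also have "\<dots> < \<infinity>"
      using b c by (auto simp: integrable_iff_nn sq_iff_nn ennreal_mult_less_top power_less_top_ennreal)
    finally show ?thesis using a by (simp add: sq_iff_nn ennreal_power)
  qed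
  finally show ?thesis by (subst integrable_iff_nn) measurable
qed

lemma conv_pair_integrable:
  fixes f g :: "'a \<Rightarrow> complex"
  assumes f: "integrable \<mu> f" and g: "integrable \<mu> g"
  shows "integrable (\<mu> \<Otimes>\<^sub>M \<mu>) (\<lambda>p. f (fst p - snd p) * g (snd p))"
proof -
  have [measurable]: "f \<in> borel_measurable \<mu>" "g \<in> borel_measurable \<mu>" using f g by measurable
  have "(\<integral>\<^sup>+p. ennreal (cmod (f (fst p - snd p) * g (snd p))) \<partial>(\<mu> \<Otimes>\<^sub>M \<mu>))
     = (\<integral>\<^sup>+x. \<integral>\<^sup>+y. ennreal (cmod (f (x - y))) * ennreal (cmod (g y)) \<partial>\<mu> \<partial>\<mu>)"
    by (subst nn_integral_fst[symmetric]) (auto simp: norm_mult ennreal_mult)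
  also have "\<dots> < \<infinity>"
    using f g by (subst nn_conv) (auto simp: integrable_iff_nn ennreal_mult_less_top)
  finally show ?thesis by (subst integrable_iff_nn) measurable
qed

lemma conv_AE_integrable:
  fixes f g :: "'a \<Rightarrow> complex"
  assumes f: "integrable \<mu> f" and g: "integrable \<mu> g"
  shows "AE x in \<mu>. integrable \<mu> (\<lambda>y. f (x - y) * g y)"
  using P.AE_integrable_fst'[OF conv_pair_integrable[OF f g]] by simp

lemma conv_integrable:
  assumes f: "integrable \<mu> f" and g: "integrable \<mu> g"
  shows "integrable \<mu> (conv f g)"
  using P.integrable_fst'[OF conv_pair_integrable[OF f g]] by (simp add: conv_def[abs_def])

lemma conv_commute:
  assumes [measurable]: "f \<in> borel_measurable \<mu>" "g \<in> borel_measurable \<mu>"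
  shows "conv f g = conv g f"
proof
  fix x
  show "conv f g x = conv g f x"
    unfolding conv_def using integral_sub[of "\<lambda>y. g (x - y) * f y" x] by (simp add: mult.commute)
qed

text \<open>The triple integral converges absolutely for almost every \<open>x\<close> only, since
  its integral over \<open>x\<close> is the product of the three L1 norms; at such points
  associativity is Fubini and a translation.\<close>

lemma conv_assoc:
  assumes f: "integrable \<mu> f" and g: "integrable \<mu> g" and h: "integrable \<mu> h"
  shows "AE x in \<mu>. conv (conv f g) h x = conv f (conv g h) x"
proof -
  have [measurable]: "f \<in> borel_measurable \<mu>" "g \<in> borel_measurable \<mu>" "h \<in> borel_measurable \<mu>" using f g h by measurable
  let ?\<Phi> = "\<lambda>x. \<integral>\<^sup>+w. ennreal (cmod (f (x - w))) * (\<integral>\<^sup>+y. ennreal (cmod (g (w - y))) * ennreal (cmod (h y)) \<partial>\<mu>) \<partial>\<mu>"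
  have "(\<integral>\<^sup>+x. ?\<Phi> x \<partial>\<mu>) = (\<integral>\<^sup>+x. ennreal (cmod (f x)) \<partial>\<mu>) * ((\<integral>\<^sup>+x. ennreal (cmod (g x)) \<partial>\<mu>) * (\<integral>\<^sup>+x. ennreal (cmod (h x)) \<partial>\<mu>))"
    by (subst nn_conv, measurable, subst nn_conv) auto
  also have "\<dots> < \<infinity>"
    using f g h by (auto simp: integrable_iff_nn ennreal_mult_less_top)
  finally have "AE x in \<mu>. ?\<Phi> x \<noteq> \<infinity>"
    by (intro nn_integral_PInf_AE) auto
  then show ?thesis
  proof eventually_elim
    case (elim x)
    let ?F = "\<lambda>w y. f (x - w) * (g (w - y) * h y)"
    have "(\<integral>\<^sup>+p. ennreal (cmod (?F (fst p) (snd p))) \<partial>(\<mu> \<Otimes>\<^sub>M \<mu>)) = (\<integral>\<^sup>+w. \<integral>\<^sup>+y. ennreal (cmod (f (x - w))) * (ennreal (cmod (g (w - y))) * ennreal (cmod (h y))) \<partial>\<mu> \<partial>\<mu>)"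
      by (subst nn_integral_fst[symmetric]) (auto simp: norm_mult ennreal_mult)
    also have "\<dots> = ?\<Phi> x" by (intro nn_integral_cong nn_integral_cmult) measurable
    also have "\<dots> < \<infinity>" using elim by (simp add: less_top)
    finally have i: "integrable (\<mu> \<Otimes>\<^sub>M \<mu>) (\<lambda>p. ?F (fst p) (snd p))" by (subst integrable_iff_nn) measurable
    have "conv f (conv g h) x = (\<integral>w. \<integral>y. ?F w y \<partial>\<mu> \<partial>\<mu>)"
      by (simp add: conv_def)
    also have "\<dots> = (\<integral>y. \<integral>w. ?F w y \<partial>\<mu> \<partial>\<mu>)"
      by (rule P.Fubini_integral[symmetric]) (use i in \<open>simp add: case_prod_unfold\<close>)
    also have "\<dots> = (\<integral>y. \<integral>w. f (x - (w + y)) * (g (w + y - y) * h y) \<partial>\<mu> \<partial>\<mu>)"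
      by (intro Bochner_Integration.integral_cong refl integral_shift[symmetric]) measurable
    also have "\<dots> = conv (conv f g) h x"
      unfolding conv_def
      by (intro Bochner_Integration.integral_cong refl, subst integral_mult_left_zero[symmetric])
        (simp add: algebra_simps)
    finally show ?case by simp
  qed
qed

text \<open>The frequency side of complex conjugation in space; its fixed points stand for real
  functions.\<close>

definition reflect :: "('a \<Rightarrow> complex) \<Rightarrow> 'a \<Rightarrow> complex" where
  "reflect f x = cnj (f (- x))"

lemma reflect_measurable[measurable]:
  assumes [measurable]: "f \<in> borel_measurable \<mu>"
  shows "reflect f \<in> borel_measurable \<mu>"
  unfolding reflect_def[abs_def] by measurable

lemma reflect_tl[simp]: "reflect (reflect f) = f"
  by (simp add: reflect_def[abs_def])

lemma reflect_integrable: "integrable \<mu> f \<Longrightarrow> integrable \<mu> (reflect f)"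
  unfolding reflect_def[abs_def] by (simp add: integrable_reflect)

lemma reflect_sq: "sq \<mu> f \<Longrightarrow> sq \<mu> (reflect f)"
  unfolding reflect_def[abs_def] using sq_sub[of f 0] by simp

lemma reflect_conv:
  assumes [measurable]: "f \<in> borel_measurable \<mu>" "g \<in> borel_measurable \<mu>"
  shows "reflect (conv f g) = conv (reflect f) (reflect g)"
proof
  fix x
  have "conv (reflect f) (reflect g) x = (\<integral>y. cnj (f (- x - (- y)) * g (- y)) \<partial>\<mu>)"
    by (simp add: conv_def reflect_def algebra_simps)
  also have "\<dots> = (\<integral>y. cnj (f (- x - y) * g y) \<partial>\<mu>)"
    by (rule integral_reflect[of "\<lambda>y. cnj (f (- x - y) * g y)"]) measurable
  finally show "reflect (conv f g) x = conv (reflect f) (reflect g) x"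
    by (simp add: reflect_def conv_def flip: integral_cnj')
qed

text \<open>The adjoint of multiplication by a function is multiplication by its conjugate.\<close>

lemma ip_conv:
  assumes f: "sq \<mu> f" and g: "integrable \<mu> g" and h: "sq \<mu> h"
  shows "ip f (conv g h) = ip (conv (reflect g) f) h"
proof -
  have i: "integrable (\<mu> \<Otimes>\<^sub>M \<mu>) (\<lambda>p. cnj (f (fst p)) * g (fst p - snd p) * h (snd p))"
    by (rule trilinear) (use f g h in auto)
  have "ip f (conv g h) = (\<integral>x. \<integral>y. cnj (f x) * g (x - y) * h y \<partial>\<mu> \<partial>\<mu>)"
    by (simp add: ip_def conv_def mult.assoc)
  also have "\<dots> = (\<integral>y. \<integral>x. cnj (f x) * g (x - y) * h y \<partial>\<mu> \<partial>\<mu>)"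
    by (rule P.Fubini_integral[symmetric]) (use i in \<open>simp add: case_prod_unfold\<close>)
  also have "\<dots> = ip (conv (reflect g) f) h"
    by (simp add: ip_def conv_def reflect_def mult_ac flip: integral_cnj')
  finally show ?thesis .
qed

lemma ip_herm_swap:
  assumes p: "sq \<mu> p" "reflect p = p" and f: "sq \<mu> f"
  shows "ip f p = ip p (reflect f)"
proof -
  have [measurable]: "p \<in> borel_measurable \<mu>" "f \<in> borel_measurable \<mu>" using p f by measurable
  have ph: "p (- x) = cnj (p x)" for x using p(2) by (metis complex_cnj_cnj reflect_def)
  have "ip f p = (\<integral>x. cnj (f (- x)) * p (- x) \<partial>\<mu>)"
    unfolding ip_def by (rule integral_reflect[symmetric]) measurable
  then show ?thesis by (simp add: ip_def reflect_def ph mult.commute)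
qed

definition Dw :: "('a \<Rightarrow> complex) \<Rightarrow> 'a \<Rightarrow> complex" where
  "Dw f x = \<i> * of_real (\<omega> x) * f x"

lemma Dw_measurable[measurable]:
  assumes [measurable]: "f \<in> borel_measurable \<mu>"
  shows "Dw f \<in> borel_measurable \<mu>"
  unfolding Dw_def[abs_def] by measurable

text \<open>The Leibniz rule, from \<omega> x = \<omega> (x - y) + \<omega> y. It is claimed where
  both convolution integrals on the right converge absolutely, which is almost everywhere.\<close>

lemma Dw_conv:
  assumes "integrable \<mu> f" "integrable \<mu> g" "integrable \<mu> (Dw f)" "integrable \<mu> (Dw g)"
  shows "AE x in \<mu>. Dw (conv f g) x = conv (Dw f) g x + conv f (Dw g) x"
  using conv_AE_integrable[OF assms(3,2)] conv_AE_integrable[OF assms(1,4)]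
proof eventually_elim
  case (elim x)
  have "conv (Dw f) g x + conv f (Dw g) x = (\<integral>y. Dw f (x - y) * g y + f (x - y) * Dw g y \<partial>\<mu>)"
    unfolding conv_def by (rule Bochner_Integration.integral_add[symmetric]) (use elim in auto)
  also have "\<dots> = (\<integral>y. (\<i> * of_real (\<omega> x)) * (f (x - y) * g y) \<partial>\<mu>)"
    by (rule Bochner_Integration.integral_cong) (auto simp: Dw_def algebra_simps)
  finally show ?case by (simp add: Dw_def conv_def)
qed

text \<open>The contribution of the negative frequencies is the conjugate of that of the positive
  ones. On the circle the zero frequency has positive mass; the vanishing of \<open>X\<close> there
  removes it.\<close>

lemma ip_half:
  assumes X: "sq \<mu> X" "reflect X = X" and Y: "sq \<mu> Y" "reflect Y = Y" and z: "\<And>x. \<omega> x = 0 \<Longrightarrow> X x = 0"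
  shows "Re (ip X Y) = 2 * Re (\<integral>x. (if 0 < \<omega> x then cnj (X x) * Y x else 0) \<partial>\<mu>)"
proof -
  have [measurable]: "X \<in> borel_measurable \<mu>" "Y \<in> borel_measurable \<mu>" using X Y by measurable
  have Xh: "X (- x) = cnj (X x)" and Yh: "Y (- x) = cnj (Y x)" for x
    using X(2) Y(2) by (metis complex_cnj_cnj reflect_def)+
  let ?p = "\<lambda>x. if 0 < \<omega> x then cnj (X x) * Y x else 0" and ?n = "\<lambda>x. if \<omega> x < 0 then cnj (X x) * Y x else 0"
  have i: "integrable \<mu> (\<lambda>x. cnj (X x) * Y x)" by (rule ip_integrable[OF X(1) Y(1)])
  have ip: "integrable \<mu> ?p" and "in": "integrable \<mu> ?n"
    by (rule Bochner_Integration.integrable_bound[OF i]; auto)+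
  have "ip X Y = (\<integral>x. ?p x + ?n x \<partial>\<mu>)"
    unfolding ip_def by (rule Bochner_Integration.integral_cong) (use z in \<open>force simp: not_less\<close>)+
  also have "\<dots> = (\<integral>x. ?p x \<partial>\<mu>) + (\<integral>x. ?n x \<partial>\<mu>)" by (rule Bochner_Integration.integral_add[OF ip "in"])
  also have "(\<integral>x. ?n x \<partial>\<mu>) = (\<integral>x. ?n (- x) \<partial>\<mu>)" by (rule integral_reflect[symmetric]) measurable
  also have "\<dots> = cnj (\<integral>x. ?p x \<partial>\<mu>)"
    by (subst integral_cnj'[symmetric], rule Bochner_Integration.integral_cong) (auto simp: Xh Yh)
  finally show ?thesis by simp
qed


section \<open>The Hamiltonian identity\<close>

text \<open>Since H has the symbol -i sgn \<omega>, the term -H q'' has the symbol -i \<omega>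
  |\<omega>|; the nonlinearity is taken as 2 q q' = (q^2)'. The normalisation of the transform is
  absorbed in \<open>u\<close>, so the convolution carries no constant.\<close>

definition bo_rhs :: "('a \<Rightarrow> complex) \<Rightarrow> 'a \<Rightarrow> complex" where
  "bo_rhs u x = - \<i> * of_real (\<omega> x * \<bar>\<omega> x\<bar>) * u x + \<i> * of_real (\<omega> x) * conv u u x"

definition wt :: "('a \<Rightarrow> complex) \<Rightarrow> 'a \<Rightarrow> complex" where
  "wt f x = of_real (1 + \<bar>\<omega> x\<bar>) * f x"

lemma wt_measurable[measurable]:
  assumes [measurable]: "f \<in> borel_measurable \<mu>"
  shows "wt f \<in> borel_measurable \<mu>"
  unfolding wt_def[abs_def] by measurable

lemma cmod_wt: "cmod (wt f x) = (1 + \<bar>\<omega> x\<bar>) * cmod (f x)"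
  unfolding wt_def norm_mult norm_of_real by simp

text \<open>One factor of the weight pays for one derivative.\<close>

lemma wt_dominates:
  assumes [measurable]: "f \<in> borel_measurable \<mu>"
  shows "sq \<mu> (wt f) \<Longrightarrow> sq \<mu> f" "sq \<mu> (wt f) \<Longrightarrow> sq \<mu> (Dw f)"
    "integrable \<mu> (wt f) \<Longrightarrow> integrable \<mu> f" "integrable \<mu> (wt f) \<Longrightarrow> integrable \<mu> (Dw f)"
proof -
  have a: "cmod (f x) \<le> cmod (wt f x)" "cmod (Dw f x) \<le> cmod (wt f x)" for x
    unfolding cmod_wt by (simp_all add: Dw_def norm_mult algebra_simps)
  show "sq \<mu> (wt f) \<Longrightarrow> sq \<mu> f" "sq \<mu> (wt f) \<Longrightarrow> sq \<mu> (Dw f)"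
    by (erule sq_bound(1), measurable, use a in simp)+
  show "integrable \<mu> (wt f) \<Longrightarrow> integrable \<mu> f" "integrable \<mu> (wt f) \<Longrightarrow> integrable \<mu> (Dw f)"
    by (erule Bochner_Integration.integrable_bound, measurable, use a in simp)+
qed

text \<open>Exchanging the variables turns the part below the diagonal into minus the conjugate of
  the part above it, so both have the same imaginary part; the diagonal itself carries
  nothing.\<close>

lemma antisym_half:
  assumes H: "integrable (\<mu> \<Otimes>\<^sub>M \<mu>) (\<lambda>p. H (fst p) (snd p))"
    and sym: "\<And>x y. H y x = - cnj (H x y)" and z: "\<And>x y. \<omega> x = \<omega> y \<Longrightarrow> H x y = 0"
  shows "2 * Im (\<integral>p. (if \<omega> (snd p) < \<omega> (fst p) then H (fst p) (snd p) else 0) \<partial>(\<mu> \<Otimes>\<^sub>M \<mu>)) = Im (\<integral>p. H (fst p) (snd p) \<partial>(\<mu> \<Otimes>\<^sub>M \<mu>))"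
proof -
  let ?M = "\<mu> \<Otimes>\<^sub>M \<mu>"
  have [measurable]: "(\<lambda>p. H (fst p) (snd p)) \<in> borel_measurable ?M" using H by simp
  let ?G = "\<lambda>p. if \<omega> (snd p) < \<omega> (fst p) then H (fst p) (snd p) else 0"
  let ?L = "\<lambda>p. if \<omega> (fst p) < \<omega> (snd p) then H (fst p) (snd p) else 0"
  have iG: "integrable ?M ?G" and iL: "integrable ?M ?L"
    by (rule Bochner_Integration.integrable_bound[OF H]; auto)+
  have "(\<integral>p. H (fst p) (snd p) \<partial>?M) = (\<integral>p. ?G p + ?L p \<partial>?M)"
    by (rule Bochner_Integration.integral_cong) (use z in \<open>force simp: not_less\<close>)+
  also have "\<dots> = (\<integral>p. ?G p \<partial>?M) + (\<integral>p. ?L p \<partial>?M)" by (rule Bochner_Integration.integral_add[OF iG iL])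
  also have "(\<integral>p. ?L p \<partial>?M) = (\<integral>p. ?L (snd p, fst p) \<partial>?M)"
    using P.integral_product_swap[of ?L] by (simp add: case_prod_unfold)
  also have "\<dots> = (\<integral>p. - cnj (?G p) \<partial>?M)"
    using sym[of "fst p" "snd p" for p] by (intro Bochner_Integration.integral_cong refl) simp
  also have "\<dots> = - cnj (\<integral>p. ?G p \<partial>?M)" by (simp only: Bochner_Integration.integral_minus integral_cnj')
  finally show ?thesis by simp
qed

text \<open>
  As \<open>(x - y) (x + y + 2 \<kappa>) = (x + \<kappa>)\<^sup>2 - (y + \<kappa>)\<^sup>2\<close>, the double integral is the one of
  \<open>((\<omega> x + \<kappa>)\<^sup>2 - (\<omega> y + \<kappa>)\<^sup>2) cnj (u (x - y)) v x cnj (v y)\<close> over \<open>\<omega> y < \<omega> x\<close>. Skew symmetry extends it to all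
  \<open>x\<close>, \<open>y\<close>, where the equation gives \<open>- Im \<integral> (\<omega> + \<kappa>)\<^sup>2 cnj u v\<close>; with the single integral this leaves
  \<open>- \<kappa>\<^sup>2 Im \<langle>u, v\<rangle>\<close>.
\<close>

lemma half_identity:
  assumes k: "1 \<le> \<kappa>" and [measurable]: "u \<in> borel_measurable \<mu>" "v \<in> borel_measurable \<mu>"
    and herm: "reflect u = u" and u: "integrable \<mu> (wt u)" "sq \<mu> (wt u)"
    and v: "sq \<mu> (wt v)" and v0: "\<And>x. \<omega> x < 0 \<Longrightarrow> v x = 0"
    and eq: "\<And>x. 0 \<le> \<omega> x \<Longrightarrow> of_real (\<omega> x + \<kappa>) * v x = u x + conv u v x"
    and real: "Im (ip u v) = 0"
  shows "integrable (\<mu> \<Otimes>\<^sub>M \<mu>) (\<lambda>p. if 0 < \<omega> (fst p) then of_real (\<omega> (fst p)) * cnj (u (fst p)) *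
        (of_real (2 * \<omega> (snd p) + \<omega> (fst p) + 2 * \<kappa>) * v (fst p + snd p) * cnj (v (snd p))) else 0)" (is ?I)
    and "Im (\<integral>x. (if 0 < \<omega> x then of_real (\<omega> x) * cnj (u x) * (of_real (\<omega> x + 2 * \<kappa>) * v x) else 0) \<partial>\<mu>)
     + Im (\<integral>p. (if 0 < \<omega> (fst p) then of_real (\<omega> (fst p)) * cnj (u (fst p)) *
        (of_real (2 * \<omega> (snd p) + \<omega> (fst p) + 2 * \<kappa>) * v (fst p + snd p) * cnj (v (snd p))) else 0) \<partial>(\<mu> \<Otimes>\<^sub>M \<mu>)) = 0" (is ?E)
proof -
  let ?M = "\<mu> \<Otimes>\<^sub>M \<mu>"
  have uh: "u (- x) = cnj (u x)" for x using herm by (metis complex_cnj_cnj reflect_def)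
  have uhd: "cnj (u (y - x)) = u (x - y)" for x y using uh[of "x - y"] by simp
  define H1 where "H1 x y = of_real ((\<omega> x + \<kappa>)\<^sup>2) * cnj (u (x - y)) * v x * cnj (v y)" for x y
  define H where "H x y = of_real ((\<omega> x + \<kappa>)\<^sup>2 - (\<omega> y + \<kappa>)\<^sup>2) * cnj (u (x - y)) * v x * cnj (v y)" for x y
  have tri: "integrable ?M (\<lambda>p. wt v (fst p) * wt u (fst p - snd p) * wt v (snd p))"
    by (rule trilinear[OF v u(1) v])
  have H1b: "cmod (H1 x y) \<le> cmod (of_real (\<kappa>\<^sup>2) * (wt v x * wt u (x - y) * wt v y))" for x y
  proof (cases "0 \<le> \<omega> x \<and> 0 \<le> \<omega> y")
    case False
    then have "H1 x y = 0" using v0 by (auto simp: H1_def not_le)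
    then show ?thesis by simp
  next
    case True
    have a: "\<omega> x + \<kappa> \<le> \<kappa> * (1 + \<omega> x)"
      using True k mult_right_mono[of 1 \<kappa> "\<omega> x"] by (simp add: algebra_simps)
    \<comment> \<open>One of the two powers of 1 + \<omega> x is distributed over the other
      arguments, so that each of the three functions carries exactly one weight and
      \<open>trilinear\<close> applies.\<close>
    have b: "1 + \<omega> x \<le> (1 + \<bar>\<omega> (x - y)\<bar>) * (1 + \<omega> y)"
    proof -
      have "1 + \<omega> x \<le> 1 + \<bar>\<omega> (x - y)\<bar> + \<omega> y" by simp
      also have "\<dots> \<le> (1 + \<bar>\<omega> (x - y)\<bar>) * (1 + \<omega> y)" using True by (simp add: algebra_simps)
      finally show ?thesis .
    qed
    have "(\<omega> x + \<kappa>)\<^sup>2 \<le> (\<kappa> * (1 + \<omega> x))\<^sup>2" using a True k by (intro power_mono) auto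
    also have "\<dots> = \<kappa>\<^sup>2 * ((1 + \<omega> x) * (1 + \<omega> x))" by (simp add: power2_eq_square)
    also have "\<dots> \<le> \<kappa>\<^sup>2 * ((1 + \<omega> x) * ((1 + \<bar>\<omega> (x - y)\<bar>) * (1 + \<omega> y)))"
      using b True by (intro mult_left_mono) auto
    finally have "(\<omega> x + \<kappa>)\<^sup>2 * (cmod (u (x - y)) * cmod (v x) * cmod (v y))
       \<le> \<kappa>\<^sup>2 * ((1 + \<omega> x) * ((1 + \<bar>\<omega> (x - y)\<bar>) * (1 + \<omega> y))) * (cmod (u (x - y)) * cmod (v x) * cmod (v y))"
      by (rule mult_right_mono) simp
    then show ?thesis
      using True k by (simp add: H1_def norm_mult cmod_wt mult_ac del: freq_diff of_real_add of_real_power)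
  qed
  have [measurable]: "(\<lambda>p. H1 (fst p) (snd p)) \<in> borel_measurable ?M" unfolding H1_def by measurable
  have iH1: "integrable ?M (\<lambda>p. H1 (fst p) (snd p))"
    by (rule Bochner_Integration.integrable_bound[OF integrable_mult_right[OF tri, of "of_real (\<kappa>\<^sup>2)"]]) (use H1b in auto)
  have H1s: "H x y = H1 x y - cnj (H1 y x)" for x y
    by (simp add: H_def H1_def uhd algebra_simps)
  have iH1': "integrable ?M (\<lambda>p. cnj (H1 (snd p) (fst p)))"
    using P.integrable_product_swap[OF iH1] by (simp add: case_prod_unfold)
  have iH: "integrable ?M (\<lambda>p. H (fst p) (snd p))"
    unfolding H1s by (rule Bochner_Integration.integrable_diff[OF iH1 iH1'])
  let ?H1 = "\<integral>p. H1 (fst p) (snd p) \<partial>?M"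
  have "(\<integral>p. H (fst p) (snd p) \<partial>?M) = ?H1 - (\<integral>p. cnj (H1 (snd p) (fst p)) \<partial>?M)"
    unfolding H1s by (rule Bochner_Integration.integral_diff[OF iH1 iH1'])
  also have "(\<integral>p. cnj (H1 (snd p) (fst p)) \<partial>?M) = cnj ?H1"
    using P.integral_product_swap[of "\<lambda>p. H1 (fst p) (snd p)"] by (simp add: case_prod_unfold)
  finally have ImH: "Im (\<integral>p. H (fst p) (snd p) \<partial>?M) = 2 * Im ?H1" by simp
  have iuv: "integrable \<mu> (\<lambda>x. of_real ((\<omega> x + \<kappa>)\<^sup>2) * (cnj (u x) * v x))"
  proof -
    have 1: "integrable \<mu> (\<lambda>x. of_real (\<kappa>\<^sup>2) * (cnj (wt u x) * wt v x))"
      by (intro integrable_mult_right ip_integrable u v)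
    have 2: "cmod (of_real ((\<omega> x + \<kappa>)\<^sup>2) * (cnj (u x) * v x)) \<le> cmod (of_real (\<kappa>\<^sup>2) * (cnj (wt u x) * wt v x))" for x
    proof (cases "0 \<le> \<omega> x")
      case False then show ?thesis using v0 by simp
    next
      case True
      have a: "\<omega> x + \<kappa> \<le> \<kappa> * (1 + \<omega> x)"
        using True k mult_right_mono[of 1 \<kappa> "\<omega> x"] by (simp add: algebra_simps)
      have "(\<omega> x + \<kappa>)\<^sup>2 \<le> (\<kappa> * (1 + \<omega> x))\<^sup>2" using a True k by (intro power_mono) auto
      then have "(\<omega> x + \<kappa>)\<^sup>2 * (cmod (u x) * cmod (v x)) \<le> (\<kappa> * (1 + \<omega> x))\<^sup>2 * (cmod (u x) * cmod (v x))"
        by (rule mult_right_mono) simp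
      then show ?thesis using True k by (simp add: norm_mult cmod_wt power2_eq_square mult_ac del: of_real_add of_real_power of_real_mult)
    qed
    show ?thesis by (rule Bochner_Integration.integrable_bound[OF 1]) (use 2 in auto)
  qed
  have iI: "integrable \<mu> (\<lambda>x. Im (cnj (u x) * v x))"
    using ip_integrable[OF wt_dominates(1)[OF _ u(2)] wt_dominates(1)[OF _ v]] by (intro integrable_Im) auto
  have iI2: "integrable \<mu> (\<lambda>x. (\<omega> x + \<kappa>)\<^sup>2 * Im (cnj (u x) * v x))"
    using integrable_Im[OF iuv] by simp
  have "?H1 = (\<integral>x. \<integral>y. H1 x y \<partial>\<mu> \<partial>\<mu>)"
    by (subst P.integral_fst'[symmetric, OF iH1]) simp
  also have "\<dots> = (\<integral>x. of_real ((\<omega> x + \<kappa>)\<^sup>2) * v x * cnj (conv u v x) \<partial>\<mu>)"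
    unfolding H1_def conv_def integral_cnj'[symmetric]
    by (intro Bochner_Integration.integral_cong refl, subst integral_mult_right_zero[symmetric])
      (simp add: mult_ac)
  finally have H1e: "?H1 = (\<integral>x. of_real ((\<omega> x + \<kappa>)\<^sup>2) * v x * cnj (conv u v x) \<partial>\<mu>)" .
  have iC: "integrable \<mu> (\<lambda>x. of_real ((\<omega> x + \<kappa>)\<^sup>2) * v x * cnj (conv u v x))"
  proof -
    have "integrable \<mu> (\<lambda>x. \<integral>y. H1 x y \<partial>\<mu>)" using P.integrable_fst'[OF iH1] by simp
    moreover have "(\<integral>y. H1 x y \<partial>\<mu>) = of_real ((\<omega> x + \<kappa>)\<^sup>2) * v x * cnj (conv u v x)" for x
      unfolding H1_def conv_def integral_cnj'[symmetric]
      by (subst integral_mult_right_zero[symmetric]) (simp add: mult_ac)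
    ultimately show ?thesis by simp
  qed
  have "Im ?H1 = (\<integral>x. Im (of_real ((\<omega> x + \<kappa>)\<^sup>2) * v x * cnj (conv u v x)) \<partial>\<mu>)"
    unfolding H1e using integral_Im[OF iC] by simp
  also have "\<dots> = (\<integral>x. - ((\<omega> x + \<kappa>)\<^sup>2 * Im (cnj (u x) * v x)) \<partial>\<mu>)"
  proof (rule Bochner_Integration.integral_cong[OF refl])
    fix x
    show "Im (of_real ((\<omega> x + \<kappa>)\<^sup>2) * v x * cnj (conv u v x)) = - ((\<omega> x + \<kappa>)\<^sup>2 * Im (cnj (u x) * v x))"
    proof (cases "0 \<le> \<omega> x")
      case False then show ?thesis using v0 by simp
    next
      case True
      \<comment> \<open>The convolution is eliminated through the equation; the term (\<omega> +
        \<kappa>) |v|^2 is real and disappears from the imaginary part.\<close>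
      have "conv u v x = of_real (\<omega> x + \<kappa>) * v x - u x" using eq[OF True] by simp
      then have "Im (v x * cnj (conv u v x)) = - Im (cnj (u x) * v x)"
        unfolding \<open>conv u v x = of_real (\<omega> x + \<kappa>) * v x - u x\<close> by (simp add: algebra_simps)
      moreover have "Im (of_real ((\<omega> x + \<kappa>)\<^sup>2) * v x * cnj (conv u v x)) = (\<omega> x + \<kappa>)\<^sup>2 * Im (v x * cnj (conv u v x))"
        unfolding mult.assoc Im_complex_of_real times_complex.sel by (simp add: algebra_simps)
      ultimately show ?thesis by (simp only: mult_minus_right)
    qed
  qed
  finally have ImH1: "Im ?H1 = - (\<integral>x. (\<omega> x + \<kappa>)\<^sup>2 * Im (cnj (u x) * v x) \<partial>\<mu>)" by simp
  let ?G = "\<lambda>p. if \<omega> (snd p) < \<omega> (fst p) then H (fst p) (snd p) else 0"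
  let ?S = "\<lambda>p. if 0 < \<omega> (fst p) then of_real (\<omega> (fst p)) * cnj (u (fst p)) *
        (of_real (2 * \<omega> (snd p) + \<omega> (fst p) + 2 * \<kappa>) * v (fst p + snd p) * cnj (v (snd p))) else 0"
  have Hm[measurable]: "(\<lambda>p. H (fst p) (snd p)) \<in> borel_measurable ?M" using iH by simp
  have iG: "integrable ?M ?G"
    by (rule Bochner_Integration.integrable_bound[OF iH]) auto
  \<comment> \<open>The shear (x, y) to (x + y, y) turns the difference \<open>x - y\<close> into
    \<open>x\<close>; it preserves the measure, so \<open>?S\<close> and \<open>?G\<close> have
    equal integrals.\<close>
  have GS: "?G (x + y, y) = ?S (x, y)" for x y
    by (simp add: H_def power2_eq_square algebra_simps)
  have Sm: "?S \<in> borel_measurable ?M" by measurable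
  have "(\<integral>\<^sup>+p. ennreal (cmod (?S p)) \<partial>?M) = (\<integral>\<^sup>+y. \<integral>\<^sup>+x. ennreal (cmod (?G (x + y, y))) \<partial>\<mu> \<partial>\<mu>)"
    unfolding GS by (subst P.nn_integral_snd[symmetric]) (use Sm in auto)
  also have "\<dots> = (\<integral>\<^sup>+y. \<integral>\<^sup>+x. ennreal (cmod (?G (x, y))) \<partial>\<mu> \<partial>\<mu>)"
    by (intro nn_integral_cong nn_integral_shift[of "\<lambda>x. ennreal (cmod (?G (x, y)))" y for y]) (use iG in simp)
  also have "\<dots> = (\<integral>\<^sup>+p. ennreal (cmod (?G p)) \<partial>?M)"
    by (subst P.nn_integral_snd[symmetric]) auto
  also have "\<dots> < \<infinity>" using iG by (subst (asm) integrable_iff_nn) auto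
  finally have iS: "integrable ?M ?S" using integrable_iff_nn[OF Sm] by simp
  then show ?I .
  have "(\<integral>p. ?S p \<partial>?M) = (\<integral>y. \<integral>x. ?S (x, y) \<partial>\<mu> \<partial>\<mu>)"
    using P.integral_snd[of "\<lambda>x y. ?S (x, y)"] iS by (simp only: case_prod_unfold fst_conv snd_conv)
  also have "\<dots> = (\<integral>y. \<integral>x. ?G (x + y, y) \<partial>\<mu> \<partial>\<mu>)" unfolding GS ..
  also have "\<dots> = (\<integral>y. \<integral>x. ?G (x, y) \<partial>\<mu> \<partial>\<mu>)"
    by (intro Bochner_Integration.integral_cong refl integral_shift[of "\<lambda>x. ?G (x, y)" y for y]) measurable
  also have "\<dots> = (\<integral>p. ?G p \<partial>?M)"
    using P.integral_snd[of "\<lambda>x y. ?G (x, y)"] iG by (simp only: case_prod_unfold fst_conv snd_conv)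
  finally have SG: "(\<integral>p. ?S p \<partial>?M) = (\<integral>p. ?G p \<partial>?M)" .
  have "2 * Im (\<integral>p. ?G p \<partial>?M) = Im (\<integral>p. H (fst p) (snd p) \<partial>?M)"
    by (rule antisym_half[OF iH]) (simp_all add: H_def uhd algebra_simps)
  then have S_val: "Im (\<integral>p. ?S p \<partial>?M) = - (\<integral>x. (\<omega> x + \<kappa>)\<^sup>2 * Im (cnj (u x) * v x) \<partial>\<mu>)"
    unfolding SG ImH ImH1 by simp
  let ?f = "\<lambda>x. if 0 < \<omega> x then of_real (\<omega> x) * cnj (u x) * (of_real (\<omega> x + 2 * \<kappa>) * v x) else 0"
  \<comment> \<open>Here \<omega> (\<omega> + 2 \<kappa>) = (\<omega> + \<kappa>)^2 - \<kappa>^2.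
    Both sides vanish at \<omega> = 0, and for \<omega> < 0 because \<open>v\<close> does.\<close>
  have fe: "?f x = of_real ((\<omega> x + \<kappa>)\<^sup>2) * (cnj (u x) * v x) - of_real (\<kappa>\<^sup>2) * (cnj (u x) * v x)" for x
    using v0[of x] by (cases "\<omega> x" "0::real" rule: linorder_cases) (auto simp: power2_eq_square algebra_simps)
  have iuv0: "integrable \<mu> (\<lambda>x. of_real (\<kappa>\<^sup>2) * (cnj (u x) * v x))"
    using ip_integrable[OF wt_dominates(1)[OF _ u(2)] wt_dominates(1)[OF _ v]] by (intro integrable_mult_right) auto
  have "(\<integral>x. ?f x \<partial>\<mu>) = (\<integral>x. of_real ((\<omega> x + \<kappa>)\<^sup>2) * (cnj (u x) * v x) \<partial>\<mu>) - of_real (\<kappa>\<^sup>2) * ip u v"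
    unfolding fe ip_def using Bochner_Integration.integral_diff[OF iuv iuv0] by simp
  then have "Im (\<integral>x. ?f x \<partial>\<mu>) = Im (\<integral>x. of_real ((\<omega> x + \<kappa>)\<^sup>2) * (cnj (u x) * v x) \<partial>\<mu>)"
    using real by simp
  also have "\<dots> = (\<integral>x. (\<omega> x + \<kappa>)\<^sup>2 * Im (cnj (u x) * v x) \<partial>\<mu>)"
    using integral_Im[OF iuv] by simp
  finally show ?E using S_val by simp
qed


text \<open>With m the inverse transform of \<open>v\<close>, the functions \<open>M\<close>,
  \<open>N\<close> and \<open>A\<close> are the transforms of |1 + m|^2 - 1, of q (1 + m) and of q
  |1 + m|^2. Pairing the equation of motion with \<open>M\<close> and keeping positive frequencies
  leaves 2 A - \<omega> M against \<omega> \<open>u\<close>. There \<open>N\<close> equals (\<omega>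
  + \<kappa>) \<open>v\<close>, which makes the expression quadratic in \<open>v\<close> and reduces
  it to \<open>half_identity\<close>.\<close>

lemma hamiltonian_identity:
  assumes k: "1 \<le> \<kappa>" and [measurable]: "u \<in> borel_measurable \<mu>" "v \<in> borel_measurable \<mu>"
    and herm: "reflect u = u" and u: "integrable \<mu> (wt u)" "sq \<mu> (wt u)"
    and p: "sq \<mu> (bo_rhs u)"
    and v: "sq \<mu> (wt v)" "integrable \<mu> v" and v0: "\<And>x. \<omega> x < 0 \<Longrightarrow> v x = 0"
    and eq: "\<And>x. 0 \<le> \<omega> x \<Longrightarrow> of_real (\<omega> x + \<kappa>) * v x = u x + conv u v x"
    and real: "Im (ip u v) = 0"
  shows "Re (ip (bo_rhs u) v + ip v (bo_rhs u) + ip v (conv (bo_rhs u) v)) = 0"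
proof -
  let ?p = "bo_rhs u"
  define w where "w = Dw u"
  define p1 where "p1 x = - \<i> * of_real (\<omega> x * \<bar>\<omega> x\<bar>) * u x" for x
  define M where "M x = v x + reflect v x + conv v (reflect v) x" for x
  define A where "A x = u x + conv u M x" for x
  define N where "N x = u x + conv u v x" for x
  have u1: "integrable \<mu> u" "sq \<mu> u" and w1: "integrable \<mu> w" "sq \<mu> w"
    unfolding w_def by (rule wt_dominates(3)[OF _ u(1)] wt_dominates(1)[OF _ u(2)]
        wt_dominates(4)[OF _ u(1)] wt_dominates(2)[OF _ u(2)], measurable)+
  have v1: "sq \<mu> v" "sq \<mu> (Dw v)" by (rule wt_dominates(1)[OF _ v(1)] wt_dominates(2)[OF _ v(1)], measurable)+
  have [measurable]: "w \<in> borel_measurable \<mu>" "p1 \<in> borel_measurable \<mu>" "M \<in> borel_measurable \<mu>"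
     "A \<in> borel_measurable \<mu>" "N \<in> borel_measurable \<mu>" "?p \<in> borel_measurable \<mu>"
    unfolding w_def p1_def[abs_def] M_def[abs_def] A_def[abs_def] N_def[abs_def] bo_rhs_def[abs_def] by measurable
  have vv: "integrable \<mu> (conv v (reflect v))" "sq \<mu> (conv v (reflect v))"
    using conv_integrable[OF v(2) reflect_integrable[OF v(2)]] conv_sq[OF v(2) reflect_sq[OF v1(1)]] by auto
  have M1: "integrable \<mu> M" "sq \<mu> M"
    unfolding M_def using vv v v1 reflect_integrable[OF v(2)] reflect_sq[OF v1(1)] by (auto intro!: sq_add)
  have uM: "integrable \<mu> (conv u M)" "sq \<mu> (conv u M)"
    using conv_integrable[OF u1(1) M1(1)] conv_sq[OF u1(1) M1(2)] by auto
  have A1: "sq \<mu> A" unfolding A_def by (rule sq_add[OF u1(2) uM(2)])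
  have reflect_add: "reflect (\<lambda>x. f x + g x) = (\<lambda>x. reflect f x + reflect g x)" for f g by (simp add: reflect_def[abs_def])
  have tlvv: "reflect (conv v (reflect v)) = conv v (reflect v)"
    by (simp add: reflect_conv conv_commute[of "reflect v" v])
  have tlM: "reflect M = M"
    unfolding M_def[abs_def] reflect_add tlvv reflect_tl by (simp add: add_ac)
  have tlA: "reflect A = A"
    unfolding A_def[abs_def] reflect_add by (simp add: reflect_conv herm tlM)
  have uh: "u (- x) = cnj (u x)" for x using herm by (metis complex_cnj_cnj reflect_def)
  have tlw: "reflect w = w" by (auto simp: reflect_def w_def Dw_def uh fun_eq_iff)
  have tlp1: "reflect p1 = p1" by (auto simp: reflect_def p1_def uh fun_eq_iff)
  have uuh: "conv u u (- x) = cnj (conv u u x)" for x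
    using reflect_conv[of u u] herm by (metis \<open>u \<in> borel_measurable \<mu>\<close> complex_cnj_cnj reflect_def)
  have tlp: "reflect ?p = ?p" by (auto simp: reflect_def bo_rhs_def uh uuh fun_eq_iff)
  \<comment> \<open>the derivative of the conserved quantity is the pairing of the nonlinearity with \<open>|1 + m|\<^sup>2 - 1\<close>\<close>
  have F: "ip ?p v + ip v ?p + ip v (conv ?p v) = ip ?p M"
  proof -
    have "ip v (conv ?p v) = ip v (conv v ?p)" by (simp add: conv_commute[of ?p v])
    also have "\<dots> = ip (conv (reflect v) v) ?p" by (rule ip_conv[OF v1(1) v(2) p])
    also have "\<dots> = ip ?p (reflect (conv (reflect v) v))"
      by (rule ip_herm_swap[OF p tlp]) (simp add: conv_commute[of "reflect v" v] vv)
    also have "reflect (conv (reflect v) v) = conv v (reflect v)"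
      by (simp add: reflect_conv)
    finally have 1: "ip v (conv ?p v) = ip ?p (conv v (reflect v))" .
    have 2: "ip v ?p = ip ?p (reflect v)" by (rule ip_herm_swap[OF p tlp v1(1)])
    have "ip ?p M = ip ?p v + ip ?p (reflect v) + ip ?p (conv v (reflect v))"
      unfolding M_def
      by (simp add: ip_add_right[OF p sq_add[OF v1(1) reflect_sq[OF v1(1)]] vv(2)] ip_add_right[OF p v1(1) reflect_sq[OF v1(1)]])
    then show ?thesis using 1 2 by simp
  qed
  have wu: "sq \<mu> (conv w u)" by (rule conv_sq[OF w1(1) u1(2)])
  have p_eq: "AE x in \<mu>. ?p x = p1 x + 2 * conv w u x"
    using Dw_conv[OF u1(1) u1(1)] w1(1) conv_commute[of u w]
    by (auto simp: bo_rhs_def p1_def w_def Dw_def[of "conv u u"] elim!: eventually_mono)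
  have p1s: "sq \<mu> p1"
  proof -
    have d: "sq \<mu> (\<lambda>x. ?p x - 2 * conv w u x)" by (rule sq_diff[OF p sq_scale[OF wu]])
    show ?thesis
      by (rule sq_bound(1)[OF d]) (use p_eq in \<open>auto elim!: eventually_mono\<close>)
  qed
  have pM: "ip ?p M = ip p1 M + 2 * ip (conv w u) M"
  proof -
    have "ip ?p M = ip (\<lambda>x. p1 x + 2 * conv w u x) M"
      unfolding ip_def by (rule integral_cong_AE) (use p_eq in \<open>auto elim!: eventually_mono\<close>)
    also have "\<dots> = ip p1 M + ip (\<lambda>x. 2 * conv w u x) M"
      by (rule ip_add_left[OF p1s sq_scale[OF wu] M1(2)])
    also have "ip (\<lambda>x. 2 * conv w u x) M = 2 * ip (conv w u) M"
      unfolding ip_def by (simp add: mult.assoc)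
    finally show ?thesis .
  qed
  \<comment> \<open>In space: the factor q of q q' is moved to the other side, where q (|1 + m|^2 -
    1) is \<open>A\<close> minus \<open>u\<close>.\<close>
  have "ip (conv w u) M = cnj (ip M (conv u w))" by (simp add: ip_cnj conv_commute[of w u])
  also have "\<dots> = ip w (conv (reflect u) M)"
    unfolding ip_conv[OF M1(2) u1(1) w1(2)] by (simp add: ip_cnj)
  also have "\<dots> = ip w A - ip w u"
    unfolding herm A_def using ip_add_right[OF w1(2) u1(2) uM(2)] by simp
  finally have wuM: "ip (conv w u) M = ip w A - ip w u" .
  \<comment> \<open>The spatial integral of q' q vanishes; here the integrand is purely
    imaginary.\<close>
  have "ip w u = (\<integral>x. - \<i> * of_real (\<omega> x * (cmod (u x))\<^sup>2) \<partial>\<mu>)"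
    unfolding ip_def w_def Dw_def
    by (rule Bochner_Integration.integral_cong[OF refl])
      (simp add: mult.assoc mult.commute[of "cnj _" "u _"] complex_norm_square[symmetric])
  then have "Re (ip w u) = 0"
    by (simp only: integral_mult_right_zero integral_complex_of_real) simp
  then have ReF: "Re (ip ?p M) = Re (ip p1 M) + 2 * Re (ip w A)"
    unfolding pM wuM by simp
  let ?h1 = "\<lambda>x. if 0 < \<omega> x then cnj (p1 x) * M x else 0" and ?h2 = "\<lambda>x. if 0 < \<omega> x then cnj (w x) * A x else 0"
  have ih1: "integrable \<mu> ?h1"
    by (rule Bochner_Integration.integrable_bound[OF ip_integrable[OF p1s M1(2)]]) auto
  have ih2: "integrable \<mu> ?h2"
    by (rule Bochner_Integration.integrable_bound[OF ip_integrable[OF w1(2) A1]]) auto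
  have "Re (ip ?p M) = 2 * Re ((\<integral>x. ?h1 x \<partial>\<mu>) + 2 * (\<integral>x. ?h2 x \<partial>\<mu>))"
    unfolding ReF
    using ip_half[OF p1s tlp1 M1(2) tlM] ip_half[OF w1(2) tlw A1 tlA] by (simp add: p1_def w_def Dw_def)
  also have "(\<integral>x. ?h1 x \<partial>\<mu>) + 2 * (\<integral>x. ?h2 x \<partial>\<mu>) = (\<integral>x. ?h1 x + 2 * ?h2 x \<partial>\<mu>)"
    by (subst Bochner_Integration.integral_add[OF ih1 integrable_mult_right[OF ih2]]) simp
  finally have ReF2: "Re (ip ?p M) = 2 * Re (\<integral>x. ?h1 x + 2 * ?h2 x \<partial>\<mu>)" .
  let ?a = "\<lambda>x. if 0 < \<omega> x then of_real (\<omega> x) * cnj (u x) * (of_real (\<omega> x + 2 * \<kappa>) * v x) else 0"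
  let ?S = "\<lambda>p. if 0 < \<omega> (fst p) then of_real (\<omega> (fst p)) * cnj (u (fst p)) *
        (of_real (2 * \<omega> (snd p) + \<omega> (fst p) + 2 * \<kappa>) * v (fst p + snd p) * cnj (v (snd p))) else 0"
  have iS: "integrable (\<mu> \<Otimes>\<^sub>M \<mu>) ?S" by (rule half_identity(1)[OF k _ _ herm u v(1) v0 eq real]) auto
  have ia: "integrable \<mu> ?a"
  proof (rule Bochner_Integration.integrable_bound)
    show "integrable \<mu> (\<lambda>x. of_real (2 * \<kappa>) * (cnj (wt u x) * wt v x))"
      by (intro integrable_mult_right ip_integrable u v)
    show "?a \<in> borel_measurable \<mu>" by measurable
    have "cmod (?a x) \<le> cmod (of_real (2 * \<kappa>) * (cnj (wt u x) * wt v x))" for x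
    proof (cases "0 < \<omega> x")
      case True
      have "\<omega> x * (\<omega> x + 2 * \<kappa>) \<le> (1 + \<omega> x) * (2 * \<kappa> * (1 + \<omega> x))"
      proof (intro mult_mono)
        show "\<omega> x + 2 * \<kappa> \<le> 2 * \<kappa> * (1 + \<omega> x)"
          using True k mult_right_mono[of 1 "2 * \<kappa>" "\<omega> x"] by (simp add: algebra_simps)
      qed (use True k in auto)
      then have "\<omega> x * (\<omega> x + 2 * \<kappa>) * (cmod (u x) * cmod (v x)) \<le> (1 + \<omega> x) * (2 * \<kappa> * (1 + \<omega> x)) * (cmod (u x) * cmod (v x))"
        by (rule mult_right_mono) simp
      then show ?thesis using True k
        by (simp add: norm_mult cmod_wt mult_ac del: of_real_add of_real_mult)
    qed simp
    then show "AE x in \<mu>. cmod (?a x) \<le> cmod (of_real (2 * \<kappa>) * (cnj (wt u x) * wt v x))" by simp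
  qed
  \<comment> \<open>In space this is q |1 + m|^2 = q (1 + m) times the conjugate of 1 + m; it rests
    on associativity of convolution, hence holds almost everywhere.\<close>
  have AN: "AE x in \<mu>. A x = N x + conv N (reflect v) x"
  proof -
    have uv: "integrable \<mu> (conv u v)" by (rule conv_integrable[OF u1(1) v(2)])
    note tv = reflect_integrable[OF v(2)]
    show ?thesis
      using conv_assoc[OF u1(1) v(2) tv] conv_AE_integrable[OF u1(1) v(2)] conv_AE_integrable[OF u1(1) tv]
        conv_AE_integrable[OF u1(1) vv(1)] conv_AE_integrable[OF uv tv]
    proof eventually_elim
      case (elim x)
      have "conv u M x = (\<integral>y. u (x - y) * v y + u (x - y) * reflect v y + u (x - y) * conv v (reflect v) y \<partial>\<mu>)"
        unfolding conv_def[of u M] M_def by (simp add: distrib_left)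
      also have "\<dots> = conv u v x + conv u (reflect v) x + conv u (conv v (reflect v)) x"
        unfolding conv_def[of u] using elim by simp
      also have "conv u (conv v (reflect v)) x = conv (conv u v) (reflect v) x" using elim(1) by simp
      finally have 1: "conv u M x = conv u v x + conv u (reflect v) x + conv (conv u v) (reflect v) x" .
      have "conv N (reflect v) x = (\<integral>y. u (x - y) * reflect v y + conv u v (x - y) * reflect v y \<partial>\<mu>)"
        unfolding conv_def[of N] N_def by (simp add: distrib_right)
      also have "\<dots> = conv u (reflect v) x + conv (conv u v) (reflect v) x"
        unfolding conv_def[of u "reflect v"] conv_def[of "conv u v" "reflect v"] using elim by simp
      finally show ?case using 1 by (simp add: A_def N_def)
    qed
  qed
  have N1: "integrable \<mu> N" unfolding N_def using u1 conv_integrable[OF u1(1) v(2)] by simp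
  have "AE x in \<mu>. ?h1 x + 2 * ?h2 x = - \<i> * (?a x + (\<integral>y. ?S (x, y) \<partial>\<mu>))"
    using AN conv_AE_integrable[OF N1 reflect_integrable[OF v(2)]] conv_AE_integrable[OF v(2) reflect_integrable[OF v(2)]]
  proof eventually_elim
    case (elim x)
    show ?case
    proof (cases "0 < \<omega> x")
      case False then show ?thesis by simp
    next
      case True
      \<comment> \<open>Convolution with the reflection of \<open>v\<close> is correlation with
        \<open>v\<close>.\<close>
      have refl_conv: "conv f (reflect v) x = (\<integral>y. f (x + y) * cnj (v y) \<partial>\<mu>)"
        if [measurable]: "f \<in> borel_measurable \<mu>" for f
        unfolding conv_def reflect_def
        using integral_reflect[of "\<lambda>y. f (x - y) * cnj (v (- y))"] by simp
      have refl_int: "integrable \<mu> (\<lambda>y. f (x + y) * cnj (v y))"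
        if "integrable \<mu> (\<lambda>y. f (x - y) * reflect v y)" for f
        using integrable_reflect[OF that] by (simp add: reflect_def)
      have vx: "of_real (\<omega> x + \<kappa>) * v x = N x" using eq[of x] True by (simp add: N_def)
      \<comment> \<open>Only \<omega> y \<ge> 0 matters, since \<open>v y\<close> vanishes
        otherwise; then \<omega> (x + y) > 0 and the equation is available at
        \<open>x + y\<close>.\<close>
      have Nv: "N (x + y) * cnj (v y) = of_real (\<omega> x + \<omega> y + \<kappa>) * v (x + y) * cnj (v y)" for y
      proof (cases "0 \<le> \<omega> y")
        case True2: True
        then show ?thesis using eq[of "x + y"] True by (simp add: N_def)
      next
        case False then show ?thesis using v0[of y] by simp
      qed
      have i1: "integrable \<mu> (\<lambda>y. N (x + y) * cnj (v y))" by (rule refl_int[OF elim(2)])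
      have i2: "integrable \<mu> (\<lambda>y. v (x + y) * cnj (v y))" by (rule refl_int[OF elim(3)])
      have Ax: "A x = of_real (\<omega> x + \<kappa>) * v x + (\<integral>y. N (x + y) * cnj (v y) \<partial>\<mu>)"
        using elim(1) vx refl_conv[of N] by simp
      have "reflect v x = 0" using v0[of "- x"] True by (simp add: reflect_def)
      then have Mx: "M x = v x + (\<integral>y. v (x + y) * cnj (v y) \<partial>\<mu>)"
        unfolding M_def using refl_conv[of v] by simp
      have "2 * A x - of_real (\<omega> x) * M x = of_real (\<omega> x + 2 * \<kappa>) * v x
         + (2 * (\<integral>y. N (x + y) * cnj (v y) \<partial>\<mu>) - of_real (\<omega> x) * (\<integral>y. v (x + y) * cnj (v y) \<partial>\<mu>))"
        unfolding Ax Mx by (simp add: algebra_simps)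
      also have "2 * (\<integral>y. N (x + y) * cnj (v y) \<partial>\<mu>) - of_real (\<omega> x) * (\<integral>y. v (x + y) * cnj (v y) \<partial>\<mu>)
         = (\<integral>y. 2 * (N (x + y) * cnj (v y)) - of_real (\<omega> x) * (v (x + y) * cnj (v y)) \<partial>\<mu>)"
        using i1 i2 by (subst Bochner_Integration.integral_diff) auto
      also have "\<dots> = (\<integral>y. of_real (2 * \<omega> y + \<omega> x + 2 * \<kappa>) * v (x + y) * cnj (v y) \<partial>\<mu>)"
        unfolding Nv by (rule Bochner_Integration.integral_cong) (auto simp: algebra_simps)
      finally have AM: "2 * A x - of_real (\<omega> x) * M x = of_real (\<omega> x + 2 * \<kappa>) * v x
         + (\<integral>y. of_real (2 * \<omega> y + \<omega> x + 2 * \<kappa>) * v (x + y) * cnj (v y) \<partial>\<mu>)" .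
      \<comment> \<open>For \<omega> x > 0 the linear part contributes i \<omega>^2 cnj(u) M and the
        nonlinear part -2 i \<omega> cnj(u) A.\<close>
      have "?h1 x + 2 * ?h2 x = - \<i> * (of_real (\<omega> x) * cnj (u x) * (2 * A x - of_real (\<omega> x) * M x))"
        using True by (simp add: p1_def w_def Dw_def algebra_simps)
      also have "\<dots> = - \<i> * (?a x + (\<integral>y. ?S (x, y) \<partial>\<mu>))"
        unfolding AM using True by (simp add: distrib_left flip: integral_mult_right_zero)
      finally show ?thesis .
    qed
  qed
  then have "(\<integral>x. ?h1 x + 2 * ?h2 x \<partial>\<mu>) = (\<integral>x. - \<i> * (?a x + (\<integral>y. ?S (x, y) \<partial>\<mu>)) \<partial>\<mu>)"
    by (intro integral_cong_AE) measurable
  also have "\<dots> = - \<i> * ((\<integral>x. ?a x \<partial>\<mu>) + (\<integral>p. ?S p \<partial>(\<mu> \<Otimes>\<^sub>M \<mu>)))"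
    using P.integrable_fst'[OF iS] P.integral_fst'[OF iS] ia
    by (subst integral_mult_right_zero, subst Bochner_Integration.integral_add) (simp_all only:)
  finally have "Re (ip ?p M) = 2 * (Im (\<integral>x. ?a x \<partial>\<mu>) + Im (\<integral>p. ?S p \<partial>(\<mu> \<Otimes>\<^sub>M \<mu>)))"
    unfolding ReF2 by simp
  also have "\<dots> = 0"
    using half_identity(2)[OF k _ _ herm u v(1) v0 eq real] by simp
  finally show ?thesis using F by simp
qed


text \<open>On the shell where 1 + |\<omega>| is about 2^j the square is at most 4^(-j), while
  \<open>growth\<close> bounds the measure by a multiple of 2^j; the series is geometric.\<close>

lemma inv_weight_sq: "sq \<mu> (\<lambda>x. of_real (1 / (1 + \<bar>\<omega> x\<bar>)))"
proof -
  let ?A = "\<lambda>j::nat. {x. - (2 * 2 ^ j) \<le> \<omega> x \<and> \<omega> x < 2 * 2 ^ j}"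
  let ?c = "\<lambda>j::nat. ennreal ((1 / 2 ^ j)\<^sup>2)"
  have A[measurable]: "?A j \<in> sets \<mu>" for j
    using measurable_sets[OF freq_measurable, of "{- (2 * 2 ^ j)..<2 * 2 ^ j}"]
    by (simp add: vimage_def)
  have "(\<integral>\<^sup>+x. ennreal ((cmod (of_real (1 / (1 + \<bar>\<omega> x\<bar>))))\<^sup>2) \<partial>\<mu>) \<le> (\<integral>\<^sup>+x. (\<Sum>j. ?c j * indicator (?A j) x) \<partial>\<mu>)"
  proof (rule nn_integral_mono)
    fix x
    obtain j :: nat where j: "2 ^ j * 1 \<le> 1 + \<bar>\<omega> x\<bar>" "1 + \<bar>\<omega> x\<bar> < 2 * (2 ^ j * 1)"
      using dyadic_exists[of 1 "1 + \<bar>\<omega> x\<bar>"] by auto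
    have "1 / (1 + \<bar>\<omega> x\<bar>) \<le> 1 / 2 ^ j" using j by (intro divide_left_mono) auto
    then have "(1 / (1 + \<bar>\<omega> x\<bar>))\<^sup>2 \<le> (1 / 2 ^ j)\<^sup>2" by (rule power_mono) simp
    then have "ennreal ((cmod (of_real (1 / (1 + \<bar>\<omega> x\<bar>))))\<^sup>2) \<le> ?c j"
      unfolding norm_of_real power2_abs by (rule ennreal_leI)
    also have "x \<in> ?A j" using j by auto
    then have "?c j = ?c j * indicator (?A j) x" by simp
    also have "\<dots> \<le> (\<Sum>j. ?c j * indicator (?A j) x)"
      by (rule le_suminf_ennreal)
    finally show "ennreal ((cmod (of_real (1 / (1 + \<bar>\<omega> x\<bar>))))\<^sup>2) \<le> (\<Sum>j. ?c j * indicator (?A j) x)" .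
  qed
  also have "\<dots> = (\<Sum>j. ?c j * emeasure \<mu> (?A j))"
    by (subst nn_integral_suminf) (auto simp: nn_integral_cmult)
  also have "\<dots> \<le> (\<Sum>j. ennreal (8 * (1/2) ^ j))"
  proof (rule suminf_le)
    fix j :: nat
    have "emeasure \<mu> (?A j) \<le> ennreal (2 * (2 * 2 ^ j - (- (2 * 2 ^ j))))"
      by (rule growth) (use one_le_power[of "2::real" j] in linarith)
    then have "?c j * emeasure \<mu> (?A j) \<le> ?c j * ennreal (2 * (2 * 2 ^ j - (- (2 * 2 ^ j))))" by (rule mult_left_mono) simp
    also have "\<dots> = ennreal ((1 / 2 ^ j)\<^sup>2 * (2 * (2 * 2 ^ j - (- (2 * 2 ^ j)))))"
      by (rule ennreal_mult[symmetric]) auto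
    also have "(1 / 2 ^ j)\<^sup>2 * (2 * (2 * 2 ^ j - (- (2 * 2 ^ j)))) = 8 * (1/2 :: real) ^ j"
      by (simp add: power2_eq_square power_one_over)
    finally show "?c j * emeasure \<mu> (?A j) \<le> ennreal (8 * (1/2) ^ j)" .
  qed auto
  also have "\<dots> = ennreal (\<Sum>j. 8 * (1/2) ^ j)"
    by (rule suminf_ennreal2) (auto intro!: summable_mult summable_geometric)
  also have "\<dots> < \<infinity>" by simp
  finally show ?thesis by (subst sq_iff_nn) measurable
qed

text \<open>Cauchy--Schwarz against the reciprocal weight: one derivative in L2 gives an absolutely
  integrable transform.\<close>

lemma integrable_of_wt:
  assumes [measurable]: "f \<in> borel_measurable \<mu>" and f: "sq \<mu> (wt f)"
  shows "integrable \<mu> f"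
proof -
  have "f = (\<lambda>x. of_real (1 / (1 + \<bar>\<omega> x\<bar>)) * wt f x)"
  proof
    fix x
    have "1 + \<bar>\<omega> x\<bar> \<noteq> 0" by linarith
    then show "f x = of_real (1 / (1 + \<bar>\<omega> x\<bar>)) * wt f x"
      unfolding wt_def mult.assoc[symmetric] of_real_mult[symmetric] by simp
  qed
  then show ?thesis using sq_mult_integrable[OF inv_weight_sq f] by simp
qed

section \<open>Conservation along the flow\<close>

text \<open>The regularity on which \<open>hamiltonian_identity\<close> runs: a real potential whose
  transform, with one weight, is both integrable and square-integrable. Three derivatives in L2
  provide it.\<close>

definition nice :: "('a \<Rightarrow> complex) \<Rightarrow> bool" where
  "nice u \<longleftrightarrow> u \<in> borel_measurable \<mu> \<and> reflect u = u \<and> integrable \<mu> (wt u) \<and> sq \<mu> (wt u)"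

lemma niceD:
  assumes "nice u"
  shows "u \<in> borel_measurable \<mu>" "reflect u = u" "integrable \<mu> (wt u)" "sq \<mu> (wt u)" "sq \<mu> u" "integrable \<mu> u" "u (- x) = cnj (u x)"
proof -
  show *: "u \<in> borel_measurable \<mu>" "reflect u = u" "integrable \<mu> (wt u)" "sq \<mu> (wt u)"
    using assms by (auto simp: nice_def)
  show "sq \<mu> u" by (rule wt_dominates(1)[OF *(1,4)])
  show "integrable \<mu> u" by (rule wt_dominates(3)[OF *(1,3)])
  show "u (- x) = cnj (u x)" using *(2) by (metis complex_cnj_cnj reflect_def)
qed

text \<open>Undoing the symmetrisation, \<open>v = rt \<kappa> * w\<close> satisfies the equation of
  \<open>hamiltonian_identity\<close>. The weight on \<open>v\<close> demanded there comes from the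
  equation itself: (\<omega> + \<kappa>) v is u + u * v on \<omega> \<ge> 0, and the right side is
  square-integrable.\<close>

lemma Fder_zero:
  assumes k: "1 \<le> \<kappa>" and u: "nice u" and p: "sq \<mu> (bo_rhs u)" and s: "sol \<kappa> u w"
  shows "Re (Fder \<kappa> (bo_rhs u) w) = 0"
proof -
  note n = niceD[OF u]
  have [measurable]: "u \<in> borel_measurable \<mu>" by (rule n)
  have w: "sq \<mu> w" and we: "\<And>x. w x = src \<kappa> u x + kern_op \<kappa> u w x" using s by (auto simp: sol_def)
  have [measurable]: "w \<in> borel_measurable \<mu>" using w by measurable
  define v where "v x = of_real (rt \<kappa> x) * w x" for x
  have [measurable]: "v \<in> borel_measurable \<mu>" unfolding v_def[abs_def] by measurable
  have T: "kern_op \<kappa> f w x = of_real (rt \<kappa> x) * conv f v x" for f x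
    unfolding kern_op_def hs_op_def kern_def conv_def v_def
    by (subst integral_mult_right_zero[symmetric]) (simp add: mult_ac)
  have vn: "sq \<mu> v"
    unfolding v_def using src_bound(1)[OF k w] by (simp add: src_def[abs_def])
  have v0: "v x = 0" if "\<omega> x < 0" for x using that by (simp add: v_def rt_def)
  have eq: "of_real (\<omega> x + \<kappa>) * v x = u x + conv u v x" if x: "0 \<le> \<omega> x" for x
  proof -
    have "v x = of_real ((rt \<kappa> x)\<^sup>2) * (u x + conv u v x)"
      unfolding v_def we[of x] T src_def by (simp add: power2_eq_square algebra_simps v_def[symmetric])
    also have "(rt \<kappa> x)\<^sup>2 = 1 / (\<omega> x + \<kappa>)" using x k by (simp add: rt_sq)
    finally have "v x = of_real (1 / (\<omega> x + \<kappa>)) * (u x + conv u v x)" .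
    moreover have "\<omega> x + \<kappa> \<noteq> 0" using x k by linarith
    ultimately show ?thesis
      by (simp add: mult.assoc[symmetric] of_real_mult[symmetric] del: of_real_add of_real_mult of_real_divide)
  qed
  have N: "sq \<mu> (\<lambda>x. u x + conv u v x)" by (rule sq_add[OF n(5) conv_sq[OF n(6) vn]])
  have vw: "sq \<mu> (wt v)"
  proof (rule sq_bound(1)[OF N])
    have "cmod (wt v x) \<le> cmod (u x + conv u v x)" for x
    proof (cases "0 \<le> \<omega> x")
      case False then show ?thesis using v0 by (simp add: wt_def)
    next
      case True
      have "cmod (wt v x) \<le> (\<omega> x + \<kappa>) * cmod (v x)"
        unfolding cmod_wt using True k by (intro mult_right_mono) auto
      also have "\<dots> = cmod (of_real (\<omega> x + \<kappa>) * v x)" using True k by (simp add: norm_mult del: of_real_add)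
      finally show ?thesis unfolding eq[OF True] .
    qed
    then show "AE x in \<mu>. cmod (wt v x) \<le> cmod (u x + conv u v x)" by simp
  qed measurable
  have vi: "integrable \<mu> v" by (rule integrable_of_wt[OF _ vw]) measurable
  have ips: "ip (src \<kappa> f) w = ip f v" "ip w (src \<kappa> f) = ip v f" for f
    by (simp_all add: ip_def src_def v_def mult_ac)
  have "ip u v = cnj (ip u v)"
    using beta_real[OF s k n(5) n(7)] by (simp add: ips ip_cnj)
  then have real: "Im (ip u v) = 0" by (metis cnj.simps(2) neg_equal_zero)
  have "ip w (kern_op \<kappa> (bo_rhs u) w) = ip v (conv (bo_rhs u) v)"
    by (simp add: ip_def T v_def mult_ac)
  then have "Fder \<kappa> (bo_rhs u) w = ip (bo_rhs u) v + ip v (bo_rhs u) + ip v (conv (bo_rhs u) v)"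
    by (simp add: Fder_def ips)
  also have "Re \<dots> = 0"
    by (rule hamiltonian_identity[OF k _ _ n(2-4) p vw vi v0 eq real]) measurable
  finally show ?thesis .
qed

section \<open>The continuity argument in time\<close>

lemma hsq_tail: "hsq u (2 ^ j * \<kappa>) \<le> hsq u \<kappa>"
proof -
  have "hsq u (2 ^ j * \<kappa>) = (\<Sum>i. qf u (2 ^ (i + j) * \<kappa>))"
    by (simp add: hsq_def power_add mult_ac)
  also have "\<dots> \<le> hsq u \<kappa>"
    unfolding hsq_def using suminf_offset[of "\<lambda>i. qf u (2 ^ i * \<kappa>)" j]
    by (simp add: le_iff_add)
  finally show ?thesis .
qed

text \<open>From |a + b|^2 \<le> 2 |a|^2 + 2 |b|^2 and \<open>hsq_le\<close>. It lets smallness at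
  one time spill over to nearby times when the curve is continuous in L2.\<close>

lemma hsq_quasi_triangle:
  assumes k: "1 \<le> \<kappa>" and u: "sq \<mu> u" and u': "sq \<mu> u'"
  shows "hsq u \<kappa> \<le> 2 * hsq u' \<kappa> + ennreal (4 * (nm \<mu> (\<lambda>x. u x - u' x))\<^sup>2)"
proof -
  let ?d = "\<lambda>x. u x - u' x"
  have d: "sq \<mu> ?d" by (rule sq_diff[OF u u'])
  have [measurable]: "u \<in> borel_measurable \<mu>" "u' \<in> borel_measurable \<mu>" using u u' by measurable
  have "qf u c \<le> 2 * qf u' c + 2 * qf ?d c" if c: "0 < c" for c
  proof -
    have "(cmod (u x))\<^sup>2 \<le> 2 * (cmod (u' x))\<^sup>2 + 2 * (cmod (?d x))\<^sup>2" for x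
    proof -
      have "(cmod (u x))\<^sup>2 \<le> (cmod (u' x) + cmod (?d x))\<^sup>2"
        using norm_triangle_ineq[of "u' x" "?d x"] by (intro power_mono) auto
      also have "\<dots> \<le> 2 * (cmod (u' x))\<^sup>2 + 2 * (cmod (?d x))\<^sup>2"
        using sum_squares_bound[of "cmod (u' x)" "cmod (?d x)"] by (simp add: power2_sum)
      finally show ?thesis .
    qed
    then have le: "(cmod (u x))\<^sup>2 / (\<bar>\<omega> x\<bar> + c) \<le> 2 * ((cmod (u' x))\<^sup>2 / (\<bar>\<omega> x\<bar> + c)) + 2 * ((cmod (?d x))\<^sup>2 / (\<bar>\<omega> x\<bar> + c))" for x
      using c divide_right_mono[of "(cmod (u x))\<^sup>2" "2 * (cmod (u' x))\<^sup>2 + 2 * (cmod (?d x))\<^sup>2" "\<bar>\<omega> x\<bar> + c"]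
      by (simp add: add_divide_distrib)
    have "qf u c \<le> (\<integral>\<^sup>+x. 2 * ennreal ((cmod (u' x))\<^sup>2 / (\<bar>\<omega> x\<bar> + c)) + 2 * ennreal ((cmod (?d x))\<^sup>2 / (\<bar>\<omega> x\<bar> + c)) \<partial>\<mu>)"
      unfolding qf_def
    proof (rule nn_integral_mono)
      fix x
      have p: "0 \<le> (cmod (u' x))\<^sup>2 / (\<bar>\<omega> x\<bar> + c)" "0 \<le> (cmod (?d x))\<^sup>2 / (\<bar>\<omega> x\<bar> + c)" using c by auto
      have "ennreal ((cmod (u x))\<^sup>2 / (\<bar>\<omega> x\<bar> + c)) \<le> ennreal (2 * ((cmod (u' x))\<^sup>2 / (\<bar>\<omega> x\<bar> + c)) + 2 * ((cmod (?d x))\<^sup>2 / (\<bar>\<omega> x\<bar> + c)))"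
        by (rule ennreal_leI[OF le])
      also have "\<dots> = ennreal 2 * ennreal ((cmod (u' x))\<^sup>2 / (\<bar>\<omega> x\<bar> + c)) + ennreal 2 * ennreal ((cmod (?d x))\<^sup>2 / (\<bar>\<omega> x\<bar> + c))"
        using p by (simp only: ennreal_plus ennreal_mult mult_nonneg_nonneg zero_le_numeral)
      finally show "ennreal ((cmod (u x))\<^sup>2 / (\<bar>\<omega> x\<bar> + c)) \<le> 2 * ennreal ((cmod (u' x))\<^sup>2 / (\<bar>\<omega> x\<bar> + c)) + 2 * ennreal ((cmod (?d x))\<^sup>2 / (\<bar>\<omega> x\<bar> + c))"
        by simp
    qed
    also have "\<dots> = 2 * qf u' c + 2 * qf ?d c"
      unfolding qf_def by (subst nn_integral_add) (auto simp: nn_integral_cmult)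
    finally show ?thesis .
  qed
  then have "hsq u \<kappa> \<le> (\<Sum>j. 2 * qf u' (2 ^ j * \<kappa>) + 2 * qf ?d (2 ^ j * \<kappa>))"
    unfolding hsq_def using k by (intro suminf_le) auto
  also have "\<dots> = 2 * hsq u' \<kappa> + 2 * hsq ?d \<kappa>"
    unfolding hsq_def by (subst suminf_add[symmetric]) (auto simp: ennreal_suminf_cmult)
  also have "2 * hsq ?d \<kappa> \<le> 2 * ennreal (2 * (nm \<mu> ?d)\<^sup>2)"
    by (intro mult_left_mono hsq_le[OF d k]) simp
  also have "2 * ennreal (2 * (nm \<mu> ?d)\<^sup>2) = ennreal 2 * ennreal (2 * (nm \<mu> ?d)\<^sup>2)" by simp
  also have "\<dots> = ennreal (4 * (nm \<mu> ?d)\<^sup>2)"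
    by (subst ennreal_mult[symmetric]) auto
  finally show ?thesis by (simp add: add_left_mono)
qed

text \<open>The difference quotients converge in the L2 norm over frequencies, which is the topology
  in which \<open>beta_deriv\<close> differentiates.\<close>

definition flow :: "(real \<Rightarrow> 'a \<Rightarrow> complex) \<Rightarrow> bool" where
  "flow u \<longleftrightarrow> (\<forall>t. nice (u t) \<and> sq \<mu> (bo_rhs (u t)) \<and>
     ((\<lambda>h. nm \<mu> (\<lambda>x. (u (t + h) x - u t x) / of_real h - bo_rhs (u t) x)) \<longlongrightarrow> 0) (at 0))"

lemma flow_continuous:
  assumes "flow u"
  shows "((\<lambda>h. nm \<mu> (\<lambda>x. u (t + h) x - u t x)) \<longlongrightarrow> 0) (at 0)"
proof -
  let ?e = "\<lambda>h x. (u (t + h) x - u t x) / of_real h - bo_rhs (u t) x"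
  have p: "sq \<mu> (bo_rhs (u t))" and l: "((\<lambda>h. nm \<mu> (?e h)) \<longlongrightarrow> 0) (at 0)" and u: "\<And>t. sq \<mu> (u t)"
    using assms niceD(5) by (auto simp: flow_def)
  have b: "nm \<mu> (\<lambda>x. u (t + h) x - u t x) \<le> \<bar>h\<bar> * (nm \<mu> (?e h) + nm \<mu> (bo_rhs (u t)))" if "h \<noteq> 0" for h
  proof -
    have e: "sq \<mu> (?e h)"
      using sq_diff[OF sq_scale[OF sq_diff[OF u[of "t + h"] u[of t]], of "1 / of_real h"] p] by simp
    have "(\<lambda>x. u (t + h) x - u t x) = (\<lambda>x. of_real h * (?e h x + bo_rhs (u t) x))"
      using that by auto
    then have "nm \<mu> (\<lambda>x. u (t + h) x - u t x) = \<bar>h\<bar> * nm \<mu> (\<lambda>x. ?e h x + bo_rhs (u t) x)"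
      by (simp only: nm_scale norm_of_real)
    also have "\<dots> \<le> \<bar>h\<bar> * (nm \<mu> (?e h) + nm \<mu> (bo_rhs (u t)))"
      by (intro mult_left_mono nm_triangle e p) simp
    finally show ?thesis .
  qed
  have "((\<lambda>h. \<bar>h\<bar> * (nm \<mu> (?e h) + nm \<mu> (bo_rhs (u t)))) \<longlongrightarrow> \<bar>0\<bar> * (0 + nm \<mu> (bo_rhs (u t)))) (at 0)"
    by (intro tendsto_intros l)
  then have l2: "((\<lambda>h. \<bar>h\<bar> * (nm \<mu> (?e h) + nm \<mu> (bo_rhs (u t)))) \<longlongrightarrow> 0) (at 0)" by simp
  show ?thesis
  proof (rule Lim_null_comparison[OF _ l2])
    have "\<forall>\<^sub>F h in at (0::real). h \<noteq> 0" by (rule eventually_neq_at_within)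
    then show "\<forall>\<^sub>F h in at 0. norm (nm \<mu> (\<lambda>x. u (t + h) x - u t x)) \<le> \<bar>h\<bar> * (nm \<mu> (?e h) + nm \<mu> (bo_rhs (u t)))"
      by eventually_elim (use b in simp)
  qed
qed

text \<open>On the interval \<beta> has derivative 0, hence equal values at both times, and
  \<open>beta_bound\<close> compares it with the norm of the source at either end. The solutions are
  chosen separately at each time; their continuity comes from \<open>sol_lipschitz\<close>.\<close>

lemma qf_conserved:
  assumes fl: "flow u" and k: "1 \<le> \<kappa>" and small: "\<And>\<tau>. a < \<tau> \<Longrightarrow> \<tau> < b \<Longrightarrow> hsq (u \<tau>) \<kappa> \<le> ennreal (1/32)"
    and t: "a < t" "t < b" and t0: "a < t0" "t0 < b"
  shows "qf (u t) \<kappa> \<le> 4 * qf (u t0) \<kappa>"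
proof -
  let ?S = "{a<..<b}"
  have nice: "nice (u \<tau>)" and p: "sq \<mu> (bo_rhs (u \<tau>))"
    and l: "((\<lambda>h. nm \<mu> (\<lambda>x. (u (\<tau> + h) x - u \<tau> x) / of_real h - bo_rhs (u \<tau>) x)) \<longlongrightarrow> 0) (at 0)" for \<tau>
    using fl by (auto simp: flow_def)
  note u = niceD(5)[OF nice] and herm = niceD(7)[OF nice]
  have sm: "small \<kappa> (u \<tau>)" if "\<tau> \<in> ?S" for \<tau>
    using that by (intro smallI[OF k u] small) auto
  have "\<exists>w. \<forall>\<tau>\<in>?S. sol \<kappa> (u \<tau>) (w \<tau>)"
    using sol_exists[OF sm] by (intro bchoice) auto
  then obtain w where w: "\<And>\<tau>. \<tau> \<in> ?S \<Longrightarrow> sol \<kappa> (u \<tau>) (w \<tau>)" by blast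
  let ?B = "\<lambda>\<tau>. Re (ip (src \<kappa> (u \<tau>)) (w \<tau>))"
  have "(?B has_field_derivative 0) (at \<tau>)" if \<tau>: "\<tau> \<in> ?S" for \<tau>
  proof -
    have "DERIV ?B \<tau> :> Re (Fder \<kappa> (bo_rhs (u \<tau>)) (w \<tau>))"
      by (rule beta_deriv[where S = ?S, OF _ \<tau> sm w herm p l]) auto
    then show ?thesis using Fder_zero[OF k nice p w[OF \<tau>]] by simp
  qed
  then have "\<exists>c. \<forall>\<tau>\<in>?S. ?B \<tau> = c"
    by (intro has_field_derivative_zero_constant) (auto intro: has_field_derivative_at_within)
  then have B: "?B t = ?B t0" using t t0 by auto
  have tS: "t \<in> ?S" "t0 \<in> ?S" using t t0 by auto
  \<comment> \<open>\<open>beta_bound\<close> gives 2/3 N^2 \<le> \<beta> \<le> 4/3 Z^2, so N^2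
    \<le> 2 Z^2; restoring the negative frequencies doubles this to the constant 4.\<close>
  let ?N = "nm \<mu> (src \<kappa> (u t))" and ?Z = "nm \<mu> (src \<kappa> (u t0))"
  have "?N\<^sup>2 \<le> 2 * ?Z\<^sup>2"
    using beta_bound[OF sm[OF tS(1)] w[OF tS(1)]] beta_bound[OF sm[OF tS(2)] w[OF tS(2)]] B
    unfolding abs_le_iff by linarith
  have "qf (u t) \<kappa> \<le> ennreal (2 * ?N\<^sup>2)" by (rule qf_src[OF k u herm])
  also have "\<dots> \<le> ennreal (4 * ?Z\<^sup>2)" using \<open>?N\<^sup>2 \<le> 2 * ?Z\<^sup>2\<close> by (intro ennreal_leI) simp
  also have "\<dots> = ennreal 4 * ennreal (?Z\<^sup>2)" by (rule ennreal_mult) auto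
  also have "\<dots> \<le> ennreal 4 * qf (u t0) \<kappa>" by (intro mult_left_mono src_qf[OF k u]) simp
  finally show ?thesis by simp
qed

lemma hsq_conserved:
  assumes fl: "flow u" and k: "1 \<le> \<kappa>" and small: "\<And>\<tau>. a < \<tau> \<Longrightarrow> \<tau> < b \<Longrightarrow> hsq (u \<tau>) \<kappa> \<le> ennreal (1/32)"
    and t: "a < t" "t < b" and t0: "a < t0" "t0 < b"
  shows "hsq (u t) \<kappa> \<le> 4 * hsq (u t0) \<kappa>"
proof -
  have "qf (u t) (2 ^ j * \<kappa>) \<le> 4 * qf (u t0) (2 ^ j * \<kappa>)" for j
  proof (rule qf_conserved[OF fl _ _ t t0])
    show "1 \<le> 2 ^ j * \<kappa>" using k mult_mono[of 1 "2 ^ j" 1 \<kappa>] by simp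
    show "hsq (u \<tau>) (2 ^ j * \<kappa>) \<le> ennreal (1/32)" if "a < \<tau>" "\<tau> < b" for \<tau>
      using hsq_tail small[OF that] by (rule order.trans)
  qed
  then have "hsq (u t) \<kappa> \<le> (\<Sum>j. 4 * qf (u t0) (2 ^ j * \<kappa>))"
    unfolding hsq_def by (intro suminf_le) auto
  then show ?thesis by (simp add: hsq_def ennreal_suminf_cmult)
qed

text \<open>Consider the symmetric time intervals on which the bound \<open>1/32\<close> holds. If
  it failed at \<open>t\<close>, their supremum \<open>s\<close> would be finite. Strictly inside,
  conservation improves the bound to 4/512 = 1/128, and L2 continuity at \<open>s\<close> and
  \<open>- s\<close> then extends the weaker bound beyond \<open>s\<close>, a contradiction.\<close>

lemma hsq_global:
  assumes fl: "flow u" and k: "1 \<le> \<kappa>" and init: "hsq (u 0) \<kappa> \<le> ennreal (1/512)"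
  shows "hsq (u t) \<kappa> \<le> ennreal (1/32)"
proof (rule ccontr)
  assume bad: "\<not> ?thesis"
  have u: "sq \<mu> (u \<tau>)" for \<tau> using fl niceD(5) by (auto simp: flow_def)
  let ?h = "\<lambda>\<tau>. hsq (u \<tau>) \<kappa>"
  define B where "B = {T. 0 \<le> T \<and> (\<forall>\<tau>. \<bar>\<tau>\<bar> \<le> T \<longrightarrow> ?h \<tau> \<le> ennreal (1/32))}"
  have i0: "?h 0 \<le> ennreal (1/32)" using init by (rule order.trans) (simp add: ennreal_leI)
  have 0: "0 \<in> B" using i0 by (auto simp: B_def)
  have bd: "T \<le> \<bar>t\<bar>" if "T \<in> B" for T 
  proof (rule ccontr)
    assume "\<not> T \<le> \<bar>t\<bar>"
    then have "?h t \<le> ennreal (1/32)" using that by (auto simp: B_def)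
    then show False using bad by simp
  qed
  then have bdd: "bdd_above B" by (intro bdd_aboveI[of _ "\<bar>t\<bar>"]) auto
  define s where "s = Sup B"
  have s0: "0 \<le> s" unfolding s_def by (rule cSup_upper[OF 0 bdd])
  have in_B: "?h \<tau> \<le> ennreal (1/32)" if lt: "\<bar>\<tau>\<bar> < s" for \<tau>
  proof -
    have "B \<noteq> {}" using 0 by auto
    then obtain T where "T \<in> B" "\<bar>\<tau>\<bar> < T" using lt less_cSup_iff[OF _ bdd, of "\<bar>\<tau>\<bar>"] unfolding s_def by auto
    then show ?thesis by (auto simp: B_def)
  qed
  have improved: "?h \<tau> \<le> ennreal (1/128)" if "\<bar>\<tau>\<bar> < s \<or> \<tau> = 0" for \<tau>
  proof (cases "\<tau> = 0")
    case True then show ?thesis using init by (auto elim: order.trans simp: ennreal_leI)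
  next
    case False
    then have a: "\<bar>\<tau>\<bar> < s" using that by simp
    have "?h \<tau> \<le> 4 * ?h 0"
      by (rule hsq_conserved[OF fl k, of "- s" s]) (use in_B a in auto)
    also have "\<dots> \<le> 4 * ennreal (1/512)" by (intro mult_left_mono init) simp
    also have "\<dots> = ennreal 4 * ennreal (1/512)" by simp
    also have "\<dots> = ennreal (1/128)" by (subst ennreal_mult[symmetric]) auto
    finally show ?thesis .
  qed
  have near: "\<exists>e>0. \<forall>\<tau>. \<bar>\<tau> - c\<bar> < e \<longrightarrow> nm \<mu> (\<lambda>x. u \<tau> x - u c x) < 1/32" for c
  proof -
    have "\<forall>\<^sub>F h in at 0. dist (nm \<mu> (\<lambda>x. u (c + h) x - u c x)) 0 < 1/32"
      using flow_continuous[OF fl, of c] by (rule tendstoD) simp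
    then obtain d where d: "d > 0" "\<And>h. h \<noteq> 0 \<Longrightarrow> \<bar>h\<bar> < d \<Longrightarrow> nm \<mu> (\<lambda>x. u (c + h) x - u c x) < 1/32"
      unfolding eventually_at by (auto simp: dist_real_def)
    have "nm \<mu> (\<lambda>x. u \<tau> x - u c x) < 1/32" if "\<bar>\<tau> - c\<bar> < d" for \<tau>
    proof (cases "\<tau> = c")
      case True then show ?thesis by (simp add: nm_def)
    next
      case False then show ?thesis using d(2)[of "\<tau> - c"] that by simp
    qed
    then show ?thesis using d(1) by blast
  qed
  \<comment> \<open>Two times close to a common \<open>c\<close> are within 1/16 of each other, and
    2/128 + 4 (1/16)^2 = 1/32.\<close>
  have step: "?h \<tau> \<le> ennreal (1/32)" if h: "?h \<sigma> \<le> ennreal (1/128)" and d1: "nm \<mu> (\<lambda>x. u \<sigma> x - u c x) < 1/32" and d2: "nm \<mu> (\<lambda>x. u \<tau> x - u c x) < 1/32" for \<tau> \<sigma> c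
  proof -
    have "nm \<mu> (\<lambda>x. u \<tau> x - u \<sigma> x) = nm \<mu> (\<lambda>x. (u \<tau> x - u c x) - (u \<sigma> x - u c x))" by simp
    also have "\<dots> \<le> nm \<mu> (\<lambda>x. u \<tau> x - u c x) + nm \<mu> (\<lambda>x. u \<sigma> x - u c x)"
      by (intro nm_triangle_diff sq_diff u)
    also have "\<dots> \<le> 1/16" using d1 d2 by simp
    finally have "(nm \<mu> (\<lambda>x. u \<tau> x - u \<sigma> x))\<^sup>2 \<le> (1/16)\<^sup>2" by (rule power_mono) simp
    then have n: "4 * (nm \<mu> (\<lambda>x. u \<tau> x - u \<sigma> x))\<^sup>2 \<le> 1/64" by (simp add: power2_eq_square)
    have "?h \<tau> \<le> 2 * ?h \<sigma> + ennreal (4 * (nm \<mu> (\<lambda>x. u \<tau> x - u \<sigma> x))\<^sup>2)" by (rule hsq_quasi_triangle[OF k u u])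
    also have "\<dots> \<le> 2 * ennreal (1/128) + ennreal (1/64)"
      by (intro add_mono mult_left_mono h ennreal_leI n) simp
    also have "2 * ennreal (1/128) = ennreal 2 * ennreal (1/128)" by simp
    also have "\<dots> = ennreal (1/64)" by (subst ennreal_mult[symmetric]) auto
    also have "ennreal (1/64) + ennreal (1/64) = ennreal (1/32)" by (subst ennreal_plus[symmetric]) auto
    finally show ?thesis .
  qed
  obtain e1 where e1: "e1 > 0" "\<And>\<tau>. \<bar>\<tau> - s\<bar> < e1 \<Longrightarrow> nm \<mu> (\<lambda>x. u \<tau> x - u s x) < 1/32" using near[of s] by auto
  obtain e2 where e2: "e2 > 0" "\<And>\<tau>. \<bar>\<tau> - (- s)\<bar> < e2 \<Longrightarrow> nm \<mu> (\<lambda>x. u \<tau> x - u (- s) x) < 1/32" using near[of "- s"] by auto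
  define e where "e = min e1 e2 / 2"
  have e: "e > 0" "e < e1" "e < e2" using e1(1) e2(1) by (auto simp: e_def min_def)
  \<comment> \<open>A base time just inside the interval. When \<open>s = 0\<close> the open
    interval is empty; then \<sigma> is 0 and the initial bound takes over.\<close>
  define \<sigma> where "\<sigma> = max 0 (s - e)"
  have \<sigma>: "\<bar>\<sigma>\<bar> < s \<or> \<sigma> = 0" "\<bar>\<sigma> - s\<bar> \<le> e" using s0 e by (auto simp: \<sigma>_def max_def)
  have h\<sigma>: "?h \<sigma> \<le> ennreal (1/128)" "?h (- \<sigma>) \<le> ennreal (1/128)" using improved \<sigma>(1) by auto
  have "s + e \<in> B"
    unfolding B_def
  proof (intro CollectI conjI allI impI)
    show "0 \<le> s + e" using s0 e by simp
    fix \<tau> assume t: "\<bar>\<tau>\<bar> \<le> s + e"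
    show "?h \<tau> \<le> ennreal (1/32)"
    proof (cases "\<bar>\<tau>\<bar> < s")
      case True then show ?thesis by (rule in_B)
    next
      case False
      show ?thesis
      proof (cases "0 \<le> \<tau>")
        case True
        then have "\<bar>\<tau> - s\<bar> < e1" "\<bar>\<sigma> - s\<bar> < e1" using False t e \<sigma> by auto
        then show ?thesis using step[OF h\<sigma>(1)] e1(2) by blast
      next
        case neg: False
        then have "\<bar>\<tau> - (- s)\<bar> < e2" "\<bar>- \<sigma> - (- s)\<bar> < e2" using False t e \<sigma> by auto
        then show ?thesis using step[OF h\<sigma>(2)] e2(2) by blast
      qed
    qed
  qed
  then have "s + e \<le> s" unfolding s_def by (rule cSup_upper[OF _ bdd])
  then show False using e by simp
qed

theorem qf_global:
  assumes fl: "flow u" and k: "1 \<le> \<kappa>" and init: "hsq (u 0) \<kappa> \<le> ennreal (1/512)"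
  shows "qf (u t) (2 ^ j * \<kappa>) \<le> 4 * qf (u 0) (2 ^ j * \<kappa>)"
proof (rule qf_conserved[OF fl, where a = "- \<bar>t\<bar> - 1" and b = "\<bar>t\<bar> + 1"])
  show "1 \<le> 2 ^ j * \<kappa>" using k mult_mono[of 1 "2 ^ j" 1 \<kappa>] by simp
  show "hsq (u \<tau>) (2 ^ j * \<kappa>) \<le> ennreal (1/32)" for \<tau>
    using hsq_tail hsq_global[OF fl k init] by (rule order.trans)
qed auto

end

section \<open>Besov norms of sequences\<close>

lemma epowr_ennreal: "0 < p \<Longrightarrow> 0 \<le> x \<Longrightarrow> epowr (ennreal x) p = ennreal (x powr p)"
  by (auto simp: epowr_def ennreal_eq_0_iff)

lemma epowr_top[simp]: "0 < p \<Longrightarrow> epowr \<infinity> p = \<infinity>"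
  by (simp add: epowr_def)

lemma epowr_zero[simp]: "0 < p \<Longrightarrow> epowr 0 p = 0"
  by (simp add: epowr_def)

lemma epowr_mono:
  assumes "x \<le> y" "0 < p"
  shows "epowr x p \<le> epowr y p"
proof (cases y)
  case (real b)
  then obtain a where "x = ennreal a" "0 \<le> a" "a \<le> b"
    using assms(1) by (cases x) (auto simp: ennreal_le_iff top_unique)
  then show ?thesis using real assms(2) by (simp add: epowr_ennreal powr_mono2)
next
  case top then show ?thesis using epowr_top[OF assms(2)] by simp
qed

lemma epowr_mult:
  assumes "0 < p"
  shows "epowr (x * y) p = epowr x p * epowr y p"
proof (cases "x = 0 \<or> y = 0")
  case True then show ?thesis using assms by auto
next
  case False
  then have nz: "epowr x p \<noteq> 0" "epowr y p \<noteq> 0"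
    using assms by (auto simp: epowr_def ennreal_eq_0_iff enn2real_eq_0_iff)
  show ?thesis
  proof (cases x; cases y)
    fix a b assume "x = ennreal a" "0 \<le> a" "y = ennreal b" "0 \<le> b"
    then show ?thesis using assms by (simp add: ennreal_mult[symmetric] epowr_ennreal powr_mult)
  qed (use False nz epowr_top[OF assms] in \<open>auto simp: ennreal_mult_top ennreal_top_mult\<close>)
qed

lemma epowr_epowr: "0 < p \<Longrightarrow> 0 < q \<Longrightarrow> epowr (epowr x p) q = epowr x (p * q)"
  using epowr_top[of p] epowr_top[of q] epowr_top[of "p * q"]
  by (cases x) (auto simp: epowr_ennreal powr_powr)

lemma epowr_one[simp]: "epowr x 1 = x"
  using epowr_top[of 1] by (cases x) (auto simp: epowr_ennreal)

lemma epowr_two: "epowr x 2 = x\<^sup>2"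
  using epowr_top[of 2] by (cases x) (auto simp: epowr_ennreal powr_numeral ennreal_power power2_eq_square ennreal_mult)

lemma sq_epowr_half: "(epowr x (1/2))\<^sup>2 = x"
  using epowr_epowr[of "1/2" 2 x] by (simp add: epowr_two)

lemma epowr_half_sq: "epowr (x\<^sup>2) (1/2) = x"
  using epowr_epowr[of 2 "1/2" x] by (simp add: epowr_two)

text \<open>With truncated subtraction \<open>(n - m) + (m - n)\<close> is the distance of
  \<open>n\<close> and \<open>m\<close>. The terms with m \<ge> n and those with m < n are each at
  most one geometric series.\<close>

lemma geometric_two_sided:
  fixes x :: real
  assumes x: "0 \<le> x" "x < 1"
  shows "(\<Sum>m. ennreal (x ^ ((n - m) + (m - n)))) \<le> ennreal (2 / (1 - x))"
proof -
  have g: "(\<Sum>i. ennreal (x ^ i)) = ennreal (1 / (1 - x))"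
    using x by (subst suminf_ennreal2) (auto simp: suminf_geometric summable_geometric)
  have "(\<Sum>m. ennreal (x ^ ((n - m) + (m - n)))) = (\<Sum>i. ennreal (x ^ ((n - (i + n)) + (i + n - n)))) + (\<Sum>i<n. ennreal (x ^ ((n - i) + (i - n))))"
    by (rule suminf_offset) simp
  also have "(\<Sum>i. ennreal (x ^ ((n - (i + n)) + (i + n - n)))) = ennreal (1 / (1 - x))" using g by simp
  also have "(\<Sum>i<n. ennreal (x ^ ((n - i) + (i - n)))) \<le> (\<Sum>i<n. ennreal (x ^ (n - Suc i)))"
    by (rule sum_mono) (use x in \<open>auto intro!: ennreal_leI power_decreasing\<close>)
  also have "\<dots> = (\<Sum>i<n. ennreal (x ^ i))" by (rule sum.nat_diff_reindex)
  also have "\<dots> \<le> (\<Sum>i. ennreal (x ^ i))" by (rule sum_le_suminf) auto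
  also have "\<dots> = ennreal (1 / (1 - x))" by (rule g)
  finally have "(\<Sum>m. ennreal (x ^ ((n - m) + (m - n)))) \<le> ennreal (1 / (1 - x)) + ennreal (1 / (1 - x))"
    by (simp add: add_left_mono)
  also have "\<dots> = ennreal (2 / (1 - x))" using x by (subst ennreal_plus[symmetric]) auto
  finally show ?thesis .
qed

lemma suminf_swap_ennreal: "(\<Sum>n. \<Sum>m. F n m) = (\<Sum>m. \<Sum>n. (F n m :: ennreal))" for F :: "nat \<Rightarrow> nat \<Rightarrow> ennreal"
  using nn_integral_suminf[of "\<lambda>m n. F n m" "count_space UNIV"] by (simp add: nn_integral_count_space_nat)

definition lnorm :: "ennreal \<Rightarrow> (nat \<Rightarrow> ennreal) \<Rightarrow> ennreal" where
  "lnorm r a = (if r = \<infinity> then (SUP n. a n)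
     else epowr (\<Sum>n. epowr (a n) (enn2real r)) (1 / enn2real r))"

lemma enn2real_ge1: "1 \<le> r \<Longrightarrow> r \<noteq> \<infinity> \<Longrightarrow> 1 \<le> enn2real r"
  by (cases r) auto

lemma lnorm_ge: "1 \<le> r \<Longrightarrow> a n \<le> lnorm r a"
proof (cases "r = \<infinity>")
  case True then show ?thesis by (simp add: lnorm_def SUP_upper)
next
  case False
  assume "1 \<le> r"
  then have p: "1 \<le> enn2real r" using False by (rule enn2real_ge1)
  have "epowr (a n) (enn2real r) \<le> (\<Sum>n. epowr (a n) (enn2real r))"
    using sum_le_suminf[of "\<lambda>n. epowr (a n) (enn2real r)" "{n}"] by simp
  then have "epowr (epowr (a n) (enn2real r)) (1 / enn2real r) \<le> lnorm r a"
    unfolding lnorm_def using False p by (simp add: epowr_mono)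
  then show ?thesis using p by (simp add: epowr_epowr)
qed

text \<open>
  A kernel with geometric off-diagonal decay is bounded on \<open>\<ell>\<^sup>r\<close>; only a bound by a supremum is
  available for the part with \<open>n < J\<close>, which is summed with the decaying weight \<open>x ^ n\<close>.
\<close>

lemma lnorm_kernel:
  fixes C x y :: real
  assumes r: "1 \<le> r" and x: "0 < x" "x < 1" and y: "0 < y" "y < 1" and C: "0 \<le> C" and L: "1 \<le> L"
    and b: "\<And>n \<tau>. J \<le> n \<Longrightarrow> (\<And>m. ennreal (x ^ ((n - m) + (m - n))) * a m \<le> \<tau>) \<Longrightarrow> b n \<le> ennreal C * \<tau>"
    and b': "\<And>n. n < J \<Longrightarrow> b n \<le> ennreal C * (ennreal (y ^ n) * (ennreal L * lnorm r a))"
  shows "lnorm r b \<le> ennreal (C * (2 / (1 - x) + 1 / (1 - y))) * (ennreal L * lnorm r a)"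
proof -
  have c1: "1 \<le> 2 / (1 - x)" "1 \<le> 1 / (1 - y)" using x y by (auto simp: field_simps)
  let ?A = "ennreal L * lnorm r a"
  have LA: "lnorm r a \<le> ?A"
    using mult_right_mono[of 1 "ennreal L" "lnorm r a"] L by simp
  show ?thesis
  proof (cases "r = \<infinity>")
    case True
    have "b n \<le> ennreal C * ?A" for n
    proof (cases "J \<le> n")
      case True2: True
      have "ennreal (x ^ ((n - m) + (m - n))) * a m \<le> ?A" for m
      proof -
        have "ennreal (x ^ ((n - m) + (m - n))) * a m \<le> 1 * lnorm r a"
          using x by (intro mult_mono lnorm_ge r) (auto simp: power_le_one)
        then show ?thesis using LA by simp
      qed
      then show ?thesis by (rule b[OF True2])
    next
      case False
      then have "b n \<le> ennreal C * (ennreal (y ^ n) * ?A)" using b' by simp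
      also have "\<dots> \<le> ennreal C * (1 * ?A)"
        using y by (intro mult_left_mono mult_right_mono) (auto simp: power_le_one)
      finally show ?thesis by simp
    qed
    moreover have "lnorm r b = (SUP n. b n)" using True by (simp add: lnorm_def)
    ultimately have "lnorm r b \<le> ennreal C * ?A" by (simp add: SUP_least)
    also have "ennreal C \<le> ennreal (C * (2 / (1 - x) + 1 / (1 - y)))"
      using c1 C mult_left_mono[of 1 "2 / (1 - x) + 1 / (1 - y)" C] by (intro ennreal_leI) simp
    finally show ?thesis by (simp add: mult_right_mono)
  next
    case False
    define p where "p = enn2real r"
    have p: "1 \<le> p" "0 < p" using enn2real_ge1[OF r False] by (auto simp: p_def)
    have ln: "lnorm r c = epowr (\<Sum>n. epowr (c n) p) (1 / p)" for c
      using False by (simp add: lnorm_def p_def)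
    have lnp: "epowr (lnorm r c) p = (\<Sum>n. epowr (c n) p)" for c
      unfolding ln using p by (simp add: epowr_epowr)
    let ?k = "\<lambda>n m. ennreal (x ^ ((n - m) + (m - n)))"
    have b1: "epowr (b n) p \<le> epowr (ennreal C) p * (\<Sum>m. ?k n m * epowr (a m) p)" if n: "J \<le> n" for n
    proof -
      let ?T = "\<Sum>m. epowr (?k n m * a m) p"
      \<comment> \<open>The assumption on \<open>b\<close> is free in \<tau>; for finite exponents
        \<tau> is the l^p norm of the whole row, for r = \<infinity> it was a supremum.\<close>
      have "?k n m * a m \<le> epowr ?T (1 / p)" for m
      proof -
        have "epowr (?k n m * a m) p \<le> ?T"
          using sum_le_suminf[of "\<lambda>m. epowr (?k n m * a m) p" "{m}"] by simp
        then have "epowr (epowr (?k n m * a m) p) (1 / p) \<le> epowr ?T (1 / p)" using p by (simp add: epowr_mono)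
        then show ?thesis using p by (simp add: epowr_epowr)
      qed
      then have "b n \<le> ennreal C * epowr ?T (1 / p)" by (rule b[OF n])
      then have "epowr (b n) p \<le> epowr (ennreal C * epowr ?T (1 / p)) p" using p by (simp add: epowr_mono)
      also have "\<dots> = epowr (ennreal C) p * ?T" using p by (simp add: epowr_mult epowr_epowr)
      also have "?T \<le> (\<Sum>m. ?k n m * epowr (a m) p)"
      proof (intro suminf_le)
        fix m
        have z: "0 < x ^ ((n - m) + (m - n))" "x ^ ((n - m) + (m - n)) \<le> 1" using x by (auto simp: power_le_one)
        \<comment> \<open>The kernel entries are at most 1 and p \<ge> 1, so their p-th powers are
          bounded by the entries themselves; this keeps the constants independent of p.\<close>
        have "(x ^ ((n - m) + (m - n))) powr p \<le> (x ^ ((n - m) + (m - n))) powr 1"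
          using z p by (intro powr_mono') auto
        then have "epowr (?k n m) p \<le> ?k n m" using z p by (simp add: epowr_ennreal ennreal_leI)
        then show "epowr (?k n m * a m) p \<le> ?k n m * epowr (a m) p"
          using p by (simp add: epowr_mult mult_right_mono)
      qed auto
      finally show ?thesis by (simp add: mult_left_mono)
    qed
    have b2: "epowr (b n) p \<le> epowr (ennreal C) p * (ennreal (y ^ n) * epowr ?A p)" if n: "n < J" for n
    proof -
      have z: "0 < y ^ n" "y ^ n \<le> 1" using y by (auto simp: power_le_one)
      have "(y ^ n) powr p \<le> (y ^ n) powr 1" using z p by (intro powr_mono') auto
      then have *: "epowr (ennreal (y ^ n)) p \<le> ennreal (y ^ n)" using z p by (simp add: epowr_ennreal ennreal_leI)
      have "epowr (b n) p \<le> epowr (ennreal C * (ennreal (y ^ n) * ?A)) p"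
        using b'[OF n] p by (simp add: epowr_mono)
      also have "\<dots> = epowr (ennreal C) p * (epowr (ennreal (y ^ n)) p * epowr ?A p)"
        using p by (simp only: epowr_mult)
      also have "\<dots> \<le> epowr (ennreal C) p * (ennreal (y ^ n) * epowr ?A p)"
        by (intro mult_left_mono mult_right_mono *) auto
      finally show ?thesis .
    qed
    have b12: "epowr (b n) p \<le> epowr (ennreal C) p * ((\<Sum>m. ?k n m * epowr (a m) p) + ennreal (y ^ n) * epowr ?A p)" for n
    proof (cases "J \<le> n")
      case True
      show ?thesis by (rule order.trans[OF b1[OF True]]) (intro mult_left_mono, auto)
    next
      case False
      then have "n < J" by simp
      show ?thesis by (rule order.trans[OF b2[OF \<open>n < J\<close>]]) (intro mult_left_mono, auto)
    qed
    have "(\<Sum>n. epowr (b n) p) \<le> (\<Sum>n. epowr (ennreal C) p * ((\<Sum>m. ?k n m * epowr (a m) p) + ennreal (y ^ n) * epowr ?A p))"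
      by (intro suminf_le b12) auto
    also have "\<dots> = epowr (ennreal C) p * ((\<Sum>n. \<Sum>m. ?k n m * epowr (a m) p) + (\<Sum>n. ennreal (y ^ n)) * epowr ?A p)"
      by (simp only: ennreal_suminf_cmult ennreal_suminf_multc suminf_add[symmetric] summableI)
    also have "(\<Sum>n. \<Sum>m. ?k n m * epowr (a m) p) = (\<Sum>m. (\<Sum>n. ?k n m) * epowr (a m) p)"
      by (subst suminf_swap_ennreal) (simp only: ennreal_suminf_multc)
    also have "\<dots> \<le> (\<Sum>m. ennreal (2 / (1 - x)) * epowr (a m) p)"
    proof (intro suminf_le mult_right_mono)
      fix m
      have "(\<Sum>n. ?k n m) = (\<Sum>n. ?k m n)" by (simp add: add.commute)
      also have "\<dots> \<le> ennreal (2 / (1 - x))" by (rule geometric_two_sided) (use x in auto)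
      finally show "(\<Sum>n. ?k n m) \<le> ennreal (2 / (1 - x))" .
    qed auto
    also have "\<dots> = ennreal (2 / (1 - x)) * epowr (lnorm r a) p" by (simp add: lnp)
    also have "\<dots> \<le> ennreal (2 / (1 - x)) * epowr ?A p"
      using p by (intro mult_left_mono epowr_mono LA) auto
    also have "(\<Sum>n. ennreal (y ^ n)) = ennreal (1 / (1 - y))"
      using y by (subst suminf_ennreal2) (auto simp: suminf_geometric summable_geometric)
    finally have "(\<Sum>n. epowr (b n) p) \<le> epowr (ennreal C) p * (ennreal (2 / (1 - x)) * epowr ?A p + ennreal (1 / (1 - y)) * epowr ?A p)"
      by (simp add: mult_left_mono add_right_mono)
    also have "ennreal (2 / (1 - x)) * epowr ?A p + ennreal (1 / (1 - y)) * epowr ?A p = ennreal (2 / (1 - x) + 1 / (1 - y)) * epowr ?A p"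
      using x y by (subst ennreal_plus) (auto simp: distrib_right)
    also have "\<dots> \<le> epowr (ennreal (2 / (1 - x) + 1 / (1 - y))) p * epowr ?A p"
    proof (rule mult_right_mono)
      \<comment> \<open>The constant is at least 1, hence below its p-th power; after the p-th root
        it reappears unchanged for every p.\<close>
      have "(2 / (1 - x) + 1 / (1 - y)) powr 1 \<le> (2 / (1 - x) + 1 / (1 - y)) powr p"
        using p c1 by (intro powr_mono) auto
      then show "ennreal (2 / (1 - x) + 1 / (1 - y)) \<le> epowr (ennreal (2 / (1 - x) + 1 / (1 - y))) p"
        using p c1 by (subst epowr_ennreal) (auto simp: ennreal_leI)
    qed simp
    finally have "(\<Sum>n. epowr (b n) p) \<le> epowr (ennreal C) p * (epowr (ennreal (2 / (1 - x) + 1 / (1 - y))) p * epowr ?A p)"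
      by (simp add: mult_left_mono)
    also have "\<dots> = epowr (ennreal C * (ennreal (2 / (1 - x) + 1 / (1 - y)) * ?A)) p"
      using p by (simp only: epowr_mult)
    finally have "epowr (\<Sum>n. epowr (b n) p) (1 / p) \<le> epowr (epowr (ennreal C * (ennreal (2 / (1 - x) + 1 / (1 - y)) * ?A)) p) (1 / p)"
      using p by (intro epowr_mono) auto
    then have "lnorm r b \<le> ennreal C * (ennreal (2 / (1 - x) + 1 / (1 - y)) * ?A)"
      unfolding ln using p by (simp add: epowr_epowr)
    also have "\<dots> = ennreal (C * (2 / (1 - x) + 1 / (1 - y))) * ?A"
      using C c1 by (subst ennreal_mult) (auto simp: mult.assoc)
    finally show ?thesis .
  qed
qed

text \<open>The index is shifted by one: 0 is the low-frequency part and \<open>Suc j\<close> the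
  block at N = 2^j. Up to a factor 2 the weight is 2^(s n).\<close>

definition dw :: "real \<Rightarrow> nat \<Rightarrow> real" where
  "dw s n = (case n of 0 \<Rightarrow> 1 | Suc j \<Rightarrow> (2 ^ j) powr s)"

definition bnorm :: "real \<Rightarrow> ennreal \<Rightarrow> (nat \<Rightarrow> ennreal) \<Rightarrow> ennreal" where
  "bnorm s r D = lnorm r (\<lambda>n. ennreal (dw s n) * epowr (D n) (1/2))"

text \<open>Blocks 0 and 1 share the frequencies of modulus 1, as in the Besov norm; the comparisons
  below rest on covering, not on disjointness.\<close>

definition dyadic_block :: "nat \<Rightarrow> real set" where
  "dyadic_block n = (case n of 0 \<Rightarrow> {\<xi>. \<bar>\<xi>\<bar> \<le> 1} | Suc j \<Rightarrow> {\<xi>. 2 ^ j \<le> \<bar>\<xi>\<bar> \<and> \<bar>\<xi>\<bar> < 2 * 2 ^ j})"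

lemma besov_norm_bnorm:
  assumes r: "1 \<le> r"
  shows "besov_norm X s r f = bnorm s r (\<lambda>n. \<integral>\<^sup>+\<xi>\<in>dyadic_block n. ennreal ((cmod (fourier X f \<xi>))\<^sup>2) \<partial>freq_measure X)"
proof -
  let ?a = "\<lambda>n. ennreal (dw s n) * fourier_norm X f (dyadic_block n)"
  have b: "bnorm s r (\<lambda>n. \<integral>\<^sup>+\<xi>\<in>dyadic_block n. ennreal ((cmod (fourier X f \<xi>))\<^sup>2) \<partial>freq_measure X) = lnorm r ?a"
    by (simp add: bnorm_def fourier_norm_def)
  have a0: "?a 0 = fourier_norm X f {\<xi>. \<bar>\<xi>\<bar> \<le> 1}" by (simp add: dw_def dyadic_block_def)
  have aS: "?a (Suc j) = ennreal ((2 ^ j) powr s) * fourier_norm X f {\<xi>. 2 ^ j \<le> \<bar>\<xi>\<bar> \<and> \<bar>\<xi>\<bar> < 2 * 2 ^ j}" for j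
    by (simp add: dw_def dyadic_block_def)
  show ?thesis
  proof (cases "r = \<infinity>")
    case True
    have "(SUP n. ?a n) = max (?a 0) (SUP j. ?a (Suc j))"
    proof (rule antisym)
      show "(SUP n. ?a n) \<le> max (?a 0) (SUP j. ?a (Suc j))"
      proof (rule SUP_least)
        fix n show "?a n \<le> max (?a 0) (SUP j. ?a (Suc j))"
        proof (cases n)
          case 0 then show ?thesis by simp
        next
          case (Suc j)
          have "?a (Suc j) \<le> (SUP j. ?a (Suc j))" by (rule SUP_upper) simp
          then show ?thesis unfolding Suc by (rule max.coboundedI2)
        qed
      qed
      show "max (?a 0) (SUP j. ?a (Suc j)) \<le> (SUP n. ?a n)"
        by (intro max.boundedI SUP_least SUP_upper) auto
    qed
    then show ?thesis unfolding b lnorm_def a0 aS using True by (simp add: besov_norm_def)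
  next
    case False
    define p where "p = enn2real r"
    have p: "0 < p" using enn2real_ge1[OF r False] by (auto simp: p_def)
    have "epowr (?a (Suc j)) p = ennreal ((2 ^ j) powr (p * s)) * epowr (fourier_norm X f {\<xi>. 2 ^ j \<le> \<bar>\<xi>\<bar> \<and> \<bar>\<xi>\<bar> < 2 * 2 ^ j}) p" for j
      unfolding aS using p by (simp add: epowr_mult epowr_ennreal powr_powr mult.commute)
    moreover have "(\<Sum>n. epowr (?a n) p) = (\<Sum>j. epowr (?a (Suc j)) p) + epowr (?a 0) p"
      using suminf_offset[of "\<lambda>n. epowr (?a n) p" 1] by simp
    ultimately show ?thesis
      unfolding b lnorm_def a0 using False
      by (simp add: besov_norm_def Let_def p_def[symmetric] add.commute)
  qed
qed


section \<open>Dyadic averages and propagation of the sequence norm\<close>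

definition Qs :: "(nat \<Rightarrow> ennreal) \<Rightarrow> nat \<Rightarrow> ennreal" where
  "Qs D i = (\<Sum>m. D m * ennreal (1 / (2 ^ m + 2 ^ i)))"

lemma dw_bounds:
  assumes "- 1 / 2 < s" "s < 0"
  shows "0 < dw s n" "dw s n \<le> 2 * 2 powr (s * n)" "2 powr (s * n) \<le> dw s n"
proof -
  show "0 < dw s n" by (cases n) (auto simp: dw_def)
  show "dw s n \<le> 2 * 2 powr (s * n)"
  proof (cases n)
    case 0 then show ?thesis by (simp add: dw_def)
  next
    case (Suc j)
    have "dw s n = 2 powr (s * j)" by (simp add: dw_def Suc powr_powr flip: powr_realpow)
      (simp add: mult.commute)
    also have "\<dots> \<le> 2 powr (1 + s * n)" using assms by (intro powr_mono) (auto simp: Suc algebra_simps)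
    finally show ?thesis by (simp add: powr_add)
  qed
  show "2 powr (s * n) \<le> dw s n"
  proof (cases n)
    case 0 then show ?thesis by (simp add: dw_def)
  next
    case (Suc j)
    have "2 powr (s * n) \<le> 2 powr (s * j)" using assms by (intro powr_mono) (auto simp: Suc algebra_simps)
    also have "\<dots> = dw s n" by (simp add: dw_def Suc powr_powr flip: powr_realpow)
      (simp add: mult.commute)
    finally show ?thesis .
  qed
qed

text \<open>Each octave off the diagonal multiplies the weighted kernel by at most 2^(2s) on one
  side and 2^(-(1+2s)) on the other; both are below 1 exactly for -1/2 < s < 0. The fourth root
  splits the decay into four equal shares: two accompany the squared \<tau>, the others make the sum
  over blocks converge.\<close>

definition decay :: "real \<Rightarrow> real" where
  "decay s = (max (2 powr (2 * s)) (2 powr (- (1 + 2 * s)))) powr (1/4)"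

lemma decay_bounds:
  assumes "- 1 / 2 < s" "s < 0"
  shows "0 < decay s" "decay s < 1" "decay s ^ 4 = max (2 powr (2 * s)) (2 powr (- (1 + 2 * s)))"
proof -
  let ?t = "max (2 powr (2 * s)) (2 powr (- (1 + 2 * s)))"
  have t: "0 < ?t" "?t < 1" using assms by (auto simp: max_def powr_less_one)
  show "0 < decay s" using t by (simp add: decay_def)
  have "?t powr (1/4) < 1 powr (1/4)" using t by (intro powr_less_mono2) auto
  then show "decay s < 1" by (simp add: decay_def)
  have "decay s ^ 4 = decay s powr (real 4)" using \<open>0 < decay s\<close> by (simp only: powr_realpow)
  also have "\<dots> = ?t" using t by (simp add: decay_def powr_powr)
  finally show "decay s ^ 4 = ?t" .
qed

text \<open>For m \<le> n the quotient 2^n / (2^m + 2^n) is at most 1 and the weights decay; for m >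
  n it is at most 2^(n - m), which outweighs the growth of the weights because 1 + 2s > 0.\<close>

lemma kernel_decay:
  assumes s: "- 1 / 2 < s" "s < 0"
  shows "2 powr (2 * s * n) * 2 ^ n * (2 powr (- (2 * s * m)) * (1 / (2 ^ m + 2 ^ n))) \<le> decay s ^ (4 * ((n - m) + (m - n)))"
proof -
  let ?t = "max (2 powr (2 * s)) (2 powr (- (1 + 2 * s)))"
  have e: "decay s ^ (4 * ((n - m) + (m - n))) = ?t ^ ((n - m) + (m - n))"
    by (simp only: power_mult decay_bounds(3)[OF s])
  have l: "2 powr (2 * s * n) * 2 ^ n * (2 powr (- (2 * s * m)) * (1 / (2 ^ m + 2 ^ n)))
     = 2 powr (2 * s * (real n - real m)) * (2 ^ n / (2 ^ m + 2 ^ n))"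
    by (simp add: algebra_simps powr_diff powr_minus divide_simps)
  show ?thesis
  proof (cases "m \<le> n")
    case True
    have "2 powr (2 * s * (real n - real m)) * (2 ^ n / (2 ^ m + 2 ^ n)) \<le> 2 powr (2 * s * (real n - real m)) * 1"
    proof (rule mult_left_mono)
      show "2 ^ n / (2 ^ m + 2 ^ n) \<le> (1 :: real)"
        by (rule divide_le_eq_1_pos[THEN iffD2]) (auto intro: add_pos_pos)
    qed simp
    also have "\<dots> = (2 powr (2 * s)) ^ (n - m)"
      using True by (simp add: powr_powr of_nat_diff flip: powr_realpow)
    also have "\<dots> \<le> ?t ^ (n - m)" by (intro power_mono) auto
    finally show ?thesis unfolding e l using True by simp
  next
    case False
    have "2 ^ n / (2 ^ m + 2 ^ n) \<le> (2 ^ n / 2 ^ m :: real)" by (intro divide_left_mono mult_pos_pos add_pos_pos) auto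
    also have "\<dots> = 2 powr (- (real m - real n))" by (simp add: powr_diff powr_realpow)
    finally have "2 powr (2 * s * (real n - real m)) * (2 ^ n / (2 ^ m + 2 ^ n)) \<le> 2 powr (2 * s * (real n - real m)) * 2 powr (- (real m - real n))"
      by (intro mult_left_mono) auto
    also have "\<dots> = 2 powr (- (1 + 2 * s) * (real m - real n))"
      by (simp add: powr_add[symmetric] algebra_simps)
    also have "\<dots> = (2 powr (- (1 + 2 * s))) ^ (m - n)"
      using False by (simp add: powr_powr of_nat_diff flip: powr_realpow)
    also have "\<dots> \<le> ?t ^ (m - n)" by (intro power_mono) auto
    finally show ?thesis unfolding e l using False by simp
  qed
qed

text \<open>Each mass is recovered as a squared norm term divided by the squared weight. The bound
  is phrased with \<tau> so that it matches the assumption of \<open>lnorm_kernel\<close>.\<close>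

lemma Qs_bound:
  assumes s: "- 1 / 2 < s" "s < 0"
    and \<tau>: "\<And>m. ennreal (decay s ^ ((n - m) + (m - n))) * (ennreal (dw s m) * epowr (D m) (1/2)) \<le> \<tau>"
  shows "ennreal (2 powr (2 * s * n) * 2 ^ n) * Qs D n \<le> ennreal (2 / (1 - decay s)) * \<tau>\<^sup>2"
proof -
  note x = decay_bounds[OF s]
  let ?x = "decay s"
  let ?d = "\<lambda>m. (n - m) + (m - n)"
  have "ennreal (2 powr (2 * s * n) * 2 ^ n) * Qs D n = (\<Sum>m. ennreal (2 powr (2 * s * n) * 2 ^ n) * (D m * ennreal (1 / (2 ^ m + 2 ^ n))))"
    by (simp add: Qs_def)
  also have "\<dots> \<le> (\<Sum>m. ennreal (?x ^ ?d m) * \<tau>\<^sup>2)"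
  proof (intro suminf_le)
    fix m
    let ?a = "ennreal (dw s m) * epowr (D m) (1/2)"
    have w: "0 < dw s m" by (rule dw_bounds[OF s])
    have Dm: "D m = ennreal (1 / (dw s m)\<^sup>2) * ?a\<^sup>2"
    proof -
      have "ennreal (1 / (dw s m)\<^sup>2) * ?a\<^sup>2 = (ennreal (1 / (dw s m)\<^sup>2) * ennreal ((dw s m)\<^sup>2)) * D m"
        using w by (simp add: power_mult_distrib sq_epowr_half ennreal_power mult.assoc)
      also have "ennreal (1 / (dw s m)\<^sup>2) * ennreal ((dw s m)\<^sup>2) = 1"
        using w by (simp add: ennreal_mult[symmetric])
      finally show ?thesis by simp
    qed
    have w2: "1 / (dw s m)\<^sup>2 \<le> 2 powr (- (2 * s * m))"
    proof -
      have "2 powr (2 * s * m) = (2 powr (s * m))\<^sup>2" by (simp add: power2_eq_square powr_add[symmetric] algebra_simps)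
      also have "\<dots> \<le> (dw s m)\<^sup>2" by (intro power_mono dw_bounds[OF s]) simp
      finally show ?thesis using w by (simp add: powr_minus field_simps)
    qed
    have "ennreal (2 powr (2 * s * n) * 2 ^ n) * (D m * ennreal (1 / (2 ^ m + 2 ^ n)))
       = ennreal (2 powr (2 * s * n) * 2 ^ n * ((1 / (dw s m)\<^sup>2) * (1 / (2 ^ m + 2 ^ n)))) * ?a\<^sup>2"
    proof -
      have "ennreal A * (ennreal B * X * ennreal C) = ennreal (A * (B * C)) * X" if "0 \<le> A" "0 \<le> B" "0 \<le> C" for A B C X
        using that by (simp add: ennreal_mult mult_ac)
      then show ?thesis by (subst Dm) simp
    qed
    also have "\<dots> \<le> ennreal (?x ^ (4 * ?d m)) * ?a\<^sup>2"
    proof (intro mult_right_mono ennreal_leI)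
      have "2 powr (2 * s * n) * 2 ^ n * ((1 / (dw s m)\<^sup>2) * (1 / (2 ^ m + 2 ^ n)))
         \<le> 2 powr (2 * s * n) * 2 ^ n * (2 powr (- (2 * s * m)) * (1 / (2 ^ m + 2 ^ n)))"
        by (intro mult_left_mono mult_right_mono w2) auto
      also have "\<dots> \<le> ?x ^ (4 * ?d m)" by (rule kernel_decay[OF s])
      finally show "2 powr (2 * s * n) * 2 ^ n * ((1 / (dw s m)\<^sup>2) * (1 / (2 ^ m + 2 ^ n))) \<le> ?x ^ (4 * ?d m)" .
    qed simp
    \<comment> \<open>The decay is shared out: two factors go into the square, where the assumption
      on \<tau> applies; of the remaining two, one is kept for the summation over
      \<open>m\<close>.\<close>
    also have "ennreal (?x ^ (4 * ?d m)) = ennreal (?x ^ (2 * ?d m)) * (ennreal (?x ^ ?d m))\<^sup>2"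
      using x by (simp add: ennreal_power ennreal_mult[symmetric] power_mult[symmetric] power_add[symmetric] mult.commute[of _ 2])
    also have "\<dots> * ?a\<^sup>2 = ennreal (?x ^ (2 * ?d m)) * (ennreal (?x ^ ?d m) * ?a)\<^sup>2"
      by (simp add: power_mult_distrib mult.assoc)
    also have "\<dots> \<le> ennreal (?x ^ ?d m) * \<tau>\<^sup>2"
      by (intro mult_mono power_mono \<tau> ennreal_leI power_decreasing) (use x in auto)
    finally show "ennreal (2 powr (2 * s * n) * 2 ^ n) * (D m * ennreal (1 / (2 ^ m + 2 ^ n))) \<le> ennreal (?x ^ ?d m) * \<tau>\<^sup>2" .
  qed auto
  also have "\<dots> = (\<Sum>m. ennreal (?x ^ ?d m)) * \<tau>\<^sup>2" by (rule ennreal_suminf_multc)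
  also have "\<dots> \<le> ennreal (2 / (1 - ?x)) * \<tau>\<^sup>2"
    by (intro mult_right_mono geometric_two_sided) (use x in auto)
  finally show ?thesis .
qed

text \<open>\<open>Qs_bound\<close> with the whole norm as \<tau>. It gives \<open>Qs D n\<close>
  the decay 2^(-(1+2s) n), the source of smallness at high thresholds, and it also serves the blocks
  below the threshold.\<close>

lemma Qs_bound_norm:
  assumes s: "- 1 / 2 < s" "s < 0" and r: "1 \<le> r"
  shows "ennreal (2 ^ n) * Qs D n \<le> ennreal (2 powr (- (2 * s * n)) * (2 / (1 - decay s))) * (bnorm s r D)\<^sup>2"
proof -
  note x = decay_bounds[OF s]
  have "ennreal (decay s ^ ((n - m) + (m - n))) * (ennreal (dw s m) * epowr (D m) (1/2)) \<le> 1 * bnorm s r D" for m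
    unfolding bnorm_def using x lnorm_ge[OF r, of "\<lambda>m. ennreal (dw s m) * epowr (D m) (1/2)" m]
    by (intro mult_mono) (auto simp: power_le_one)
  then have "ennreal (2 powr (2 * s * n) * 2 ^ n) * Qs D n \<le> ennreal (2 / (1 - decay s)) * (bnorm s r D)\<^sup>2"
    by (intro Qs_bound[OF s]) simp
  then have "ennreal (2 powr (- (2 * s * n))) * (ennreal (2 powr (2 * s * n) * 2 ^ n) * Qs D n)
      \<le> ennreal (2 powr (- (2 * s * n))) * (ennreal (2 / (1 - decay s)) * (bnorm s r D)\<^sup>2)"
    by (rule mult_left_mono) simp
  also have "ennreal (2 powr (- (2 * s * n))) * (ennreal (2 powr (2 * s * n) * 2 ^ n) * Qs D n) = ennreal (2 ^ n) * Qs D n"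
    by (simp add: mult.assoc[symmetric] ennreal_mult[symmetric] powr_minus)
  also have "ennreal (2 powr (- (2 * s * n))) * (ennreal (2 / (1 - decay s)) * (bnorm s r D)\<^sup>2)
      = ennreal (2 powr (- (2 * s * n)) * (2 / (1 - decay s))) * (bnorm s r D)\<^sup>2"
    using x by (subst ennreal_mult) (auto simp: mult.assoc)
  finally show ?thesis .
qed

lemma le_of_sq_le:
  assumes "x\<^sup>2 \<le> ennreal c * y\<^sup>2" "0 \<le> c"
  shows "x \<le> ennreal (sqrt c) * y"
proof -
  have "epowr (x\<^sup>2) (1/2) \<le> epowr (ennreal c * y\<^sup>2) (1/2)" by (rule epowr_mono[OF assms(1)]) simp
  then show ?thesis using assms(2) by (simp add: epowr_half_sq epowr_mult epowr_ennreal powr_half_sqrt)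
qed

text \<open>For n \<ge> J the hypothesis is used on the diagonal i = n and leads to
  \<open>Qs_bound\<close>. For n < J the best available choice is i = J, where 2^n + 2^J \<le> 2
  2^J; relative to the norm this costs 2^(-s J) and leaves the summable factor 2^(s n).\<close>

lemma bnorm_propagation:
  assumes s: "- 1 / 2 < s" "s < 0" and r: "1 \<le> r"
    and H: "\<And>n i. J \<le> i \<Longrightarrow> D1 n \<le> ennreal (8 * (2 ^ n + 2 ^ i)) * Qs D0 i"
  shows "bnorm s r D1 \<le> ennreal (sqrt (128 / (1 - decay s)) * (2 / (1 - decay s) + 1 / (1 - 2 powr s))) * (ennreal (2 powr (- (s * J))) * bnorm s r D0)"
  unfolding bnorm_def
proof (rule lnorm_kernel[OF r, where J = J])
  note x = decay_bounds[OF s]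
  let ?a = "\<lambda>n. ennreal (dw s n) * epowr (D0 n) (1/2)"
  let ?b = "\<lambda>n. ennreal (dw s n) * epowr (D1 n) (1/2)"
  have bsq: "(?b n)\<^sup>2 \<le> ennreal (4 * 2 powr (2 * s * n)) * D1 n" for n
  proof -
    have "(?b n)\<^sup>2 = ennreal ((dw s n)\<^sup>2) * D1 n"
      using dw_bounds(1)[OF s, of n] by (simp add: power_mult_distrib sq_epowr_half ennreal_power)
    also have "(dw s n)\<^sup>2 \<le> (2 * 2 powr (s * n))\<^sup>2"
      using dw_bounds(1,2)[OF s, of n] by (intro power_mono) auto
    also have "(2 * 2 powr (s * n))\<^sup>2 = 4 * 2 powr (2 * s * n)"
      by (simp add: power2_eq_square powr_add[symmetric] algebra_simps)
    finally show ?thesis by (simp add: mult_right_mono ennreal_leI)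
  qed
  show "0 < decay s" "decay s < 1" by (rule x)+
  show "0 < 2 powr s" "2 powr s < 1" using s by (auto simp: powr_less_one)
  show "0 \<le> sqrt (128 / (1 - decay s))" using x by simp
  show "1 \<le> 2 powr (- (s * J))" using s by (intro ge_one_powr_ge_zero) (auto simp: mult_nonpos_nonneg)
  fix n
  show "?b n \<le> ennreal (sqrt (128 / (1 - decay s))) * \<tau>"
    if n: "J \<le> n" and t: "\<And>m. ennreal (decay s ^ ((n - m) + (m - n))) * ?a m \<le> \<tau>" for \<tau>
  proof (rule le_of_sq_le)
    have "(?b n)\<^sup>2 \<le> ennreal (4 * 2 powr (2 * s * n)) * (ennreal (8 * (2 ^ n + 2 ^ n)) * Qs D0 n)"
      by (rule order.trans[OF bsq]) (intro mult_left_mono H n, simp)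
    also have "\<dots> = ennreal 64 * (ennreal (2 powr (2 * s * n) * 2 ^ n) * Qs D0 n)"
      by (simp add: mult.assoc[symmetric] ennreal_mult[symmetric] del: ennreal_numeral)
    also have "\<dots> \<le> ennreal 64 * (ennreal (2 / (1 - decay s)) * \<tau>\<^sup>2)"
      by (intro mult_left_mono Qs_bound[OF s t]) simp
    also have "\<dots> = ennreal (128 / (1 - decay s)) * \<tau>\<^sup>2"
      using x by (simp add: mult.assoc[symmetric] ennreal_mult[symmetric] del: ennreal_numeral)
    finally show "(?b n)\<^sup>2 \<le> ennreal (128 / (1 - decay s)) * \<tau>\<^sup>2" .
    show "0 \<le> 128 / (1 - decay s)" using x by simp
  qed
  show "?b n \<le> ennreal (sqrt (128 / (1 - decay s))) * (ennreal ((2 powr s) ^ n) * (ennreal (2 powr (- (s * J))) * lnorm r ?a))"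
    if n: "n < J"
  proof (rule le_of_sq_le)
    have p: "(2 powr s) ^ n = 2 powr (s * n)" by (simp add: powr_powr flip: powr_realpow)
    have "(?b n)\<^sup>2 \<le> ennreal (4 * 2 powr (2 * s * n)) * (ennreal (8 * (2 ^ n + 2 ^ J)) * Qs D0 J)"
      by (rule order.trans[OF bsq]) (intro mult_left_mono H, auto)
    also have "\<dots> \<le> ennreal (4 * 2 powr (2 * s * n)) * (ennreal (16 * 2 ^ J) * Qs D0 J)"
      using n by (intro mult_left_mono mult_right_mono ennreal_leI) (auto intro!: power_increasing)
    also have "\<dots> = ennreal (64 * 2 powr (2 * s * n)) * (ennreal (2 ^ J) * Qs D0 J)"
      by (simp add: mult.assoc[symmetric] ennreal_mult[symmetric] del: ennreal_numeral)
    also have "\<dots> \<le> ennreal (64 * 2 powr (2 * s * n)) * (ennreal (2 powr (- (2 * s * J)) * (2 / (1 - decay s))) * (lnorm r ?a)\<^sup>2)"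
      using Qs_bound_norm[OF s r, of J D0] unfolding bnorm_def by (intro mult_left_mono) auto
    also have "\<dots> = ennreal (64 * 2 powr (2 * s * n) * (2 powr (- (2 * s * J)) * (2 / (1 - decay s)))) * (lnorm r ?a)\<^sup>2"
      using x by (subst ennreal_mult) (auto simp: mult.assoc)
    also have "64 * 2 powr (2 * s * n) * (2 powr (- (2 * s * J)) * (2 / (1 - decay s)))
       = 128 / (1 - decay s) * (((2 powr s) ^ n)\<^sup>2 * (2 powr (- (s * J)))\<^sup>2)"
    proof -
      have "2 powr (2 * s * n) = (2 powr (s * n))\<^sup>2" "2 powr (- (2 * s * J)) = (2 powr (- (s * J)))\<^sup>2"
        by (simp_all add: power2_eq_square powr_add[symmetric] algebra_simps)
      then show ?thesis unfolding p by simp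
    qed
    also have "ennreal \<dots> * (lnorm r ?a)\<^sup>2 = ennreal (128 / (1 - decay s)) * (ennreal ((2 powr s) ^ n) * (ennreal (2 powr (- (s * J))) * lnorm r ?a))\<^sup>2"
      using x by (subst ennreal_mult, simp, simp, subst ennreal_mult, simp, simp)
        (simp add: power_mult_distrib ennreal_power mult.assoc)
    finally show "(?b n)\<^sup>2 \<le> ennreal (128 / (1 - decay s)) * (ennreal ((2 powr s) ^ n) * (ennreal (2 powr (- (s * J))) * lnorm r ?a))\<^sup>2" .
    show "0 \<le> 128 / (1 - decay s)" using x by simp
  qed
qed


text \<open>The frequency threshold \<open>2 ^ J\<close> is chosen just large enough for the smallness hypothesis to hold.\<close>

lemma threshold_exists:
  fixes G \<alpha> s :: real
  assumes s: "- 1 / 2 < s" "s < 0" and G: "1 \<le> G" and \<alpha>: "0 \<le> \<alpha>"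
  shows "\<exists>J::nat. G * \<alpha>\<^sup>2 * (2 powr (- (1 + 2 * s))) ^ J \<le> 1 \<and>
    2 powr (- (s * J)) \<le> 2 * G powr (1 / (1 + 2 * s)) * (1 + \<alpha> powr (2 / (1 + 2 * s))) powr (- s)"
proof -
  define b where "b = 1 + 2 * s"
  have b: "0 < b" using s by (simp add: b_def)
  define g where "g = G powr (1 / b)"
  have g: "1 \<le> g" unfolding g_def using G b by (intro ge_one_powr_ge_zero) auto
  \<comment> \<open>The threshold 2^J will lie between M and 2 M. The power 2/b makes M^b at least G
    \<alpha>^2, and the summand 1 ensures M \<ge> 1, so that the logarithm is nonnegative.\<close>
  define M where "M = g * (1 + \<alpha> powr (2 / b))"
  have M: "1 \<le> M" unfolding M_def using g mult_mono[of 1 g 1 "1 + \<alpha> powr (2 / b)"] by simp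
  define J where "J = nat \<lceil>log 2 M\<rceil>"
  have l0: "0 \<le> log 2 M" using M by simp
  have J1: "log 2 M \<le> real J" and J2: "real J \<le> log 2 M + 1"
    using l0 by (auto simp: J_def)
  have MJ: "M \<le> 2 powr real J" using J1 M by (subst log_le_iff[symmetric]) auto
  have JM: "2 powr real J \<le> 2 * M"
  proof -
    have "2 powr real J \<le> 2 powr (log 2 M + 1)" using J2 by (intro powr_mono) auto
    also have "\<dots> = 2 * M" using M by (simp add: powr_add)
    finally show ?thesis .
  qed
  have Mb: "G * \<alpha>\<^sup>2 \<le> M powr b"
  proof -
    have "G * \<alpha>\<^sup>2 = (g * \<alpha> powr (2 / b)) powr b"
    proof (cases "\<alpha> = 0")
      case True then show ?thesis by simp
    next
      case False
      then have "\<alpha> > 0" using \<alpha> by simp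
      then show ?thesis using b G unfolding g_def by (simp add: powr_mult powr_powr powr_numeral)
    qed
    also have "\<dots> \<le> M powr b" unfolding M_def using g b by (intro powr_mono2 mult_left_mono) auto
    finally show ?thesis .
  qed
  have "G * \<alpha>\<^sup>2 * (2 powr (- b)) ^ J \<le> 1"
  proof -
    have e: "(2 powr (- b)) ^ J = (2 powr real J) powr (- b)"
      by (simp add: powr_powr mult.commute flip: powr_realpow)
    have "(2 powr real J) powr (- b) \<le> M powr (- b)"
      using MJ M b by (intro powr_mono2') auto
    then have "G * \<alpha>\<^sup>2 * (2 powr (- b)) ^ J \<le> M powr b * M powr (- b)"
      unfolding e using Mb G by (intro mult_mono) auto
    also have "\<dots> = 1" using M by (simp add: powr_add[symmetric])
    finally show ?thesis .
  qed
  moreover have "2 powr (- (s * J)) \<le> 2 * g * (1 + \<alpha> powr (2 / b)) powr (- s)"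
  proof -
    have "2 powr (- (s * J)) = (2 powr real J) powr (- s)" by (simp add: powr_powr mult.commute)
    also have "\<dots> \<le> (2 * M) powr (- s)" using JM s by (intro powr_mono2) auto
    also have "\<dots> = (2 * g) powr (- s) * (1 + \<alpha> powr (2 / b)) powr (- s)"
      unfolding M_def using g by (simp add: powr_mult mult.assoc)
    \<comment> \<open>As 2 g \<ge> 1 and -s \<le> 1, the exponent may be raised to 1.\<close>
    also have "\<dots> \<le> (2 * g) powr 1 * (1 + \<alpha> powr (2 / b)) powr (- s)"
      using s g by (intro mult_right_mono powr_mono) auto
    finally show ?thesis using g by simp
  qed
  ultimately show ?thesis unfolding g_def b_def by blast
qed

text \<open>A statement about two mass sequences only: the flow enters through the implication from
  smallness of \<open>D0\<close> beyond \<open>J\<close> to control of \<open>D1\<close>. The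
  constant therefore depends on \<open>s\<close> and not on the domain or the solution.\<close>

lemma besov_growth:
  assumes s: "- 1 / 2 < s" "s < 0" and r: "1 \<le> r"
  shows "\<exists>K::real. 0 < K \<and> (\<forall>D0 D1. (\<forall>J. (\<Sum>j. 2 * Qs D0 (j + J)) \<le> ennreal (1/512) \<longrightarrow>
      (\<forall>n i. J \<le> i \<longrightarrow> D1 n \<le> ennreal (8 * (2 ^ n + 2 ^ i)) * Qs D0 i)) \<longrightarrow>
    bnorm s r D1 \<le> ennreal K * (epowr (1 + epowr (bnorm s r D0) (2 / (1 + 2 * s))) (- s) * bnorm s r D0))"
proof -
  note x = decay_bounds[OF s]
  define y where "y = 2 powr (- (1 + 2 * s))"
  have y: "0 < y" "y < 1" using s by (auto simp: y_def powr_less_one)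
  define c where "c = 2 / (1 - decay s)"
  have c: "1 \<le> c" using x by (auto simp: c_def field_simps)
  \<comment> \<open>Beyond J the series of \<open>2 * Qs\<close> is at most 2 c \<alpha>^2 y^J / (1
    - y); multiplying by 512 gives the number that \<open>threshold_exists\<close> must push below
    1.\<close>
  define G where "G = 1024 * c / (1 - y)"
  have G: "1 \<le> G" unfolding G_def using c y by (simp add: field_simps)
  define C where "C = sqrt (128 / (1 - decay s)) * (c + 1 / (1 - 2 powr s))"
  define K where "K = C * (2 * G powr (1 / (1 + 2 * s)))"
  have y2: "2 powr s < 1" using s by (auto simp: powr_less_one)
  have C: "0 < C" unfolding C_def using c x y2 by (intro mult_pos_pos add_pos_pos) auto
  have K: "0 < K" unfolding K_def using C G by (intro mult_pos_pos) auto
  have s1: "0 < - s" "0 < 2 / (1 + 2 * s)" using s by auto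
  show ?thesis
  proof (intro exI[of _ K] conjI K allI impI)
    fix D0 D1 :: "nat \<Rightarrow> ennreal"
    assume H: "\<forall>J. (\<Sum>j. 2 * Qs D0 (j + J)) \<le> ennreal (1/512) \<longrightarrow>
      (\<forall>n i. J \<le> i \<longrightarrow> D1 n \<le> ennreal (8 * (2 ^ n + 2 ^ i)) * Qs D0 i)"
    let ?A = "bnorm s r D0"
    show "bnorm s r D1 \<le> ennreal K * (epowr (1 + epowr ?A (2 / (1 + 2 * s))) (- s) * ?A)"
    proof (cases ?A)
      case top
      then have "ennreal K * (epowr (1 + epowr ?A (2 / (1 + 2 * s))) (- s) * ?A) = \<infinity>"
        using K epowr_top[OF s1(1)] epowr_top[OF s1(2)] by (simp add: ennreal_mult_top)
      then show ?thesis by simp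
    next
      case (real \<alpha>)
      obtain J :: nat where J: "G * \<alpha>\<^sup>2 * y ^ J \<le> 1"
        "2 powr (- (s * J)) \<le> 2 * G powr (1 / (1 + 2 * s)) * (1 + \<alpha> powr (2 / (1 + 2 * s))) powr (- s)"
        using threshold_exists[OF s G real(1)] unfolding y_def by blast
      have Qb: "Qs D0 i \<le> ennreal (c * \<alpha>\<^sup>2 * y ^ i)" for i
      proof -
        have "ennreal (2 ^ i) * Qs D0 i \<le> ennreal (2 powr (- (2 * s * i)) * c) * ?A\<^sup>2"
          unfolding c_def by (rule Qs_bound_norm[OF s r])
        also have "\<dots> = ennreal (2 powr (- (2 * s * i)) * c * \<alpha>\<^sup>2)"
          unfolding real(2) using c real(1) by (simp add: ennreal_power ennreal_mult[symmetric])
        finally have "ennreal (1 / 2 ^ i) * (ennreal (2 ^ i) * Qs D0 i) \<le> ennreal (1 / 2 ^ i) * ennreal (2 powr (- (2 * s * i)) * c * \<alpha>\<^sup>2)"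
          by (rule mult_left_mono) simp
        also have "ennreal (1 / 2 ^ i) * (ennreal (2 ^ i) * Qs D0 i) = Qs D0 i"
          by (simp add: mult.assoc[symmetric] ennreal_mult[symmetric])
        also have "ennreal (1 / 2 ^ i) * ennreal (2 powr (- (2 * s * i)) * c * \<alpha>\<^sup>2) = ennreal (1 / 2 ^ i * (2 powr (- (2 * s * i)) * c * \<alpha>\<^sup>2))"
          using c by (intro ennreal_mult[symmetric]) auto
        also have "1 / 2 ^ i * (2 powr (- (2 * s * i)) * c * \<alpha>\<^sup>2) = c * \<alpha>\<^sup>2 * y ^ i"
        proof -
          have "y ^ i = 2 powr (- (2 * s * i)) * 2 powr (- real i)"
            by (simp add: y_def powr_powr powr_add[symmetric] algebra_simps flip: powr_realpow)
          also have "2 powr (- real i) = 1 / 2 ^ i" by (simp add: powr_minus powr_realpow divide_inverse)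
          finally show ?thesis by simp
        qed
        finally show ?thesis .
      qed
      have "(\<Sum>j. 2 * Qs D0 (j + J)) \<le> (\<Sum>j. ennreal (2 * c * \<alpha>\<^sup>2 * y ^ J * y ^ j))"
      proof (intro suminf_le)
        fix j
        have "2 * Qs D0 (j + J) \<le> ennreal 2 * ennreal (c * \<alpha>\<^sup>2 * y ^ (j + J))"
          using mult_left_mono[OF Qb[of "j + J"], of 2] by simp
        also have "\<dots> = ennreal (2 * (c * \<alpha>\<^sup>2 * y ^ (j + J)))"
          using c y by (intro ennreal_mult[symmetric]) auto
        finally show "2 * Qs D0 (j + J) \<le> ennreal (2 * c * \<alpha>\<^sup>2 * y ^ J * y ^ j)" by (simp add: power_add mult_ac)
      qed auto
      also have "\<dots> = ennreal (\<Sum>j. 2 * c * \<alpha>\<^sup>2 * y ^ J * y ^ j)"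
        using c y by (intro suminf_ennreal2) (auto intro!: summable_mult summable_geometric)
      also have "(\<Sum>j. 2 * c * \<alpha>\<^sup>2 * y ^ J * y ^ j) = 2 * c * \<alpha>\<^sup>2 * y ^ J * (1 / (1 - y))"
        using y by (subst suminf_mult) (auto simp: suminf_geometric summable_geometric)
      also have "\<dots> = G * \<alpha>\<^sup>2 * y ^ J / 512" unfolding G_def using y by (simp add: field_simps)
      also have "ennreal (G * \<alpha>\<^sup>2 * y ^ J / 512) \<le> ennreal (1/512)" using J(1) by (intro ennreal_leI) simp
      finally have "(\<Sum>j. 2 * Qs D0 (j + J)) \<le> ennreal (1/512)" .
      then have "bnorm s r D1 \<le> ennreal C * (ennreal (2 powr (- (s * J))) * ?A)"
        unfolding C_def c_def using H by (intro bnorm_propagation[OF s r]) auto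
      also have "\<dots> \<le> ennreal C * (ennreal (2 * G powr (1 / (1 + 2 * s)) * (1 + \<alpha> powr (2 / (1 + 2 * s))) powr (- s)) * ?A)"
        by (intro mult_left_mono mult_right_mono ennreal_leI J(2)) auto
      also have "\<dots> = ennreal K * (ennreal ((1 + \<alpha> powr (2 / (1 + 2 * s))) powr (- s)) * ?A)"
        unfolding K_def using C G by (simp add: ennreal_mult mult.assoc)
      also have "ennreal ((1 + \<alpha> powr (2 / (1 + 2 * s))) powr (- s)) = epowr (1 + epowr ?A (2 / (1 + 2 * s))) (- s)"
      proof -
        have e: "1 + epowr ?A (2 / (1 + 2 * s)) = ennreal (1 + \<alpha> powr (2 / (1 + 2 * s)))"
          unfolding real(2) using real(1) s1 by (simp add: epowr_ennreal)
        show ?thesis unfolding e using s1 by (subst epowr_ennreal) auto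
      qed
      finally show ?thesis .
    qed
  qed
qed

section \<open>Fourier synthesis\<close>

lemma cis_lipschitz: "cmod (cis a - cis b) \<le> \<bar>a - b\<bar>"
proof -
  have "cis a - cis b = cis b * (cis (a - b) - 1)"
    by (simp add: right_diff_distrib cis_mult)
  then have "cmod (cis a - cis b) = cmod (cis (a - b) - 1)"
    by (simp add: norm_mult)
  also have "\<dots> \<le> \<bar>a - b\<bar>"
    using iexp_approx1[of "a - b" 0] by (simp add: cis_conv_exp)
  finally show ?thesis .
qed

lemma has_vector_derivative_quotient:
  fixes f :: "real \<Rightarrow> complex"
  shows "(f has_vector_derivative D) (at x) \<longleftrightarrow> ((\<lambda>h. (f (x + h) - f x) / of_real h) \<longlongrightarrow> D) (at 0)"
proof -
  have "(f has_vector_derivative D) (at x) \<longleftrightarrow> ((\<lambda>h. cmod (f (x + h) - f x - h *\<^sub>R D) / \<bar>h\<bar>) \<longlongrightarrow> 0) (at 0)"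
    by (simp add: has_vector_derivative_def has_derivative_at bounded_linear_scaleR_left)
  also have "\<dots> \<longleftrightarrow> ((\<lambda>h. cmod ((f (x + h) - f x) / of_real h - D)) \<longlongrightarrow> 0) (at 0)"
  proof (rule Lim_cong_within[OF refl refl refl])
    fix h :: real assume "h \<noteq> 0"
    then have "(f (x + h) - f x) / of_real h - D = (f (x + h) - f x - h *\<^sub>R D) / of_real h"
      by (simp add: scaleR_conv_of_real diff_divide_distrib)
    then show "cmod (f (x + h) - f x - h *\<^sub>R D) / \<bar>h\<bar> = cmod ((f (x + h) - f x) / of_real h - D)"
      by (simp add: norm_divide)
  qed
  also have "\<dots> \<longleftrightarrow> ((\<lambda>h. (f (x + h) - f x) / of_real h - D) \<longlongrightarrow> 0) (at 0)"
    by (rule tendsto_norm_zero_iff)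
  also have "\<dots> \<longleftrightarrow> ((\<lambda>h. (f (x + h) - f x) / of_real h) \<longlongrightarrow> D) (at 0)"
    by (rule Lim_null[symmetric])
  finally show ?thesis .
qed

lemma cis_mult_has_vector_derivative:
  "((\<lambda>y. cis (y * w)) has_vector_derivative \<i> * of_real w * cis (x * w)) (at x)"
proof -
  have "((\<lambda>z. exp (\<i> * (z * of_real w))) has_field_derivative \<i> * of_real w * exp (\<i> * (of_real x * of_real w))) (at (of_real x))"
    by (auto intro!: derivative_eq_intros)
  from has_vector_derivative_real_field[OF this] show ?thesis by (simp add: cis_conv_exp)
qed

context freq_space
begin

definition synth :: "('a \<Rightarrow> complex) \<Rightarrow> real \<Rightarrow> complex" where
  "synth u x = (\<integral>\<xi>. u \<xi> * cis (x * \<omega> \<xi>) \<partial>\<mu>)"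

lemma synth_integrable:
  assumes u: "integrable \<mu> u"
  shows "integrable \<mu> (\<lambda>\<xi>. u \<xi> * cis (x * \<omega> \<xi>))"
proof (rule Bochner_Integration.integrable_bound[OF u])
  have [measurable]: "u \<in> borel_measurable \<mu>" using u by simp
  show "(\<lambda>\<xi>. u \<xi> * cis (x * \<omega> \<xi>)) \<in> borel_measurable \<mu>"
    unfolding cis_conv_exp by measurable
qed (simp add: norm_mult)

lemma synth_continuous:
  assumes u: "integrable \<mu> u"
  shows "continuous_on UNIV (synth u)"
proof -
  have [measurable]: "u \<in> borel_measurable \<mu>" using u by simp
  have "(synth u \<circ> f) \<longlonglongrightarrow> synth u x" if "f \<longlonglongrightarrow> x" for f x
    unfolding synth_def comp_def
  proof (rule integral_dominated_convergence[where w = "\<lambda>\<xi>. cmod (u \<xi>)"])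
    show "integrable \<mu> (\<lambda>\<xi>. cmod (u \<xi>))" using u by simp
    show "AE \<xi> in \<mu>. (\<lambda>i. u \<xi> * cis (f i * \<omega> \<xi>)) \<longlonglongrightarrow> u \<xi> * cis (x * \<omega> \<xi>)"
      using that by (auto intro!: tendsto_intros)
  qed (use synth_integrable[OF u] in \<open>auto simp: norm_mult\<close>)
  then show ?thesis
    by (auto simp: continuous_on_sequentially comp_def)
qed

text \<open>Differentiation under the integral: \<open>cis\<close> is 1-Lipschitz, so all difference
  quotients are dominated by the modulus of \<open>Dw u\<close>.\<close>

lemma synth_derivative:
  assumes u: "integrable \<mu> u" and Du: "integrable \<mu> (Dw u)"
  shows "(synth u has_vector_derivative synth (Dw u) x) (at x)"
proof -
  have [measurable]: "u \<in> borel_measurable \<mu>" using u by simp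
  let ?q = "\<lambda>h \<xi>. u \<xi> * ((cis ((x + h) * \<omega> \<xi>) - cis (x * \<omega> \<xi>)) / of_real h)"
  have "((\<lambda>h. (synth u (x + h) - synth u x) / of_real h) \<longlongrightarrow> synth (Dw u) x) (at 0)"
  proof (subst tendsto_at_iff_sequentially, intro allI impI)
    fix f :: "nat \<Rightarrow> real" assume f: "\<forall>i. f i \<in> UNIV - {0}" "f \<longlonglongrightarrow> 0"
    then have nz: "f i \<noteq> 0" for i by auto
    have lim: "(\<lambda>i. \<integral>\<xi>. ?q (f i) \<xi> \<partial>\<mu>) \<longlonglongrightarrow> (\<integral>\<xi>. Dw u \<xi> * cis (x * \<omega> \<xi>) \<partial>\<mu>)"
    proof (rule integral_dominated_convergence[where w = "\<lambda>\<xi>. cmod (Dw u \<xi>)"])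
      show "integrable \<mu> (\<lambda>\<xi>. cmod (Dw u \<xi>))" using Du by simp
      show "(\<lambda>\<xi>. Dw u \<xi> * cis (x * \<omega> \<xi>)) \<in> borel_measurable \<mu>"
        using synth_integrable[OF Du] by simp
      show "?q (f i) \<in> borel_measurable \<mu>" for i
        unfolding cis_conv_exp by measurable
      show "AE \<xi> in \<mu>. cmod (?q (f i) \<xi>) \<le> cmod (Dw u \<xi>)" for i
      proof (rule AE_I2)
        fix \<xi>
        have "cmod (cis ((x + f i) * \<omega> \<xi>) - cis (x * \<omega> \<xi>)) \<le> \<bar>f i * \<omega> \<xi>\<bar>"
          using cis_lipschitz[of "(x + f i) * \<omega> \<xi>" "x * \<omega> \<xi>"] by (simp add: algebra_simps)
        then have "cmod ((cis ((x + f i) * \<omega> \<xi>) - cis (x * \<omega> \<xi>)) / of_real (f i)) \<le> \<bar>\<omega> \<xi>\<bar>"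
          using nz[of i] by (simp add: norm_divide abs_mult divide_le_eq mult.commute)
        then show "cmod (?q (f i) \<xi>) \<le> cmod (Dw u \<xi>)"
          using mult_left_mono[of _ "\<bar>\<omega> \<xi>\<bar>" "cmod (u \<xi>)"] unfolding norm_mult Dw_def
          by (simp add: mult.commute[of "\<bar>\<omega> \<xi>\<bar>"])
      qed
      show "AE \<xi> in \<mu>. (\<lambda>i. ?q (f i) \<xi>) \<longlonglongrightarrow> Dw u \<xi> * cis (x * \<omega> \<xi>)"
      proof (rule AE_I2)
        fix \<xi>
        have "((\<lambda>h. (cis ((x + h) * \<omega> \<xi>) - cis (x * \<omega> \<xi>)) / of_real h) \<longlongrightarrow> \<i> * of_real (\<omega> \<xi>) * cis (x * \<omega> \<xi>)) (at 0)"
          using cis_mult_has_vector_derivative[of "\<omega> \<xi>" x] by (simp add: has_vector_derivative_quotient)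
        then have "((\<lambda>i. (cis ((x + f i) * \<omega> \<xi>) - cis (x * \<omega> \<xi>)) / of_real (f i)) \<longlonglongrightarrow> \<i> * of_real (\<omega> \<xi>) * cis (x * \<omega> \<xi>))"
          using f unfolding tendsto_at_iff_sequentially comp_def by blast
        then have "(\<lambda>i. ?q (f i) \<xi>) \<longlonglongrightarrow> u \<xi> * (\<i> * of_real (\<omega> \<xi>) * cis (x * \<omega> \<xi>))"
          by (intro tendsto_intros)
        then show "(\<lambda>i. ?q (f i) \<xi>) \<longlonglongrightarrow> Dw u \<xi> * cis (x * \<omega> \<xi>)" by (simp add: Dw_def mult_ac)
      qed
    qed
    have eqs: "(synth u (x + f i) - synth u x) / of_real (f i) = (\<integral>\<xi>. ?q (f i) \<xi> \<partial>\<mu>)" for i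
      unfolding synth_def
      by (subst Bochner_Integration.integral_diff[symmetric], (rule synth_integrable[OF u])+, subst integral_divide_zero[symmetric])
        (simp add: algebra_simps diff_divide_distrib)
    then show "((\<lambda>h. (synth u (x + h) - synth u x) / of_real h) \<circ> f) \<longlonglongrightarrow> synth (Dw u) x"
      unfolding comp_def eqs using lim by (simp only: synth_def)
  qed
  then show ?thesis
    by (simp add: has_vector_derivative_quotient)
qed

text \<open>The exponential is a character, so it splits over \<xi> - \<eta> and \<eta>; Fubini and
  translation invariance do the rest.\<close>

lemma synth_conv:
  assumes u: "integrable \<mu> u" and v: "integrable \<mu> v"
  shows "synth u x * synth v x = synth (conv u v) x"
proof -
  have [measurable]: "u \<in> borel_measurable \<mu>" "v \<in> borel_measurable \<mu>" using u v by auto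
  let ?u = "\<lambda>\<xi>. u \<xi> * cis (x * \<omega> \<xi>)" and ?v = "\<lambda>\<xi>. v \<xi> * cis (x * \<omega> \<xi>)"
  have iu: "integrable \<mu> ?u" and iv: "integrable \<mu> ?v" using u v by (auto intro: synth_integrable)
  have [measurable]: "?u \<in> borel_measurable \<mu>" using iu by simp
  have "synth (conv u v) x = (\<integral>\<xi>. \<integral>\<eta>. ?u (\<xi> - \<eta>) * ?v \<eta> \<partial>\<mu> \<partial>\<mu>)"
    unfolding synth_def conv_def
  proof (rule Bochner_Integration.integral_cong[OF refl])
    fix \<xi>
    have "(\<integral>\<eta>. u (\<xi> - \<eta>) * v \<eta> \<partial>\<mu>) * cis (x * \<omega> \<xi>) = (\<integral>\<eta>. u (\<xi> - \<eta>) * v \<eta> * cis (x * \<omega> \<xi>) \<partial>\<mu>)"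
      by (rule integral_mult_left_zero[symmetric])
    also have "\<dots> = (\<integral>\<eta>. ?u (\<xi> - \<eta>) * ?v \<eta> \<partial>\<mu>)"
    proof (rule Bochner_Integration.integral_cong[OF refl])
      fix \<eta>
      have "cis (x * \<omega> \<xi>) = cis (x * \<omega> (\<xi> - \<eta>)) * cis (x * \<omega> \<eta>)"
        by (simp add: cis_mult algebra_simps)
      then show "u (\<xi> - \<eta>) * v \<eta> * cis (x * \<omega> \<xi>) = ?u (\<xi> - \<eta>) * ?v \<eta>" by simp
    qed
    finally show "(\<integral>\<eta>. u (\<xi> - \<eta>) * v \<eta> \<partial>\<mu>) * cis (x * \<omega> \<xi>) = (\<integral>\<eta>. ?u (\<xi> - \<eta>) * ?v \<eta> \<partial>\<mu>)" .
  qed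
  also have "\<dots> = (\<integral>\<eta>. \<integral>\<xi>. ?u (\<xi> - \<eta>) * ?v \<eta> \<partial>\<mu> \<partial>\<mu>)"
    by (rule P.Fubini_integral[symmetric]) (use conv_pair_integrable[OF iu iv] in \<open>simp add: case_prod_unfold\<close>)
  also have "\<dots> = (\<integral>\<eta>. (\<integral>\<xi>. ?u \<xi> \<partial>\<mu>) * ?v \<eta> \<partial>\<mu>)"
  proof (rule Bochner_Integration.integral_cong[OF refl])
    fix \<eta>
    have "(\<integral>\<xi>. ?u (\<xi> - \<eta>) * ?v \<eta> \<partial>\<mu>) = (\<integral>\<xi>. ?u (\<xi> - \<eta>) \<partial>\<mu>) * ?v \<eta>" by (rule integral_mult_left_zero)
    also have "(\<integral>\<xi>. ?u (\<xi> - \<eta>) \<partial>\<mu>) = (\<integral>\<xi>. ?u \<xi> \<partial>\<mu>)"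
      using integral_shift[of ?u "- \<eta>"] by simp
    finally show "(\<integral>\<xi>. ?u (\<xi> - \<eta>) * ?v \<eta> \<partial>\<mu>) = (\<integral>\<xi>. ?u \<xi> \<partial>\<mu>) * ?v \<eta>" .
  qed
  also have "\<dots> = synth u x * synth v x" by (simp add: synth_def)
  finally show ?thesis by simp
qed

lemma synth_real:
  assumes [measurable]: "u \<in> borel_measurable \<mu>" and h: "reflect u = u"
  shows "synth u x = of_real (Re (synth u x))"
proof -
  have uh: "u (- y) = cnj (u y)" for y using h by (metis complex_cnj_cnj reflect_def)
  have "cnj (synth u x) = (\<integral>\<xi>. u (- \<xi>) * cis (x * \<omega> (- \<xi>)) \<partial>\<mu>)"
    unfolding synth_def integral_cnj'[symmetric] by (simp add: uh cis_cnj)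
  also have "\<dots> = synth u x"
    unfolding synth_def by (rule integral_reflect[of "\<lambda>\<xi>. u \<xi> * cis (x * \<omega> \<xi>)"]) (unfold cis_conv_exp, measurable)
  finally show ?thesis by (metis Reals_cnj_iff of_real_Re)
qed

lemma synth_cong_AE:
  assumes "u \<in> borel_measurable \<mu>" "v \<in> borel_measurable \<mu>" "AE x in \<mu>. u x = v x"
  shows "synth u x = synth v x"
  unfolding synth_def
  by (rule integral_cong_AE) (use assms in \<open>auto simp: cis_conv_exp elim!: eventually_mono\<close>)

end

section \<open>The Fourier transform on the line\<close>

lemma cis_measurable [measurable (raw)]:
  "f \<in> borel_measurable M \<Longrightarrow> (\<lambda>x. cis (f x)) \<in> borel_measurable M"
  unfolding cis_conv_exp by measurable

lemma integrable_mult_bounded: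
  fixes f g :: "'a \<Rightarrow> complex"
  assumes f: "integrable M f" and [measurable]: "g \<in> borel_measurable M" and b: "\<And>x. cmod (g x) \<le> c"
  shows "integrable M (\<lambda>x. f x * g x)"
proof (rule Bochner_Integration.integrable_bound)
  show "integrable M (\<lambda>x. of_real c * f x)" using f by simp
  show "(\<lambda>x. f x * g x) \<in> borel_measurable M" using f by measurable
  have "cmod (f x * g x) \<le> cmod (of_real c * f x)" for x
    using mult_right_mono[OF b[of x], of "cmod (f x)"] order.trans[OF norm_ge_zero b[of x]]
    by (simp add: norm_mult mult.commute)
  then show "AE x in M. cmod (f x * g x) \<le> cmod (of_real c * f x)" by simp
qed

lemma (in pair_sigma_finite) prod_integrable:
  fixes f :: "'a \<Rightarrow> complex" and g :: "'b \<Rightarrow> complex"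
  assumes f: "integrable M1 f" and g: "integrable M2 g"
  shows "integrable (M1 \<Otimes>\<^sub>M M2) (\<lambda>p. f (fst p) * g (snd p))"
proof -
  have [measurable]: "f \<in> borel_measurable M1" "g \<in> borel_measurable M2" using f g by auto
  have "(\<integral>\<^sup>+p. ennreal (cmod (f (fst p) * g (snd p))) \<partial>(M1 \<Otimes>\<^sub>M M2))
     = (\<integral>\<^sup>+x. \<integral>\<^sup>+y. ennreal (cmod (f x)) * ennreal (cmod (g y)) \<partial>M2 \<partial>M1)"
    by (subst M2.nn_integral_fst[symmetric]) (auto simp: norm_mult ennreal_mult)
  also have "\<dots> = (\<integral>\<^sup>+x. ennreal (cmod (f x)) \<partial>M1) * (\<integral>\<^sup>+y. ennreal (cmod (g y)) \<partial>M2)"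
    by (simp add: nn_integral_cmult nn_integral_multc)
  also have "\<dots> < \<infinity>" using f g by (auto simp: integrable_iff_bounded ennreal_mult_less_top)
  finally show ?thesis by (subst integrable_iff_bounded) auto
qed

lemma cnj_mult_self: "cnj z * z = of_real ((cmod z)\<^sup>2)"
  by (metis complex_norm_square mult.commute of_real_power)

definition ft :: "(real \<Rightarrow> complex) \<Rightarrow> real \<Rightarrow> complex" where
  "ft f \<xi> = of_real (1 / sqrt (2 * pi)) * (\<integral>x. cis (- (x * \<xi>)) * f x \<partial>lborel)"

lemma ft_measurable[measurable]:
  assumes [measurable]: "f \<in> borel_measurable borel"
  shows "ft f \<in> borel_measurable borel"
  unfolding ft_def[abs_def] by measurable

lemma ft_bound:
  assumes f: "integrable lborel f"
  shows "cmod (ft f \<xi>) \<le> 1 / sqrt (2 * pi) * (\<integral>x. cmod (f x) \<partial>lborel)"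
proof -
  have "cmod (\<integral>x. cis (- (x * \<xi>)) * f x \<partial>lborel) \<le> (\<integral>x. cmod (cis (- (x * \<xi>)) * f x) \<partial>lborel)"
    by (rule integral_norm_bound)
  then show ?thesis unfolding ft_def norm_mult norm_of_real by (simp add: norm_mult divide_right_mono)
qed

lemma ft_integrand:
  assumes f: "integrable lborel f"
  shows "integrable lborel (\<lambda>x. cis (- (x * \<xi>)) * f x)"
  using integrable_mult_bounded[OF f, of "\<lambda>x. cis (- (x * \<xi>))" 1] by (simp add: mult.commute)

text \<open>Fubini, as the exponential is symmetric in the two variables. All transfers between the
  two sides of the transform go through this formula.\<close>

lemma ft_multiplication:
  assumes f: "integrable lborel f" and h: "integrable lborel h"
  shows "(\<integral>\<xi>. h \<xi> * ft f \<xi> \<partial>lborel) = (\<integral>x. ft h x * f x \<partial>lborel)"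
proof -
  have [measurable]: "f \<in> borel_measurable lborel" "h \<in> borel_measurable lborel" using f h by auto
  let ?F = "\<lambda>\<xi> x. h \<xi> * f x * cis (- (x * \<xi>))"
  have i: "integrable (lborel \<Otimes>\<^sub>M lborel) (\<lambda>p. ?F (fst p) (snd p))"
    by (rule integrable_mult_bounded[OF lborel_pair.prod_integrable[OF h f], where c = 1]) auto
  have 1: "h \<xi> * ft f \<xi> = of_real (1 / sqrt (2 * pi)) * (\<integral>x. ?F \<xi> x \<partial>lborel)" for \<xi>
    unfolding ft_def by (simp add: mult_ac flip: integral_mult_right_zero)
  have 2: "ft h x * f x = of_real (1 / sqrt (2 * pi)) * (\<integral>\<xi>. ?F \<xi> x \<partial>lborel)" for x
    unfolding ft_def by (simp add: mult_ac flip: integral_mult_left_zero integral_mult_right_zero)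
  show ?thesis
    unfolding 1 2 integral_mult_right_zero
    using lborel_pair.Fubini_integral[of ?F] i by (simp add: case_prod_unfold)
qed

abbreviation gs :: "real \<Rightarrow> real" where "gs \<equiv> std_normal_density"

text \<open>The one explicit transform required is read off from the characteristic function of the
  standard normal law.\<close>

lemma gauss_char: "(\<integral>z. of_real (gs z) * cis (t * z) \<partial>lborel) = of_real (exp (- (t\<^sup>2) / 2))"
proof -
  have "char std_normal_distribution t = of_real (exp (- (t\<^sup>2) / 2))"
    by (simp add: char_std_normal_distribution)
  also have "char std_normal_distribution t = (\<integral>z. of_real (gs z) * cis (t * z) \<partial>lborel)"
    unfolding char_def
    by (subst integral_density) (auto simp: cis_conv_exp scaleR_conv_of_real normal_density_nonneg)
  finally show ?thesis by simp
qed

lemma gs_def': "gs z = exp (- (z\<^sup>2) / 2) / sqrt (2 * pi)"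
  by (simp add: std_normal_density_def)

lemma gauss_ft:
  assumes d: "0 < \<delta>"
  shows "(\<integral>\<xi>. of_real (exp (- ((\<delta> * \<xi>)\<^sup>2) / 2)) * cis (- (w * \<xi>)) \<partial>lborel) = of_real (2 * pi / \<delta> * gs (w / \<delta>))"
proof -
  let ?f = "\<lambda>z. of_real (gs z) * cis ((- w / \<delta>) * z)"
  have e: "exp (- ((w / \<delta>)\<^sup>2) / 2) = sqrt (2 * pi) * gs (w / \<delta>)" by (simp add: gs_def')
  have "of_real (sqrt (2 * pi) * gs (w / \<delta>)) = (\<integral>z. ?f z \<partial>lborel)"
    unfolding gauss_char e[symmetric] by (simp add: power_divide)
  also have "\<dots> = \<bar>\<delta>\<bar> *\<^sub>R (\<integral>\<xi>. ?f (0 + \<delta> * \<xi>) \<partial>lborel)"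
    by (rule lborel_integral_real_affine) (use d in simp)
  also have "(\<integral>\<xi>. ?f (0 + \<delta> * \<xi>) \<partial>lborel) = (\<integral>\<xi>. of_real (1 / sqrt (2 * pi)) * (of_real (exp (- ((\<delta> * \<xi>)\<^sup>2) / 2)) * cis (- (w * \<xi>))) \<partial>lborel)"
    using d by (simp add: gs_def' mult_ac)
  also have "\<dots> = of_real (1 / sqrt (2 * pi)) * (\<integral>\<xi>. of_real (exp (- ((\<delta> * \<xi>)\<^sup>2) / 2)) * cis (- (w * \<xi>)) \<partial>lborel)"
    by (rule integral_mult_right_zero)
  finally have a: "of_real (sqrt (2 * pi) * gs (w / \<delta>)) = of_real (\<delta> / sqrt (2 * pi)) * (\<integral>\<xi>. of_real (exp (- ((\<delta> * \<xi>)\<^sup>2) / 2)) * cis (- (w * \<xi>)) \<partial>lborel)"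
    using d by (simp add: scaleR_conv_of_real)
  have "of_real (2 * pi / \<delta> * gs (w / \<delta>)) = of_real (sqrt (2 * pi) / \<delta>) * (of_real (sqrt (2 * pi) * gs (w / \<delta>)) :: complex)"
  proof -
    have "2 * pi / \<delta> * gs (w / \<delta>) = (sqrt (2 * pi) * sqrt (2 * pi)) / \<delta> * gs (w / \<delta>)" by simp
    also have "\<dots> = sqrt (2 * pi) / \<delta> * (sqrt (2 * pi) * gs (w / \<delta>))" by (simp only: divide_inverse mult_ac)
    finally show ?thesis unfolding of_real_mult[symmetric] by (rule arg_cong)
  qed
  also have "\<dots> = (of_real (sqrt (2 * pi) / \<delta>) * of_real (\<delta> / sqrt (2 * pi))) * (\<integral>\<xi>. of_real (exp (- ((\<delta> * \<xi>)\<^sup>2) / 2)) * cis (- (w * \<xi>)) \<partial>lborel)"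
    unfolding a by (simp only: mult.assoc)
  also have "of_real (sqrt (2 * pi) / \<delta>) * of_real (\<delta> / sqrt (2 * pi)) = (1::complex)"
    unfolding of_real_mult[symmetric] using d by simp
  finally show ?thesis by simp
qed

lemma gauss_integrable:
  assumes d: "0 < \<delta>"
  shows "integrable lborel (\<lambda>\<xi>. of_real (exp (- ((\<delta> * \<xi>)\<^sup>2) / 2)) :: complex)"
proof -
  have "integrable lborel (\<lambda>\<xi>. gs (0 + \<delta> * \<xi>))"
    by (rule lborel_integrable_real_affine) (use d in auto)
  then have "integrable lborel (\<lambda>\<xi>. of_real (sqrt (2 * pi) * gs (0 + \<delta> * \<xi>)) :: complex)"
    by (intro integrable_of_real integrable_mult_right)
  then show ?thesis by (simp add: gs_def')
qed

lemma gs_integrable: "integrable lborel (\<lambda>z. of_real (gs z) :: complex)"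
  by (intro integrable_of_real) auto

text \<open>The Gaussian factor makes the double integral absolutely convergent. After Fubini the
  frequency integral is a rescaled Gaussian, so inversion up to \<delta> is averaging over a normal
  variable of standard deviation \<delta>.\<close>

lemma ft_gauss_weight:
  assumes g: "integrable lborel g" and d: "0 < \<delta>"
  shows "ft (\<lambda>\<xi>. of_real (exp (- ((\<delta> * \<xi>)\<^sup>2) / 2)) * cnj (ft g \<xi>)) x = (\<integral>z. cnj (g (x - \<delta> * z)) * of_real (gs z) \<partial>lborel)"
proof -
  have [measurable]: "g \<in> borel_measurable lborel" using g by auto
  let ?c = "of_real (1 / sqrt (2 * pi)) :: complex"
  let ?e = "\<lambda>\<xi>. of_real (exp (- ((\<delta> * \<xi>)\<^sup>2) / 2)) :: complex"
  have cc: "cnj (ft g \<xi>) = ?c * (\<integral>y. cis (y * \<xi>) * cnj (g y) \<partial>lborel)" for \<xi>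
    unfolding ft_def by (simp add: cis_cnj flip: integral_cnj')
  let ?F = "\<lambda>\<xi> y. ?e \<xi> * cnj (g y) * cis (- ((x - y) * \<xi>))"
  have i: "integrable (lborel \<Otimes>\<^sub>M lborel) (\<lambda>p. ?F (fst p) (snd p))"
    by (rule integrable_mult_bounded[OF lborel_pair.prod_integrable[OF gauss_integrable[OF d]], where c = 1 and g = "\<lambda>p. cis (- ((x - snd p) * fst p))"])
      (use g in auto)
  have "ft (\<lambda>\<xi>. ?e \<xi> * cnj (ft g \<xi>)) x = ?c * (\<integral>\<xi>. ?c * (\<integral>y. ?F \<xi> y \<partial>lborel) \<partial>lborel)"
  proof -
    have "cis (- (\<xi> * x)) * (?e \<xi> * cnj (ft g \<xi>)) = ?c * (\<integral>y. ?F \<xi> y \<partial>lborel)" for \<xi>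
    proof -
      have "cis (- (\<xi> * x)) * (?e \<xi> * cnj (ft g \<xi>)) = ?c * ((cis (- (\<xi> * x)) * ?e \<xi>) * (\<integral>y. cis (y * \<xi>) * cnj (g y) \<partial>lborel))"
        unfolding cc by (simp only: mult_ac)
      also have "(cis (- (\<xi> * x)) * ?e \<xi>) * (\<integral>y. cis (y * \<xi>) * cnj (g y) \<partial>lborel) = (\<integral>y. (cis (- (\<xi> * x)) * ?e \<xi>) * (cis (y * \<xi>) * cnj (g y)) \<partial>lborel)"
        by (rule integral_mult_right_zero[symmetric])
      also have "\<dots> = (\<integral>y. ?F \<xi> y \<partial>lborel)"
      proof (rule Bochner_Integration.integral_cong[OF refl])
        fix y
        have "cis (- ((x - y) * \<xi>)) = cis (- (\<xi> * x)) * cis (y * \<xi>)" by (simp add: cis_mult algebra_simps)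
        then show "(cis (- (\<xi> * x)) * ?e \<xi>) * (cis (y * \<xi>) * cnj (g y)) = ?F \<xi> y" by (simp only: mult_ac)
      qed
      finally show ?thesis .
    qed
    then show ?thesis unfolding ft_def[of _ x] by simp
  qed
  also have "\<dots> = ?c * ?c * (\<integral>\<xi>. \<integral>y. ?F \<xi> y \<partial>lborel \<partial>lborel)"
    by (simp only: integral_mult_right_zero mult.assoc)
  also have "(\<integral>\<xi>. \<integral>y. ?F \<xi> y \<partial>lborel \<partial>lborel) = (\<integral>y. \<integral>\<xi>. ?F \<xi> y \<partial>lborel \<partial>lborel)"
    using lborel_pair.Fubini_integral[of ?F] i by (simp add: case_prod_unfold)
  also have "\<dots> = (\<integral>y. cnj (g y) * of_real (2 * pi / \<delta> * gs ((x - y) / \<delta>)) \<partial>lborel)"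
  proof (rule Bochner_Integration.integral_cong[OF refl])
    fix y
    have "(\<integral>\<xi>. ?F \<xi> y \<partial>lborel) = (\<integral>\<xi>. cnj (g y) * (?e \<xi> * cis (- ((x - y) * \<xi>))) \<partial>lborel)" by (simp only: mult_ac)
    also have "\<dots> = cnj (g y) * (\<integral>\<xi>. ?e \<xi> * cis (- ((x - y) * \<xi>)) \<partial>lborel)" by (rule integral_mult_right_zero)
    finally show "(\<integral>\<xi>. ?F \<xi> y \<partial>lborel) = cnj (g y) * of_real (2 * pi / \<delta> * gs ((x - y) / \<delta>))" unfolding gauss_ft[OF d] .
  qed
  also have "\<dots> = \<bar>- \<delta>\<bar> *\<^sub>R (\<integral>z. cnj (g (x + - \<delta> * z)) * of_real (2 * pi / \<delta> * gs ((x - (x + - \<delta> * z)) / \<delta>)) \<partial>lborel)"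
    by (rule lborel_integral_real_affine) (use d in simp)
  also have "\<dots> = of_real \<delta> * (\<integral>z. of_real (2 * pi / \<delta>) * (cnj (g (x - \<delta> * z)) * of_real (gs z)) \<partial>lborel)"
    using d by (simp add: scaleR_conv_of_real mult_ac)
  also have "\<dots> = of_real (2 * pi) * (\<integral>z. cnj (g (x - \<delta> * z)) * of_real (gs z) \<partial>lborel)"
  proof -
    have "of_real \<delta> * of_real (2 * pi / \<delta>) = (of_real (2 * pi) :: complex)"
      unfolding of_real_mult[symmetric] using d by simp
    then show ?thesis
      by (subst integral_mult_right_zero) (simp only: mult.assoc[symmetric])
  qed
  also have "?c * ?c * \<dots> = (\<integral>z. cnj (g (x - \<delta> * z)) * of_real (gs z) \<partial>lborel)"
    unfolding mult.assoc[symmetric] of_real_mult[symmetric] by simp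
  finally show ?thesis .
qed

lemma ft_polar:
  assumes f: "integrable lborel f" and g: "integrable lborel g" and d: "0 < \<delta>"
  shows "(\<integral>\<xi>. of_real (exp (- ((\<delta> * \<xi>)\<^sup>2) / 2)) * cnj (ft g \<xi>) * ft f \<xi> \<partial>lborel)
     = (\<integral>x. (\<integral>z. cnj (g (x - \<delta> * z)) * of_real (gs z) \<partial>lborel) * f x \<partial>lborel)"
proof -
  have [measurable]: "g \<in> borel_measurable borel" using g by auto
  have h: "integrable lborel (\<lambda>\<xi>. of_real (exp (- ((\<delta> * \<xi>)\<^sup>2) / 2)) * cnj (ft g \<xi>))"
    by (rule integrable_mult_bounded[OF gauss_integrable[OF d]]) (use ft_bound[OF g] in auto)
  show ?thesis using ft_multiplication[OF f h] unfolding ft_gauss_weight[OF g d] .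
qed

lemma nn_shift_product:
  fixes f :: "real \<Rightarrow> complex"
  assumes f: "sq lborel f"
  shows "(\<integral>\<^sup>+x. ennreal (cmod (f x) * cmod (f (x - a))) \<partial>lborel) \<le> ennreal ((nm lborel f)\<^sup>2)"
proof -
  have [measurable]: "f \<in> borel_measurable borel" using f by (auto simp: sq_def)
  have "(\<integral>\<^sup>+x. ennreal ((cmod (f (x - a)))\<^sup>2) \<partial>lborel) = (\<integral>\<^sup>+x. ennreal ((cmod (f x))\<^sup>2) \<partial>lborel)"
    using nn_integral_real_affine[of "\<lambda>x. ennreal ((cmod (f x))\<^sup>2)" 1 "- a"] by simp
  then have "(\<integral>\<^sup>+x. ennreal (cmod (f x) * cmod (f (x - a))) \<partial>lborel)\<^sup>2 \<le> (ennreal ((nm lborel f)\<^sup>2))\<^sup>2"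
    using nn_Cauchy_Schwarz[of "\<lambda>x. cmod (f x)" lborel "\<lambda>x. cmod (f (x - a))"]
    unfolding sq_nn_eq[OF f] power2_eq_square[of "ennreal ((nm lborel f)\<^sup>2)"] by simp
  then have "epowr ((\<integral>\<^sup>+x. ennreal (cmod (f x) * cmod (f (x - a))) \<partial>lborel)\<^sup>2) (1/2) \<le> epowr ((ennreal ((nm lborel f)\<^sup>2))\<^sup>2) (1/2)"
    by (rule epowr_mono) simp
  then show ?thesis by (simp add: epowr_half_sq)
qed

text \<open>The inequality half of Plancherel. With the Gaussian inserted, \<open>ft_polar\<close>
  rewrites the integral as an average of correlations of \<open>f\<close> with its translates, each
  at most the squared norm; Fatou then removes the Gaussian.\<close>

lemma ft_bessel:
  assumes f: "integrable lborel f" and s: "sq lborel f"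
  shows "sq lborel (ft f)" "nm lborel (ft f) \<le> nm lborel f"
proof -
  have [measurable]: "f \<in> borel_measurable borel" using f by auto
  let ?e = "\<lambda>n \<xi>. exp (- ((1 / Suc n * \<xi>)\<^sup>2) / 2)"
  have b: "(\<integral>\<^sup>+\<xi>. ennreal (?e n \<xi> * (cmod (ft f \<xi>))\<^sup>2) \<partial>lborel) \<le> ennreal ((nm lborel f)\<^sup>2)" for n
  proof -
    let ?d = "1 / real (Suc n)"
    have d: "0 < ?d" by simp
    have h: "integrable lborel (\<lambda>\<xi>. of_real (?e n \<xi>) * (cnj (ft f \<xi>) * ft f \<xi>))"
    proof (rule integrable_mult_bounded[OF gauss_integrable[OF d], where c = "(1 / sqrt (2 * pi) * (\<integral>x. cmod (f x) \<partial>lborel))\<^sup>2"])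
      show "cmod (cnj (ft f \<xi>) * ft f \<xi>) \<le> (1 / sqrt (2 * pi) * (\<integral>x. cmod (f x) \<partial>lborel))\<^sup>2" for \<xi>
        using power_mono[OF ft_bound[OF f, of \<xi>], of 2] by (simp add: norm_mult power2_eq_square)
    qed measurable
    have e: "of_real (?e n \<xi>) * (cnj (ft f \<xi>) * ft f \<xi>) = of_real (?e n \<xi> * (cmod (ft f \<xi>))\<^sup>2)" for \<xi>
      by (simp only: cnj_mult_self of_real_mult)
    have h2: "integrable lborel (\<lambda>\<xi>. ?e n \<xi> * (cmod (ft f \<xi>))\<^sup>2)"
      using integrable_Re[OF h] unfolding e Re_complex_of_real .
    have "of_real (\<integral>\<xi>. ?e n \<xi> * (cmod (ft f \<xi>))\<^sup>2 \<partial>lborel) = (\<integral>\<xi>. of_real (?e n \<xi>) * cnj (ft f \<xi>) * ft f \<xi> \<partial>lborel)"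
      unfolding integral_complex_of_real[symmetric] e[symmetric] by (simp add: mult.assoc)
    also have "\<dots> = (\<integral>x. (\<integral>z. cnj (f (x - ?d * z)) * of_real (gs z) \<partial>lborel) * f x \<partial>lborel)"
      by (rule ft_polar[OF f f d])
    finally have eq: "of_real (\<integral>\<xi>. ?e n \<xi> * (cmod (ft f \<xi>))\<^sup>2 \<partial>lborel) = (\<integral>x. (\<integral>z. cnj (f (x - ?d * z)) * of_real (gs z) \<partial>lborel) * f x \<partial>lborel)" .
    have "(\<integral>\<^sup>+\<xi>. ennreal (?e n \<xi> * (cmod (ft f \<xi>))\<^sup>2) \<partial>lborel) = ennreal (\<integral>\<xi>. ?e n \<xi> * (cmod (ft f \<xi>))\<^sup>2 \<partial>lborel)"
      by (rule nn_integral_eq_integral[OF h2]) simp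
    also have "\<dots> \<le> ennreal (cmod (of_real (\<integral>\<xi>. ?e n \<xi> * (cmod (ft f \<xi>))\<^sup>2 \<partial>lborel)))"
      unfolding norm_of_real by (rule ennreal_leI) simp
    also have "\<dots> \<le> (\<integral>\<^sup>+x. ennreal (cmod ((\<integral>z. cnj (f (x - ?d * z)) * of_real (gs z) \<partial>lborel) * f x)) \<partial>lborel)"
      unfolding eq by (rule cmod_integral_le_nn)
    also have "\<dots> \<le> (\<integral>\<^sup>+x. \<integral>\<^sup>+z. ennreal (cmod (f x) * cmod (f (x - ?d * z))) * ennreal (gs z) \<partial>lborel \<partial>lborel)"
    proof (rule nn_integral_mono)
      fix x
      have "ennreal (cmod ((\<integral>z. cnj (f (x - ?d * z)) * of_real (gs z) \<partial>lborel) * f x))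
        = ennreal (cmod (\<integral>z. cnj (f (x - ?d * z)) * of_real (gs z) \<partial>lborel)) * ennreal (cmod (f x))"
        by (simp add: norm_mult ennreal_mult)
      also have "\<dots> \<le> (\<integral>\<^sup>+z. ennreal (cmod (cnj (f (x - ?d * z)) * of_real (gs z))) \<partial>lborel) * ennreal (cmod (f x))"
        by (intro mult_right_mono cmod_integral_le_nn) simp
      also have "\<dots> = (\<integral>\<^sup>+z. ennreal (cmod (f x) * cmod (f (x - ?d * z))) * ennreal (gs z) \<partial>lborel)"
        by (subst nn_integral_multc[symmetric], measurable)
          (simp add: norm_mult normal_density_nonneg ennreal_mult[symmetric] mult_ac)
      finally show "ennreal (cmod ((\<integral>z. cnj (f (x - ?d * z)) * of_real (gs z) \<partial>lborel) * f x))
         \<le> (\<integral>\<^sup>+z. ennreal (cmod (f x) * cmod (f (x - ?d * z))) * ennreal (gs z) \<partial>lborel)" .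
    qed
    also have "\<dots> = (\<integral>\<^sup>+z. \<integral>\<^sup>+x. ennreal (cmod (f x) * cmod (f (x - ?d * z))) * ennreal (gs z) \<partial>lborel \<partial>lborel)"
      by (rule lborel_pair.Fubini') measurable
    also have "\<dots> = (\<integral>\<^sup>+z. (\<integral>\<^sup>+x. ennreal (cmod (f x) * cmod (f (x - ?d * z))) \<partial>lborel) * ennreal (gs z) \<partial>lborel)"
      by (intro nn_integral_cong nn_integral_multc) measurable
    also have "\<dots> \<le> (\<integral>\<^sup>+z. ennreal ((nm lborel f)\<^sup>2) * ennreal (gs z) \<partial>lborel)"
      by (intro nn_integral_mono mult_right_mono nn_shift_product[OF s]) simp
    also have "\<dots> = ennreal ((nm lborel f)\<^sup>2) * (\<integral>\<^sup>+z. ennreal (gs z) \<partial>lborel)"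
      by (rule nn_integral_cmult) measurable
    also have "(\<integral>\<^sup>+z. ennreal (gs z) \<partial>lborel) = 1"
      by (subst nn_integral_eq_integral) (auto simp: normal_density_nonneg)
    finally show ?thesis by simp
  qed
  have lim: "(\<lambda>n. ?e n \<xi> * (cmod (ft f \<xi>))\<^sup>2) \<longlonglongrightarrow> (cmod (ft f \<xi>))\<^sup>2" for \<xi>
  proof -
    have "(\<lambda>n. exp (- ((1 / real (Suc n) * \<xi>)\<^sup>2) / 2) * (cmod (ft f \<xi>))\<^sup>2) \<longlonglongrightarrow> exp (- ((0 * \<xi>)\<^sup>2) / 2) * (cmod (ft f \<xi>))\<^sup>2"
      by (intro tendsto_intros LIMSEQ_Suc[OF lim_1_over_n]) simp
    then show ?thesis by simp
  qed
  have "(\<integral>\<^sup>+\<xi>. ennreal ((cmod (ft f \<xi>))\<^sup>2) \<partial>lborel) = (\<integral>\<^sup>+\<xi>. liminf (\<lambda>n. ennreal (?e n \<xi> * (cmod (ft f \<xi>))\<^sup>2)) \<partial>lborel)"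
    by (intro nn_integral_cong lim_imp_Liminf[symmetric] tendsto_ennrealI lim) simp
  also have "\<dots> \<le> liminf (\<lambda>n. \<integral>\<^sup>+\<xi>. ennreal (?e n \<xi> * (cmod (ft f \<xi>))\<^sup>2) \<partial>lborel)"
    by (rule nn_integral_liminf) measurable
  also have "\<dots> \<le> ennreal ((nm lborel f)\<^sup>2)"
    by (rule order.trans[OF Liminf_mono[of _ "\<lambda>_. ennreal ((nm lborel f)\<^sup>2)"]]) (use b in \<open>auto simp: Liminf_const\<close>)
  finally have F: "(\<integral>\<^sup>+\<xi>. ennreal ((cmod (ft f \<xi>))\<^sup>2) \<partial>lborel) \<le> ennreal ((nm lborel f)\<^sup>2)" .
  have m: "ft f \<in> borel_measurable lborel" by measurable
  show "sq lborel (ft f)" "nm lborel (ft f) \<le> nm lborel f"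
    by (rule nm_le_nn[OF m F], simp)+
qed

text \<open>Both sides arise as limits of \<open>ft_polar\<close> as the Gaussian disappears: on the
  left \<open>ft_bessel\<close> supplies the majorant, on the right the averaged indicator stays
  below 1. Indicators of intervals suffice as test functions, since they separate functions up to
  null sets.\<close>

lemma ft_parseval_interval:
  assumes f: "integrable lborel f" and s: "sq lborel f"
  shows "(\<integral>\<xi>. cnj (ft (\<lambda>x. indicator {a<..b} x) \<xi>) * ft f \<xi> \<partial>lborel) = (\<integral>x. indicator {a<..b} x * f x \<partial>lborel)"
proof (rule LIMSEQ_unique)
  let ?g = "\<lambda>x. indicator {a<..b} x :: complex"
  have [measurable]: "f \<in> borel_measurable borel" using f by auto
  have g: "integrable lborel ?g"
  proof -
    have "emeasure lborel {a<..b} \<le> emeasure lborel {a..b}" by (rule emeasure_mono) auto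
    also have "\<dots> < \<infinity>" by (simp add: emeasure_lborel_Icc_eq)
    finally have "integrable lborel (\<lambda>x. of_real (indicator {a<..b} x) :: complex)"
      by (intro integrable_of_real integrable_real_indicator) auto
    moreover have "(\<lambda>x. of_real (indicator {a<..b} x)) = ?g" by (auto simp: indicator_def)
    ultimately show ?thesis by simp
  qed
  have gs': "sq lborel ?g"
  proof -
    have "(cmod (?g x))\<^sup>2 = cmod (?g x)" for x by (simp add: indicator_def)
    then show ?thesis unfolding sq_def using g[THEN integrable_norm] by (simp only:) simp
  qed
  let ?e = "\<lambda>n \<xi>. of_real (exp (- ((1 / real (Suc n) * \<xi>)\<^sup>2) / 2)) :: complex"
  let ?I = "\<lambda>n. \<integral>\<xi>. ?e n \<xi> * cnj (ft ?g \<xi>) * ft f \<xi> \<partial>lborel"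
  have prod: "integrable lborel (\<lambda>\<xi>. cnj (ft ?g \<xi>) * ft f \<xi>)"
    by (rule sq_mult_integrable) (use ft_bessel[OF f s] ft_bessel[OF g gs'] in auto)
  show "?I \<longlonglongrightarrow> (\<integral>\<xi>. cnj (ft ?g \<xi>) * ft f \<xi> \<partial>lborel)"
  proof (rule integral_dominated_convergence[where w = "\<lambda>\<xi>. cmod (cnj (ft ?g \<xi>) * ft f \<xi>)"])
    show "integrable lborel (\<lambda>\<xi>. cmod (cnj (ft ?g \<xi>) * ft f \<xi>))" using prod by (rule integrable_norm)
    show "AE \<xi> in lborel. (\<lambda>n. ?e n \<xi> * cnj (ft ?g \<xi>) * ft f \<xi>) \<longlonglongrightarrow> cnj (ft ?g \<xi>) * ft f \<xi>"
    proof (rule AE_I2)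
      fix \<xi>
      have "(\<lambda>n. of_real (exp (- ((1 / real (Suc n) * \<xi>)\<^sup>2) / 2)) * cnj (ft ?g \<xi>) * ft f \<xi>) \<longlonglongrightarrow> of_real (exp (- ((0 * \<xi>)\<^sup>2) / 2)) * cnj (ft ?g \<xi>) * ft f \<xi>"
        by (intro tendsto_intros LIMSEQ_Suc[OF lim_1_over_n]) simp
      then show "(\<lambda>n. ?e n \<xi> * cnj (ft ?g \<xi>) * ft f \<xi>) \<longlonglongrightarrow> cnj (ft ?g \<xi>) * ft f \<xi>" by simp
    qed
    show "AE \<xi> in lborel. cmod (?e n \<xi> * cnj (ft ?g \<xi>) * ft f \<xi>) \<le> cmod (cnj (ft ?g \<xi>) * ft f \<xi>)" for n
      by (auto simp: norm_mult mult.assoc intro!: mult_left_le_one_le)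
  qed measurable
  have e: "?I n = (\<integral>x. (\<integral>z. cnj (?g (x - 1 / real (Suc n) * z)) * of_real (gs z) \<partial>lborel) * f x \<partial>lborel)" for n
    by (rule ft_polar[OF f g]) simp
  have gs1: "(\<integral>z. of_real (gs z) \<partial>lborel) = (1 :: complex)"
    unfolding integral_complex_of_real by simp
  show "?I \<longlonglongrightarrow> (\<integral>x. ?g x * f x \<partial>lborel)"
    unfolding e
  proof (rule integral_dominated_convergence[where w = "\<lambda>x. cmod (f x)"])
    show "integrable lborel (\<lambda>x. cmod (f x))" using f by simp
    have inner: "cmod (\<integral>z. cnj (?g (x - 1 / real (Suc n) * z)) * of_real (gs z) \<partial>lborel) \<le> 1" for x n
    proof -
      have "cmod (\<integral>z. cnj (?g (x - 1 / real (Suc n) * z)) * of_real (gs z) \<partial>lborel) \<le> (\<integral>z. gs z \<partial>lborel)"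
      proof (rule order.trans[OF integral_norm_bound], rule integral_mono)
        show "integrable lborel (\<lambda>z. cmod (cnj (?g (x - 1 / real (Suc n) * z)) * of_real (gs z)))"
          by (rule Bochner_Integration.integrable_bound[OF gs_integrable]) (auto simp: indicator_def norm_mult)
      qed (auto simp: indicator_def norm_mult normal_density_nonneg)
      then show ?thesis by simp
    qed
    show "AE x in lborel. cmod ((\<integral>z. cnj (?g (x - 1 / real (Suc n) * z)) * of_real (gs z) \<partial>lborel) * f x) \<le> cmod (f x)" for n
      using inner by (auto simp: norm_mult intro!: mult_left_le_one_le)
    \<comment> \<open>At the two endpoints the Gaussian averages need not converge to the
      indicator.\<close>
    have "AE x in lborel. x \<noteq> a \<and> x \<noteq> b"
      using AE_lborel_singleton[of a] AE_lborel_singleton[of b] by eventually_elim auto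
    then show "AE x in lborel. (\<lambda>n. (\<integral>z. cnj (?g (x - 1 / real (Suc n) * z)) * of_real (gs z) \<partial>lborel) * f x) \<longlonglongrightarrow> ?g x * f x"
    proof eventually_elim
      case (elim x)
      have "(\<lambda>n. \<integral>z. cnj (?g (x - 1 / real (Suc n) * z)) * of_real (gs z) \<partial>lborel) \<longlonglongrightarrow> (\<integral>z. ?g x * of_real (gs z) \<partial>lborel)"
      proof (rule integral_dominated_convergence[where w = gs])
        show "AE z in lborel. (\<lambda>n. cnj (?g (x - 1 / real (Suc n) * z)) * of_real (gs z)) \<longlonglongrightarrow> ?g x * of_real (gs z)"
        proof (rule AE_I2)
          fix z
          have l: "(\<lambda>n. x - 1 / real (Suc n) * z) \<longlonglongrightarrow> x - 0 * z"
            by (intro tendsto_intros LIMSEQ_Suc[OF lim_1_over_n])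
          have "\<forall>\<^sub>F n in sequentially. ?g (x - 1 / real (Suc n) * z) = ?g x"
          proof (cases "x \<in> {a<..<b}")
            case True
            have "\<forall>\<^sub>F n in sequentially. x - 1 / real (Suc n) * z \<in> {a<..<b}"
              using l by (rule topological_tendstoD) (use True in auto)
            then show ?thesis by eventually_elim (use True in auto)
          next
            case False
            then have x: "x \<in> - {a..b}" using elim by auto
            have "\<forall>\<^sub>F n in sequentially. x - 1 / real (Suc n) * z \<in> - {a..b}"
              using l by (rule topological_tendstoD) (use x in auto)
            then show ?thesis by eventually_elim (use x in auto)
          qed
          then have "\<forall>\<^sub>F n in sequentially. cnj (?g (x - 1 / real (Suc n) * z)) * of_real (gs z) = ?g x * of_real (gs z)"
            by eventually_elim (simp add: indicator_def)
          then show "(\<lambda>n. cnj (?g (x - 1 / real (Suc n) * z)) * of_real (gs z)) \<longlonglongrightarrow> ?g x * of_real (gs z)"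
            by (rule tendsto_eventually)
        qed
      qed (auto simp: indicator_def norm_mult normal_density_nonneg)
      also have "(\<integral>z. ?g x * of_real (gs z) \<partial>lborel) = ?g x" by (simp add: gs1)
      finally show ?case by (intro tendsto_intros)
    qed
  qed measurable
qed

text \<open>Completeness for rapidly Cauchy sequences. The series of 2^k times the squared
  increments has finite integral, hence is finite almost everywhere, which forces pointwise
  convergence; Fatou upgrades this to convergence in norm.\<close>

lemma sq_complete:
  assumes F: "\<And>k. sq M (F k)" and d: "\<And>k. nm M (\<lambda>x. F (Suc k) x - F k x) \<le> (1/4) ^ k"
  shows "\<exists>g. sq M g \<and> (\<lambda>k. nm M (\<lambda>x. F k x - g x)) \<longlonglongrightarrow> 0"
proof -
  have [measurable]: "F k \<in> borel_measurable M" for k using F[of k] by (simp add: sq_def)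
  let ?d = "\<lambda>k x. F (Suc k) x - F k x"
  have ds: "sq M (?d k)" for k by (rule sq_diff[OF F F])
  have "(\<integral>\<^sup>+x. (\<Sum>k. ennreal (2 ^ k * (cmod (?d k x))\<^sup>2)) \<partial>M) = (\<Sum>k. ennreal (2 ^ k) * (\<integral>\<^sup>+x. ennreal ((cmod (?d k x))\<^sup>2) \<partial>M))"
    by (subst nn_integral_suminf) (auto simp: ennreal_mult nn_integral_cmult)
  also have "\<dots> \<le> (\<Sum>k. ennreal ((1/2) ^ k))"
  proof (intro suminf_le)
    fix k
    have "(nm M (?d k))\<^sup>2 \<le> ((1/4) ^ k)\<^sup>2" using d by (intro power_mono) auto
    then have "2 ^ k * (nm M (?d k))\<^sup>2 \<le> 2 ^ k * ((1/4) ^ k)\<^sup>2" by simp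
    also have "\<dots> = (1/8) ^ k"
      unfolding power2_eq_square power_mult_distrib[symmetric] by simp
    also have "\<dots> \<le> (1/2) ^ k" by (rule power_mono) auto
    finally show "ennreal (2 ^ k) * (\<integral>\<^sup>+x. ennreal ((cmod (?d k x))\<^sup>2) \<partial>M) \<le> ennreal ((1/2) ^ k)"
      unfolding sq_nn_eq[OF ds] by (simp add: ennreal_mult[symmetric] ennreal_leI)
  qed auto
  also have "\<dots> = ennreal (\<Sum>k. (1/2) ^ k)" by (rule suminf_ennreal2) (auto intro!: summable_geometric)
  also have "\<dots> < \<infinity>" by simp
  finally have "AE x in M. (\<Sum>k. ennreal (2 ^ k * (cmod (?d k x))\<^sup>2)) \<noteq> \<infinity>"
    by (intro nn_integral_PInf_AE) auto
  then have conv: "AE x in M. convergent (\<lambda>k. F k x)"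
  proof eventually_elim
    case (elim x)
    have s: "summable (\<lambda>k. 2 ^ k * (cmod (?d k x))\<^sup>2)"
      by (rule summable_suminf_not_top) (use elim in auto)
    \<comment> \<open>With c = 2^k |d|, c \<le> 1 + c^2 divided by 2^k: the increments are dominated
      by two summable sequences.\<close>
    have le: "cmod (?d k x) \<le> (1/2) ^ k + 2 ^ k * (cmod (?d k x))\<^sup>2" for k
    proof -
      have "0 \<le> (1 - 2 ^ k * cmod (?d k x))\<^sup>2" by simp
      then have "2 * (2 ^ k * cmod (?d k x)) \<le> 1 + (2 ^ k * cmod (?d k x))\<^sup>2" by (simp add: power2_diff)
      moreover have "0 \<le> 2 ^ k * cmod (?d k x)" by simp
      ultimately have "2 ^ k * cmod (?d k x) \<le> 1 + (2 ^ k * cmod (?d k x))\<^sup>2" by linarith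
      then have "(1/2) ^ k * (2 ^ k * cmod (?d k x)) \<le> (1/2) ^ k * (1 + (2 ^ k * cmod (?d k x))\<^sup>2)"
        by (rule mult_left_mono) simp
      also have "(1/2) ^ k * (2 ^ k * cmod (?d k x)) = cmod (?d k x)"
        unfolding mult.assoc[symmetric] power_mult_distrib[symmetric] by simp
      also have "(1/2) ^ k * (1 + (2 ^ k * cmod (?d k x))\<^sup>2) = (1/2) ^ k + ((1/2) ^ k * 2 ^ k) * (2 ^ k * (cmod (?d k x))\<^sup>2)"
        by (simp add: power2_eq_square distrib_left mult_ac)
      also have "(1/2) ^ k * 2 ^ k = (1 :: real)" unfolding power_mult_distrib[symmetric] by simp
      finally show ?thesis by simp
    qed
    have "summable (\<lambda>k. ?d k x)"
      by (rule summable_comparison_test[OF _ summable_add[OF summable_geometric[of "1/2"] s]]) (use le in auto)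
    then have "convergent (\<lambda>n. \<Sum>k<n. ?d k x)" by (simp add: summable_iff_convergent)
    then have "convergent (\<lambda>n. F n x - F 0 x)" using sum_lessThan_telescope[of "\<lambda>k. F k x"] by simp
    then show ?case using convergent_add[OF _ convergent_const[of "F 0 x"]] by fastforce
  qed
  define g where "g x = lim (\<lambda>k. F k x)" for x
  have [measurable]: "g \<in> borel_measurable M" unfolding g_def by measurable
  have lim: "AE x in M. (\<lambda>k. F k x) \<longlonglongrightarrow> g x"
    using conv by eventually_elim (simp add: g_def convergent_LIMSEQ_iff)
  have far: "nm M (\<lambda>x. F (k + j) x - F k x) \<le> 4/3 * ((1/4) ^ k - (1/4) ^ (k + j))" for k j
  proof (induction j)
    case 0 then show ?case by (simp add: nm_def)
  next
    case (Suc j)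
    have "nm M (\<lambda>x. F (k + Suc j) x - F k x) = nm M (\<lambda>x. ?d (k + j) x + (F (k + j) x - F k x))" by simp
    also have "\<dots> \<le> nm M (?d (k + j)) + nm M (\<lambda>x. F (k + j) x - F k x)"
      by (intro nm_triangle sq_diff F)
    also have "\<dots> \<le> (1/4) ^ (k + j) + 4/3 * ((1/4) ^ k - (1/4) ^ (k + j))" using Suc d by (intro add_mono) auto
    also have "\<dots> = 4/3 * ((1/4) ^ k - (1/4) ^ (k + Suc j))"
      by (simp add: add_divide_distrib diff_divide_distrib)
    finally show ?case .
  qed
  have far2: "(\<integral>\<^sup>+x. ennreal ((cmod (F k x - g x))\<^sup>2) \<partial>M) \<le> ennreal ((4/3 * (1/4) ^ k)\<^sup>2)" for k
  proof -
    have "(\<integral>\<^sup>+x. ennreal ((cmod (F k x - g x))\<^sup>2) \<partial>M) = (\<integral>\<^sup>+x. liminf (\<lambda>j. ennreal ((cmod (F (k + j) x - F k x))\<^sup>2)) \<partial>M)"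
    proof (rule nn_integral_cong_AE)
      show "AE x in M. ennreal ((cmod (F k x - g x))\<^sup>2) = liminf (\<lambda>j. ennreal ((cmod (F (k + j) x - F k x))\<^sup>2))"
        using lim
      proof eventually_elim
        case (elim x)
        have "(\<lambda>j. F (k + j) x) \<longlonglongrightarrow> g x" using LIMSEQ_ignore_initial_segment[OF elim, of k] by (simp add: add.commute)
        then have "(\<lambda>j. ennreal ((cmod (F (k + j) x - F k x))\<^sup>2)) \<longlonglongrightarrow> ennreal ((cmod (g x - F k x))\<^sup>2)"
          by (intro tendsto_ennrealI tendsto_intros)
        from lim_imp_Liminf[OF sequentially_bot this, symmetric] show ?case
          by (simp only: norm_minus_commute[of "F k x" "g x"])
      qed
    qed
    also have "\<dots> \<le> liminf (\<lambda>j. \<integral>\<^sup>+x. ennreal ((cmod (F (k + j) x - F k x))\<^sup>2) \<partial>M)"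
      by (rule nn_integral_liminf) measurable
    also have "\<dots> \<le> ennreal ((4/3 * (1/4) ^ k)\<^sup>2)"
    proof (rule order.trans[OF Liminf_mono[of _ "\<lambda>_. ennreal ((4/3 * (1/4) ^ k)\<^sup>2)"]])
      have "(\<integral>\<^sup>+x. ennreal ((cmod (F (k + j) x - F k x))\<^sup>2) \<partial>M) \<le> ennreal ((4/3 * (1/4) ^ k)\<^sup>2)" for j
        unfolding sq_nn_eq[OF sq_diff[OF F F]]
      proof (rule ennreal_leI, rule power_mono)
        show "nm M (\<lambda>x. F (k + j) x - F k x) \<le> 4/3 * (1/4) ^ k"
          by (rule order.trans[OF far]) simp
      qed simp
      then show "\<forall>\<^sub>F j in sequentially. (\<integral>\<^sup>+x. ennreal ((cmod (F (k + j) x - F k x))\<^sup>2) \<partial>M) \<le> ennreal ((4/3 * (1/4) ^ k)\<^sup>2)"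
        by simp
    qed (simp add: Liminf_const)
    finally show ?thesis .
  qed
  have m: "(\<lambda>x. F k x - g x) \<in> borel_measurable M" for k by measurable
  note fb = nm_le_nn[OF m far2]
  have "sq M (\<lambda>x. F 0 x - g x)" by (rule fb) simp
  from sq_diff[OF F[of 0] this] have "sq M g" by simp
  moreover have "(\<lambda>k. nm M (\<lambda>x. F k x - g x)) \<longlonglongrightarrow> 0"
  proof (rule Lim_null_comparison)
    show "\<forall>\<^sub>F k in sequentially. norm (nm M (\<lambda>x. F k x - g x)) \<le> 4/3 * (1/4) ^ k"
      using fb(2) by simp
    have "(\<lambda>k. 4/3 * (1/4) ^ k) \<longlonglongrightarrow> 4/3 * (0::real)" by (intro tendsto_intros LIMSEQ_power_zero) simp
    then show "(\<lambda>k. 4/3 * (1/4::real) ^ k) \<longlonglongrightarrow> 0" by simp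
  qed
  ultimately show ?thesis by blast
qed

section \<open>The transform of square-integrable functions as a limit of truncations\<close>

definition cut :: "real \<Rightarrow> (real \<Rightarrow> real) \<Rightarrow> real \<Rightarrow> complex" where
  "cut R f x = indicator {-R..R} x * of_real (f x)"

lemma L2_line: "f \<in> L2 Line \<longleftrightarrow> f \<in> borel_measurable borel \<and> integrable lborel (\<lambda>x. (f x)\<^sup>2)"
  by (simp add: L2_def space_measure_def)

lemma L2_line_sq:
  assumes "f \<in> L2 Line"
  shows "sq lborel (\<lambda>x. of_real (f x))"
proof -
  have [measurable]: "f \<in> borel_measurable borel" using assms by (simp add: L2_line)
  have "(\<lambda>x. of_real (f x) :: complex) \<in> borel_measurable lborel" by measurable
  then show ?thesis using assms by (simp add: L2_line sq_def)
qed

lemma cut_measurable: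
  assumes [measurable]: "f \<in> borel_measurable borel"
  shows "cut R f \<in> borel_measurable borel"
  unfolding cut_def[abs_def] by measurable

lemma cut_sq:
  assumes f: "f \<in> L2 Line"
  shows "sq lborel (cut R f)"
proof -
  have "cut R f \<in> borel_measurable borel" using f by (intro cut_measurable) (simp add: L2_line)
  then show ?thesis
    by (intro sq_bound(1)[OF L2_line_sq[OF f]]) (auto simp: cut_def indicator_def)
qed

lemma indicator_sq:
  fixes R :: real
  shows "sq lborel (\<lambda>x. indicator {-R..R} x :: complex)"
proof -
  have "(\<integral>\<^sup>+x. ennreal ((cmod (indicator {-R..R} x :: complex))\<^sup>2) \<partial>lborel) = (\<integral>\<^sup>+x. indicator {-R..R} x \<partial>lborel)"
    by (rule nn_integral_cong) (simp add: indicator_def)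
  also have "\<dots> < \<infinity>" by (subst nn_integral_indicator) (auto simp: emeasure_lborel_Icc_eq)
  finally have i: "(\<integral>\<^sup>+x. ennreal ((cmod (indicator {-R..R} x :: complex))\<^sup>2) \<partial>lborel) < \<infinity>" .
  have m: "(\<lambda>x. indicator {-R..R} x :: complex) \<in> borel_measurable lborel" by measurable
  show ?thesis using sq_iff_nn[OF m] i by blast
qed

lemma cut_integrable:
  assumes f: "f \<in> L2 Line"
  shows "integrable lborel (cut R f)"
  using sq_mult_integrable[OF indicator_sq[of R] L2_line_sq[OF f]] by (simp add: cut_def[abs_def])

lemma truncated_fourier_ft: "truncated_fourier R f = ft (cut R f)"
  by (auto simp: fun_eq_iff truncated_fourier_def ft_def cut_def set_lebesgue_integral_def scaleR_conv_of_real indicator_def mult_ac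
      intro!: Bochner_Integration.integral_cong)

lemma trunc_sq: "f \<in> L2 Line \<Longrightarrow> sq lborel (truncated_fourier R f)"
  unfolding truncated_fourier_ft by (rule ft_bessel[OF cut_integrable cut_sq])

lemma ft_add:
  assumes "integrable lborel f" "integrable lborel g"
  shows "ft (\<lambda>x. a * f x + b * g x) \<xi> = a * ft f \<xi> + b * ft g \<xi>"
proof -
  have "(\<integral>x. cis (- (x * \<xi>)) * (a * f x + b * g x) \<partial>lborel)
     = (\<integral>x. a * (cis (- (x * \<xi>)) * f x) + b * (cis (- (x * \<xi>)) * g x) \<partial>lborel)"
    by (simp add: algebra_simps)
  also have "\<dots> = a * (\<integral>x. cis (- (x * \<xi>)) * f x \<partial>lborel) + b * (\<integral>x. cis (- (x * \<xi>)) * g x \<partial>lborel)"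
    using ft_integrand[OF assms(1)] ft_integrand[OF assms(2)]
    by (subst Bochner_Integration.integral_add) auto
  finally show ?thesis by (simp add: ft_def algebra_simps)
qed

text \<open>By Bessel the distance of two truncated transforms is at most that of the truncations,
  both of which are compared with the full function.\<close>

lemma trunc_diff_bound:
  assumes f: "f \<in> L2 Line"
  shows "nm lborel (\<lambda>\<xi>. truncated_fourier R f \<xi> - truncated_fourier S f \<xi>)
     \<le> nm lborel (\<lambda>x. cut R f x - of_real (f x)) + nm lborel (\<lambda>x. cut S f x - of_real (f x))"
proof -
  note c = L2_line_sq[OF f]
  have e: "(\<lambda>\<xi>. truncated_fourier R f \<xi> - truncated_fourier S f \<xi>) = ft (\<lambda>x. cut R f x - cut S f x)"
    using ft_add[OF cut_integrable[OF f, of R] cut_integrable[OF f, of S], of 1 "-1"]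
    by (simp add: truncated_fourier_ft fun_eq_iff)
  have "nm lborel (ft (\<lambda>x. cut R f x - cut S f x)) \<le> nm lborel (\<lambda>x. cut R f x - cut S f x)"
    by (intro ft_bessel(2) Bochner_Integration.integrable_diff cut_integrable sq_diff cut_sq f)
  also have "\<dots> = nm lborel (\<lambda>x. (cut R f x - of_real (f x)) - (cut S f x - of_real (f x)))" by simp
  also have "\<dots> \<le> nm lborel (\<lambda>x. cut R f x - of_real (f x)) + nm lborel (\<lambda>x. cut S f x - of_real (f x))"
    by (intro nm_triangle_diff sq_diff cut_sq c f)
  finally show ?thesis unfolding e .
qed

lemma cut_tail:
  assumes f: "f \<in> L2 Line"
  shows "((\<lambda>R. nm lborel (\<lambda>x. cut R f x - of_real (f x))) \<longlongrightarrow> 0) at_top"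
proof -
  have [measurable]: "f \<in> borel_measurable borel" and i: "integrable lborel (\<lambda>x. (f x)\<^sup>2)" using f by (auto simp: L2_line)
  have [measurable]: "cut R f \<in> borel_measurable borel" for R by (rule cut_measurable) measurable
  have "((\<lambda>R. \<integral>x. (cmod (cut R f x - of_real (f x)))\<^sup>2 \<partial>lborel) \<longlongrightarrow> (\<integral>x. 0 \<partial>(lborel :: real measure))) at_top"
  proof (rule integral_dominated_convergence_at_top[where w = "\<lambda>x. (f x)\<^sup>2"])
    show "AE x in lborel. ((\<lambda>R. (cmod (cut R f x - of_real (f x)))\<^sup>2) \<longlongrightarrow> 0) at_top"
    proof (rule AE_I2)
      fix x
      have "\<forall>\<^sub>F R in at_top. (cmod (cut R f x - of_real (f x)))\<^sup>2 = 0"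
        using eventually_ge_at_top[of "\<bar>x\<bar>"] by eventually_elim (auto simp: cut_def indicator_def)
      then show "((\<lambda>R. (cmod (cut R f x - of_real (f x)))\<^sup>2) \<longlongrightarrow> 0) at_top" by (rule tendsto_eventually)
    qed
    show "\<forall>\<^sub>F R in at_top. AE x in lborel. norm ((cmod (cut R f x - of_real (f x)))\<^sup>2) \<le> (f x)\<^sup>2"
      by (auto simp: cut_def indicator_def)
  qed (use i in auto)
  then have "((\<lambda>R. sqrt (\<integral>x. (cmod (cut R f x - of_real (f x)))\<^sup>2 \<partial>lborel)) \<longlongrightarrow> sqrt 0) at_top"
    by (intro tendsto_intros) simp
  then show ?thesis by (simp add: nm_def)
qed

text \<open>The property by which \<open>fourier Line\<close> selects its value, restated with real
  norms; \<open>is_ft_nn\<close> is the equivalence.\<close>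

definition is_ft :: "(real \<Rightarrow> real) \<Rightarrow> (real \<Rightarrow> complex) \<Rightarrow> bool" where
  "is_ft f g \<longleftrightarrow> sq lborel g \<and> ((\<lambda>R. nm lborel (\<lambda>\<xi>. truncated_fourier R f \<xi> - g \<xi>)) \<longlongrightarrow> 0) at_top"

text \<open>Radii are chosen along which the truncated transforms are rapidly Cauchy, so
  \<open>sq_complete\<close> gives a limit. Comparing an arbitrary radius with this subsequence
  shows that the whole family converges.\<close>

lemma is_ft_exists:
  assumes f: "f \<in> L2 Line"
  shows "\<exists>g. is_ft f g"
proof -
  let ?t = "\<lambda>R. nm lborel (\<lambda>x. cut R f x - of_real (f x))"
  have "\<exists>R. \<forall>S\<ge>R. ?t S < (1/4) ^ k / 2" for k :: nat
  proof -
    have "\<forall>\<^sub>F R in at_top. dist (?t R) 0 < (1/4) ^ k / 2" by (rule tendstoD[OF cut_tail[OF f]]) simp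
    then show ?thesis by (simp add: eventually_at_top_linorder)
  qed
  then obtain r where r: "\<And>k S. r k \<le> S \<Longrightarrow> ?t S < (1/4) ^ k / 2" by metis
  \<comment> \<open>A running maximum, so that both \<open>\<rho> k\<close> and
    \<open>\<rho> (Suc k)\<close> lie beyond \<open>r k\<close>.\<close>
  define \<rho> where "\<rho> k = Max (r ` {..k})" for k :: nat
  have \<rho>: "r j \<le> \<rho> k" if "j \<le> k" for j k unfolding \<rho>_def using that by (intro Max_ge) auto
  let ?F = "\<lambda>k. truncated_fourier (\<rho> k) f"
  have Fs: "sq lborel (?F k)" for k by (rule trunc_sq[OF f])
  have "nm lborel (\<lambda>\<xi>. ?F (Suc k) \<xi> - ?F k \<xi>) \<le> (1/4) ^ k" for k
    using trunc_diff_bound[OF f, of "\<rho> (Suc k)" "\<rho> k"] r[OF \<rho>[of k "Suc k"]] r[OF \<rho>[of k k]] by simp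
  from sq_complete[OF Fs this] obtain g where g: "sq lborel g" "(\<lambda>k. nm lborel (\<lambda>\<xi>. ?F k \<xi> - g \<xi>)) \<longlonglongrightarrow> 0" by blast
  have "nm lborel (\<lambda>\<xi>. truncated_fourier R f \<xi> - g \<xi>) \<le> ?t R" for R
  proof (rule LIMSEQ_le_const)
    have "(\<lambda>k. ?t R + (1/4) ^ k / 2 + nm lborel (\<lambda>\<xi>. ?F k \<xi> - g \<xi>)) \<longlonglongrightarrow> ?t R + 0 / 2 + 0"
      by (intro tendsto_intros g LIMSEQ_power_zero) auto
    then show "(\<lambda>k. ?t R + (1/4) ^ k / 2 + nm lborel (\<lambda>\<xi>. ?F k \<xi> - g \<xi>)) \<longlonglongrightarrow> ?t R" by simp
    have "nm lborel (\<lambda>\<xi>. truncated_fourier R f \<xi> - g \<xi>) \<le> ?t R + (1/4) ^ k / 2 + nm lborel (\<lambda>\<xi>. ?F k \<xi> - g \<xi>)" for k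
    proof -
      have "nm lborel (\<lambda>\<xi>. truncated_fourier R f \<xi> - g \<xi>) = nm lborel (\<lambda>\<xi>. (truncated_fourier R f \<xi> - ?F k \<xi>) + (?F k \<xi> - g \<xi>))" by simp
      also have "\<dots> \<le> nm lborel (\<lambda>\<xi>. truncated_fourier R f \<xi> - ?F k \<xi>) + nm lborel (\<lambda>\<xi>. ?F k \<xi> - g \<xi>)"
        by (intro nm_triangle sq_diff trunc_sq f g)
      also have "nm lborel (\<lambda>\<xi>. truncated_fourier R f \<xi> - ?F k \<xi>) \<le> ?t R + (1/4) ^ k / 2"
        using trunc_diff_bound[OF f, of R "\<rho> k"] r[OF \<rho>[of k k]] by simp
      finally show ?thesis by simp
    qed
    then show "\<exists>N. \<forall>k\<ge>N. nm lborel (\<lambda>\<xi>. truncated_fourier R f \<xi> - g \<xi>) \<le> ?t R + (1/4) ^ k / 2 + nm lborel (\<lambda>\<xi>. ?F k \<xi> - g \<xi>)"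
      by blast
  qed
  then have "((\<lambda>R. nm lborel (\<lambda>\<xi>. truncated_fourier R f \<xi> - g \<xi>)) \<longlongrightarrow> 0) at_top"
    by (intro Lim_null_comparison[OF _ cut_tail[OF f]]) auto
  then show ?thesis using g by (auto simp: is_ft_def)
qed

lemma nm_eq_zero_AE:
  assumes "sq M f" "nm M f = 0"
  shows "AE x in M. f x = 0"
proof -
  have [measurable]: "f \<in> borel_measurable M" using assms by (simp add: sq_def)
  have "(\<integral>\<^sup>+x. ennreal ((cmod (f x))\<^sup>2) \<partial>M) = 0" using sq_nn_eq[OF assms(1)] assms(2) by simp
  then have "AE x in M. ennreal ((cmod (f x))\<^sup>2) = 0" by (subst (asm) nn_integral_0_iff_AE) auto
  then show ?thesis by eventually_elim (simp add: ennreal_eq_0_iff)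
qed

lemma is_ft_unique:
  assumes f: "f \<in> L2 Line" and g: "is_ft f g" and h: "is_ft f h"
  shows "AE \<xi> in lborel. g \<xi> = h \<xi>"
proof -
  have s: "sq lborel g" "sq lborel h" using g h by (auto simp: is_ft_def)
  let ?t = "\<lambda>k R. nm lborel (\<lambda>\<xi>. truncated_fourier R f \<xi> - k \<xi>)"
  have l: "((\<lambda>R. ?t h R + ?t g R) \<longlongrightarrow> 0 + 0) at_top"
    using g h by (intro tendsto_add) (auto simp: is_ft_def)
  have "nm lborel (\<lambda>\<xi>. g \<xi> - h \<xi>) \<le> 0 + 0"
  proof (rule tendsto_lowerbound[OF l])
    have "nm lborel (\<lambda>\<xi>. g \<xi> - h \<xi>) \<le> ?t h R + ?t g R" for R
      using nm_triangle_diff[OF sq_diff[OF trunc_sq[OF f, of R] s(2)] sq_diff[OF trunc_sq[OF f, of R] s(1)]] by simp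
    then show "\<forall>\<^sub>F R in at_top. nm lborel (\<lambda>\<xi>. g \<xi> - h \<xi>) \<le> ?t h R + ?t g R" by simp
  qed simp
  then have "nm lborel (\<lambda>\<xi>. g \<xi> - h \<xi>) = 0" using nm_nonneg[of lborel "\<lambda>\<xi>. g \<xi> - h \<xi>"] by linarith
  from nm_eq_zero_AE[OF sq_diff[OF s] this] show ?thesis by eventually_elim simp
qed

text \<open>From right to left, the integral is finite for some \<open>R\<close>; as the truncated
  transform is square-integrable, so is \<open>g\<close>.\<close>

lemma is_ft_nn:
  assumes f: "f \<in> L2 Line"
  shows "is_ft f g \<longleftrightarrow> g \<in> borel_measurable borel \<and>
       ((\<lambda>R. \<integral>\<^sup>+\<xi>. ennreal ((cmod (truncated_fourier R f \<xi> - g \<xi>))\<^sup>2) \<partial>lborel) \<longlongrightarrow> 0) at_top"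
proof
  assume g: "is_ft f g"
  then have s: "sq lborel g" by (simp add: is_ft_def)
  have "((\<lambda>R. ennreal ((nm lborel (\<lambda>\<xi>. truncated_fourier R f \<xi> - g \<xi>))\<^sup>2)) \<longlongrightarrow> ennreal (0\<^sup>2)) at_top"
    using g by (intro tendsto_ennrealI tendsto_power) (simp add: is_ft_def)
  then show "g \<in> borel_measurable borel \<and>
       ((\<lambda>R. \<integral>\<^sup>+\<xi>. ennreal ((cmod (truncated_fourier R f \<xi> - g \<xi>))\<^sup>2) \<partial>lborel) \<longlongrightarrow> 0) at_top"
    using s sq_nn_eq[OF sq_diff[OF trunc_sq[OF f] s]] by (simp add: sq_def)
next
  assume "g \<in> borel_measurable borel \<and>
       ((\<lambda>R. \<integral>\<^sup>+\<xi>. ennreal ((cmod (truncated_fourier R f \<xi> - g \<xi>))\<^sup>2) \<partial>lborel) \<longlongrightarrow> 0) at_top"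
  then have [measurable]: "g \<in> borel_measurable borel" and l: "((\<lambda>R. \<integral>\<^sup>+\<xi>. ennreal ((cmod (truncated_fourier R f \<xi> - g \<xi>))\<^sup>2) \<partial>lborel) \<longlongrightarrow> 0) at_top" by auto
  have [measurable]: "truncated_fourier R f \<in> borel_measurable borel" for R using trunc_sq[OF f, of R] by (simp add: sq_def)
  have "\<forall>\<^sub>F R in at_top. (\<integral>\<^sup>+\<xi>. ennreal ((cmod (truncated_fourier R f \<xi> - g \<xi>))\<^sup>2) \<partial>lborel) < \<infinity>"
    using l by (rule order_tendstoD) simp
  then obtain R where "(\<integral>\<^sup>+\<xi>. ennreal ((cmod (truncated_fourier R f \<xi> - g \<xi>))\<^sup>2) \<partial>lborel) < \<infinity>"
    using eventually_happens by fastforce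
  then have "sq lborel (\<lambda>\<xi>. truncated_fourier R f \<xi> - g \<xi>)" by (subst sq_iff_nn) measurable
  from sq_diff[OF trunc_sq[OF f, of R] this] have s: "sq lborel g" by simp
  have "((\<lambda>R. ennreal ((nm lborel (\<lambda>\<xi>. truncated_fourier R f \<xi> - g \<xi>))\<^sup>2)) \<longlongrightarrow> ennreal 0) at_top"
    using l sq_nn_eq[OF sq_diff[OF trunc_sq[OF f] s]] by simp
  then have "((\<lambda>R. (nm lborel (\<lambda>\<xi>. truncated_fourier R f \<xi> - g \<xi>))\<^sup>2) \<longlongrightarrow> 0) at_top"
    by (subst (asm) tendsto_ennreal_iff) auto
  then have "((\<lambda>R. sqrt ((nm lborel (\<lambda>\<xi>. truncated_fourier R f \<xi> - g \<xi>))\<^sup>2)) \<longlongrightarrow> sqrt 0) at_top"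
    by (intro tendsto_intros)
  then show "is_ft f g" using s by (simp add: is_ft_def)
qed

lemma fourier_is_ft: "f \<in> L2 Line \<Longrightarrow> is_ft f (fourier Line f)"
  using someI_ex[OF is_ft_exists[of f, unfolded is_ft_nn]] is_ft_nn[of f] by (simp add: fourier_def)

lemma cut_linear: "cut R (\<lambda>x. a * f x + b * g x) x = of_real a * cut R f x + of_real b * cut R g x"
  by (simp add: cut_def algebra_simps)

lemma L2_line_linear:
  assumes f: "f \<in> L2 Line" and g: "g \<in> L2 Line"
  shows "(\<lambda>x. a * f x + b * g x) \<in> L2 Line"
proof -
  have "sq lborel (\<lambda>x. of_real a * of_real (f x) + of_real b * of_real (g x))"
    by (intro sq_add sq_scale L2_line_sq f g)
  then have "sq lborel (\<lambda>x. of_real (a * f x + b * g x))" by simp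
  then show ?thesis using f g unfolding L2_line sq_def norm_of_real power2_abs by (auto simp: L2_line)
qed

lemma is_ft_linear:
  assumes f: "f \<in> L2 Line" "is_ft f g" and f': "f' \<in> L2 Line" "is_ft f' g'"
  shows "is_ft (\<lambda>x. a * f x + b * f' x) (\<lambda>\<xi>. of_real a * g \<xi> + of_real b * g' \<xi>)"
  unfolding is_ft_def
proof
  have s: "sq lborel g" "sq lborel g'" using f f' by (auto simp: is_ft_def)
  show "sq lborel (\<lambda>\<xi>. of_real a * g \<xi> + of_real b * g' \<xi>)" by (intro sq_add sq_scale s)
  let ?d = "\<lambda>R \<xi>. truncated_fourier R f \<xi> - g \<xi>" and ?d' = "\<lambda>R \<xi>. truncated_fourier R f' \<xi> - g' \<xi>"
  have e: "(\<lambda>\<xi>. truncated_fourier R (\<lambda>x. a * f x + b * f' x) \<xi> - (of_real a * g \<xi> + of_real b * g' \<xi>))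
    = (\<lambda>\<xi>. of_real a * ?d R \<xi> + of_real b * ?d' R \<xi>)" for R
    using ft_add[OF cut_integrable[OF f(1), of R] cut_integrable[OF f'(1), of R], of "of_real a" "of_real b"]
    by (simp add: truncated_fourier_ft cut_linear[abs_def] fun_eq_iff algebra_simps)
  have bd: "nm lborel (\<lambda>\<xi>. of_real a * ?d R \<xi> + of_real b * ?d' R \<xi>) \<le> \<bar>a\<bar> * nm lborel (?d R) + \<bar>b\<bar> * nm lborel (?d' R)" for R
    using nm_triangle[OF sq_scale[OF sq_diff[OF trunc_sq[OF f(1), of R] s(1)], of "of_real a"] sq_scale[OF sq_diff[OF trunc_sq[OF f'(1), of R] s(2)], of "of_real b"]]
    unfolding nm_scale norm_of_real .
  have "((\<lambda>R. \<bar>a\<bar> * nm lborel (?d R) + \<bar>b\<bar> * nm lborel (?d' R)) \<longlongrightarrow> \<bar>a\<bar> * 0 + \<bar>b\<bar> * 0) at_top"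
    using f f' by (intro tendsto_intros) (auto simp: is_ft_def)
  then have l: "((\<lambda>R. \<bar>a\<bar> * nm lborel (?d R) + \<bar>b\<bar> * nm lborel (?d' R)) \<longlongrightarrow> 0) at_top" by simp
  show "((\<lambda>R. nm lborel (\<lambda>\<xi>. truncated_fourier R (\<lambda>x. a * f x + b * f' x) \<xi> - (of_real a * g \<xi> + of_real b * g' \<xi>))) \<longlongrightarrow> 0) at_top"
    unfolding e by (rule Lim_null_comparison[OF _ l]) (intro always_eventually allI, simp only: real_norm_def abs_of_nonneg[OF nm_nonneg], rule bd)
qed

lemma cnj_indicator: "cnj (indicator A x) = indicator A x"
  by (cases "x \<in> A") auto

lemma Ioc_indicator:
  fixes a b :: real
  shows "integrable lborel (\<lambda>x. indicator {a<..b} x :: complex)" "sq lborel (\<lambda>x. indicator {a<..b} x :: complex)"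
proof -
  have "emeasure lborel {a<..b} \<le> emeasure lborel {a..b}" by (rule emeasure_mono) auto
  also have "\<dots> < \<infinity>" by (simp add: emeasure_lborel_Icc_eq)
  finally have "integrable lborel (\<lambda>x. of_real (indicator {a<..b} x) :: complex)"
    by (intro integrable_of_real integrable_real_indicator) auto
  moreover have "(\<lambda>x. of_real (indicator {a<..b} x)) = (\<lambda>x. indicator {a<..b} x :: complex)" by (auto simp: indicator_def)
  ultimately show g: "integrable lborel (\<lambda>x. indicator {a<..b} x :: complex)" by simp
  have "(cmod (indicator {a<..b} x))\<^sup>2 = cmod (indicator {a<..b} x)" for x by (simp add: indicator_def)
  then show "sq lborel (\<lambda>x. indicator {a<..b} x :: complex)"
    unfolding sq_def using g[THEN integrable_norm] by (simp only:) simp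
qed

text \<open>The positive and negative parts, as densities, give finite and equal mass to every
  half-line, hence define the same measure and agree almost everywhere.\<close>

lemma AE_zero_of_intervals_real:
  fixes g :: "real \<Rightarrow> real"
  assumes g: "integrable lborel g" and z: "\<And>a b. (\<integral>x. indicator {a<..b} x * g x \<partial>lborel) = 0"
  shows "AE x in lborel. g x = 0"
proof -
  have [measurable]: "g \<in> borel_measurable borel" using g by auto
  let ?M1 = "density lborel (\<lambda>x. ennreal (g x))" and ?M2 = "density lborel (\<lambda>x. ennreal (- g x))"
  have i: "integrable lborel (\<lambda>x. indicator {a<..} x * g x)" for a
    by (rule Bochner_Integration.integrable_bound[OF g]) (auto simp: indicator_def)
  have z2: "(\<integral>x. indicator {a<..} x * g x \<partial>lborel) = 0" for a
  proof (rule LIMSEQ_unique)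
    show "(\<lambda>n. \<integral>x. indicator {a<..real n} x * g x \<partial>lborel) \<longlonglongrightarrow> (\<integral>x. indicator {a<..} x * g x \<partial>lborel)"
    proof (rule integral_dominated_convergence[where w = "\<lambda>x. \<bar>g x\<bar>"])
      show "AE x in lborel. (\<lambda>n. indicator {a<..real n} x * g x) \<longlonglongrightarrow> indicator {a<..} x * g x"
      proof (rule AE_I2)
        fix x
        obtain m :: nat where m: "x \<le> real m" using real_arch_simple by blast
        have "\<forall>\<^sub>F n in sequentially. indicator {a<..real n} x * g x = indicator {a<..} x * g x"
          using eventually_ge_at_top[of m] by eventually_elim (use m in \<open>auto simp: indicator_def\<close>)
        then show "(\<lambda>n. indicator {a<..real n} x * g x) \<longlonglongrightarrow> indicator {a<..} x * g x" by (rule tendsto_eventually)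
      qed
    qed (use g in \<open>auto simp: indicator_def\<close>)
    show "(\<lambda>n. \<integral>x. indicator {a<..real n} x * g x \<partial>lborel) \<longlonglongrightarrow> 0" unfolding z by simp
  qed
  have e1: "emeasure ?M1 {a<..} = (\<integral>\<^sup>+x. ennreal (indicator {a<..} x * g x) \<partial>lborel)" for a
    by (subst emeasure_density) (auto simp: indicator_def intro!: nn_integral_cong)
  have e2: "emeasure ?M2 {a<..} = (\<integral>\<^sup>+x. ennreal (- (indicator {a<..} x * g x)) \<partial>lborel)" for a
    by (subst emeasure_density) (auto simp: indicator_def intro!: nn_integral_cong)
  have fin: "(\<integral>\<^sup>+x. ennreal (indicator {a<..} x * g x) \<partial>lborel) < \<infinity>" "(\<integral>\<^sup>+x. ennreal (- (indicator {a<..} x * g x)) \<partial>lborel) < \<infinity>" for a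
    using i[of a] by (auto simp: real_integrable_def less_top)
  have "?M1 = ?M2"
  proof (rule measure_eqI_lessThan)
    fix a
    have "enn2real (\<integral>\<^sup>+x. ennreal (indicator {a<..} x * g x) \<partial>lborel) = enn2real (\<integral>\<^sup>+x. ennreal (- (indicator {a<..} x * g x)) \<partial>lborel)"
      using z2[of a] real_lebesgue_integral_def[OF i[of a]] by simp
    then show "emeasure ?M1 {a<..} = emeasure ?M2 {a<..}"
      unfolding e1 e2 using fin[of a] by (metis ennreal_enn2real infinity_ennreal_def)
    show "emeasure ?M1 {a<..} < \<infinity>" unfolding e1 by (rule fin)
  qed auto
  \<comment> \<open>\<open>ennreal\<close> maps negative numbers to 0, so this equality excludes
    either sign of \<open>g x\<close>.\<close>
  then have "AE x in lborel. ennreal (g x) = ennreal (- g x)"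
    by (intro sigma_finite_measure.density_unique[OF sigma_finite_lborel]) auto
  then show ?thesis
  proof eventually_elim
    case (elim x)
    show ?case
    proof (rule ccontr)
      assume "g x \<noteq> 0"
      then consider "g x > 0" | "g x < 0" by linarith
      then show False using elim by cases (auto simp: ennreal_neg ennreal_eq_0_iff)
    qed
  qed
qed

text \<open>Square integrability gives only local integrability, so the real version is applied on
  each (-n, n] to real and imaginary parts; half-open intervals are stable under
  intersection.\<close>

lemma AE_zero_of_intervals:
  fixes f :: "real \<Rightarrow> complex"
  assumes f: "sq lborel f" and z: "\<And>a b. (\<integral>x. indicator {a<..b} x * f x \<partial>lborel) = 0"
  shows "AE x in lborel. f x = 0"
proof -
  have [measurable]: "f \<in> borel_measurable borel" using f by (simp add: sq_def)
  have i: "integrable lborel (\<lambda>x. indicator {a<..b} x * f x)" for a b :: real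
    by (rule sq_mult_integrable[OF Ioc_indicator(2) f])
  have "AE x in lborel. indicator {- real n<..real n} x * Re (f x) = 0 \<and> indicator {- real n<..real n} x * Im (f x) = 0" for n
  proof -
    let ?I = "{- real n<..real n}"
    have ii: "indicator {a<..b} x * (indicator ?I x * f x) = indicator {max a (- real n)<..min b (real n)} x * f x" for a b x
      by (auto simp: indicator_def)
    have re: "indicator ?I x * Re (f x) = Re (indicator ?I x * f x)" "indicator ?I x * Im (f x) = Im (indicator ?I x * f x)" for x
      by (simp_all add: indicator_def)
    have re2: "indicator {a<..b} x * Re (indicator ?I x * f x) = Re (indicator {a<..b} x * (indicator ?I x * f x))"
      "indicator {a<..b} x * Im (indicator ?I x * f x) = Im (indicator {a<..b} x * (indicator ?I x * f x))" for a b x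
      by (simp_all add: indicator_def)
    have "AE x in lborel. Re (indicator ?I x * f x) = 0"
    proof (rule AE_zero_of_intervals_real)
      show "integrable lborel (\<lambda>x. Re (indicator ?I x * f x))" by (rule integrable_Re[OF i])
      show "(\<integral>x. indicator {a<..b} x * Re (indicator ?I x * f x) \<partial>lborel) = 0" for a b
        unfolding re2 ii using z[of "max a (- real n)" "min b (real n)"] integral_Re[OF i] by simp
    qed
    moreover have "AE x in lborel. Im (indicator ?I x * f x) = 0"
    proof (rule AE_zero_of_intervals_real)
      show "integrable lborel (\<lambda>x. Im (indicator ?I x * f x))" by (rule integrable_Im[OF i])
      show "(\<integral>x. indicator {a<..b} x * Im (indicator ?I x * f x) \<partial>lborel) = 0" for a b
        unfolding re2 ii using z[of "max a (- real n)" "min b (real n)"] integral_Im[OF i] by simp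
    qed
    ultimately show ?thesis unfolding re by eventually_elim auto
  qed
  then have "AE x in lborel. \<forall>n. indicator {- real n<..real n} x * Re (f x) = 0 \<and> indicator {- real n<..real n} x * Im (f x) = 0"
    by (simp only: AE_all_countable) simp
  then show ?thesis
  proof eventually_elim
    case (elim x)
    obtain n :: nat where n: "\<bar>x\<bar> < real n" using reals_Archimedean2 by blast
    then have "x \<in> {- real n<..real n}" by auto
    then show ?case using elim[rule_format, of n] by (simp add: complex_eq_iff)
  qed
qed

text \<open>\<open>ft_parseval_interval\<close> for the truncations, passed to the limit by
  Cauchy--Schwarz on both sides.\<close>

lemma is_ft_interval:
  assumes f: "f \<in> L2 Line" and G: "is_ft f G"
  shows "(\<integral>\<xi>. cnj (ft (\<lambda>x. indicator {a<..b} x) \<xi>) * G \<xi> \<partial>lborel) = (\<integral>x. indicator {a<..b} x * of_real (f x) \<partial>lborel)"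
proof -
  let ?g = "\<lambda>x. indicator {a<..b} x :: complex"
  have gb: "sq lborel (ft ?g)" by (rule ft_bessel(1)[OF Ioc_indicator])
  have gc: "sq lborel (\<lambda>\<xi>. cnj (ft ?g \<xi>))" using gb by simp
  have Gs: "sq lborel G" using G by (simp add: is_ft_def)
  let ?A = "\<integral>\<xi>. cnj (ft ?g \<xi>) * G \<xi> \<partial>lborel" and ?B = "\<integral>x. ?g x * of_real (f x) \<partial>lborel"
  have b: "cmod (?A - ?B) \<le> nm lborel (ft ?g) * nm lborel (\<lambda>\<xi>. truncated_fourier R f \<xi> - G \<xi>)
       + nm lborel ?g * nm lborel (\<lambda>x. cut R f x - of_real (f x))" for R
  proof -
    note t = trunc_sq[OF f, of R] and c = cut_sq[OF f, of R] and fs = L2_line_sq[OF f]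
    have p: "(\<integral>\<xi>. cnj (ft ?g \<xi>) * truncated_fourier R f \<xi> \<partial>lborel) = (\<integral>x. ?g x * cut R f x \<partial>lborel)"
      unfolding truncated_fourier_ft by (rule ft_parseval_interval[OF cut_integrable[OF f] c])
    have e: "?A - ?B = (\<integral>x. ?g x * (cut R f x - of_real (f x)) \<partial>lborel) - (\<integral>\<xi>. cnj (ft ?g \<xi>) * (truncated_fourier R f \<xi> - G \<xi>) \<partial>lborel)"
      using p sq_mult_integrable[OF gc t] sq_mult_integrable[OF gc Gs] sq_mult_integrable[OF Ioc_indicator(2) c] sq_mult_integrable[OF Ioc_indicator(2) fs]
      by (simp add: right_diff_distrib)
    have e1: "cmod (\<integral>x. ?g x * (cut R f x - of_real (f x)) \<partial>lborel) \<le> nm lborel ?g * nm lborel (\<lambda>x. cut R f x - of_real (f x))"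
      by (rule nm_CS[OF Ioc_indicator(2) sq_diff[OF c fs]])
    have e2: "cmod (\<integral>\<xi>. cnj (ft ?g \<xi>) * (truncated_fourier R f \<xi> - G \<xi>) \<partial>lborel) \<le> nm lborel (\<lambda>\<xi>. cnj (ft ?g \<xi>)) * nm lborel (\<lambda>\<xi>. truncated_fourier R f \<xi> - G \<xi>)"
      by (rule nm_CS[OF gc sq_diff[OF t Gs]])
    show ?thesis unfolding e by (rule order.trans[OF norm_triangle_ineq4]) (use e1 e2 in simp)
  qed
  have l: "((\<lambda>R. nm lborel (ft ?g) * nm lborel (\<lambda>\<xi>. truncated_fourier R f \<xi> - G \<xi>)
       + nm lborel ?g * nm lborel (\<lambda>x. cut R f x - of_real (f x))) \<longlongrightarrow> nm lborel (ft ?g) * 0 + nm lborel ?g * 0) at_top"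
    using G cut_tail[OF f] by (intro tendsto_intros) (auto simp: is_ft_def)
  have "cmod (?A - ?B) \<le> nm lborel (ft ?g) * 0 + nm lborel ?g * 0"
    by (rule tendsto_lowerbound[OF l]) (use b in auto)
  then show ?thesis by simp
qed

lemma ft_injective:
  assumes f: "f \<in> L2 Line" and z: "is_ft f G" "AE \<xi> in lborel. G \<xi> = 0"
  shows "AE x in lborel. f x = 0"
proof -
  have [measurable]: "G \<in> borel_measurable borel" using z by (simp add: is_ft_def sq_def)
  have "(\<integral>x. indicator {a<..b} x * of_real (f x) \<partial>lborel) = (0 :: complex)" for a b
  proof -
    have "(\<integral>\<xi>. cnj (ft (\<lambda>x. indicator {a<..b} x) \<xi>) * G \<xi> \<partial>lborel) = 0"
      by (rule integral_eq_zero_AE) (use z(2) in \<open>eventually_elim, simp\<close>)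
    then show ?thesis using is_ft_interval[OF f z(1), of a b] by simp
  qed
  then have "AE x in lborel. (of_real (f x) :: complex) = 0" by (rule AE_zero_of_intervals[OF L2_line_sq[OF f]])
  then show ?thesis by simp
qed

lemma nm_reflect:
  fixes f :: "real \<Rightarrow> complex"
  assumes [measurable]: "f \<in> borel_measurable borel"
  shows "nm lborel (\<lambda>x. f (- x)) = nm lborel f"
  unfolding nm_def using lborel_integral_real_affine[of "-1" "\<lambda>x. (cmod (f x))\<^sup>2" 0] by simp

lemma sq_reflect:
  fixes f :: "real \<Rightarrow> complex"
  assumes f: "sq lborel f"
  shows "sq lborel (\<lambda>x. f (- x))"
proof -
  have [measurable]: "f \<in> borel_measurable borel" using f by (simp add: sq_def)
  have "integrable lborel (\<lambda>x. (cmod (f (0 + -1 * x)))\<^sup>2)"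
    by (rule lborel_integrable_real_affine) (use f in \<open>auto simp: sq_def\<close>)
  then show ?thesis by (simp add: sq_def)
qed

text \<open>The truncated transforms of a real function are hermitian at every point, so the
  reflected conjugate of a limit is again a limit; uniqueness holds up to a null set.\<close>

lemma is_ft_hermitian:
  assumes f: "f \<in> L2 Line" and G: "is_ft f G"
  shows "AE \<xi> in lborel. G (- \<xi>) = cnj (G \<xi>)"
proof -
  have s: "sq lborel G" using G by (simp add: is_ft_def)
  have [measurable]: "G \<in> borel_measurable borel" "truncated_fourier R f \<in> borel_measurable borel" for R
    using s trunc_sq[OF f, of R] by (auto simp: sq_def)
  have t: "truncated_fourier R f (- \<xi>) = cnj (truncated_fourier R f \<xi>)" for R \<xi>
    unfolding truncated_fourier_ft ft_def by (simp add: cut_def cis_cnj cnj_indicator flip: integral_cnj')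
  have "nm lborel (\<lambda>\<xi>. truncated_fourier R f \<xi> - cnj (G (- \<xi>))) = nm lborel (\<lambda>\<xi>. truncated_fourier R f \<xi> - G \<xi>)" for R
  proof -
    have "nm lborel (\<lambda>\<xi>. truncated_fourier R f \<xi> - cnj (G (- \<xi>))) = nm lborel (\<lambda>\<xi>. cnj (truncated_fourier R f (- \<xi>) - G (- \<xi>)))"
      by (simp add: t)
    also have "\<dots> = nm lborel (\<lambda>\<xi>. truncated_fourier R f \<xi> - G \<xi>)"
      unfolding nm_cnj by (rule nm_reflect[of "\<lambda>\<xi>. truncated_fourier R f \<xi> - G \<xi>"]) measurable
    finally show ?thesis .
  qed
  then have "is_ft f (\<lambda>\<xi>. cnj (G (- \<xi>)))"
    using G sq_reflect[OF s] by (simp add: is_ft_def)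
  from is_ft_unique[OF f this G] show ?thesis by eventually_elim (metis complex_cnj_cnj)
qed

text \<open>Inversion in L2. Tested on an interval, the transform of \<open>h\<close> becomes, by
  the multiplication formula, the pairing of the interval's transform with \<open>h\<close>; as
  \<open>h\<close> is the reflected transform of \<open>g\<close>, Parseval returns the integral of
  \<open>g\<close> over the interval.\<close>

lemma ft_of_inverse:
  assumes g: "integrable lborel g" "sq lborel g" and h: "\<And>x. ft g (- x) = of_real (h x)"
  shows "h \<in> L2 Line" "is_ft h g"
proof -
  have gb: "sq lborel (ft g)" by (rule ft_bessel[OF g])
  have hs: "sq lborel (\<lambda>x. of_real (h x))" using sq_reflect[OF gb] by (simp add: h)
  have hm: "h \<in> borel_measurable borel"
  proof -
    have "(\<lambda>x. of_real (h x) :: complex) \<in> borel_measurable borel" using hs by (simp add: sq_def)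
    from measurable_compose[OF this borel_measurable_Re] show ?thesis by simp
  qed
  show L: "h \<in> L2 Line" using hs hm by (simp add: L2_line sq_def)
  obtain G where G: "is_ft h G" using is_ft_exists[OF L] by blast
  have Gs: "sq lborel G" using G by (simp add: is_ft_def)
  have "(\<integral>\<xi>. indicator {a<..b} \<xi> * (G \<xi> - g \<xi>) \<partial>lborel) = 0" for a b
  proof -
    let ?I = "\<lambda>x. indicator {a<..b} x :: complex"
    note I = Ioc_indicator[of a b]
    have Ib: "sq lborel (ft ?I)" by (rule ft_bessel[OF I])
    have [measurable]: "ft ?I \<in> borel_measurable borel" "ft g \<in> borel_measurable borel" using Ib gb by (auto simp: sq_def)
    let ?A = "\<integral>\<xi>. ?I \<xi> * G \<xi> \<partial>lborel" and ?B = "\<integral>x. ft ?I x * of_real (h x) \<partial>lborel"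
    have b: "cmod (?A - ?B) \<le> nm lborel ?I * nm lborel (\<lambda>\<xi>. truncated_fourier R h \<xi> - G \<xi>)
       + nm lborel (ft ?I) * nm lborel (\<lambda>x. cut R h x - of_real (h x))" for R
    proof -
      note t = trunc_sq[OF L, of R] and c = cut_sq[OF L, of R]
      have p: "(\<integral>\<xi>. ?I \<xi> * truncated_fourier R h \<xi> \<partial>lborel) = (\<integral>x. ft ?I x * cut R h x \<partial>lborel)"
        unfolding truncated_fourier_ft by (rule ft_multiplication[OF cut_integrable[OF L] I(1)])
      have e: "?A - ?B = (\<integral>x. ft ?I x * (cut R h x - of_real (h x)) \<partial>lborel) - (\<integral>\<xi>. ?I \<xi> * (truncated_fourier R h \<xi> - G \<xi>) \<partial>lborel)"
        using p sq_mult_integrable[OF I(2) t] sq_mult_integrable[OF I(2) Gs] sq_mult_integrable[OF Ib c] sq_mult_integrable[OF Ib hs]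
        by (simp add: right_diff_distrib)
      have e1: "cmod (\<integral>x. ft ?I x * (cut R h x - of_real (h x)) \<partial>lborel) \<le> nm lborel (ft ?I) * nm lborel (\<lambda>x. cut R h x - of_real (h x))"
        by (rule nm_CS[OF Ib sq_diff[OF c hs]])
      have e2: "cmod (\<integral>\<xi>. ?I \<xi> * (truncated_fourier R h \<xi> - G \<xi>) \<partial>lborel) \<le> nm lborel ?I * nm lborel (\<lambda>\<xi>. truncated_fourier R h \<xi> - G \<xi>)"
        by (rule nm_CS[OF I(2) sq_diff[OF t Gs]])
      show ?thesis unfolding e by (rule order.trans[OF norm_triangle_ineq4]) (use e1 e2 in simp)
    qed
    have l: "((\<lambda>R. nm lborel ?I * nm lborel (\<lambda>\<xi>. truncated_fourier R h \<xi> - G \<xi>)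
       + nm lborel (ft ?I) * nm lborel (\<lambda>x. cut R h x - of_real (h x))) \<longlongrightarrow> nm lborel ?I * 0 + nm lborel (ft ?I) * 0) at_top"
      using G cut_tail[OF L] by (intro tendsto_intros) (auto simp: is_ft_def)
    have "cmod (?A - ?B) \<le> nm lborel ?I * 0 + nm lborel (ft ?I) * 0"
      by (rule tendsto_lowerbound[OF l]) (use b in auto)
    then have AB: "?A = ?B" by simp
    have tI: "ft ?I (- x) = cnj (ft ?I x)" for x
      unfolding ft_def by (simp add: cis_cnj cnj_indicator flip: integral_cnj')
    have "?B = (\<integral>x. ft ?I x * ft g (- x) \<partial>lborel)" by (simp add: h)
    also have "\<dots> = (\<integral>x. ft ?I (- x) * ft g x \<partial>lborel)"
      using lborel_integral_real_affine[of "-1" "\<lambda>x. ft ?I x * ft g (- x)" 0] by simp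
    also have "\<dots> = (\<integral>x. ?I x * g x \<partial>lborel)"
      unfolding tI by (rule ft_parseval_interval[OF g])
    finally show ?thesis
      using AB sq_mult_integrable[OF I(2) Gs] sq_mult_integrable[OF I(2) g(2)] by (simp add: right_diff_distrib)
  qed
  from AE_zero_of_intervals[OF sq_diff[OF Gs g(2)] this] have ae: "AE \<xi> in lborel. G \<xi> = g \<xi>"
    by eventually_elim simp
  have m: "G \<in> borel_measurable lborel" "g \<in> borel_measurable lborel" using Gs g by (auto simp: sq_def)
  have "nm lborel (\<lambda>\<xi>. truncated_fourier R h \<xi> - g \<xi>) = nm lborel (\<lambda>\<xi>. truncated_fourier R h \<xi> - G \<xi>)" for R
    by (rule nm_cong_AE) (use trunc_sq[OF L, of R] m ae in \<open>auto simp: sq_def elim: eventually_mono\<close>)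
  then show "is_ft h g" using G g(2) by (simp add: is_ft_def)
qed

lemma continuous_AE_zero:
  fixes f :: "real \<Rightarrow> real"
  assumes c: "continuous_on UNIV f" and U: "open U" "x \<in> U" and z: "AE x in lborel. x \<in> U \<longrightarrow> f x = 0"
  shows "f x = 0"
proof (rule ccontr)
  assume nz: "f x \<noteq> 0"
  let ?S = "{x. f x \<noteq> 0} \<inter> U"
  have o: "open ?S" using c U by (intro open_Int) (auto simp: open_Collect_neq)
  have "x \<in> ?S" using nz U by simp
  from openE[OF o this] obtain e where e: "e > 0" "ball x e \<subseteq> ?S" .
  have sub: "{x - e / 2 .. x + e / 2} \<subseteq> ?S"
  proof
    fix y assume "y \<in> {x - e / 2 .. x + e / 2}"
    then have "y \<in> ball x e" using e(1) by (auto simp: dist_real_def)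
    then show "y \<in> ?S" using e(2) by auto
  qed
  have S: "?S \<in> sets lborel" using o by simp
  have "AE x in lborel. x \<notin> ?S" using z by eventually_elim auto
  then have "?S \<in> null_sets lborel" using AE_iff_null_sets[OF S] by simp
  then have "emeasure lborel ?S = 0" by (simp add: null_sets_def)
  then have "emeasure lborel {x - e / 2 .. x + e / 2} = 0"
    using emeasure_mono[OF sub S] by auto
  then show False using e(1) by simp
qed

text \<open>\<open>G\<close> is replaced by its hermitian version \<open>g\<close>, whose inverse
  transform \<open>h\<close> is real and continuous and has the same transform as \<open>f\<close>.
  Injectivity gives equality almost everywhere, continuity gives it everywhere.\<close>

lemma line_inversion:
  assumes f: "f \<in> L2 Line" "continuous_on UNIV f" and G: "is_ft f G" "integrable lborel G"
  shows "of_real (f x) = of_real (1 / sqrt (2 * pi)) * (\<integral>\<xi>. G \<xi> * cis (x * \<xi>) \<partial>lborel)"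
proof -
  have Gs: "sq lborel G" using G by (simp add: is_ft_def)
  have [measurable]: "G \<in> borel_measurable borel" using Gs by (simp add: sq_def)
  define g where "g \<xi> = (G \<xi> + cnj (G (- \<xi>))) / 2" for \<xi>
  have [measurable]: "g \<in> borel_measurable borel" unfolding g_def[abs_def] by measurable
  have gG: "AE \<xi> in lborel. g \<xi> = G \<xi>"
    using is_ft_hermitian[OF f(1) G(1)] by eventually_elim (simp add: g_def)
  have gi: "integrable lborel g"
    by (rule integrable_cong_AE_imp[OF G(2)]) (use gG in \<open>auto elim: eventually_mono\<close>)
  have gs: "sq lborel g" by (rule sq_bound(1)[OF Gs]) (use gG in \<open>auto elim: eventually_mono\<close>)
  have gh: "g (- \<xi>) = cnj (g \<xi>)" for \<xi> by (simp add: g_def add.commute)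
  define h where "h x = Re (ft g (- x))" for x
  have "cnj (ft g (- x)) = ft g (- x)" for x
  proof -
    have "(\<integral>\<xi>. cis (- (\<xi> * - x)) * g \<xi> \<partial>lborel) = (\<integral>\<xi>. cis (- (- \<xi> * - x)) * g (- \<xi>) \<partial>lborel)"
      using lborel_integral_real_affine[of "-1" "\<lambda>\<xi>. cis (- (\<xi> * - x)) * g \<xi>" 0] by simp
    also have "\<dots> = cnj (\<integral>\<xi>. cis (- (\<xi> * - x)) * g \<xi> \<partial>lborel)"
      by (simp add: gh cis_cnj flip: integral_cnj')
    finally show ?thesis by (simp add: ft_def)
  qed
  then have h: "ft g (- x) = of_real (h x)" for x unfolding h_def by (metis Reals_cnj_iff of_real_Re)
  note inv = ft_of_inverse[OF gi gs h]
  have d: "(\<lambda>x. 1 * f x + (-1) * h x) \<in> L2 Line" by (rule L2_line_linear[OF f(1) inv(1)])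
  have "AE x in lborel. 1 * f x + (-1) * h x = 0"
    by (rule ft_injective[OF d is_ft_linear[OF f(1) G(1) inv]]) (use gG in \<open>eventually_elim, simp\<close>)
  moreover have "continuous_on UNIV (\<lambda>x. 1 * f x + (-1) * h x)"
  proof -
    have "continuous_on UNIV (\<lambda>x. ft g (- x))"
    proof -
      have "((\<lambda>x. ft g (- x)) \<circ> r) \<longlonglongrightarrow> ft g (- x)" if r: "r \<longlonglongrightarrow> x" for r x
      proof -
        have "(\<lambda>i. \<integral>\<xi>. cis (- (\<xi> * - r i)) * g \<xi> \<partial>lborel) \<longlonglongrightarrow> (\<integral>\<xi>. cis (- (\<xi> * - x)) * g \<xi> \<partial>lborel)"
        proof (rule integral_dominated_convergence[where w = "\<lambda>\<xi>. cmod (g \<xi>)"])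
          show "integrable lborel (\<lambda>\<xi>. cmod (g \<xi>))" using gi by simp
          show "AE \<xi> in lborel. (\<lambda>i. cis (- (\<xi> * - r i)) * g \<xi>) \<longlonglongrightarrow> cis (- (\<xi> * - x)) * g \<xi>"
            using r by (auto intro!: tendsto_intros)
        qed (auto simp: norm_mult)
        then show ?thesis unfolding ft_def comp_def by (intro tendsto_intros)
      qed
      then show ?thesis by (auto simp: continuous_on_sequentially comp_def)
    qed
    then have "continuous_on UNIV h" unfolding h_def[abs_def] by (intro continuous_intros)
    then show ?thesis using f(2) by (intro continuous_intros)
  qed
  ultimately have "1 * f x + (-1) * h x = 0"
    using continuous_AE_zero[of "\<lambda>x. 1 * f x + (-1) * h x" UNIV x] by simp
  then have "of_real (f x) = ft g (- x)" using h[of x] by simp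
  also have "\<dots> = of_real (1 / sqrt (2 * pi)) * (\<integral>\<xi>. G \<xi> * cis (x * \<xi>) \<partial>lborel)"
    unfolding ft_def
    by (rule arg_cong[where f = "\<lambda>z. _ * z"], rule integral_cong_AE) (use gG in \<open>auto elim!: eventually_mono simp: mult.commute\<close>)
  finally show ?thesis .
qed

lemma fourier_line_cong:
  assumes "f \<in> borel_measurable borel" "g \<in> borel_measurable borel" "AE x in lborel. f x = g x"
  shows "fourier Line f = fourier Line g"
proof -
  have "truncated_fourier R f = truncated_fourier R g" for R
  proof
    fix \<xi>
    have "(\<integral>x. cis (- (x * \<xi>)) * cut R f x \<partial>lborel) = (\<integral>x. cis (- (x * \<xi>)) * cut R g x \<partial>lborel)"
      by (rule integral_cong_AE) (use assms cut_measurable[OF assms(1), of R] cut_measurable[OF assms(2), of R] in \<open>auto simp: cut_def elim!: eventually_mono\<close>)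
    then show "truncated_fourier R f \<xi> = truncated_fourier R g \<xi>" by (simp add: truncated_fourier_ft ft_def)
  qed
  then show ?thesis by (simp add: fourier_def)
qed

section \<open>Fourier series\<close>

definition zero_coeffs :: "(real \<Rightarrow> complex) \<Rightarrow> bool" where
  "zero_coeffs G \<longleftrightarrow> continuous_on UNIV G \<and> (\<forall>m::int. (\<integral>x. indicator {0..1} x *\<^sub>R (cis (- (2 * pi * m * x)) * G x) \<partial>lborel) = 0)"

text \<open>Functions whose multiplication preserves the vanishing of all Fourier coefficients. The
  class is closed under sums and products, which suits induction over polynomial functions.\<close>

definition multiplier :: "(real \<Rightarrow> complex) \<Rightarrow> bool" where
  "multiplier \<psi> \<longleftrightarrow> (\<forall>G. zero_coeffs G \<longrightarrow> zero_coeffs (\<lambda>x. \<psi> x * G x))"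

lemma Icc_integrable:
  fixes G :: "real \<Rightarrow> complex"
  assumes "continuous_on UNIV G"
  shows "integrable lborel (\<lambda>x. indicator {0..1} x *\<^sub>R G x)"
  by (rule borel_integrable_compact) (use assms continuous_on_subset in auto)

lemma Icc_integrable_cis:
  fixes G :: "real \<Rightarrow> complex"
  assumes "continuous_on UNIV G"
  shows "integrable lborel (\<lambda>x. indicator {0..1} x *\<^sub>R (cis (a * x) * G x))"
  by (rule Icc_integrable) (use assms in \<open>auto intro!: continuous_intros simp: cis_conv_exp\<close>)

lemma multiplier_add:
  assumes "multiplier f" "multiplier g"
  shows "multiplier (\<lambda>x. f x + g x)"
  unfolding multiplier_def
proof (intro allI impI)
  fix G assume G: "zero_coeffs G"
  have f: "zero_coeffs (\<lambda>x. f x * G x)" and g: "zero_coeffs (\<lambda>x. g x * G x)"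
    using assms G by (auto simp: multiplier_def)
  have c: "continuous_on UNIV (\<lambda>x. f x * G x)" "continuous_on UNIV (\<lambda>x. g x * G x)"
    using f g by (auto simp: zero_coeffs_def)
  show "zero_coeffs (\<lambda>x. (f x + g x) * G x)"
    unfolding zero_coeffs_def
  proof (intro conjI allI)
    show "continuous_on UNIV (\<lambda>x. (f x + g x) * G x)"
      using continuous_on_add[OF c] by (simp add: distrib_right)
    fix m :: int
    have "(\<integral>x. indicator {0..1} x *\<^sub>R (cis (- (2 * pi * m * x)) * ((f x + g x) * G x)) \<partial>lborel)
       = (\<integral>x. indicator {0..1} x *\<^sub>R (cis (- (2 * pi * m) * x) * (f x * G x)) + indicator {0..1} x *\<^sub>R (cis (- (2 * pi * m) * x) * (g x * G x)) \<partial>lborel)"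
      by (rule Bochner_Integration.integral_cong) (auto simp: algebra_simps)
    also have "\<dots> = (\<integral>x. indicator {0..1} x *\<^sub>R (cis (- (2 * pi * m) * x) * (f x * G x)) \<partial>lborel) + (\<integral>x. indicator {0..1} x *\<^sub>R (cis (- (2 * pi * m) * x) * (g x * G x)) \<partial>lborel)"
      by (rule Bochner_Integration.integral_add[OF Icc_integrable_cis[OF c(1)] Icc_integrable_cis[OF c(2)]])
    also have "\<dots> = 0" using f g by (simp add: zero_coeffs_def)
    finally show "(\<integral>x. indicator {0..1} x *\<^sub>R (cis (- (2 * pi * m * x)) * ((f x + g x) * G x)) \<partial>lborel) = 0" .
  qed
qed

lemma multiplier_mult: "multiplier f \<Longrightarrow> multiplier g \<Longrightarrow> multiplier (\<lambda>x. f x * g x)"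
  by (simp add: multiplier_def mult.assoc)

lemma multiplier_cis: "multiplier (\<lambda>x. c * cis (2 * pi * of_int n * x))"
  unfolding multiplier_def
proof (intro allI impI)
  fix G assume G: "zero_coeffs G"
  show "zero_coeffs (\<lambda>x. c * cis (2 * pi * of_int n * x) * G x)"
    unfolding zero_coeffs_def
  proof (intro conjI allI)
    show "continuous_on UNIV (\<lambda>x. c * cis (2 * pi * of_int n * x) * G x)"
      using G unfolding zero_coeffs_def cis_conv_exp by (auto intro!: continuous_intros)
    fix m :: int
    have "(\<integral>x. indicator {0..1} x *\<^sub>R (cis (- (2 * pi * m * x)) * (c * cis (2 * pi * of_int n * x) * G x)) \<partial>lborel)
       = (\<integral>x. c * (indicator {0..1} x *\<^sub>R (cis (- (2 * pi * (m - n) * x)) * G x)) \<partial>lborel)"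
    proof (rule Bochner_Integration.integral_cong[OF refl])
      fix x
      have "cis (- (2 * pi * (m - n) * x)) = cis (- (2 * pi * m * x)) * cis (2 * pi * of_int n * x)"
        by (simp add: cis_mult algebra_simps)
      then show "indicator {0..1} x *\<^sub>R (cis (- (2 * pi * m * x)) * (c * cis (2 * pi * of_int n * x) * G x))
        = c * (indicator {0..1} x *\<^sub>R (cis (- (2 * pi * (m - n) * x)) * G x))" by (simp add: mult_ac)
    qed
    also have "\<dots> = c * (\<integral>x. indicator {0..1} x *\<^sub>R (cis (- (2 * pi * (m - n) * x)) * G x) \<partial>lborel)"
      by (rule integral_mult_right_zero)
    also have "(\<integral>x. indicator {0..1} x *\<^sub>R (cis (- (2 * pi * (m - n) * x)) * G x) \<partial>lborel) = 0"
      using G by (simp only: zero_coeffs_def of_int_diff[symmetric])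
    finally show "(\<integral>x. indicator {0..1} x *\<^sub>R (cis (- (2 * pi * m * x)) * (c * cis (2 * pi * of_int n * x) * G x)) \<partial>lborel) = 0" by simp
  qed
qed

text \<open>On the unit circle a real polynomial function is a trigonometric polynomial; the
  induction needs only that real linear maps become combinations of two exponentials.\<close>

lemma multiplier_polynomial:
  assumes "real_polynomial_function g"
  shows "multiplier (\<lambda>x. of_real (g (cis (2 * pi * x))))"
  using assms
proof (induction g rule: real_polynomial_function.induct)
  case (linear L)
  interpret bounded_linear L by fact
  \<comment> \<open>From L (cis t) = cos t L(1) + sin t L(i), with Euler's formulas for cosine and
    sine.\<close>
  let ?a = "of_real (L 1) / 2 + of_real (L \<i>) / (2 * \<i>)" and ?b = "of_real (L 1) / 2 - of_real (L \<i>) / (2 * \<i>)"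
  have "of_real (L (cis t)) = ?a * cis t + ?b * cis (- t)" for t
  proof -
    have "cis t = cos t *\<^sub>R 1 + sin t *\<^sub>R \<i>" by (simp add: complex_eq_iff)
    then have "L (cis t) = cos t * L 1 + sin t * L \<i>" by (simp only: add scale) simp
    then show ?thesis by (simp add: complex_eq_iff field_simps)
  qed
  then have e: "of_real (L (cis (2 * pi * x))) = ?a * cis (2 * pi * of_int 1 * x) + ?b * cis (2 * pi * of_int (-1) * x)" for x by simp
  show ?case unfolding e by (intro multiplier_add multiplier_cis)
next
  case (const c)
  show ?case using multiplier_cis[of "of_real c" 0] by simp
next
  case (add f g) then show ?case using multiplier_add by simp
next
  case (mult f g) then show ?case using multiplier_mult by simp
qed

lemma periodic_int:
  fixes F :: "real \<Rightarrow> 'b"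
  assumes "\<And>x. F (x + 1) = F x"
  shows "F (x + of_int n) = F x"
proof -
  have nat: "F (x + of_nat k) = F x" for x k
  proof (induction k)
    case (Suc k) then show ?case using assms[of "x + of_nat k"] by (simp add: algebra_simps)
  qed simp
  show ?thesis
  proof (cases "0 \<le> n")
    case True then show ?thesis using nat[of x "nat n"] by simp
  next
    case False then show ?thesis using nat[of "x + of_int n" "nat (- n)"] by simp
  qed
qed

text \<open>
  By Stone--Weierstrass on the unit circle, \<open>F\<close> is a uniform limit of trigonometric polynomials,
  and it is orthogonal to all of them.
\<close>

lemma circle_uniqueness:
  fixes F :: "real \<Rightarrow> real"
  assumes c: "continuous_on UNIV F" and per: "\<And>x. F (x + 1) = F x"
    and z: "\<And>m::int. (\<integral>x. indicator {0..1} x *\<^sub>R (cis (- (2 * pi * m * x)) * of_real (F x)) \<partial>lborel) = 0"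
  shows "F x = 0"
proof -
  define \<Phi> where "\<Phi> z = F (Arg2pi z / (2 * pi))" for z
  have cz: "cis (Arg2pi z) = z" if "cmod z = 1" for z
    using Arg2pi_eq[of z] that by (simp add: cis_conv_exp)
  have \<Phi>: "\<Phi> (cis (2 * pi * x)) = F x" if "x \<in> {0..1}" for x
  proof (cases "x = 1")
    case True
    then show ?thesis using per[of 0] Arg2pi_of_real[of 1] by (simp add: \<Phi>_def)
  next
    case False
    have "Arg2pi (cis (2 * pi * x)) = 2 * pi * x"
      by (rule Arg2pi_unique[of 1]) (use that False in \<open>auto simp: cis_conv_exp\<close>)
    then show ?thesis by (simp add: \<Phi>_def)
  qed
  \<comment> \<open>The argument jumps at 1, so continuity is obtained from closed sets: their
    preimages are images of compact subsets of [0, 1], where periodicity identifies the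
    endpoints.\<close>
  have "continuous_on (sphere 0 1) \<Phi>"
  proof (subst continuous_on_closed_vimage, simp, intro allI impI)
    fix B :: "real set" assume B: "closed B"
    have "\<Phi> -` B \<inter> sphere 0 1 = (\<lambda>x. cis (2 * pi * x)) ` ({0..1} \<inter> F -` B)"
    proof (intro equalityI subsetI)
      fix z assume z: "z \<in> \<Phi> -` B \<inter> sphere 0 1"
      let ?x = "Arg2pi z / (2 * pi)"
      have "?x \<in> {0..1}" using Arg2pi[of z] by (simp add: field_simps)
      moreover have "cis (2 * pi * ?x) = z" using cz z by simp
      moreover have "F ?x \<in> B" using z by (simp add: \<Phi>_def)
      ultimately show "z \<in> (\<lambda>x. cis (2 * pi * x)) ` ({0..1} \<inter> F -` B)" by (metis IntI image_eqI vimageI2)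
    qed (use \<Phi> in auto)
    moreover have "compact ((\<lambda>x. cis (2 * pi * x)) ` ({0..1} \<inter> F -` B))"
    proof (rule compact_continuous_image)
      show "continuous_on ({0..1} \<inter> F -` B) (\<lambda>x. cis (2 * pi * x))"
        unfolding cis_conv_exp by (intro continuous_intros)
      have "closed (F -` B)" using c B by (simp add: closed_vimage)
      then show "compact ({0..1} \<inter> F -` B)" by (intro compact_Int_closed) auto
    qed
    ultimately show "closed (\<Phi> -` B \<inter> sphere 0 1)" by (simp add: compact_imp_closed)
  qed
  note cont = this
  have FG: "zero_coeffs (\<lambda>x. of_real (F x))"
    using c z by (auto simp: zero_coeffs_def intro!: continuous_intros)
  let ?I = "\<lambda>h. \<integral>x. indicator {0..1} x *\<^sub>R (h x :: real) \<partial>lborel"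
  have int: "integrable lborel (\<lambda>x. indicator {0..1} x *\<^sub>R h x)" if "continuous_on UNIV h" for h :: "real \<Rightarrow> real"
    by (rule borel_integrable_compact) (use that continuous_on_subset in auto)
  have iF2: "integrable lborel (\<lambda>x. indicator {0..1} x *\<^sub>R (F x)\<^sup>2)" using c by (intro int continuous_intros)
  have iF: "integrable lborel (\<lambda>x. indicator {0..1} x *\<^sub>R \<bar>F x\<bar>)" using c by (intro int continuous_intros)
  \<comment> \<open>Orthogonality replaces F^2 by (F - g) F for a polynomial \<open>g\<close> that
    is uniformly within \<open>e\<close> of F.\<close>
  have le: "?I (\<lambda>x. (F x)\<^sup>2) \<le> e * ?I (\<lambda>x. \<bar>F x\<bar>)" if e: "e > 0" for e
  proof -
    obtain g where g: "real_polynomial_function g" "\<And>z. z \<in> sphere 0 1 \<Longrightarrow> \<bar>\<Phi> z - g z\<bar> < e"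
      using Stone_Weierstrass_real_polynomial_function[OF compact_sphere cont e] by blast
    have cg: "continuous_on UNIV (\<lambda>x. g (cis (2 * pi * x)))"
      unfolding cis_conv_exp
      by (rule continuous_on_compose2[OF continuous_on_polymonial_function[of g UNIV]])
        (use g in \<open>auto simp: real_polynomial_function_eq intro!: continuous_intros\<close>)
    have igF: "integrable lborel (\<lambda>x. indicator {0..1} x *\<^sub>R (g (cis (2 * pi * x)) * F x))" using c cg by (intro int continuous_intros)
    have "zero_coeffs (\<lambda>x. of_real (g (cis (2 * pi * x))) * of_real (F x))"
      using multiplier_polynomial[OF g(1)] FG by (simp add: multiplier_def)
    then have "(\<integral>x. indicator {0..1} x *\<^sub>R (cis (- (2 * pi * of_int 0 * x)) * (of_real (g (cis (2 * pi * x))) * of_real (F x))) \<partial>lborel) = (0::complex)"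
      unfolding zero_coeffs_def by blast
    then have "(\<integral>x. of_real (indicator {0..1} x *\<^sub>R (g (cis (2 * pi * x)) * F x)) \<partial>lborel) = (0::complex)"
      by (simp add: scaleR_conv_of_real)
    then have g0: "?I (\<lambda>x. g (cis (2 * pi * x)) * F x) = 0" by (simp only: integral_complex_of_real of_real_eq_0_iff)
    have "?I (\<lambda>x. (F x)\<^sup>2) = ?I (\<lambda>x. (F x)\<^sup>2) - ?I (\<lambda>x. g (cis (2 * pi * x)) * F x)" using g0 by simp
    also have "\<dots> = (\<integral>x. indicator {0..1} x *\<^sub>R (F x)\<^sup>2 - indicator {0..1} x *\<^sub>R (g (cis (2 * pi * x)) * F x) \<partial>lborel)"
      by (rule Bochner_Integration.integral_diff[OF iF2 igF, symmetric])
    also have "\<dots> \<le> (\<integral>x. e * (indicator {0..1} x *\<^sub>R \<bar>F x\<bar>) \<partial>lborel)"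
    proof (rule integral_mono)
      show "integrable lborel (\<lambda>x. indicator {0..1} x *\<^sub>R (F x)\<^sup>2 - indicator {0..1} x *\<^sub>R (g (cis (2 * pi * x)) * F x))"
        using iF2 igF by simp
      show "integrable lborel (\<lambda>x. e * (indicator {0..1} x *\<^sub>R \<bar>F x\<bar>))" using iF by simp
      fix x :: real
      show "indicator {0..1} x *\<^sub>R (F x)\<^sup>2 - indicator {0..1} x *\<^sub>R (g (cis (2 * pi * x)) * F x) \<le> e * (indicator {0..1} x *\<^sub>R \<bar>F x\<bar>)"
      proof (cases "x \<in> {0..1}")
        case True
        have "(F x)\<^sup>2 - g (cis (2 * pi * x)) * F x = (\<Phi> (cis (2 * pi * x)) - g (cis (2 * pi * x))) * F x"
          using \<Phi>[OF True] by (simp add: power2_eq_square algebra_simps)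
        also have "\<dots> \<le> \<bar>\<Phi> (cis (2 * pi * x)) - g (cis (2 * pi * x))\<bar> * \<bar>F x\<bar>"
          by (simp add: abs_mult[symmetric])
        also have "\<dots> \<le> e * \<bar>F x\<bar>" using g(2)[of "cis (2 * pi * x)"] by (intro mult_right_mono) auto
        finally show ?thesis using True by simp
      qed simp
    qed
    also have "\<dots> = e * ?I (\<lambda>x. \<bar>F x\<bar>)" by (rule integral_mult_right_zero)
    finally show ?thesis .
  qed
  have I0: "0 \<le> ?I (\<lambda>x. \<bar>F x\<bar>)" by (rule integral_nonneg_AE) simp
  have "?I (\<lambda>x. (F x)\<^sup>2) \<le> 0"
  proof (rule field_le_epsilon)
    fix e :: real assume e: "e > 0"
    have aux: "0 < e / (A + 1) \<and> e / (A + 1) * A \<le> e" if "0 \<le> A" for A :: real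
      using that e by (auto simp: field_simps)
    have "?I (\<lambda>x. (F x)\<^sup>2) \<le> e / (?I (\<lambda>x. \<bar>F x\<bar>) + 1) * ?I (\<lambda>x. \<bar>F x\<bar>)"
      by (rule le) (use aux[OF I0] in blast)
    then show "?I (\<lambda>x. (F x)\<^sup>2) \<le> 0 + e" using aux[OF I0] by linarith
  qed
  moreover have "0 \<le> ?I (\<lambda>x. (F x)\<^sup>2)" by (rule integral_nonneg_AE) simp
  ultimately have "?I (\<lambda>x. (F x)\<^sup>2) = 0" by (rule antisym)
  then have "AE x in lborel. indicator {0..1} x *\<^sub>R (F x)\<^sup>2 = 0"
    using integral_nonneg_eq_0_iff_AE[OF iF2] by simp
  then have ae: "AE x in lborel. x \<in> {0..1} \<longrightarrow> F x = 0" by eventually_elim auto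
  have z01: "F x = 0" if x: "x \<in> {0<..<1}" for x
    by (rule continuous_AE_zero[OF c _ x]) (use ae in \<open>auto elim!: eventually_mono\<close>)
  have z02: "F x = 0" if x: "x \<in> {0..1}" for x
  proof -
    have "closure {0<..<1::real} = {0..1}" by simp
    moreover have "closed {x. F x = 0}" using c by (simp add: closed_Collect_eq)
    moreover have "{0<..<1} \<subseteq> {x. F x = 0}" using z01 by blast
    ultimately have "{0..1} \<subseteq> {x. F x = 0}" using closure_minimal[of "{0<..<1}" "{x. F x = 0}"] by simp
    then show ?thesis using x by auto
  qed
  have "F x = F (frac x + of_int \<lfloor>x\<rfloor>)" by (simp add: frac_def)
  also have "\<dots> = F (frac x)" by (rule periodic_int[of F, OF per])
  also have "\<dots> = 0" by (rule z02) (simp add: frac_ge_0 less_imp_le[OF frac_lt_1])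
  finally show ?thesis .
qed

section \<open>The line and the circle as frequency spaces\<close>

text \<open>\<open>c\<close> is the constant of the inversion formula. The transform scaled by
  \<open>c\<close> turns products into convolutions without a constant, and c \<le> 1 keeps its
  norms below the unscaled ones. Identities are required almost everywhere, since on the line a
  transform is determined up to null sets; \<open>F_nn_integral\<close> and \<open>F_AE\<close> move
  integrals from real frequencies to the group.\<close>

locale fourier_space = freq_space \<mu> \<omega> for \<mu> :: "'a::ab_group_add measure" and \<omega> +
  fixes X :: domain and c :: real
  assumes c_pos: "0 < c" and c_le1: "c \<le> 1"
    and F_measurable: "\<And>f. f \<in> L2 X \<Longrightarrow> (\<lambda>\<xi>. fourier X f (\<omega> \<xi>)) \<in> borel_measurable \<mu>"
    and F_linear: "\<And>f g a b. f \<in> L2 X \<Longrightarrow> g \<in> L2 X \<Longrightarrow> (\<lambda>x. a * f x + b * g x) \<in> L2 X \<and>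
      (AE \<xi> in \<mu>. fourier X (\<lambda>x. a * f x + b * g x) (\<omega> \<xi>) = of_real a * fourier X f (\<omega> \<xi>) + of_real b * fourier X g (\<omega> \<xi>))"
    and F_hermitian: "\<And>f. f \<in> L2 X \<Longrightarrow> AE \<xi> in \<mu>. fourier X f (\<omega> (- \<xi>)) = cnj (fourier X f (\<omega> \<xi>))"
    and F_inversion: "\<And>f x. f \<in> L2 X \<Longrightarrow> continuous_on UNIV f \<Longrightarrow> integrable \<mu> (\<lambda>\<xi>. fourier X f (\<omega> \<xi>)) \<Longrightarrow>
      of_real (f x) = of_real c * synth (\<lambda>\<xi>. fourier X f (\<omega> \<xi>)) x"
    and F_synthesis: "\<And>g h. integrable \<mu> g \<Longrightarrow> sq \<mu> g \<Longrightarrow> (\<And>x. of_real (h x) = of_real c * synth g x) \<Longrightarrow>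
      h \<in> L2 X \<and> (AE \<xi> in \<mu>. fourier X h (\<omega> \<xi>) = g \<xi>)"
    and F_cong: "\<And>f g. f \<in> L2 X \<Longrightarrow> g \<in> L2 X \<Longrightarrow> AE x in space_measure X. f x = g x \<Longrightarrow>
      AE \<xi> in \<mu>. fourier X f (\<omega> \<xi>) = fourier X g (\<omega> \<xi>)"
    and F_nn_integral: "\<And>F. (\<integral>\<^sup>+\<xi>. F \<xi> \<partial>freq_measure X) = (\<integral>\<^sup>+\<xi>. F (\<omega> \<xi>) \<partial>\<mu>)"
    and F_AE: "\<And>P. (AE \<xi> in freq_measure X. P \<xi>) \<longleftrightarrow> (AE \<xi> in \<mu>. P (\<omega> \<xi>))"

lemma line_freq_space: "freq_space (lborel :: real measure) (\<lambda>x. x)"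
proof (intro freq_space.intro freq_space_axioms.intro sigma_finite_lborel)
  show "(\<lambda>p. fst p - snd p) \<in> measurable (lborel \<Otimes>\<^sub>M lborel) (lborel :: real measure)"
    by (simp add: measurable_lborel1) measurable
  show "distr lborel lborel (\<lambda>x. x + a) = lborel" for a :: real
    using lborel_distr_plus[of a] by (simp add: add.commute cong: distr_cong)
  show "distr lborel lborel uminus = (lborel :: real measure)"
    using lborel_distr_uminus by (simp cong: distr_cong)
  show "emeasure lborel {x. a \<le> x \<and> x < b} \<le> ennreal (2 * (b - a))" if "1 \<le> b - a" for a b :: real
  proof -
    have "{x. a \<le> x \<and> x < b} \<subseteq> {a..b}" by auto
    then have "emeasure lborel {x. a \<le> x \<and> x < b} \<le> emeasure lborel {a..b}" by (rule emeasure_mono) simp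
    also have "\<dots> = ennreal (b - a)" using that by simp
    also have "\<dots> \<le> ennreal (2 * (b - a))" using that by (intro ennreal_leI) simp
    finally show ?thesis .
  qed
qed simp_all

lemma line_synth: "freq_space.synth lborel (\<lambda>x. x) u x = (\<integral>\<xi>. u \<xi> * cis (x * \<xi>) \<partial>lborel)"
  by (rule freq_space.synth_def[OF line_freq_space])

lemma line_fourier_space: "fourier_space (lborel :: real measure) (\<lambda>x. x) Line (1 / sqrt (2 * pi))"
proof (intro fourier_space.intro fourier_space_axioms.intro line_freq_space)
  show "0 < 1 / sqrt (2 * pi)" by simp
  have "1 \<le> sqrt (2 * pi)" using pi_ge_two by (intro real_le_rsqrt) simp
  then show "1 / sqrt (2 * pi) \<le> 1" by (simp add: divide_le_eq)
  fix f :: "real \<Rightarrow> real" assume f: "f \<in> L2 Line"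
  note F = fourier_is_ft[OF f]
  show "(\<lambda>\<xi>. fourier Line f \<xi>) \<in> borel_measurable lborel" using F by (simp add: is_ft_def sq_def)
  show "AE \<xi> in lborel. fourier Line f (- \<xi>) = cnj (fourier Line f \<xi>)" by (rule is_ft_hermitian[OF f F])
  show "of_real (f x) = of_real (1 / sqrt (2 * pi)) * freq_space.synth lborel (\<lambda>x. x) (\<lambda>\<xi>. fourier Line f \<xi>) x"
    if "continuous_on UNIV f" "integrable lborel (\<lambda>\<xi>. fourier Line f \<xi>)" for x
    unfolding line_synth by (rule line_inversion[OF f that(1) F that(2)])
  fix g assume g: "g \<in> L2 Line"
  note G = fourier_is_ft[OF g]
  show "(\<lambda>x. a * f x + b * g x) \<in> L2 Line \<and> (AE \<xi> in lborel. fourier Line (\<lambda>x. a * f x + b * g x) \<xi> = of_real a * fourier Line f \<xi> + of_real b * fourier Line g \<xi>)" for a b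
    using L2_line_linear[OF f g] is_ft_unique[OF L2_line_linear[OF f g] fourier_is_ft[OF L2_line_linear[OF f g]] is_ft_linear[OF f F g G]] by blast
  show "AE \<xi> in lborel. fourier Line f \<xi> = fourier Line g \<xi>" if "AE x in space_measure Line. f x = g x"
  proof -
    have "space_measure Line = lborel" by (simp add: space_measure_def)
    with that have "AE x in lborel. f x = g x" by (simp only:)
    then show ?thesis using fourier_line_cong[of f g] f g by (simp add: L2_line)
  qed
next
  fix g h assume g: "integrable lborel g" "sq lborel g" and h: "\<And>x. of_real (h x) = of_real (1 / sqrt (2 * pi)) * freq_space.synth lborel (\<lambda>x. x) g x"
  have e: "ft g (- x) = of_real (h x)" for x
    unfolding h ft_def line_synth by (simp add: mult.commute)
  note inv = ft_of_inverse[OF g e]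
  show "h \<in> L2 Line \<and> (AE \<xi> in lborel. fourier Line h \<xi> = g \<xi>)"
    using inv is_ft_unique[OF inv(1) fourier_is_ft[OF inv(1)] inv(2)] by blast
next
  show "(\<integral>\<^sup>+\<xi>. F \<xi> \<partial>freq_measure Line) = (\<integral>\<^sup>+\<xi>. F \<xi> \<partial>lborel)" for F by (simp add: freq_measure_def)
  show "(AE \<xi> in freq_measure Line. P \<xi>) \<longleftrightarrow> (AE \<xi> in lborel. P \<xi>)" for P
  proof -
    have "freq_measure Line = lborel" by (simp add: freq_measure_def)
    then show ?thesis by (simp only:)
  qed
qed

lemma circle_freq_space: "freq_space (count_space UNIV :: int measure) (\<lambda>k. 2 * pi * of_int k)"
proof (intro freq_space.intro freq_space_axioms.intro)
  show "sigma_finite_measure (count_space (UNIV :: int set))" by (rule sigma_finite_measure_count_space)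
  show "(\<lambda>p. fst p - snd p) \<in> measurable (count_space UNIV \<Otimes>\<^sub>M count_space UNIV) (count_space (UNIV :: int set))"
    by (simp add: pair_measure_countable)
  show "distr (count_space UNIV) (count_space UNIV) (\<lambda>x. x + a) = count_space UNIV" for a :: int
    by (rule distr_bij_count_space) (rule bij_betwI[of _ _ _ "\<lambda>x. x - a"], auto)
  show "distr (count_space UNIV) (count_space UNIV) uminus = count_space (UNIV :: int set)"
    by (rule distr_bij_count_space) (rule bij_betwI[of _ _ _ uminus], auto)
  show "emeasure (count_space UNIV) {k::int. a \<le> 2 * pi * of_int k \<and> 2 * pi * of_int k < b} \<le> ennreal (2 * (b - a))" if ab: "1 \<le> b - a" for a b :: real
  proof -
    have sub: "{k::int. a \<le> 2 * pi * of_int k \<and> 2 * pi * of_int k < b} \<subseteq> {\<lceil>a / (2 * pi)\<rceil>..\<lfloor>b / (2 * pi)\<rfloor>}"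
      by (auto simp: ceiling_le_iff le_floor_iff field_simps)
    have "emeasure (count_space UNIV) {k::int. a \<le> 2 * pi * of_int k \<and> 2 * pi * of_int k < b} \<le> emeasure (count_space UNIV) {\<lceil>a / (2 * pi)\<rceil>..\<lfloor>b / (2 * pi)\<rfloor>}"
      by (rule emeasure_mono[OF sub]) simp
    also have "\<dots> = ennreal (real (nat (\<lfloor>b / (2 * pi)\<rfloor> + 1 - \<lceil>a / (2 * pi)\<rceil>)))"
      by (simp add: emeasure_count_space_finite ennreal_of_nat_eq_real_of_nat)
    also have "\<dots> \<le> ennreal (2 * (b - a))"
    proof (rule ennreal_leI)
      \<comment> \<open>The number of integers is at most length/(2 pi) + 1; the 1 is absorbed
        because the interval has length at least 1.\<close>
      have "real_of_int (\<lfloor>b / (2 * pi)\<rfloor> + 1 - \<lceil>a / (2 * pi)\<rceil>) \<le> (b - a) / (2 * pi) + 1"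
        using of_int_floor_le[of "b / (2 * pi)"] le_of_int_ceiling[of "a / (2 * pi)"]
        unfolding of_int_diff of_int_add of_int_1 diff_divide_distrib by linarith
      moreover have "(b - a) / (2 * pi) \<le> (b - a) / 1" using ab pi_ge_two by (intro divide_left_mono) auto
      ultimately have "real_of_int (\<lfloor>b / (2 * pi)\<rfloor> + 1 - \<lceil>a / (2 * pi)\<rceil>) \<le> 2 * (b - a)" using ab by simp
      moreover have "real (nat z) \<le> y" if "real_of_int z \<le> y" "0 \<le> y" for z y
        using that by (cases "0 \<le> z") auto
      ultimately show "real (nat (\<lfloor>b / (2 * pi)\<rfloor> + 1 - \<lceil>a / (2 * pi)\<rceil>)) \<le> 2 * (b - a)" using ab by simp
    qed
    finally show ?thesis .
  qed
qed (simp_all add: algebra_simps)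

abbreviation fourier_series :: "(int \<Rightarrow> complex) \<Rightarrow> real \<Rightarrow> complex" where
  "fourier_series \<equiv> freq_space.synth (count_space UNIV) (\<lambda>k. 2 * pi * of_int k)"

lemmas fourier_series_def = freq_space.synth_def[OF circle_freq_space]
lemmas fourier_series_continuous = freq_space.synth_continuous[OF circle_freq_space]

lemma fourier_circle: "fourier Circle f \<xi> = (\<integral>x. indicator {0..1} x *\<^sub>R (cis (- (x * \<xi>)) * of_real (f x)) \<partial>lborel)"
  by (simp add: fourier_def set_lebesgue_integral_def)

lemma L2_circle:
  "f \<in> L2 Circle \<longleftrightarrow> f \<in> borel_measurable borel \<and> (\<forall>x. f (x + 1) = f x) \<and> integrable lborel (\<lambda>x. indicator {0..1} x *\<^sub>R (f x)\<^sup>2)"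
  by (auto simp: L2_def space_measure_def integrable_restrict_space)

lemma L2_circle_sq:
  assumes "f \<in> L2 Circle"
  shows "sq lborel (\<lambda>x. indicator {0..1} x * of_real (f x))"
proof -
  have [measurable]: "f \<in> borel_measurable borel" using assms by (simp add: L2_circle)
  have "(\<lambda>x. (cmod (indicator {0..1} x * of_real (f x)))\<^sup>2) = (\<lambda>x. indicator {0..1} x *\<^sub>R (f x)\<^sup>2)"
    by (auto simp: indicator_def)
  then show ?thesis using assms by (simp add: sq_def L2_circle)
qed

lemma sq_circle_L2:
  assumes "f \<in> borel_measurable borel" "\<And>x. f (x + 1) = f x" "sq lborel (\<lambda>x. indicator {0..1} x * of_real (f x))"
  shows "f \<in> L2 Circle"
proof -
  have "(\<lambda>x. (cmod (indicator {0..1} x * of_real (f x)))\<^sup>2) = (\<lambda>x. indicator {0..1} x *\<^sub>R (f x)\<^sup>2)"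
    by (auto simp: indicator_def)
  then show ?thesis using assms by (simp add: sq_def L2_circle)
qed

lemma L2_circle_integrand:
  assumes "f \<in> L2 Circle"
  shows "integrable lborel (\<lambda>x. indicator {0..1} x *\<^sub>R (cis (- (x * \<xi>)) * of_real (f x)))"
proof -
  have s: "sq lborel (\<lambda>x. indicator {0..1::real} x :: complex)"
    using indicator_sq[of 1] by (rule sq_bound(1)) (auto simp: indicator_def)
  have "integrable lborel (\<lambda>x. indicator {0..1} x * (indicator {0..1} x * of_real (f x)) :: complex)"
    by (rule sq_mult_integrable[OF s L2_circle_sq[OF assms]])
  from integrable_mult_bounded[OF this, of "\<lambda>x. cis (- (x * \<xi>))" 1] show ?thesis
    by (rule Bochner_Integration.integrable_cong[THEN iffD1, rotated -1]) (auto simp: indicator_def)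
qed

lemma integral_cis_period:
  "(\<integral>x. indicator {0..1} x *\<^sub>R cis (2 * pi * of_int n * x) \<partial>lborel) = (if n = 0 then 1 else 0)"
proof (cases "n = 0")
  case True
  have "(\<integral>x. indicator {0..1::real} x *\<^sub>R (1::complex) \<partial>lborel) = (\<integral>x. of_real (indicator {0..1::real} x) \<partial>lborel)"
    by (rule Bochner_Integration.integral_cong) (auto simp: indicator_def)
  also have "\<dots> = of_real (\<integral>x. indicator {0..1::real} x \<partial>lborel)"
    by (rule integral_complex_of_real)
  also have "\<dots> = 1" by (simp add: content_real)
  finally have "(\<integral>x. indicator {0..1::real} x *\<^sub>R (1::complex) \<partial>lborel) = 1" .
  then show ?thesis using True by (simp add: content_real)
next
  case False
  let ?w = "2 * pi * of_int n :: real"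
  have w: "?w \<noteq> 0" using False by simp
  have "has_bochner_integral lborel (\<lambda>x. indicator {0..1} x *\<^sub>R (\<i> * of_real ?w * cis (x * ?w))) (cis (1 * ?w) - cis (0 * ?w))"
    by (rule has_bochner_integral_FTC_Icc)
      (auto intro!: has_vector_derivative_at_within cis_mult_has_vector_derivative continuous_intros simp del: of_real_mult simp: cis_conv_exp[of "_ * _", symmetric])
  moreover have "cis ?w = 1" by (rule cis_multiple_2pi) simp
  ultimately have "(\<integral>x. indicator {0..1} x *\<^sub>R (\<i> * of_real ?w * cis (x * ?w)) \<partial>lborel) = 0"
    by (simp only: has_bochner_integral_iff mult_1 mult_zero_left cis_zero diff_self)
  also have "(\<lambda>x. indicator {0..1} x *\<^sub>R (\<i> * of_real ?w * cis (x * ?w))) = (\<lambda>x. (\<i> * of_real ?w) * (indicator {0..1} x *\<^sub>R cis (?w * x)))"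
    by (simp add: fun_eq_iff mult_ac)
  finally have "(\<i> * of_real ?w) * (\<integral>x. indicator {0..1} x *\<^sub>R cis (?w * x) \<partial>lborel) = 0"
    by (simp only: integral_mult_right_zero)
  then show ?thesis using False by simp
qed

text \<open>Absolute summability of the coefficients permits exchanging sum and integral, after
  which orthogonality of the exponentials singles out one term.\<close>

lemma fourier_circle_synth:
  assumes g: "integrable (count_space UNIV) g" and h: "\<And>x. of_real (h x) = fourier_series g x"
  shows "h \<in> L2 Circle" "fourier Circle h (2 * pi * of_int m) = g m"
proof -
  have ch: "continuous_on UNIV h"
  proof -
    have "continuous_on UNIV (\<lambda>x. Re (fourier_series g x))" by (intro continuous_intros fourier_series_continuous[OF g])
    then show ?thesis by (simp flip: h)
  qed
  have per: "h (x + 1) = h x" for x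
  proof -
    have "cis ((x + 1) * (2 * pi * of_int k)) = cis (x * (2 * pi * of_int k))" for k :: int
    proof -
      have "cis ((x + 1) * (2 * pi * of_int k)) = cis (x * (2 * pi * of_int k)) * cis (2 * pi * of_int k)"
        by (simp add: cis_mult algebra_simps)
      also have "cis (2 * pi * of_int k) = 1" by (rule cis_multiple_2pi) simp
      finally show ?thesis by simp
    qed
    then have "fourier_series g (x + 1) = fourier_series g x" unfolding fourier_series_def by simp
    then show ?thesis by (simp flip: h)
  qed
  have "integrable lborel (\<lambda>x. indicator {0..1} x *\<^sub>R (h x)\<^sup>2)"
    by (rule borel_integrable_compact) (use ch in \<open>auto intro!: continuous_intros elim: continuous_on_subset\<close>)
  then show "h \<in> L2 Circle" using per ch by (simp add: L2_circle borel_measurable_continuous_onI)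
  let ?P = "lborel :: real measure" and ?C = "count_space UNIV :: int measure"
  interpret Q: pair_sigma_finite ?P ?C
    by (intro pair_sigma_finite.intro sigma_finite_lborel sigma_finite_measure_count_space)
  let ?F = "\<lambda>x k. (indicator {0..1} x * g k) * cis (2 * pi * of_int (k - m) * x)"
  have i1: "integrable ?P (\<lambda>x. indicator {0..1} x :: complex)"
    using Icc_integrable[of "\<lambda>_. 1"] by (simp add: scaleR_conv_of_real of_real_indicator)
  have [measurable]: "(\<lambda>p. real_of_int (snd p - m)) \<in> borel_measurable (?P \<Otimes>\<^sub>M ?C)"
    by (rule measurable_compose[OF measurable_snd]) simp
  then have cm: "(\<lambda>p. cis (2 * pi * real_of_int (snd p - m) * fst p)) \<in> borel_measurable (?P \<Otimes>\<^sub>M ?C)"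
    by (intro cis_measurable borel_measurable_times borel_measurable_const) measurable
  have ip: "integrable (?P \<Otimes>\<^sub>M ?C) (\<lambda>p. ?F (fst p) (snd p))"
    by (rule integrable_mult_bounded[OF Q.prod_integrable[OF i1 g], where c = 1]) (rule cm, simp)
  have "fourier Circle h (2 * pi * of_int m) = (\<integral>x. \<integral>k. ?F x k \<partial>?C \<partial>?P)"
    unfolding fourier_circle
  proof (rule Bochner_Integration.integral_cong[OF refl])
    fix x :: real
    have "indicator {0..1} x *\<^sub>R (cis (- (x * (2 * pi * of_int m))) * of_real (h x))
       = (indicator {0..1} x * cis (- (x * (2 * pi * of_int m)))) * (\<integral>k. g k * cis (x * (2 * pi * of_int k)) \<partial>?C)"
      unfolding h fourier_series_def by (simp add: indicator_def)
    also have "\<dots> = (\<integral>k. (indicator {0..1} x * cis (- (x * (2 * pi * of_int m)))) * (g k * cis (x * (2 * pi * of_int k))) \<partial>?C)"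
      by (rule integral_mult_right_zero[symmetric])
    also have "\<dots> = (\<integral>k. ?F x k \<partial>?C)"
    proof (rule Bochner_Integration.integral_cong[OF refl])
      fix k
      have "cis (2 * pi * of_int (k - m) * x) = cis (- (x * (2 * pi * of_int m))) * cis (x * (2 * pi * of_int k))"
        by (simp add: cis_mult algebra_simps)
      then show "(indicator {0..1} x * cis (- (x * (2 * pi * of_int m)))) * (g k * cis (x * (2 * pi * of_int k))) = ?F x k" by simp
    qed
    finally show "indicator {0..1} x *\<^sub>R (cis (- (x * (2 * pi * of_int m))) * of_real (h x)) = (\<integral>k. ?F x k \<partial>?C)" .
  qed
  also have "\<dots> = (\<integral>k. \<integral>x. ?F x k \<partial>?P \<partial>?C)"
    using Q.Fubini_integral[of ?F] ip by (simp add: case_prod_unfold)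
  also have "\<dots> = (\<integral>k. g k * (if k = m then 1 else 0) \<partial>?C)"
  proof (rule Bochner_Integration.integral_cong[OF refl])
    fix k
    have "(\<integral>x. ?F x k \<partial>?P) = (\<integral>x. g k * (indicator {0..1} x *\<^sub>R cis (2 * pi * of_int (k - m) * x)) \<partial>?P)"
      by (rule Bochner_Integration.integral_cong) (auto simp: indicator_def)
    also have "\<dots> = g k * (\<integral>x. indicator {0..1} x *\<^sub>R cis (2 * pi * of_int (k - m) * x) \<partial>?P)" by (rule integral_mult_right_zero)
    finally show "(\<integral>x. ?F x k \<partial>?P) = g k * (if k = m then 1 else 0)" unfolding integral_cis_period by simp
  qed
  also have "\<dots> = g m"
  proof -
    have e: "{k \<in> UNIV. g k * (if k = m then 1 else 0) \<noteq> 0} = (if g m = 0 then {} else {m})"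
      by (auto split: if_splits)
    then have "finite {k \<in> UNIV. g k * (if k = m then 1 else 0) \<noteq> 0}" by simp
    from lebesgue_integral_count_space_finite_support[OF this] show ?thesis unfolding e by simp
  qed
  finally show "fourier Circle h (2 * pi * of_int m) = g m" .
qed

lemma circle_fourier_space: "fourier_space (count_space UNIV :: int measure) (\<lambda>k. 2 * pi * of_int k) Circle 1"
proof (intro fourier_space.intro fourier_space_axioms.intro circle_freq_space)
  fix f :: "real \<Rightarrow> real" assume f: "f \<in> L2 Circle"
  note fi = L2_circle_integrand[OF f]
  have [measurable]: "f \<in> borel_measurable borel" using f by (simp add: L2_circle)
  show "AE \<xi> in count_space UNIV. fourier Circle f (2 * pi * of_int (- \<xi>)) = cnj (fourier Circle f (2 * pi * of_int \<xi>))"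
    unfolding fourier_circle by (simp add: cis_cnj flip: integral_cnj')
  show "of_real (f x) = of_real 1 * fourier_series (\<lambda>\<xi>. fourier Circle f (2 * pi * of_int \<xi>)) x"
    if cf: "continuous_on UNIV f" and i: "integrable (count_space UNIV) (\<lambda>\<xi>::int. fourier Circle f (2 * pi * of_int \<xi>))" for x
  proof -
    let ?g = "\<lambda>k::int. fourier Circle f (2 * pi * of_int k)"
    \<comment> \<open>The sum of the Fourier series of \<open>f\<close>, real since the coefficients
      are hermitian. Then \<open>f - h\<close> is continuous with vanishing coefficients, and
      \<open>circle_uniqueness\<close> applies.\<close>
    define h where "h x = Re (fourier_series ?g x)" for x
    have "freq_space.reflect ?g = ?g"
      unfolding freq_space.reflect_def[OF circle_freq_space, abs_def] fourier_circle by (simp add: cis_cnj flip: integral_cnj')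
    then have h: "of_real (h x) = fourier_series ?g x" for x
      unfolding h_def by (intro freq_space.synth_real[OF circle_freq_space, symmetric]) auto
    note hc = fourier_circle_synth[OF i h]
    have "f x - h x = 0"
    proof (rule circle_uniqueness[of "\<lambda>x. f x - h x"])
      have "continuous_on UNIV h"
        unfolding h_def[abs_def] by (intro continuous_intros fourier_series_continuous[OF i])
      then show "continuous_on UNIV (\<lambda>x. f x - h x)" using cf by (intro continuous_intros)
      show "f (x + 1) - h (x + 1) = f x - h x" for x using f hc(1) by (simp add: L2_circle)
      fix m :: int
      have "(\<integral>x. indicator {0..1} x *\<^sub>R (cis (- (2 * pi * m * x)) * of_real (f x - h x)) \<partial>lborel)
        = (\<integral>x. indicator {0..1} x *\<^sub>R (cis (- (x * (2 * pi * m))) * of_real (f x)) - indicator {0..1} x *\<^sub>R (cis (- (x * (2 * pi * m))) * of_real (h x)) \<partial>lborel)"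
        by (rule Bochner_Integration.integral_cong) (auto simp: algebra_simps)
      also have "\<dots> = ?g m - fourier Circle h (2 * pi * of_int m)"
        unfolding fourier_circle by (rule Bochner_Integration.integral_diff[OF fi L2_circle_integrand[OF hc(1)]])
      also have "\<dots> = 0" by (simp add: hc(2))
      finally show "(\<integral>x. indicator {0..1} x *\<^sub>R (cis (- (2 * pi * m * x)) * of_real (f x - h x)) \<partial>lborel) = 0" .
    qed
    then have "of_real (f x) = (of_real (h x) :: complex)" by simp
    then show ?thesis using h by simp
  qed
  fix g assume g: "g \<in> L2 Circle"
  note gi = L2_circle_integrand[OF g]
  have [measurable]: "g \<in> borel_measurable borel" using g by (simp add: L2_circle)
  fix a b :: real
  have "sq lborel (\<lambda>x. of_real a * (indicator {0..1} x * of_real (f x)) + of_real b * (indicator {0..1} x * of_real (g x)))"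
    by (intro sq_add sq_scale L2_circle_sq f g)
  then have "sq lborel (\<lambda>x. indicator {0..1} x * of_real (a * f x + b * g x))"
    by (simp add: algebra_simps)
  then have L: "(\<lambda>x. a * f x + b * g x) \<in> L2 Circle" using f g by (intro sq_circle_L2) (auto simp: L2_circle)
  have "fourier Circle (\<lambda>x. a * f x + b * g x) \<xi> = of_real a * fourier Circle f \<xi> + of_real b * fourier Circle g \<xi>" for \<xi>
  proof -
    have "fourier Circle (\<lambda>x. a * f x + b * g x) \<xi> = (\<integral>x. of_real a * (indicator {0..1} x *\<^sub>R (cis (- (x * \<xi>)) * of_real (f x))) + of_real b * (indicator {0..1} x *\<^sub>R (cis (- (x * \<xi>)) * of_real (g x))) \<partial>lborel)"
      unfolding fourier_circle by (rule Bochner_Integration.integral_cong) (auto simp: algebra_simps)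
    also have "\<dots> = of_real a * fourier Circle f \<xi> + of_real b * fourier Circle g \<xi>"
      unfolding fourier_circle
      by (subst Bochner_Integration.integral_add[OF integrable_mult_right[OF fi] integrable_mult_right[OF gi]])
        (simp only: integral_mult_right_zero)
    finally show ?thesis .
  qed
  then show "(\<lambda>x. a * f x + b * g x) \<in> L2 Circle \<and> (AE \<xi> in count_space UNIV. fourier Circle (\<lambda>x. a * f x + b * g x) (2 * pi * of_int \<xi>)
      = of_real a * fourier Circle f (2 * pi * of_int \<xi>) + of_real b * fourier Circle g (2 * pi * of_int \<xi>))"
    using L by simp
next
  fix f g assume fg: "f \<in> L2 Circle" "g \<in> L2 Circle" "AE x in space_measure Circle. f x = g x"
  have [measurable]: "f \<in> borel_measurable borel" "g \<in> borel_measurable borel" using fg by (auto simp: L2_circle)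
  have "AE x in lborel. x \<in> {0..1} \<longrightarrow> f x = g x"
  proof -
    have "space_measure Circle = restrict_space lborel {0..1}" by (simp add: space_measure_def)
    with fg(3) have "AE x in restrict_space lborel {0..1}. f x = g x" by (simp only:)
    then show ?thesis by (simp add: AE_restrict_space_iff)
  qed
  then have "fourier Circle f \<xi> = fourier Circle g \<xi>" for \<xi>
    unfolding fourier_circle by (intro integral_cong_AE) (auto elim!: eventually_mono simp: indicator_def)
  then show "AE \<xi> in count_space UNIV. fourier Circle f (2 * pi * of_int \<xi>) = fourier Circle g (2 * pi * of_int \<xi>)" by simp
next
  fix g h assume "integrable (count_space UNIV) g" "\<And>x. of_real (h x) = of_real 1 * fourier_series g x"
  then show "h \<in> L2 Circle \<and> (AE \<xi> in count_space UNIV. fourier Circle h (2 * pi * of_int \<xi>) = g \<xi>)"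
    using fourier_circle_synth[of g h] by simp
next
  have inj: "inj (\<lambda>k::int. 2 * pi * of_int k)" by (auto simp: inj_on_def)
  show "(\<integral>\<^sup>+\<xi>. F \<xi> \<partial>freq_measure Circle) = (\<integral>\<^sup>+\<xi>. F (2 * pi * of_int \<xi>) \<partial>count_space UNIV)" for F
    unfolding freq_measure_def
    using nn_integral_bij_count_space[of "\<lambda>k::int. 2 * pi * of_int k" UNIV "range (\<lambda>k::int. 2 * pi * of_int k)" F] inj
    by (simp add: bij_betw_def)
  show "(AE \<xi> in freq_measure Circle. P \<xi>) \<longleftrightarrow> (AE \<xi> in count_space UNIV. P (2 * pi * of_int \<xi>))" for P
  proof -
    have "freq_measure Circle = count_space (range (\<lambda>k::int. 2 * pi * of_int k))" by (simp add: freq_measure_def)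
    then show ?thesis by (simp only: AE_count_space) auto
  qed
qed simp_all

section \<open>Solutions as flows in frequency space\<close>

context fourier_space
begin

definition FX :: "(real \<Rightarrow> real) \<Rightarrow> 'a \<Rightarrow> complex" where
  "FX f \<xi> = fourier X f (\<omega> \<xi>)"

text \<open>
  The transform of a real function on the line is hermitian only almost everywhere; the average
  makes it so at every point.
\<close>

definition UX :: "(real \<Rightarrow> real) \<Rightarrow> 'a \<Rightarrow> complex" where
  "UX f \<xi> = of_real c * ((FX f \<xi> + cnj (FX f (- \<xi>))) / 2)"

lemma FX_measurable: "f \<in> L2 X \<Longrightarrow> FX f \<in> borel_measurable \<mu>"
  unfolding FX_def[abs_def] by (rule F_measurable)

lemma UX_measurable:
  assumes "f \<in> L2 X"
  shows "UX f \<in> borel_measurable \<mu>"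
proof -
  have [measurable]: "FX f \<in> borel_measurable \<mu>" by (rule FX_measurable[OF assms])
  show ?thesis unfolding UX_def[abs_def] by measurable
qed

lemma UX_tl: "reflect (UX f) = UX f"
  by (auto simp: reflect_def UX_def add.commute)

lemma UX_AE: "f \<in> L2 X \<Longrightarrow> AE \<xi> in \<mu>. UX f \<xi> = of_real c * FX f \<xi>"
proof -
  assume "f \<in> L2 X"
  from F_hermitian[OF this] show ?thesis
  proof eventually_elim
    case (elim \<xi>)
    then have "FX f (- \<xi>) = cnj (FX f \<xi>)" unfolding FX_def .
    then show ?case by (simp add: UX_def)
  qed
qed

lemma sobolev_norm_FX:
  "sobolev_norm X k f = epowr (\<integral>\<^sup>+\<xi>. ennreal ((1 + (\<omega> \<xi>)\<^sup>2) ^ k * (cmod (FX f \<xi>))\<^sup>2) \<partial>\<mu>) (1/2)"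
  by (simp add: sobolev_norm_def F_nn_integral FX_def)

lemma sobolev_integral_finite:
  assumes "f \<in> sobolev X k"
  shows "(\<integral>\<^sup>+\<xi>. ennreal ((1 + (\<omega> \<xi>)\<^sup>2) ^ k * (cmod (FX f \<xi>))\<^sup>2) \<partial>\<mu>) < \<infinity>"
proof (rule ccontr)
  assume "\<not> ?thesis"
  then have "(\<integral>\<^sup>+\<xi>. ennreal ((1 + (\<omega> \<xi>)\<^sup>2) ^ k * (cmod (FX f \<xi>))\<^sup>2) \<partial>\<mu>) = \<infinity>" by (simp only: infinity_ennreal_def less_top[symmetric] not_not)
  then have "sobolev_norm X k f = \<infinity>" unfolding sobolev_norm_FX using epowr_top[of "1/2"] by simp
  then show False using assms by (simp add: sobolev_def)
qed

lemma sobolev_L2: "f \<in> sobolev X k \<Longrightarrow> f \<in> L2 X"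
  by (simp add: sobolev_def)

lemma wt_power_bound: "((1 + \<bar>w\<bar>) ^ k)\<^sup>2 \<le> 2 ^ k * (1 + w\<^sup>2) ^ k" for w :: real
proof -
  have "(1 + \<bar>w\<bar>)\<^sup>2 \<le> 2 * (1 + w\<^sup>2)"
    using sum_squares_bound[of 1 "\<bar>w\<bar>"] by (simp add: power2_sum)
  then have "((1 + \<bar>w\<bar>)\<^sup>2) ^ k \<le> (2 * (1 + w\<^sup>2)) ^ k" by (rule power_mono) simp
  then show ?thesis by (simp only: power_mult_distrib[of 2 "1 + w\<^sup>2" k] power_mult[symmetric] mult.commute[of 2 k])
qed

lemma sobolev_wt:
  assumes f: "f \<in> sobolev X k"
  shows "sq \<mu> (\<lambda>\<xi>. of_real ((1 + \<bar>\<omega> \<xi>\<bar>) ^ k) * UX f \<xi>)"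
proof -
  have [measurable]: "UX f \<in> borel_measurable \<mu>" "FX f \<in> borel_measurable \<mu>"
    using UX_measurable FX_measurable sobolev_L2[OF f] by auto
  have "(\<integral>\<^sup>+\<xi>. ennreal ((cmod (of_real ((1 + \<bar>\<omega> \<xi>\<bar>) ^ k) * UX f \<xi>))\<^sup>2) \<partial>\<mu>)
     \<le> (\<integral>\<^sup>+\<xi>. ennreal (2 ^ k) * ennreal ((1 + (\<omega> \<xi>)\<^sup>2) ^ k * (cmod (FX f \<xi>))\<^sup>2) \<partial>\<mu>)"
  proof (rule nn_integral_mono_AE)
    show "AE \<xi> in \<mu>. ennreal ((cmod (of_real ((1 + \<bar>\<omega> \<xi>\<bar>) ^ k) * UX f \<xi>))\<^sup>2) \<le> ennreal (2 ^ k) * ennreal ((1 + (\<omega> \<xi>)\<^sup>2) ^ k * (cmod (FX f \<xi>))\<^sup>2)"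
      using UX_AE[OF sobolev_L2[OF f]]
    proof eventually_elim
      case (elim \<xi>)
      have "cmod (UX f \<xi>) \<le> cmod (FX f \<xi>)"
        using c_pos c_le1 elim by (simp add: norm_mult mult_left_le_one_le)
      then have "((1 + \<bar>\<omega> \<xi>\<bar>) ^ k)\<^sup>2 * (cmod (UX f \<xi>))\<^sup>2 \<le> (2 ^ k * (1 + (\<omega> \<xi>)\<^sup>2) ^ k) * (cmod (FX f \<xi>))\<^sup>2"
        by (intro mult_mono wt_power_bound power_mono) auto
      moreover have "(cmod (of_real ((1 + \<bar>\<omega> \<xi>\<bar>) ^ k) * UX f \<xi>))\<^sup>2 = ((1 + \<bar>\<omega> \<xi>\<bar>) ^ k)\<^sup>2 * (cmod (UX f \<xi>))\<^sup>2"
        unfolding norm_mult norm_of_real by (simp add: power_mult_distrib)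
      ultimately show ?case by (simp add: ennreal_mult[symmetric] ennreal_leI mult.assoc)
    qed
  qed
  also have "\<dots> = ennreal (2 ^ k) * (\<integral>\<^sup>+\<xi>. ennreal ((1 + (\<omega> \<xi>)\<^sup>2) ^ k * (cmod (FX f \<xi>))\<^sup>2) \<partial>\<mu>)"
    by (rule nn_integral_cmult) measurable
  also have "\<dots> < \<infinity>" using sobolev_integral_finite[OF f] by (simp add: ennreal_mult_less_top)
  finally show ?thesis by (subst sq_iff_nn) measurable
qed

lemma synthesis:
  assumes v: "integrable \<mu> v" "sq \<mu> v" and h: "\<And>x. of_real (h x) = synth v x"
  shows "h \<in> L2 X" "AE \<xi> in \<mu>. of_real c * FX h \<xi> = v \<xi>"
proof -
  let ?g = "\<lambda>\<xi>. of_real (1 / c) * v \<xi>"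
  have g: "integrable \<mu> ?g" "sq \<mu> ?g" by (rule integrable_mult_right[OF v(1)] sq_scale[OF v(2)])+
  have e: "of_real c * of_real (1 / c) = (1 :: complex)"
    unfolding of_real_mult[symmetric] using c_pos by simp
  have "of_real (h x) = of_real c * synth ?g x" for x
  proof -
    have "synth ?g x = of_real (1 / c) * synth v x" by (simp add: synth_def mult.assoc del: of_real_divide)
    then have "of_real c * synth ?g x = (of_real c * of_real (1 / c)) * synth v x" by (simp only: mult.assoc)
    then show ?thesis unfolding e h by simp
  qed
  from F_synthesis[OF g this] show "h \<in> L2 X" and ae: "AE \<xi> in \<mu>. of_real c * FX h \<xi> = v \<xi>"
    using e by (auto simp: FX_def mult.assoc[symmetric] elim!: eventually_mono)
qed

lemma deriv_synth:
  assumes v: "integrable \<mu> v" "integrable \<mu> (Dw v)" "reflect v = v" and h: "\<And>x. of_real (h x) = synth v x"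
  shows "of_real (deriv h x) = synth (Dw v) x" "reflect (Dw v) = Dw v"
proof -
  have vm: "v \<in> borel_measurable \<mu>" using v by auto
  have vh: "v (- y) = cnj (v y)" for y using v(3) by (metis complex_cnj_cnj reflect_def)
  show t: "reflect (Dw v) = Dw v" by (auto simp: reflect_def Dw_def vh fun_eq_iff)
  have "((\<lambda>x. Re (synth v x)) has_vector_derivative Re (synth (Dw v) x)) (at x)"
    using bounded_linear.has_vector_derivative[OF bounded_linear_Re synth_derivative[OF v(1,2)]] .
  then have "(h has_vector_derivative Re (synth (Dw v) x)) (at x)" by (simp flip: h)
  then have "deriv h x = Re (synth (Dw v) x)"
    by (intro DERIV_imp_deriv) (simp add: has_real_derivative_iff_has_vector_derivative)
  then show "of_real (deriv h x) = synth (Dw v) x"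
    using synth_real[of "Dw v" x] t v(2) by simp
qed

text \<open>Three weights in L2 give two weights in L1, so the function and its first two
  derivatives are absolutely convergent syntheses and the classical derivatives can be read off in
  frequency. The equation is then transformed term by term.\<close>

lemma rhs_fourier:
  assumes f: "f \<in> sobolev X 3" "continuous_on UNIV f" and p: "p \<in> sobolev X 1"
    and eq: "AE x in space_measure X. p x = - hilbert X (deriv (deriv f)) x + 2 * f x * deriv f x"
  shows "nice (UX f)" "AE \<xi> in \<mu>. of_real c * FX p \<xi> = bo_rhs (UX f) \<xi>"
proof -
  let ?u = "UX f"
  have fL: "f \<in> L2 X" by (rule sobolev_L2[OF f(1)])
  have um[measurable]: "?u \<in> borel_measurable \<mu>" by (rule UX_measurable[OF fL])
  have w3: "sq \<mu> (wt (wt (wt ?u)))"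
    using sobolev_wt[OF f(1)] unfolding wt_def[abs_def]
    by (simp add: power3_eq_cube mult.assoc del: of_real_add)
  have w2: "integrable \<mu> (wt (wt ?u))" "sq \<mu> (wt (wt ?u))"
    by (rule integrable_of_wt[OF _ w3] wt_dominates(1)[OF _ w3], measurable)+
  have w1: "integrable \<mu> (wt ?u)" "sq \<mu> (wt ?u)"
    by (rule wt_dominates(3)[OF _ w2(1)] wt_dominates(1)[OF _ w2(2)], measurable)+
  have u0: "integrable \<mu> ?u" "sq \<mu> ?u" and D1: "integrable \<mu> (Dw ?u)" "sq \<mu> (Dw ?u)"
    by (rule wt_dominates(3)[OF _ w1(1)] wt_dominates(1)[OF _ w1(2)] wt_dominates(4)[OF _ w1(1)] wt_dominates(2)[OF _ w1(2)], measurable)+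
  show nice: "nice ?u" using w1 um by (simp add: nice_def UX_tl)
  have wtDw: "wt (Dw ?u) = Dw (wt ?u)" by (auto simp: wt_def Dw_def)
  have D1w: "integrable \<mu> (wt (Dw ?u))" "sq \<mu> (wt (Dw ?u))"
    unfolding wtDw by (rule wt_dominates(4)[OF _ w2(1)] wt_dominates(2)[OF _ w2(2)], measurable)+
  have D2: "integrable \<mu> (Dw (Dw ?u))" "sq \<mu> (Dw (Dw ?u))"
    by (rule wt_dominates(4)[OF _ D1w(1)] wt_dominates(2)[OF _ D1w(2)], measurable)+
  have fF: "AE \<xi> in \<mu>. of_real c * FX f \<xi> = ?u \<xi>" using UX_AE[OF fL] by eventually_elim simp
  have iF: "integrable \<mu> (\<lambda>\<xi>. fourier X f (\<omega> \<xi>))"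
  proof -
    have e: "of_real (1 / c) * of_real c = (1 :: complex)" unfolding of_real_mult[symmetric] using c_pos by simp
    have "integrable \<mu> (\<lambda>\<xi>. of_real (1 / c) * ?u \<xi>)" using u0(1) by (rule integrable_mult_right)
    moreover have "AE \<xi> in \<mu>. of_real (1 / c) * ?u \<xi> = fourier X f (\<omega> \<xi>)"
      using fF by eventually_elim (metis FX_def e mult.assoc mult_1)
    ultimately show ?thesis
      using F_measurable[OF fL] integrable_cong_AE_imp by blast
  qed
  have fs: "of_real (f x) = synth ?u x" for x
  proof -
    have "of_real (f x) = of_real c * synth (\<lambda>\<xi>. fourier X f (\<omega> \<xi>)) x" by (rule F_inversion[OF fL f(2) iF])
    also have "\<dots> = synth (\<lambda>\<xi>. of_real c * FX f \<xi>) x" by (simp add: synth_def FX_def mult.assoc)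
    also have "\<dots> = synth ?u x" by (rule synth_cong_AE[OF _ um fF]) (use FX_measurable[OF fL] in measurable)
    finally show ?thesis .
  qed
  note d1 = deriv_synth[OF u0(1) D1(1) UX_tl fs]
  note d2 = deriv_synth[OF D1(1) D2(1) d1(2) d1(1)]
  let ?q2 = "deriv (deriv f)"
  note q2 = synthesis[OF D2 d2(1)]
  \<comment> \<open>The prospective transform, scaled by \<open>c\<close>, of the Hilbert transform
    of the second derivative.\<close>
  define v0 where "v0 \<xi> = - \<i> * of_real (sgn (\<omega> \<xi>)) * Dw (Dw ?u) \<xi>" for \<xi>
  have v0m: "v0 \<in> borel_measurable \<mu>" unfolding v0_def[abs_def] by measurable
  have v0b: "cmod (v0 \<xi>) \<le> cmod (Dw (Dw ?u) \<xi>)" for \<xi> by (simp add: v0_def norm_mult sgn_if)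
  have v0: "integrable \<mu> v0" "sq \<mu> v0"
    using Bochner_Integration.integrable_bound[OF D2(1) v0m] sq_bound(1)[OF D2(2) v0m] v0b by auto
  have v0t: "reflect v0 = v0"
  proof
    fix \<xi>
    have "Dw (Dw ?u) (- \<xi>) = cnj (Dw (Dw ?u) \<xi>)" using d2(2) by (metis complex_cnj_cnj reflect_def)
    then show "reflect v0 \<xi> = v0 \<xi>" by (simp add: reflect_def v0_def sgn_minus)
  qed
  have h0: "of_real (Re (synth v0 x)) = synth v0 x" for x by (rule synth_real[OF v0m v0t, symmetric])
  note hh = synthesis[OF v0 h0]
  have cz: "of_real c \<noteq> (0::complex)" using c_pos by simp
  \<comment> \<open>\<open>hilbert\<close> is a choice; the synthesis of \<open>v0\<close> witnesses
    that the defining property can be met, and afterwards only that property is used.\<close>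
  let ?Q = "\<lambda>h. h \<in> L2 X \<and> (AE \<xi> in freq_measure X. fourier X h \<xi> = - \<i> * of_real (sgn \<xi>) * fourier X ?q2 \<xi>)"
  have "?Q (\<lambda>x. Re (synth v0 x))"
  proof (intro conjI hh(1), subst F_AE)
    show "AE \<xi> in \<mu>. fourier X (\<lambda>x. Re (synth v0 x)) (\<omega> \<xi>) = - \<i> * of_real (sgn (\<omega> \<xi>)) * fourier X ?q2 (\<omega> \<xi>)"
      using hh(2) q2(2)
    proof eventually_elim
      case (elim \<xi>)
      have "of_real c * FX (\<lambda>x. Re (synth v0 x)) \<xi> = - \<i> * of_real (sgn (\<omega> \<xi>)) * (of_real c * FX ?q2 \<xi>)"
        unfolding elim by (simp add: v0_def)
      then have "of_real c * FX (\<lambda>x. Re (synth v0 x)) \<xi> = of_real c * (- \<i> * of_real (sgn (\<omega> \<xi>)) * FX ?q2 \<xi>)"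
        by (simp only: mult_ac)
      then show ?case using mult_left_cancel[OF cz] unfolding FX_def by blast
    qed
  qed
  from someI[of ?Q, OF this] have H: "?Q (hilbert X ?q2)" unfolding hilbert_def .
  have Hf: "AE \<xi> in \<mu>. of_real c * FX (hilbert X ?q2) \<xi> = v0 \<xi>"
  proof -
    have "AE \<xi> in \<mu>. fourier X (hilbert X ?q2) (\<omega> \<xi>) = - \<i> * of_real (sgn (\<omega> \<xi>)) * fourier X ?q2 (\<omega> \<xi>)"
      using conjunct2[OF H] unfolding F_AE .
    then show ?thesis using q2(2)
    proof eventually_elim
      case (elim \<xi>)
      have "of_real c * FX (hilbert X ?q2) \<xi> = - \<i> * of_real (sgn (\<omega> \<xi>)) * (of_real c * FX ?q2 \<xi>)"
        using elim(1) by (simp add: FX_def)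
      then show ?case unfolding elim(2) by (simp add: v0_def)
    qed
  qed
  define v1 where "v1 \<xi> = 2 * conv ?u (Dw ?u) \<xi>" for \<xi>
  have v1: "integrable \<mu> v1" "sq \<mu> v1"
    unfolding v1_def using conv_integrable[OF u0(1) D1(1)] conv_sq[OF u0(1) D1(2)] by (auto intro: sq_scale)
  have h1: "of_real (2 * f x * deriv f x) = synth v1 x" for x
  proof -
    have "of_real (2 * f x * deriv f x) = 2 * (synth ?u x * synth (Dw ?u) x)" by (simp add: fs d1(1))
    also have "\<dots> = synth v1 x"
      unfolding synth_conv[OF u0(1) D1(1)] by (simp add: synth_def v1_def mult.assoc)
    finally show ?thesis .
  qed
  note hv1 = synthesis[OF v1 h1]
  note lin = F_linear[OF conjunct1[OF H] hv1(1), of "-1" 1]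
  have "AE x in space_measure X. p x = -1 * hilbert X ?q2 x + 1 * (2 * f x * deriv f x)"
    using eq by eventually_elim simp
  from F_cong[OF sobolev_L2[OF p] conjunct1[OF lin] this]
  show "AE \<xi> in \<mu>. of_real c * FX p \<xi> = bo_rhs ?u \<xi>"
    using conjunct2[OF lin] Hf hv1(2) Dw_conv[OF u0(1) u0(1) D1(1) D1(1)]
  proof eventually_elim
    case (elim \<xi>)
    have "of_real c * FX p \<xi> = - (of_real c * FX (hilbert X ?q2) \<xi>) + of_real c * FX (\<lambda>x. 2 * f x * deriv f x) \<xi>"
      unfolding FX_def elim(1) elim(2) by (simp add: right_diff_distrib)
    also have "\<dots> = - v0 \<xi> + v1 \<xi>" unfolding elim(3,4) ..
    also have "- v0 \<xi> = - \<i> * of_real (\<omega> \<xi> * \<bar>\<omega> \<xi>\<bar>) * ?u \<xi>"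
    proof -
      have "sgn (\<omega> \<xi>) * (\<omega> \<xi> * \<omega> \<xi>) = \<omega> \<xi> * \<bar>\<omega> \<xi>\<bar>" by (simp add: sgn_if)
      then have "of_real (sgn (\<omega> \<xi>)) * (of_real (\<omega> \<xi>) * of_real (\<omega> \<xi>)) = (of_real (\<omega> \<xi> * \<bar>\<omega> \<xi>\<bar>) :: complex)"
        by (simp only: of_real_mult[symmetric])
      moreover have "- v0 \<xi> = - \<i> * (of_real (sgn (\<omega> \<xi>)) * (of_real (\<omega> \<xi>) * of_real (\<omega> \<xi>))) * ?u \<xi>"
      proof -
        have "- (- \<i> * a * (\<i> * b * (\<i> * b * z))) = - \<i> * (a * (b * b)) * z" for a b z :: complex
          by (simp add: complex_eq_iff algebra_simps)
        then show ?thesis unfolding v0_def Dw_def .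
      qed
      ultimately show ?thesis by (simp only:)
    qed
    also have "v1 \<xi> = \<i> * of_real (\<omega> \<xi>) * conv ?u ?u \<xi>"
      using elim(5) conv_commute[OF um, of "Dw ?u"] by (simp add: v1_def Dw_def[of "conv ?u ?u"])
    finally show ?case by (simp add: bo_rhs_def)
  qed
qed

text \<open>Almost everywhere the frequency-side error of the difference quotient is
  \<open>c\<close> times the transform of the spatial error. As c \<le> 1 and the Sobolev weight is
  at least 1, its L2 norm is below the H^1 norm, which tends to 0.\<close>

lemma solution_flow:
  assumes sol: "BO_solution X q"
  shows "flow (\<lambda>t. UX (q t))"
proof -
  obtain p where C3: "C0_sobolev X 3 q" and cont: "\<And>t. continuous_on UNIV (q t)" and C1: "C0_sobolev X 1 p"
    and der: "has_sobolev_time_deriv X 1 q p"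
    and eq: "\<And>t. AE x in space_measure X. p t x = - hilbert X (deriv (deriv (q t))) x + 2 * q t x * deriv (q t) x"
    using sol unfolding BO_solution_def by blast
  have q3: "q t \<in> sobolev X 3" and p1: "p t \<in> sobolev X 1" for t using C3 C1 by (auto simp: C0_sobolev_def)
  note rf = rhs_fourier[OF q3 cont p1 eq]
  have qL: "q t \<in> L2 X" and pL: "p t \<in> L2 X" for t using sobolev_L2[OF q3] sobolev_L2[OF p1] by auto
  have bs: "sq \<mu> (bo_rhs (UX (q t)))" for t
  proof -
    have [measurable]: "UX (q t) \<in> borel_measurable \<mu>" by (rule UX_measurable[OF qL])
    have m: "bo_rhs (UX (q t)) \<in> borel_measurable \<mu>" unfolding bo_rhs_def[abs_def] by measurable
    have "sq \<mu> (\<lambda>\<xi>. of_real ((1 + \<bar>\<omega> \<xi>\<bar>) ^ 1) * UX (p t) \<xi>)" by (rule sobolev_wt[OF p1])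
    then have "sq \<mu> (wt (UX (p t)))" by (simp add: wt_def[abs_def])
    then have "sq \<mu> (UX (p t))" by (rule wt_dominates(1)[OF UX_measurable[OF pL]])
    then show ?thesis
      by (rule sq_bound(1)[OF _ m]) (use rf(2)[of t] UX_AE[OF pL[of t]] in eventually_elim, simp)
  qed
  have "((\<lambda>h. nm \<mu> (\<lambda>x. (UX (q (t + h)) x - UX (q t) x) / of_real h - bo_rhs (UX (q t)) x)) \<longlongrightarrow> 0) (at 0)" for t
  proof -
    let ?e = "\<lambda>h x. (q (t + h) x - q t x) / h - p t x"
    let ?d = "\<lambda>h x. (UX (q (t + h)) x - UX (q t) x) / of_real h - bo_rhs (UX (q t)) x"
    have l: "((\<lambda>h. sobolev_norm X 1 (?e h)) \<longlongrightarrow> 0) (at 0)"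
      using der by (auto simp: has_sobolev_time_deriv_def)
    have b: "ennreal (nm \<mu> (?d h)) \<le> sobolev_norm X 1 (?e h)" for h
    proof -
      let ?a = "\<lambda>x. (1 / h) * q (t + h) x + (- (1 / h)) * q t x"
      note l1 = F_linear[OF qL[of "t + h"] qL[of t], of "1 / h" "- (1 / h)"]
      note l2 = F_linear[OF conjunct1[OF l1] pL[of t], of 1 "-1"]
      have ee: "?e h = (\<lambda>x. 1 * ?a x + (-1) * p t x)" by (auto simp: diff_divide_distrib)
      have eL: "?e h \<in> L2 X" unfolding ee by (rule conjunct1[OF l2])
      have [measurable]: "FX (?e h) \<in> borel_measurable \<mu>" by (rule FX_measurable[OF eL])
      have [measurable]: "UX (q t) \<in> borel_measurable \<mu>" for t by (rule UX_measurable[OF qL])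
      have dm: "?d h \<in> borel_measurable \<mu>" unfolding bo_rhs_def by measurable
      have ae: "AE \<xi> in \<mu>. ?d h \<xi> = of_real c * FX (?e h) \<xi>"
        using conjunct2[OF l1] conjunct2[OF l2] rf(2)[of t] UX_AE[OF qL[of t]] UX_AE[OF qL[of "t + h"]]
      proof eventually_elim
        case (elim \<xi>)
        have "FX (?e h) \<xi> = of_real (1 / h) * FX (q (t + h)) \<xi> - of_real (1 / h) * FX (q t) \<xi> - FX (p t) \<xi>"
          unfolding ee FX_def elim(2) unfolding elim(1) by simp
        then have "of_real c * FX (?e h) \<xi> = of_real (1 / h) * (of_real c * FX (q (t + h)) \<xi>) - of_real (1 / h) * (of_real c * FX (q t) \<xi>) - of_real c * FX (p t) \<xi>"
          by (simp only: right_diff_distrib mult.left_commute)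
        then show ?case unfolding elim(3) elim(4,5)[symmetric] by (simp add: diff_divide_distrib)
      qed
      have "(\<integral>\<^sup>+\<xi>. ennreal ((cmod (?d h \<xi>))\<^sup>2) \<partial>\<mu>) \<le> (\<integral>\<^sup>+\<xi>. ennreal ((1 + (\<omega> \<xi>)\<^sup>2) ^ 1 * (cmod (FX (?e h) \<xi>))\<^sup>2) \<partial>\<mu>)"
      proof (rule nn_integral_mono_AE)
        show "AE \<xi> in \<mu>. ennreal ((cmod (?d h \<xi>))\<^sup>2) \<le> ennreal ((1 + (\<omega> \<xi>)\<^sup>2) ^ 1 * (cmod (FX (?e h) \<xi>))\<^sup>2)"
          using ae
        proof eventually_elim
          case (elim \<xi>)
          have "cmod (?d h \<xi>) \<le> cmod (FX (?e h) \<xi>)"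
            unfolding elim using c_pos c_le1 by (simp add: norm_mult mult_left_le_one_le)
          then have "(cmod (?d h \<xi>))\<^sup>2 \<le> 1 * (cmod (FX (?e h) \<xi>))\<^sup>2" by (simp add: power_mono)
          also have "\<dots> \<le> (1 + (\<omega> \<xi>)\<^sup>2) ^ 1 * (cmod (FX (?e h) \<xi>))\<^sup>2" by (intro mult_right_mono) auto
          finally show ?case by (rule ennreal_leI)
        qed
      qed
      then have "epowr (\<integral>\<^sup>+\<xi>. ennreal ((cmod (?d h \<xi>))\<^sup>2) \<partial>\<mu>) (1/2) \<le> sobolev_norm X 1 (?e h)"
        unfolding sobolev_norm_FX by (rule epowr_mono) simp
      moreover have "ennreal (nm \<mu> (?d h)) \<le> epowr (\<integral>\<^sup>+\<xi>. ennreal ((cmod (?d h \<xi>))\<^sup>2) \<partial>\<mu>) (1/2)"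
      proof -
        have ds: "sq \<mu> (?d h)"
          using sq_diff[OF sq_scale[OF sq_diff[OF niceD(5)[OF rf(1)[of "t + h"]] niceD(5)[OF rf(1)[of t]]], of "1 / of_real h"] bs[of t]] by simp
        have "(ennreal (nm \<mu> (?d h)))\<^sup>2 = (\<integral>\<^sup>+\<xi>. ennreal ((cmod (?d h \<xi>))\<^sup>2) \<partial>\<mu>)"
          unfolding sq_nn_eq[OF ds] by (simp add: ennreal_power)
        then show ?thesis using epowr_half_sq[of "ennreal (nm \<mu> (?d h))"] by simp
      qed
      ultimately show ?thesis by (rule order.trans[rotated])
    qed
    have "((\<lambda>h. ennreal (nm \<mu> (?d h))) \<longlongrightarrow> 0) (at 0)"
      by (rule tendsto_sandwich[OF _ _ tendsto_const l]) (use b in auto)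
    then have "((\<lambda>h. ennreal (nm \<mu> (?d h))) \<longlongrightarrow> ennreal 0) (at 0)" by simp
    then show ?thesis by (subst (asm) tendsto_ennreal_iff) auto
  qed
  then show ?thesis using rf(1) bs by (simp add: flow_def)
qed


section \<open>Block masses compared with the conserved integrals\<close>

definition block_mass :: "(real \<Rightarrow> real) \<Rightarrow> nat \<Rightarrow> ennreal" where
  "block_mass f n = (\<integral>\<^sup>+\<xi>. ennreal ((cmod (FX f \<xi>))\<^sup>2) * indicator (dyadic_block n) (\<omega> \<xi>) \<partial>\<mu>)"

lemma besov_norm_block_mass: "1 \<le> r \<Longrightarrow> besov_norm X s r f = bnorm s r (block_mass f)"
  unfolding besov_norm_bnorm block_mass_def F_nn_integral FX_def ..

lemma dyadic_block_cover: "\<exists>n. w \<in> dyadic_block n" for w :: real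
proof (cases "\<bar>w\<bar> \<le> 1")
  case True
  then have "w \<in> dyadic_block 0" by (simp add: dyadic_block_def)
  then show ?thesis ..
next
  case False
  define j where "j = nat \<lfloor>log 2 \<bar>w\<bar>\<rfloor>"
  have l: "0 \<le> log 2 \<bar>w\<bar>" using False by (intro zero_le_log_cancel_iff[THEN iffD2]) auto
  then have j: "real j = of_int \<lfloor>log 2 \<bar>w\<bar>\<rfloor>" by (simp add: j_def)
  have "real j \<le> log 2 \<bar>w\<bar>" "log 2 \<bar>w\<bar> < real j + 1" unfolding j by linarith+
  then have "2 powr real j \<le> \<bar>w\<bar>" "\<bar>w\<bar> < 2 powr (real j + 1)"
    using False by (auto simp: le_log_iff log_less_iff)
  then have "w \<in> dyadic_block (Suc j)" by (simp add: dyadic_block_def powr_add powr_realpow)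
  then show ?thesis ..
qed

text \<open>On block n \<ge> 1 the modulus lies between 2^(n-1) and 2^n. On block 0 it may be as
  small as 0, and the second bound there rests on k \<ge> 1.\<close>

lemma dyadic_block_bounds:
  fixes w k :: real
  assumes "w \<in> dyadic_block n" "1 \<le> k"
  shows "\<bar>w\<bar> + k \<le> 2 ^ n + k" "2 ^ n + k \<le> 2 * (\<bar>w\<bar> + k)"
  using assms by (auto simp: dyadic_block_def split: nat.splits)

lemma dyadic_block_measurable [measurable]: "dyadic_block n \<in> sets borel"
  by (cases n) (auto simp: dyadic_block_def)

lemma block_mass_le_qf:
  assumes "f \<in> L2 X"
  shows "block_mass f n \<le> ennreal (2 ^ n + 2 ^ i) * qf (FX f) (2 ^ i)"
proof -
  have [measurable]: "FX f \<in> borel_measurable \<mu>" by (rule FX_measurable[OF assms])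
  have p: "ennreal ((cmod (FX f \<xi>))\<^sup>2) * indicator (dyadic_block n) (\<omega> \<xi>) \<le> ennreal (2 ^ n + 2 ^ i) * ennreal ((cmod (FX f \<xi>))\<^sup>2 / (\<bar>\<omega> \<xi>\<bar> + 2 ^ i))" for \<xi>
  proof (cases "\<omega> \<xi> \<in> dyadic_block n")
    case True
    have k: "0 < \<bar>\<omega> \<xi>\<bar> + (2::real) ^ i" by (rule add_nonneg_pos) auto
    have "(cmod (FX f \<xi>))\<^sup>2 = (\<bar>\<omega> \<xi>\<bar> + 2 ^ i) * ((cmod (FX f \<xi>))\<^sup>2 / (\<bar>\<omega> \<xi>\<bar> + 2 ^ i))" using k by simp
    also have "\<dots> \<le> (2 ^ n + 2 ^ i) * ((cmod (FX f \<xi>))\<^sup>2 / (\<bar>\<omega> \<xi>\<bar> + 2 ^ i))"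
      by (rule mult_right_mono[OF dyadic_block_bounds(1)[OF True two_realpow_ge_one]]) simp
    finally have "ennreal ((cmod (FX f \<xi>))\<^sup>2) \<le> ennreal ((2 ^ n + 2 ^ i) * ((cmod (FX f \<xi>))\<^sup>2 / (\<bar>\<omega> \<xi>\<bar> + 2 ^ i)))"
      by (rule ennreal_leI)
    also have "\<dots> = ennreal (2 ^ n + 2 ^ i) * ennreal ((cmod (FX f \<xi>))\<^sup>2 / (\<bar>\<omega> \<xi>\<bar> + 2 ^ i))"
      by (rule ennreal_mult) (use k in auto)
    finally show ?thesis using True by simp
  qed simp
  have "block_mass f n \<le> (\<integral>\<^sup>+\<xi>. ennreal (2 ^ n + 2 ^ i) * ennreal ((cmod (FX f \<xi>))\<^sup>2 / (\<bar>\<omega> \<xi>\<bar> + 2 ^ i)) \<partial>\<mu>)"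
    unfolding block_mass_def by (rule nn_integral_mono[OF p])
  then show ?thesis unfolding qf_def by (subst (asm) nn_integral_cmult) measurable
qed

text \<open>The converse direction to \<open>block_mass_le_qf\<close>: the blocks cover all
  frequencies, and on each of them |\<omega>| + 2^i is at least half of 2^m + 2^i.\<close>

lemma qf_le_Qs:
  assumes "f \<in> L2 X"
  shows "qf (FX f) (2 ^ i) \<le> 2 * Qs (block_mass f) i"
proof -
  have [measurable]: "FX f \<in> borel_measurable \<mu>" by (rule FX_measurable[OF assms])
  let ?t = "\<lambda>m \<xi>. ennreal (2 / (2 ^ m + 2 ^ i)) * (ennreal ((cmod (FX f \<xi>))\<^sup>2) * indicator (dyadic_block m) (\<omega> \<xi>))"
  have p: "ennreal ((cmod (FX f \<xi>))\<^sup>2 / (\<bar>\<omega> \<xi>\<bar> + 2 ^ i)) \<le> (\<Sum>m. ?t m \<xi>)" for \<xi>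
  proof -
    obtain m where m: "\<omega> \<xi> \<in> dyadic_block m" using dyadic_block_cover by blast
    have k: "0 < \<bar>\<omega> \<xi>\<bar> + (2::real) ^ i" "0 < (2::real) ^ m + 2 ^ i" by (auto intro: add_nonneg_pos add_pos_pos)
    have "1 / (\<bar>\<omega> \<xi>\<bar> + 2 ^ i) \<le> 2 / (2 ^ m + 2 ^ i)"
      using dyadic_block_bounds(2)[OF m two_realpow_ge_one, of i] k by (simp add: field_simps)
    then have "(cmod (FX f \<xi>))\<^sup>2 * (1 / (\<bar>\<omega> \<xi>\<bar> + 2 ^ i)) \<le> (cmod (FX f \<xi>))\<^sup>2 * (2 / (2 ^ m + 2 ^ i))"
      by (rule mult_left_mono) simp
    then have "ennreal ((cmod (FX f \<xi>))\<^sup>2 / (\<bar>\<omega> \<xi>\<bar> + 2 ^ i)) \<le> ennreal (2 / (2 ^ m + 2 ^ i) * (cmod (FX f \<xi>))\<^sup>2)"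
      by (intro ennreal_leI) (simp add: mult.commute)
    also have "\<dots> = ?t m \<xi>" using m k(2) by (subst ennreal_mult) auto
    also have "\<dots> \<le> (\<Sum>m. ?t m \<xi>)" using sum_le_suminf[of "\<lambda>m. ?t m \<xi>" "{m}"] by simp
    finally show ?thesis .
  qed
  have "qf (FX f) (2 ^ i) \<le> (\<integral>\<^sup>+\<xi>. (\<Sum>m. ?t m \<xi>) \<partial>\<mu>)" unfolding qf_def by (rule nn_integral_mono[OF p])
  also have "\<dots> = (\<Sum>m. \<integral>\<^sup>+\<xi>. ?t m \<xi> \<partial>\<mu>)" by (rule nn_integral_suminf) measurable
  also have "\<dots> = (\<Sum>m. 2 * (block_mass f m * ennreal (1 / (2 ^ m + 2 ^ i))))"
  proof (rule suminf_cong)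
    fix m
    have m: "(\<lambda>\<xi>. ennreal ((cmod (FX f \<xi>))\<^sup>2) * indicator (dyadic_block m) (\<omega> \<xi>)) \<in> borel_measurable \<mu>"
      by measurable
    have "(\<integral>\<^sup>+\<xi>. ?t m \<xi> \<partial>\<mu>) = ennreal (2 * (1 / (2 ^ m + 2 ^ i))) * block_mass f m"
      unfolding block_mass_def nn_integral_cmult[OF m] by simp
    also have "\<dots> = 2 * ennreal (1 / (2 ^ m + 2 ^ i)) * block_mass f m"
      by (subst ennreal_mult) auto
    finally show "(\<integral>\<^sup>+\<xi>. ?t m \<xi> \<partial>\<mu>) = 2 * (block_mass f m * ennreal (1 / (2 ^ m + 2 ^ i)))"
      by (simp add: mult_ac)
  qed
  also have "\<dots> = 2 * Qs (block_mass f) i" unfolding Qs_def by (rule ennreal_suminf_cmult)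
  finally show ?thesis .
qed

lemma qf_UX:
  assumes "f \<in> L2 X" "0 < k"
  shows "qf (UX f) k = ennreal (c\<^sup>2) * qf (FX f) k"
proof -
  have [measurable]: "FX f \<in> borel_measurable \<mu>" by (rule FX_measurable[OF assms(1)])
  have "qf (UX f) k = (\<integral>\<^sup>+\<xi>. ennreal (c\<^sup>2) * ennreal ((cmod (FX f \<xi>))\<^sup>2 / (\<bar>\<omega> \<xi>\<bar> + k)) \<partial>\<mu>)"
    unfolding qf_def
  proof (rule nn_integral_cong_AE)
    show "AE \<xi> in \<mu>. ennreal ((cmod (UX f \<xi>))\<^sup>2 / (\<bar>\<omega> \<xi>\<bar> + k)) = ennreal (c\<^sup>2) * ennreal ((cmod (FX f \<xi>))\<^sup>2 / (\<bar>\<omega> \<xi>\<bar> + k))"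
      using UX_AE[OF assms(1)]
      by eventually_elim (use assms(2) in \<open>simp add: norm_mult power_mult_distrib ennreal_mult[symmetric]\<close>)
  qed
  then show ?thesis unfolding qf_def by (subst (asm) nn_integral_cmult) measurable
qed

lemma flow_shift: "flow u \<Longrightarrow> flow (\<lambda>t. u (t0 + t))"
  by (auto simp: flow_def add.assoc[symmetric])

text \<open>This is the implication that \<open>besov_growth\<close> asks for. Shifting time makes
  \<open>t0\<close> the initial time; the constant 8 is the 4 of \<open>qf_global\<close> times the
  2 of \<open>qf_le_Qs\<close>, and the factor c^2 cancels.\<close>

lemma block_mass_flow:
  assumes sol: "BO_solution X q" and small: "(\<Sum>j. 2 * Qs (block_mass (q t0)) (j + J)) \<le> ennreal (1/512)" and i: "J \<le> i"
  shows "block_mass (q t) n \<le> ennreal (8 * (2 ^ n + 2 ^ i)) * Qs (block_mass (q t0)) i"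
proof -
  have qL: "q t \<in> L2 X" for t using sol by (auto simp: BO_solution_def C0_sobolev_def sobolev_def)
  have fl: "flow (\<lambda>\<tau>. UX (q (t0 + \<tau>)))" by (rule flow_shift[OF solution_flow[OF sol]])
  have c2: "0 < c\<^sup>2" "c\<^sup>2 \<le> 1" using c_pos c_le1 by (auto simp: power_le_one)
  have init: "hsq (UX (q (t0 + 0))) (2 ^ J) \<le> ennreal (1/512)"
  proof -
    have "hsq (UX (q (t0 + 0))) (2 ^ J) \<le> (\<Sum>j. 2 * Qs (block_mass (q t0)) (j + J))"
      unfolding hsq_def
    proof (intro suminf_le)
      fix j
      have "qf (UX (q t0)) (2 ^ (j + J)) \<le> 1 * qf (FX (q t0)) (2 ^ (j + J))"
        unfolding qf_UX[OF qL zero_less_power[OF zero_less_numeral]]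
        using c2 by (intro mult_right_mono) auto
      also have "\<dots> \<le> 2 * Qs (block_mass (q t0)) (j + J)" using qf_le_Qs[OF qL] by simp
      finally show "qf (UX (q (t0 + 0))) (2 ^ j * 2 ^ J) \<le> 2 * Qs (block_mass (q t0)) (j + J)"
        by (simp add: power_add)
    qed auto
    then show ?thesis using small by (rule order.trans)
  qed
  \<comment> \<open>Conservation is known at the dyadic multiples of the threshold 2^J, hence at
    every 2^i with i \<ge> J.\<close>
  have e: "(2::real) ^ (i - J) * 2 ^ J = 2 ^ i" using i by (simp add: power_add[symmetric])
  have "qf (UX (q (t0 + (t - t0)))) (2 ^ i) \<le> 4 * qf (UX (q (t0 + 0))) (2 ^ i)"
    using qf_global[OF fl _ init, of "t - t0" "i - J"] unfolding e by simp
  then have "ennreal (c\<^sup>2) * qf (FX (q t)) (2 ^ i) \<le> ennreal (c\<^sup>2) * (4 * qf (FX (q t0)) (2 ^ i))"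
    unfolding qf_UX[OF qL zero_less_power[OF zero_less_numeral]] by (simp add: mult_ac)
  then have "ennreal (1 / c\<^sup>2) * (ennreal (c\<^sup>2) * qf (FX (q t)) (2 ^ i)) \<le> ennreal (1 / c\<^sup>2) * (ennreal (c\<^sup>2) * (4 * qf (FX (q t0)) (2 ^ i)))"
    by (rule mult_left_mono) simp
  moreover have "ennreal (1 / c\<^sup>2) * ennreal (c\<^sup>2) = 1"
    using c2(1) by (subst ennreal_mult[symmetric]) (auto simp: c_pos)
  ultimately have *: "qf (FX (q t)) (2 ^ i) \<le> 4 * qf (FX (q t0)) (2 ^ i)"
    unfolding mult.assoc[symmetric] by (simp add: mult.assoc)
  have "block_mass (q t) n \<le> ennreal (2 ^ n + 2 ^ i) * qf (FX (q t)) (2 ^ i)" by (rule block_mass_le_qf[OF qL])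
  also have "\<dots> \<le> ennreal (2 ^ n + 2 ^ i) * (4 * qf (FX (q t0)) (2 ^ i))" by (rule mult_left_mono[OF *]) simp
  also have "\<dots> \<le> ennreal (2 ^ n + 2 ^ i) * (4 * (2 * Qs (block_mass (q t0)) i))"
    by (intro mult_left_mono qf_le_Qs[OF qL]) auto
  also have "\<dots> = ennreal (8 * (2 ^ n + 2 ^ i)) * Qs (block_mass (q t0)) i"
  proof -
    have "ennreal (8 * (2 ^ n + 2 ^ i)) = 8 * ennreal (2 ^ n + 2 ^ i)" by (subst ennreal_mult) auto
    then show ?thesis by (simp add: mult.left_commute del: ennreal_plus) (simp add: mult.assoc[symmetric] del: ennreal_plus)
  qed
  finally show ?thesis .
qed

end

text \<open>The constant is fixed at the level of sequences, before a domain is chosen, so it is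
  common to line and circle. Allowing any two times is what later yields the lower bound.\<close>

lemma besov_norm_flow:
  assumes s: "- 1 / 2 < s" "s < 0" and r: "1 \<le> r"
  shows "\<exists>K::real. 0 < K \<and> (\<forall>X q t0 t. BO_solution X q \<longrightarrow>
    besov_norm X s r (q t) \<le> ennreal K * (epowr (1 + epowr (besov_norm X s r (q t0)) (2 / (1 + 2 * s))) (- s) * besov_norm X s r (q t0)))"
proof -
  obtain K :: real where K: "0 < K" and K_growth: "\<And>D0 D1. (\<forall>J. (\<Sum>j. 2 * Qs D0 (j + J)) \<le> ennreal (1/512) \<longrightarrow>
      (\<forall>n i. J \<le> i \<longrightarrow> D1 n \<le> ennreal (8 * (2 ^ n + 2 ^ i)) * Qs D0 i)) \<Longrightarrow>
    bnorm s r D1 \<le> ennreal K * (epowr (1 + epowr (bnorm s r D0) (2 / (1 + 2 * s))) (- s) * bnorm s r D0)"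
    using besov_growth[OF s r] by blast
  \<comment> \<open>Stated for an arbitrary type of frequencies, to be instantiated with the reals
    and with the integers.\<close>
  have main: "besov_norm X s r (q t) \<le> ennreal K * (epowr (1 + epowr (besov_norm X s r (q t0)) (2 / (1 + 2 * s))) (- s) * besov_norm X s r (q t0))"
    if "fourier_space \<mu> \<omega> X c" "BO_solution X q" for \<mu> :: "'b::ab_group_add measure" and \<omega> c X q t0 t
  proof -
    interpret fourier_space \<mu> \<omega> X c by (rule that(1))
    show ?thesis unfolding besov_norm_block_mass[OF r]
      using K_growth[of "block_mass (q t0)" "block_mass (q t)"] block_mass_flow[OF that(2)] by blast
  qed
  show ?thesis
  proof (intro exI[of _ K] conjI K allI impI)
    fix X q t0 t assume "BO_solution X q"
    then show "besov_norm X s r (q t) \<le> ennreal K * (epowr (1 + epowr (besov_norm X s r (q t0)) (2 / (1 + 2 * s))) (- s) * besov_norm X s r (q t0))"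
      using main[OF line_fourier_space] main[OF circle_fourier_space] by (cases X) auto
  qed
qed

section \<open>From growth between two times to the two-sided estimate\<close>

lemma le_mult_INF:
  fixes B :: "'i \<Rightarrow> ennreal"
  assumes "0 < x" "\<And>t. b \<le> ennreal x * B t"
  shows "b \<le> ennreal x * (INF t. B t)"
proof -
  have e: "ennreal x * (ennreal (1 / x) * z) = z" "ennreal (1 / x) * (ennreal x * z) = z" for z
    using assms(1) by (simp_all add: mult.assoc[symmetric] ennreal_mult[symmetric])
  have "ennreal (1 / x) * b \<le> (INF t. B t)"
  proof (rule INF_greatest)
    fix t
    have "ennreal (1 / x) * b \<le> ennreal (1 / x) * (ennreal x * B t)" by (rule mult_left_mono[OF assms(2)]) simp
    then show "ennreal (1 / x) * b \<le> B t" unfolding e .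
  qed
  then have "ennreal x * (ennreal (1 / x) * b) \<le> ennreal x * (INF t. B t)" by (rule mult_left_mono) simp
  then show ?thesis unfolding e .
qed

lemma epowr_one_plus:
  assumes "0 < a" "0 \<le> b"
  shows "epowr (1 + epowr (ennreal b) a) p = ennreal ((1 + b powr a) powr p)"
proof -
  have y: "0 < 1 + b powr a" by (intro add_pos_nonneg) auto
  have "1 + epowr (ennreal b) a = ennreal (1 + b powr a)"
    using assms by (simp add: epowr_ennreal)
  then show ?thesis using y by (simp add: epowr_def del: ennreal_plus)
qed

lemma two_sided_real:
  fixes s K a b y :: real
  assumes s: "- 1 / 2 < s" "s < 0" and K: "0 < K" and a: "a = 2 / (1 + 2 * s)" and nn: "0 \<le> b" "0 \<le> y"
    and yb: "y \<le> K * ((1 + b powr a) powr (- s) * b)" and byy: "b \<le> K * ((1 + y powr a) powr (- s) * y)"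
  shows "b \<le> (K * (1 + K powr a * 2 powr (- s * a)) powr (- s)) * (1 + b powr (2 / (1 + 2 * s)\<^sup>2)) powr (- s) * y"
proof -
  have a0: "0 < a" using s by (simp add: a)
  \<comment> \<open>Replacing \<open>b\<close> by max 1 b absorbs the summand 1 and reduces both
    regimes to a single power.\<close>
  define m where "m = max 1 b"
  have m: "1 \<le> m" "b \<le> m" by (auto simp: m_def)
  define e where "e = 2 / (1 + 2 * s)\<^sup>2"
  \<comment> \<open>This computes the final exponent: a (1 - s a) = 2/(1+2s)^2.\<close>
  have "1 - s * a = 1 / (1 + 2 * s)" using s by (simp add: a field_simps)
  then have ea: "a * (1 - s * a) = e" by (simp add: a e_def power2_eq_square)
  have ma: "1 \<le> m powr a" using m a0 by (simp add: ge_one_powr_ge_zero)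
  have "(1 + b powr a) powr (- s) \<le> (2 * m powr a) powr (- s)"
    using powr_mono2[of a b m] nn m a0 ma s by (intro powr_mono2) auto
  then have "y \<le> K * ((2 * m powr a) powr (- s) * m)"
    using yb m nn K by (meson mult_left_mono mult_mono order.trans less_imp_le powr_ge_zero)
  then have "y powr a \<le> (K * ((2 * m powr a) powr (- s) * m)) powr a"
    using nn a0 by (intro powr_mono2) auto
  also have "\<dots> = K powr a * (2 powr (- s * a) * m powr e)"
  proof -
    have "m powr (a * (- s) * a) * m powr a = m powr e"
      unfolding ea[symmetric] powr_add[symmetric] by (simp add: algebra_simps)
    then show ?thesis using K m by (simp add: powr_mult powr_powr mult.assoc)
  qed
  also have "\<dots> \<le> K powr a * (2 powr (- s * a) * (1 + b powr e))"
    by (intro mult_left_mono) (auto simp: m_def max_def)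
  finally have y1: "y powr a \<le> (K powr a * 2 powr (- s * a)) * (1 + b powr e)" by (simp add: mult.assoc)
  have "1 + y powr a \<le> (1 + K powr a * 2 powr (- s * a)) * (1 + b powr e)"
    using y1 powr_ge_zero[of b e] unfolding distrib_right[of 1 _ "1 + b powr e"] mult_1_left by linarith
  then have "(1 + y powr a) powr (- s) \<le> ((1 + K powr a * 2 powr (- s * a)) * (1 + b powr e)) powr (- s)"
    using s by (intro powr_mono2) auto
  also have "\<dots> = (1 + K powr a * 2 powr (- s * a)) powr (- s) * (1 + b powr e) powr (- s)"
    by (rule powr_mult)
  finally have "K * ((1 + y powr a) powr (- s) * y) \<le> K * (((1 + K powr a * 2 powr (- s * a)) powr (- s) * (1 + b powr e) powr (- s)) * y)"
    using K nn by (intro mult_left_mono mult_right_mono) auto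
  with byy show ?thesis unfolding e_def by (simp add: mult_ac)
qed

text \<open>The upper bound is the growth estimate from time 0, multiplied by a power that cancels;
  the lower bound is the estimate from time \<open>t\<close> back to 0, made uniform in
  \<open>t\<close> by \<open>two_sided_real\<close>.\<close>

lemma two_sided_bound:
  fixes s K :: real and B :: "real \<Rightarrow> ennreal"
  assumes s: "- 1 / 2 < s" "s < 0" and K: "0 < K"
    and H: "\<And>t0 t. B t \<le> ennreal K * (epowr (1 + epowr (B t0) (2 / (1 + 2 * s))) (- s) * B t0)"
  shows "epowr (1 + epowr (B 0) (2 / (1 + 2 * s))) s * (SUP t. B t) \<le> ennreal K * B 0"
    and "B 0 \<le> ennreal (K * (1 + K powr (2 / (1 + 2 * s)) * 2 powr (- s * (2 / (1 + 2 * s)))) powr (- s))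
      * epowr (1 + epowr (B 0) (2 / (1 + 2 * s)\<^sup>2)) (- s) * (INF t. B t)"
proof -
  define a where "a = 2 / (1 + 2 * s)"
  define e where "e = 2 / (1 + 2 * s)\<^sup>2"
  define C where "C = K * (1 + K powr a * 2 powr (- s * a)) powr (- s)"
  have ae: "0 < a" "0 < e" using s by (auto simp: a_def e_def)
  have s': "0 < - s" using s by simp
  have "0 < 1 + K powr a * 2 powr (- s * a)" by (intro add_pos_nonneg) auto
  then have C: "0 < C" using K by (simp add: C_def)
  \<comment> \<open>Finiteness at one time spreads to all times, so either all norms are real
    numbers or all are infinite; in the latter case both right-hand sides are infinite.\<close>
  have fin: "B t < \<infinity>" if t0: "B t0 < \<infinity>" for t0 t
  proof -
    from t0 obtain b where b: "0 \<le> b" "B t0 = ennreal b" by (cases "B t0") auto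
    have "B t \<le> ennreal K * (ennreal ((1 + b powr a) powr (- s)) * ennreal b)"
      using H[of t t0] unfolding b(2) a_def[symmetric] epowr_one_plus[OF ae(1) b(1)] .
    also have "\<dots> < \<infinity>" by (simp add: ennreal_mult_less_top)
    finally show ?thesis .
  qed
  have "epowr (1 + epowr (B 0) a) s * (SUP t. B t) \<le> ennreal K * B 0 \<and>
    B 0 \<le> ennreal C * epowr (1 + epowr (B 0) e) (- s) * (INF t. B t)"
  proof (cases "B 0")
    case top
    have t: "B t = \<infinity>" for t
      using fin[of t 0] top by (simp only: infinity_ennreal_def less_top[symmetric]) blast
    have "epowr (1 + epowr (B 0) e) (- s) = \<infinity>"
      using epowr_top[OF ae(2)] epowr_top[OF s'] by (simp add: t)
    then show ?thesis using K C by (simp add: t ennreal_mult_top ennreal_top_mult)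
  next
    case (real b)
    have E: "epowr (1 + epowr (B 0) a) p = ennreal ((1 + b powr a) powr p)" "epowr (1 + epowr (B 0) e) p = ennreal ((1 + b powr e) powr p)" for p
      unfolding real(2) by (rule epowr_one_plus[OF ae(1) real(1)] epowr_one_plus[OF ae(2) real(1)])+
    have pos: "0 < 1 + b powr a" "0 < 1 + b powr e" by (intro add_pos_nonneg; simp)+
    have S: "(SUP t. B t) \<le> ennreal K * (ennreal ((1 + b powr a) powr (- s)) * B 0)"
      by (rule SUP_least) (use H[of _ 0] in \<open>simp only: a_def[symmetric] E\<close>)
    have "epowr (1 + epowr (B 0) a) s * (SUP t. B t) \<le> ennreal ((1 + b powr a) powr s) * (ennreal K * (ennreal ((1 + b powr a) powr (- s)) * B 0))"
      unfolding E by (rule mult_left_mono[OF S]) simp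
    also have "\<dots> = (ennreal ((1 + b powr a) powr s) * ennreal ((1 + b powr a) powr (- s))) * (ennreal K * B 0)"
      by (simp only: mult_ac)
    also have "ennreal ((1 + b powr a) powr s) * ennreal ((1 + b powr a) powr (- s)) = 1"
      using pos(1) by (subst ennreal_mult[symmetric]) (auto simp: powr_add[symmetric])
    finally have 1: "epowr (1 + epowr (B 0) a) s * (SUP t. B t) \<le> ennreal K * B 0" by simp
    have "B 0 \<le> ennreal (C * (1 + b powr e) powr (- s)) * (INF t. B t)"
    proof (rule le_mult_INF)
      show "0 < C * (1 + b powr e) powr (- s)" using C pos(2) by simp
      fix t
      have "B t < \<infinity>" using fin[of 0 t] real by simp
      then obtain y where y: "0 \<le> y" "B t = ennreal y" by (cases "B t") auto
      have "ennreal y \<le> ennreal (K * ((1 + b powr a) powr (- s) * b))"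
        using H[of t 0] K real(1) unfolding a_def[symmetric] E y(2) unfolding real(2) by (simp add: ennreal_mult)
      moreover have "ennreal b \<le> ennreal (K * ((1 + y powr a) powr (- s) * y))"
        using H[of 0 t] K y(1) unfolding a_def[symmetric] y(2) epowr_one_plus[OF ae(1) y(1)] unfolding real(2) by (simp add: ennreal_mult)
      moreover have "0 \<le> K * ((1 + b powr a) powr (- s) * b)" "0 \<le> K * ((1 + y powr a) powr (- s) * y)"
        using K y(1) real(1) by auto
      ultimately have "b \<le> C * (1 + b powr e) powr (- s) * y"
        using two_sided_real[OF s K a_def real(1) y(1)] unfolding C_def e_def by (simp add: ennreal_le_iff)
      then have "ennreal b \<le> ennreal (C * (1 + b powr e) powr (- s) * y)" by (rule ennreal_leI)
      then show "B 0 \<le> ennreal (C * (1 + b powr e) powr (- s)) * B t"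
        unfolding real(2) y(2) using C y(1) by (simp add: ennreal_mult)
    qed
    then have "B 0 \<le> ennreal C * epowr (1 + epowr (B 0) e) (- s) * (INF t. B t)"
      unfolding E using C by (simp add: ennreal_mult)
    with 1 show ?thesis ..
  qed
  then show "epowr (1 + epowr (B 0) (2 / (1 + 2 * s))) s * (SUP t. B t) \<le> ennreal K * B 0"
    and "B 0 \<le> ennreal (K * (1 + K powr (2 / (1 + 2 * s)) * 2 powr (- s * (2 / (1 + 2 * s)))) powr (- s))
      * epowr (1 + epowr (B 0) (2 / (1 + 2 * s)\<^sup>2)) (- s) * (INF t. B t)"
    by (simp_all only: a_def e_def C_def)
qed

theorem theorem3p2:
  fixes s :: real and r :: ennreal
  assumes "- 1 / 2 < s" and "s < 0" and "1 \<le> r"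
  shows "\<exists>K::ennreal. K < \<infinity> \<and> (\<forall>X q. BO_solution X q \<longrightarrow>
      epowr (1 + epowr (besov_norm X s r (q 0)) (2 / (1 + 2 * s))) s *
          (SUP t. besov_norm X s r (q t))
        \<le> K * besov_norm X s r (q 0) \<and>
      besov_norm X s r (q 0)
        \<le> K * epowr (1 + epowr (besov_norm X s r (q 0)) (2 / (1 + 2 * s)\<^sup>2)) (- s) *
          (INF t. besov_norm X s r (q t)))"
proof -
  obtain K :: real where K: "0 < K" and H: "\<And>X q t0 t. BO_solution X q \<Longrightarrow>
    besov_norm X s r (q t) \<le> ennreal K * (epowr (1 + epowr (besov_norm X s r (q t0)) (2 / (1 + 2 * s))) (- s) * besov_norm X s r (q t0))"
    using besov_norm_flow[OF assms] by blast
  define C where "C = K * (1 + K powr (2 / (1 + 2 * s)) * 2 powr (- s * (2 / (1 + 2 * s)))) powr (- s)"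
  \<comment> \<open>The two inequalities come with different constants; the larger one serves
    both.\<close>
  let ?M = "max (ennreal K) (ennreal C)"
  show ?thesis
  proof (intro exI[of _ ?M] conjI allI impI)
    show "?M < \<infinity>" by simp
    fix X q assume q: "BO_solution X q"
    note t = two_sided_bound[OF assms(1,2) K H[OF q]]
    show "epowr (1 + epowr (besov_norm X s r (q 0)) (2 / (1 + 2 * s))) s * (SUP t. besov_norm X s r (q t))
        \<le> ?M * besov_norm X s r (q 0)"
      by (rule order.trans[OF t(1) mult_right_mono]) auto
    show "besov_norm X s r (q 0) \<le> ?M * epowr (1 + epowr (besov_norm X s r (q 0)) (2 / (1 + 2 * s)\<^sup>2)) (- s) *
          (INF t. besov_norm X s r (q t))"
      by (rule order.trans[OF t(2)[folded C_def] mult_right_mono[OF mult_right_mono]]) auto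
  qed
qed

end
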